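(* There exists an absolute constant $C_\Gamma>0$, independent of $m$ and $T$, such that the following holds. Let $m\ge10^3$ be an integer, $\alpha\in(0,\frac\pi6]$, $T>0$, let $\boldsymbol{v}$ be the strong solution on $D_m\times[0,T]$ described in the context, and let $\Gamma=\rho\sin\phi\,v_\theta$ with initial value $\Gamma_0$. Then $$\|\Gamma\|_{L^\infty(D_m\times[0,T])}\le C_\Gamma\|\Gamma_0\|_{L^\infty(D_m)}.$$
   Context: Spherical coordinates $(\rho,\phi,\theta)$ on $\mathbb{R}^3$: $\rho=|x|$, $\phi$ the angle from the positive $x_3$-axis, $\theta$ the azimuthal angle, with the usual orthonormal frame $\boldsymbol{e_\rho},\boldsymbol{e_\phi},\boldsymbol{e_\theta}$. All functions and vector fields are axially symmetric (components $v_\rho,v_\phi,v_\theta$ and $P$ independent of $\theta$). $D_m=\{\frac1m<\rho<1,\ \frac\pi2-\alpha<\phi<\frac\pi2+\alpha,\ \theta\in[0,2\pi)\}$, with boundary pieces $R_{1,m},R_{2,m}$ ($\phi=\frac\pi2\mp\alpha$), $A_{1,m}$ ($\rho=\frac1m$), $A_{2,m}$ ($\rho=1$). Let $\omega_\theta=\frac1\rho\partial_\rho(\rho v_\phi)-\frac1\rho\partial_\phi v_\rho$. Boundary condition (BC): $\boldsymbol{v}\cdot\boldsymbol{n}=0$ on $\partial D_m$; on $R_{1,m}\cup R_{2,m}$: $v_\phi=\partial_\rho v_\phi=\partial_\phi v_\rho=0$, $\partial_\phi v_\theta=\cot\phi\,v_\theta$, $\omega_\theta=0$; on $A_{2,m}$: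 $v_\rho=\partial_\phi v_\rho=0$, $\partial_\rho v_\theta=\frac1\rho v_\theta$, $\partial_\rho v_\phi=\frac1\rho v_\phi$, $\omega_\theta=\frac2\rho v_\phi$; on $A_{1,m}$: $v_\rho=\partial_\phi v_\rho=0$, $\partial_\rho v_\theta=\frac1\rho v_\theta$, $\partial_\rho v_\phi=-\frac1\rho v_\phi$, $\omega_\theta=0$. Standing solution: $(\boldsymbol{v},P)$ is the strong solution on $D_m\times[0,T]$ of $\Delta\boldsymbol{v}-(\boldsymbol{v}\cdot\nabla)\boldsymbol{v}-\nabla P-\partial_t\boldsymbol{v}=0$, $\nabla\cdot\boldsymbol{v}=0$, with (BC) and initial data $\boldsymbol{v}_0\in H^2(D_m)$ which is divergence free, satisfies (BC), and has zero azimuthal angular momentum $\int_{D_m}\rho\sin\phi\,v_{\theta,0}\,dx=0$; it satisfies $\boldsymbol{v}\in H^1_tL^2_x\cap L^2_tH^2_x\cap L^\infty_{tx}(D_m\times[0,T])$, $P\in L^2_tH^1_x(D_m\times[0,T])$, and the equations hold in the $L^2_{tx}$ sense. *)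

theory Defs
  imports "HOL-Analysis.Analysis" "HOL-Probability.Essential_Supremum"
begin

section \<open>Weak derivatives and Sobolev spaces\<close>

text \<open>A class of functions modulo null sets is represented by any of its members. All measures on
  open sets are Lebesgue measures; space-time is the Euclidean space \<^typ>\<open>real \<times> real^3\<close>.\<close>

primrec Ck :: "nat \<Rightarrow> ('a::euclidean_space \<Rightarrow> real) \<Rightarrow> bool" where
  "Ck 0 f \<longleftrightarrow> continuous_on UNIV f"
| "Ck (Suc k) f \<longleftrightarrow> (\<forall>x. f differentiable (at x)) \<and>
     (\<forall>b\<in>Basis. Ck k (\<lambda>x. frechet_derivative f (at x) b))"

definition smooth :: "('a::euclidean_space \<Rightarrow> real) \<Rightarrow> bool" where
  "smooth f \<longleftrightarrow> (\<forall>k. Ck k f)"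

definition test_function :: "'a::euclidean_space set \<Rightarrow> ('a \<Rightarrow> real) \<Rightarrow> bool" where
  "test_function U \<psi> \<longleftrightarrow> smooth \<psi> \<and> compact (closure {x. \<psi> x \<noteq> 0}) \<and> closure {x. \<psi> x \<noteq> 0} \<subseteq> U"

definition locally_integrable ::
  "'a::euclidean_space set \<Rightarrow> ('a \<Rightarrow> 'b::euclidean_space) \<Rightarrow> bool" where
  "locally_integrable U f \<longleftrightarrow> (\<forall>K. compact K \<and> K \<subseteq> U \<longrightarrow> f absolutely_integrable_on K)"

definition has_weak_deriv ::
  "'a::euclidean_space set \<Rightarrow> 'a \<Rightarrow> ('a \<Rightarrow> 'b::euclidean_space) \<Rightarrow> ('a \<Rightarrow> 'b) \<Rightarrow> bool" where
  "has_weak_deriv U b f g \<longleftrightarrow> locally_integrable U f \<and> locally_integrable U g \<and>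
     (\<forall>\<psi>. test_function U \<psi> \<longrightarrow>
        (\<integral>x. frechet_derivative \<psi> (at x) b *\<^sub>R f x \<partial>lebesgue_on U) =
        - (\<integral>x. \<psi> x *\<^sub>R g x \<partial>lebesgue_on U))"

text \<open>Weak derivatives are unique up to null sets, so the choice below is immaterial (and it is
  only meaningful when a weak derivative exists).\<close>

definition wderiv ::
  "'a::euclidean_space set \<Rightarrow> 'a \<Rightarrow> ('a \<Rightarrow> 'b::euclidean_space) \<Rightarrow> 'a \<Rightarrow> 'b" where
  "wderiv U b f = (SOME g. has_weak_deriv U b f g)"

definition wgrad :: "'a::euclidean_space set \<Rightarrow> ('a \<Rightarrow> real) \<Rightarrow> 'a \<Rightarrow> 'a" where
  "wgrad U f x = (\<Sum>b\<in>Basis. wderiv U b f x *\<^sub>R b)"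

definition wdiv :: "'a::euclidean_space set \<Rightarrow> ('a \<Rightarrow> 'a) \<Rightarrow> 'a \<Rightarrow> real" where
  "wdiv U u x = (\<Sum>b\<in>Basis. wderiv U b u x \<bullet> b)"

definition wlaplacian ::
  "'a::euclidean_space set \<Rightarrow> ('a \<Rightarrow> 'b::euclidean_space) \<Rightarrow> 'a \<Rightarrow> 'b" where
  "wlaplacian U u x = (\<Sum>b\<in>Basis. wderiv U b (wderiv U b u) x)"

text \<open>The convection term $(u \cdot \nabla) w$.\<close>

definition convection ::
  "'a::euclidean_space set \<Rightarrow> ('a \<Rightarrow> 'a) \<Rightarrow> ('a \<Rightarrow> 'b::euclidean_space) \<Rightarrow> 'a \<Rightarrow> 'b" where
  "convection U u w x = (\<Sum>b\<in>Basis. (u x \<bullet> b) *\<^sub>R wderiv U b w x)"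

definition L2_norm_sq ::
  "'a::euclidean_space set \<Rightarrow> ('a \<Rightarrow> 'b::euclidean_space) \<Rightarrow> ennreal" where
  "L2_norm_sq U f = (\<integral>\<^sup>+x. ennreal ((norm (f x))\<^sup>2) \<partial>lebesgue_on U)"

definition L2_on :: "'a::euclidean_space set \<Rightarrow> ('a \<Rightarrow> 'b::euclidean_space) \<Rightarrow> bool" where
  "L2_on U f \<longleftrightarrow> f \<in> borel_measurable (lebesgue_on U) \<and> L2_norm_sq U f < \<infinity>"

definition Linfty_norm ::
  "'a::euclidean_space set \<Rightarrow> ('a \<Rightarrow> 'b::euclidean_space) \<Rightarrow> ennreal" where
  "Linfty_norm U f = esssup (lebesgue_on U) (\<lambda>x. ennreal (norm (f x)))"

definition Linfty_on :: "'a::euclidean_space set \<Rightarrow> ('a \<Rightarrow> 'b::euclidean_space) \<Rightarrow> bool" where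
  "Linfty_on U f \<longleftrightarrow> f \<in> borel_measurable (lebesgue_on U) \<and> Linfty_norm U f < \<infinity>"

text \<open>The space $H^k(U) = W^{k,2}(U)$.\<close>

primrec sobolev :: "nat \<Rightarrow> 'a::euclidean_space set \<Rightarrow> ('a \<Rightarrow> 'b::euclidean_space) \<Rightarrow> bool" where
  "sobolev 0 U f \<longleftrightarrow> L2_on U f"
| "sobolev (Suc k) U f \<longleftrightarrow> L2_on U f \<and>
     (\<forall>b\<in>Basis. \<exists>g. has_weak_deriv U b f g \<and> sobolev k U g)"

text \<open>The squared $H^k$ norm, up to combinatorial weights on the individual derivatives; meaningful
  only for members of $H^k(U)$.\<close>

primrec sobolev_norm_sq ::
  "nat \<Rightarrow> 'a::euclidean_space set \<Rightarrow> ('a \<Rightarrow> 'b::euclidean_space) \<Rightarrow> ennreal" where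
  "sobolev_norm_sq 0 U f = L2_norm_sq U f"
| "sobolev_norm_sq (Suc k) U f =
     L2_norm_sq U f + (\<Sum>b\<in>Basis. sobolev_norm_sq k U (wderiv U b f))"

text \<open>Spaces of time-dependent functions: $L^2(0,T;H^k(U))$ and $H^1(0,T;L^2(U))$. The weak time
  derivative is the distributional one on the open space-time cylinder.\<close>

definition L2_time_sobolev ::
  "nat \<Rightarrow> real \<Rightarrow> 'a::euclidean_space set \<Rightarrow> (real \<Rightarrow> 'a \<Rightarrow> 'b::euclidean_space) \<Rightarrow> bool" where
  "L2_time_sobolev k T U u \<longleftrightarrow>
     (\<lambda>(t, x). u t x) \<in> borel_measurable (lebesgue_on ({0<..<T} \<times> U)) \<and>
     (AE t in lebesgue_on {0<..<T}. sobolev k U (u t)) \<and>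
     (\<integral>\<^sup>+t. sobolev_norm_sq k U (u t) \<partial>lebesgue_on {0<..<T}) < \<infinity>"

definition H1_time_L2 ::
  "real \<Rightarrow> 'a::euclidean_space set \<Rightarrow> (real \<Rightarrow> 'a \<Rightarrow> 'b::euclidean_space) \<Rightarrow> bool" where
  "H1_time_L2 T U u \<longleftrightarrow> L2_on ({0<..<T} \<times> U) (\<lambda>(t, x). u t x) \<and>
     (\<exists>g. has_weak_deriv ({0<..<T} \<times> U) (1, 0) (\<lambda>(t, x). u t x) g \<and> L2_on ({0<..<T} \<times> U) g)"

definition time_deriv ::
  "real \<Rightarrow> 'a::euclidean_space set \<Rightarrow> (real \<Rightarrow> 'a \<Rightarrow> 'b::euclidean_space) \<Rightarrow> real \<Rightarrow> 'a \<Rightarrow> 'b" where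
  "time_deriv T U u t x = wderiv ({0<..<T} \<times> U) (1, 0) (\<lambda>(s, y). u s y) (t, x)"

text \<open>The initial value is attained in $L^2(U)$; the limit as $t \to 0^+$ is an essential one because
  single time slices of \<open>u\<close> are not determined by its class.\<close>

definition has_initial_value ::
  "'a::euclidean_space set \<Rightarrow> (real \<Rightarrow> 'a \<Rightarrow> 'b::euclidean_space) \<Rightarrow> ('a \<Rightarrow> 'b) \<Rightarrow> bool" where
  "has_initial_value U u u0 \<longleftrightarrow>
     (\<forall>\<epsilon>>0. \<exists>\<delta>>0. AE t in lebesgue_on {0<..<\<delta>}.
        L2_norm_sq U (\<lambda>x. u t x - u0 x) < ennreal \<epsilon>)"

text \<open>Boundary values of $H^1$ functions. A boundary piece is given by its surface measure \<open>S\<close>; the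
  trace of \<open>f\<close> is the $L^2(S)$ limit of the restrictions of smooth functions converging to \<open>f\<close> in
  $H^1(U)$.\<close>

definition has_trace ::
  "'a::euclidean_space set \<Rightarrow> 'a measure \<Rightarrow> ('a \<Rightarrow> real) \<Rightarrow> ('a \<Rightarrow> real) \<Rightarrow> bool" where
  "has_trace U S f h \<longleftrightarrow> sobolev 1 U f \<and> h \<in> borel_measurable S \<and>
     (\<exists>F :: nat \<Rightarrow> 'a \<Rightarrow> real. (\<forall>n. smooth (F n)) \<and>
        (\<lambda>n. sobolev_norm_sq 1 U (\<lambda>x. F n x - f x)) \<longlonglongrightarrow> 0 \<and>
        (\<lambda>n. \<integral>\<^sup>+x. ennreal ((F n x - h x)\<^sup>2) \<partial>S) \<longlonglongrightarrow> 0)"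

definition trace_eq ::
  "'a::euclidean_space set \<Rightarrow> 'a measure \<Rightarrow> ('a \<Rightarrow> real) \<Rightarrow> ('a \<Rightarrow> real) \<Rightarrow> bool" where
  "trace_eq U S f g \<longleftrightarrow> (\<exists>h. has_trace U S f h \<and> has_trace U S g h)"

section \<open>Spherical coordinates\<close>

definition rho :: "real^3 \<Rightarrow> real" where
  "rho x = norm x"

definition phi :: "real^3 \<Rightarrow> real" where
  "phi x = arccos (x $ 3 / norm x)"

definition theta :: "real^3 \<Rightarrow> real" where
  "theta x = Arg2pi (Complex (x $ 1) (x $ 2))"

definition spherical :: "real \<Rightarrow> real \<Rightarrow> real \<Rightarrow> real^3" where
  "spherical r p q = vector [r * sin p * cos q, r * sin p * sin q, r * cos p]"

definition e_rho :: "real^3 \<Rightarrow> real^3" where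
  "e_rho x = vector [sin (phi x) * cos (theta x), sin (phi x) * sin (theta x), cos (phi x)]"

definition e_phi :: "real^3 \<Rightarrow> real^3" where
  "e_phi x = vector [cos (phi x) * cos (theta x), cos (phi x) * sin (theta x), - sin (phi x)]"

definition e_theta :: "real^3 \<Rightarrow> real^3" where
  "e_theta x = vector [- sin (theta x), cos (theta x), 0]"

definition comp_rho :: "(real^3 \<Rightarrow> real^3) \<Rightarrow> real^3 \<Rightarrow> real" where
  "comp_rho u x = u x \<bullet> e_rho x"

definition comp_phi :: "(real^3 \<Rightarrow> real^3) \<Rightarrow> real^3 \<Rightarrow> real" where
  "comp_phi u x = u x \<bullet> e_phi x"

definition comp_theta :: "(real^3 \<Rightarrow> real^3) \<Rightarrow> real^3 \<Rightarrow> real" where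
  "comp_theta u x = u x \<bullet> e_theta x"

text \<open>Since $\partial_\rho x = e_\rho$ and $\partial_\phi x = \rho e_\phi$, the chain rule expresses the coordinate
  derivatives through the gradient.\<close>

definition d_rho :: "(real^3) set \<Rightarrow> (real^3 \<Rightarrow> real) \<Rightarrow> real^3 \<Rightarrow> real" where
  "d_rho U f x = wgrad U f x \<bullet> e_rho x"

definition d_phi :: "(real^3) set \<Rightarrow> (real^3 \<Rightarrow> real) \<Rightarrow> real^3 \<Rightarrow> real" where
  "d_phi U f x = rho x * (wgrad U f x \<bullet> e_phi x)"

definition omega_theta :: "(real^3) set \<Rightarrow> (real^3 \<Rightarrow> real^3) \<Rightarrow> real^3 \<Rightarrow> real" where
  "omega_theta U u x =
     1 / rho x * d_rho U (\<lambda>y. rho y * comp_phi u y) x - 1 / rho x * d_phi U (comp_rho u) x"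

definition Gamma_of :: "(real^3 \<Rightarrow> real^3) \<Rightarrow> real^3 \<Rightarrow> real" where
  "Gamma_of u x = rho x * sin (phi x) * comp_theta u x"

definition axisymmetric :: "(real^3) set \<Rightarrow> (real^3 \<Rightarrow> real) \<Rightarrow> bool" where
  "axisymmetric U f \<longleftrightarrow> (\<exists>F. AE x in lebesgue_on U. f x = F (rho x) (phi x))"

definition axisymmetric_field :: "(real^3) set \<Rightarrow> (real^3 \<Rightarrow> real^3) \<Rightarrow> bool" where
  "axisymmetric_field U u \<longleftrightarrow>
     axisymmetric U (comp_rho u) \<and> axisymmetric U (comp_phi u) \<and> axisymmetric U (comp_theta u)"

section \<open>The domain and the boundary condition\<close>

definition Dm :: "nat \<Rightarrow> real \<Rightarrow> (real^3) set" where
  "Dm m \<alpha> = {x. 1 / real m < rho x \<and> rho x < 1 \<and> pi/2 - \<alpha> < phi x \<and> phi x < pi/2 + \<alpha>}"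

text \<open>Surface measures: $r^2 \sin\phi\, d\phi\, d\theta$ on the spherical piece $\rho = r$ and
  $\rho \sin p\, d\rho\, d\theta$ on the conical piece $\phi = p$.\<close>

definition sphere_piece :: "real \<Rightarrow> real \<Rightarrow> (real^3) measure" where
  "sphere_piece \<alpha> r =
     distr (density (lebesgue_on ({pi/2 - \<alpha><..<pi/2 + \<alpha>} \<times> {0..<2*pi}))
              (\<lambda>(p, q). ennreal (r\<^sup>2 * sin p)))
       borel (\<lambda>(p, q). spherical r p q)"

definition cone_piece :: "nat \<Rightarrow> real \<Rightarrow> (real^3) measure" where
  "cone_piece m p =
     distr (density (lebesgue_on ({1 / real m<..<1} \<times> {0..<2*pi}))
              (\<lambda>(r, q). ennreal (r * sin p)))
       borel (\<lambda>(r, q). spherical r p q)"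

definition R1 :: "nat \<Rightarrow> real \<Rightarrow> (real^3) measure" where
  "R1 m \<alpha> = cone_piece m (pi/2 - \<alpha>)"

definition R2 :: "nat \<Rightarrow> real \<Rightarrow> (real^3) measure" where
  "R2 m \<alpha> = cone_piece m (pi/2 + \<alpha>)"

definition A1 :: "nat \<Rightarrow> real \<Rightarrow> (real^3) measure" where
  "A1 m \<alpha> = sphere_piece \<alpha> (1 / real m)"

definition A2 :: "nat \<Rightarrow> real \<Rightarrow> (real^3) measure" where
  "A2 m \<alpha> = sphere_piece \<alpha> 1"

text \<open>The outward normal is $\mp e_\phi$ on $R_{1,m}$, $R_{2,m}$ and $\mp e_\rho$ on $A_{1,m}$,
  $A_{2,m}$.\<close>

definition impermeable :: "nat \<Rightarrow> real \<Rightarrow> (real^3 \<Rightarrow> real^3) \<Rightarrow> bool" where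
  "impermeable m \<alpha> u \<longleftrightarrow>
     trace_eq (Dm m \<alpha>) (R1 m \<alpha>) (\<lambda>x. u x \<bullet> (- e_phi x)) (\<lambda>x. 0) \<and>
     trace_eq (Dm m \<alpha>) (R2 m \<alpha>) (\<lambda>x. u x \<bullet> e_phi x) (\<lambda>x. 0) \<and>
     trace_eq (Dm m \<alpha>) (A1 m \<alpha>) (\<lambda>x. u x \<bullet> (- e_rho x)) (\<lambda>x. 0) \<and>
     trace_eq (Dm m \<alpha>) (A2 m \<alpha>) (\<lambda>x. u x \<bullet> e_rho x) (\<lambda>x. 0)"

definition BC :: "nat \<Rightarrow> real \<Rightarrow> (real^3 \<Rightarrow> real^3) \<Rightarrow> bool" where
  "BC m \<alpha> u \<longleftrightarrow>
    (let D = Dm m \<alpha>; v\<^sub>\<rho> = comp_rho u; v\<^sub>\<phi> = comp_phi u; v\<^sub>\<theta> = comp_theta u; \<omega>\<^sub>\<theta> = omega_theta D u in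
     impermeable m \<alpha> u \<and>
     (\<forall>S \<in> {R1 m \<alpha>, R2 m \<alpha>}.
        trace_eq D S v\<^sub>\<phi> (\<lambda>x. 0) \<and>
        trace_eq D S (d_rho D v\<^sub>\<phi>) (\<lambda>x. 0) \<and>
        trace_eq D S (d_phi D v\<^sub>\<rho>) (\<lambda>x. 0) \<and>
        trace_eq D S (d_phi D v\<^sub>\<theta>) (\<lambda>x. cot (phi x) * v\<^sub>\<theta> x) \<and>
        trace_eq D S \<omega>\<^sub>\<theta> (\<lambda>x. 0)) \<and>
     (let S = A2 m \<alpha> in
        trace_eq D S v\<^sub>\<rho> (\<lambda>x. 0) \<and>
        trace_eq D S (d_phi D v\<^sub>\<rho>) (\<lambda>x. 0) \<and>
        trace_eq D S (d_rho D v\<^sub>\<theta>) (\<lambda>x. 1 / rho x * v\<^sub>\<theta> x) \<and>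
        trace_eq D S (d_rho D v\<^sub>\<phi>) (\<lambda>x. 1 / rho x * v\<^sub>\<phi> x) \<and>
        trace_eq D S \<omega>\<^sub>\<theta> (\<lambda>x. 2 / rho x * v\<^sub>\<phi> x)) \<and>
     (let S = A1 m \<alpha> in
        trace_eq D S v\<^sub>\<rho> (\<lambda>x. 0) \<and>
        trace_eq D S (d_phi D v\<^sub>\<rho>) (\<lambda>x. 0) \<and>
        trace_eq D S (d_rho D v\<^sub>\<theta>) (\<lambda>x. 1 / rho x * v\<^sub>\<theta> x) \<and>
        trace_eq D S (d_rho D v\<^sub>\<phi>) (\<lambda>x. - (1 / rho x) * v\<^sub>\<phi> x) \<and>
        trace_eq D S \<omega>\<^sub>\<theta> (\<lambda>x. 0)))"

section \<open>Strong solutions\<close>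

definition admissible_data :: "nat \<Rightarrow> real \<Rightarrow> (real^3 \<Rightarrow> real^3) \<Rightarrow> bool" where
  "admissible_data m \<alpha> v0 \<longleftrightarrow>
     sobolev 2 (Dm m \<alpha>) v0 \<and>
     axisymmetric_field (Dm m \<alpha>) v0 \<and>
     (AE x in lebesgue_on (Dm m \<alpha>). wdiv (Dm m \<alpha>) v0 x = 0) \<and>
     BC m \<alpha> v0 \<and>
     (\<integral>x. rho x * sin (phi x) * comp_theta v0 x \<partial>lebesgue_on (Dm m \<alpha>)) = 0"

definition strong_solution ::
  "nat \<Rightarrow> real \<Rightarrow> real \<Rightarrow> (real^3 \<Rightarrow> real^3) \<Rightarrow> (real \<Rightarrow> real^3 \<Rightarrow> real^3) \<Rightarrow> (real \<Rightarrow> real^3 \<Rightarrow> real) \<Rightarrow> bool"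
where
  "strong_solution m \<alpha> T v0 v P \<longleftrightarrow>
    (let D = Dm m \<alpha> in
     admissible_data m \<alpha> v0 \<and>
     H1_time_L2 T D v \<and> L2_time_sobolev 2 T D v \<and> Linfty_on ({0..T} \<times> D) (\<lambda>(t, x). v t x) \<and>
     L2_time_sobolev 1 T D P \<and>
     (AE t in lebesgue_on {0<..<T}. axisymmetric_field D (v t) \<and> axisymmetric D (P t)) \<and>
     (AE t in lebesgue_on {0<..<T}. AE x in lebesgue_on D.
        wlaplacian D (v t) x - convection D (v t) (v t) x - wgrad D (P t) x
          - time_deriv T D v t x = 0) \<and>
     (AE t in lebesgue_on {0<..<T}. AE x in lebesgue_on D. wdiv D (v t) x = 0) \<and>
     (AE t in lebesgue_on {0<..<T}. BC m \<alpha> (v t)) \<and>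
     has_initial_value D v v0)"

end

theory Submission
 imports Defs
begin

text \<open>On almost every time slice the angular momentum \<open>\<Gamma> = v \<bullet> rot_field\<close> satisfies a drift-diffusion
 equation without zeroth order term, whose diffusive flux \<open>\<nabla>\<Gamma> - 2\<Gamma> swirl_field\<close> is tangential by the
 boundary conditions. Testing with odd powers, the boundary contribution of the drift is absorbed by the
 diffusion: this conserves the mean of \<open>\<Gamma>\<close>, hence for mean zero the \<open>L^2\<close> norm decreases, and the
 \<open>L^2\<^sup>p\<close> norm is controlled by the initial one and the supremum in time of the \<open>L\<^sup>p\<close> norm, with
 constants scaling like the volume of the domain. An Alikakos iteration over \<open>p = 2\<^sup>k\<close> gives the uniform bound.\<close>

text \<open>The drift \<open>swirl_field\<close> is the gradient of the logarithm of
  \<open>cyl\<close>, which is harmonic off the axis, so the drift term of the energy identity is a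
  pure boundary integral. Its sign is favourable on both cones and on the inner sphere; only the
  outer sphere costs something, and a trace inequality with a power of the radius as weight pays for
  it. For mean zero the constant must stay below 1 uniformly in \<open>m\<close> and \<alpha>, which
  is where \<alpha> \<le> pi/6 enters. Squared L1 norms carry a factor 1/\<alpha> and the volume is
  of order \<alpha>, so \<alpha> cancels along the iteration. The obstacle is regularity. Boundary
  values are limits along smooth sequences that are unrelated for different boundary pieces and are
  not axisymmetric. Every inequality is therefore proved for C1 functions, with an error term for
  the azimuthal derivative, and then passed to the limit. In time only a weak derivative is given;
  it is integrated to a representative that is absolutely continuous in time, so that a moment which
  cannot increase above a threshold never crosses it.\<close>

lemmas BI_diff = Bochner_Integration.integral_diff and BI_add = Bochner_Integration.integral_add
 and BI_cong = Bochner_Integration.integral_cong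
 and HKI_integral_add = Henstock_Kurzweil_Integration.integral_add
 and HKI_integral_diff = Henstock_Kurzweil_Integration.integral_diff
 and HKI_integral_mult_right = Henstock_Kurzweil_Integration.integral_mult_right

section \<open>Smooth functions and test functions\<close>

lemma Ck_continuous: "Ck k f ==> continuous_on UNIV f"
 by (cases k) (auto intro: differentiable_imp_continuous_on simp: differentiable_on_def differentiable_at_withinI)

text \<open>\<open>Ck\<close> is phrased with the choice operator \<open>frechet_derivative\<close>;
  uniqueness of derivatives lets any explicit candidate stand in for it.\<close>

lemma Ck_SucI:
 assumes "!!x. (f has_derivative f' x) (at x)" "!!b. b \<in> Basis ==> Ck k (%x. f' x b)"
 shows "Ck (Suc k) f"
proof -
 have "frechet_derivative f (at x) = f' x" for x
 using assms(1) by (metis frechet_derivative_at)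
 then show ?thesis
 using assms by (auto simp: differentiable_def)
qed

lemma Ck_SucD:
 assumes "Ck (Suc k) f"
 shows "(f has_derivative frechet_derivative f (at x)) (at x)"
 "b \<in> Basis ==> Ck k (%x. frechet_derivative f (at x) b)"
 using assms by (auto simp: frechet_derivative_works)

lemma Ck_Suc_imp: "Ck (Suc k) f ==> Ck k f"
proof (induction k arbitrary: f)
 case 0
 then show ?case using Ck_continuous[of "Suc 0" f] by simp
next
 case (Suc k)
 show ?case
 by (rule Ck_SucI[OF Ck_SucD(1)[OF Suc.prems]]) (rule Suc.IH[OF Ck_SucD(2)[OF Suc.prems]])
qed

lemma Ck_const: "Ck k (%x. c)"
proof (induction k arbitrary: c)
 case (Suc k)
 show ?case by (rule Ck_SucI[where f'="%x h. 0"]) (auto intro: Suc)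
qed auto

lemma Ck_add: "Ck k f ==> Ck k g ==> Ck k (%x. f x + g x)"
proof (induction k arbitrary: f g)
 case 0
 then show ?case by (auto intro: continuous_intros)
next
 case (Suc k)
 show ?case
 by (rule Ck_SucI[OF has_derivative_add[OF Ck_SucD(1)[OF Suc.prems(1)] Ck_SucD(1)[OF Suc.prems(2)]]])
 (intro Suc.IH Ck_SucD(2)[OF Suc.prems(1)] Ck_SucD(2)[OF Suc.prems(2)])
qed

lemma Ck_mult: "Ck k f ==> Ck k g ==> Ck k (%x. f x * g x)"
proof (induction k arbitrary: f g)
 case 0
 then show ?case by (auto intro: continuous_intros)
next
 case (Suc k)
 show ?case
 by (rule Ck_SucI[OF has_derivative_mult[OF Ck_SucD(1)[OF Suc.prems(1)] Ck_SucD(1)[OF Suc.prems(2)]]])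
 (intro Ck_add Suc.IH Ck_SucD(2)[OF Suc.prems(1)] Ck_SucD(2)[OF Suc.prems(2)] Suc.prems[THEN Ck_Suc_imp])
qed

text \<open>For an affine inner map the chain rule only produces the constant factor
  \<open>b \<bullet> c\<close>, so the induction stays among functions of one real variable and no
  general composition theorem for \<open>Ck\<close> is required.\<close>

lemma Ck_affine_compose:
 fixes E :: "real => real"
 shows "Ck k E ==> Ck k (%x::'a::euclidean_space. E (x \<bullet> c + d))"
proof (induction k arbitrary: E)
 case 0
 then have "continuous_on UNIV E" by auto
 then show ?case by (auto intro!: continuous_on_compose2[of UNIV E] continuous_intros)
next
 case (Suc k)
 note E = Ck_SucD[OF Suc.prems]
 show ?case
 proof (rule Ck_SucI)
 fix x :: 'a
 have "((%x. x \<bullet> c + d) has_derivative (%h. h \<bullet> c)) (at x)"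
 by (auto intro!: derivative_eq_intros)
 then show "((%x. E (x \<bullet> c + d)) has_derivative
 (%h. frechet_derivative E (at (x \<bullet> c + d)) (h \<bullet> c))) (at x)"
 using diff_chain_at[OF _ E(1)] by (auto simp: o_def)
 next
 fix b :: 'a assume b: "b \<in> Basis"
 have "frechet_derivative E (at y) (b \<bullet> c) = (b \<bullet> c) * frechet_derivative E (at y) 1" for y
 using linear_scale[OF linear_frechet_derivative[of E "at y"], of "b \<bullet> c" 1] Suc.prems by simp
 then show "Ck k (%x. frechet_derivative E (at (x \<bullet> c + d)) (b \<bullet> c))"
 using Ck_mult[OF Ck_const[of k "b \<bullet> c"] Suc.IH[OF E(2)[of 1]]] by auto
 qed
qed

lemma smooth_const: "smooth (%x. c)"
 by (simp add: smooth_def Ck_const)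

lemma smooth_add: "smooth f ==> smooth g ==> smooth (%x. f x + g x)"
 by (simp add: smooth_def Ck_add)

lemma smooth_mult: "smooth f ==> smooth g ==> smooth (%x. f x * g x)"
 by (simp add: smooth_def Ck_mult)

lemma smooth_diff: "smooth f ==> smooth g ==> smooth (%x. f x - g x)"
 using smooth_add[OF _ smooth_mult[OF smooth_const[of "-1"]], of f g] by simp

lemma smooth_prod: "(!!i. i \<in> I ==> smooth (f i)) ==> smooth (%x. \<Prod>i\<in>I. f i x)"
 by (induction I rule: infinite_finite_induct) (simp_all add: smooth_const smooth_mult)

lemma Ck_ident: "Ck k (%x::real. x)"
proof (cases k)
 case (Suc n)
 show ?thesis unfolding Suc by (rule Ck_SucI[where f'="%x h. h"]) (auto intro: Ck_const)
qed auto

lemma smooth_inner: "smooth (%x. x \<bullet> c)"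
 using Ck_affine_compose[OF Ck_ident, of _ c 0] by (simp add: smooth_def)

lemma smooth_affine_compose:
 fixes E :: "real => real"
 shows "smooth E ==> smooth (%x::'a::euclidean_space. E (x \<bullet> c + d))"
 by (simp add: smooth_def Ck_affine_compose)

lemma smooth_has_derivative:
 "smooth f ==> (f has_derivative frechet_derivative f (at x)) (at x)"
 unfolding smooth_def by (rule Ck_SucD(1)[of 0]) blast

lemma smooth_frechet:
 assumes "smooth f" "b \<in> Basis" shows "smooth (%x. frechet_derivative f (at x) b)"
 using assms Ck_SucD(2) unfolding smooth_def by blast

lemma smooth_continuous: "smooth f ==> continuous_on S f"
 using Ck_continuous continuous_on_subset unfolding smooth_def by blast

text \<open>The flat function $e^{-1/s}$, the source of all test functions.\<close>

definition flat_poly :: "real poly => real => real" where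
 "flat_poly p s = (if s > 0 then poly p (1/s) * exp (- (1/s)) else 0)"

text \<open>With \<open>y = 1/s\<close> this is the decay of a polynomial against the exponential at
  infinity.\<close>

lemma flat_poly_tendsto_0: "(flat_poly p \<longlongrightarrow> 0) (at_right 0)"
proof -
 have *: "((%y. poly p y * exp (-y)) \<longlongrightarrow> 0) at_top"
 proof (induction p)
 case 0 then show ?case by simp
 next
 case (pCons a p)
 have "((%y::real. y * (\<Sum>i\<le>degree p. coeff p i * y^i) * exp (-y)) \<longlongrightarrow> 0) at_top"
 proof -
 have "((%y::real. \<Sum>i\<le>degree p. coeff p i * (y^(Suc i) / exp y)) \<longlongrightarrow> (\<Sum>i\<le>degree p. coeff p i * 0)) at_top"
 by (intro tendsto_intros tendsto_power_div_exp_0)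
 then show ?thesis
 by (simp add: sum_distrib_left sum_distrib_right exp_minus field_simps)
 qed
 moreover have "((%y::real. a * (y^0 / exp y)) \<longlongrightarrow> a * 0) at_top"
 by (intro tendsto_intros tendsto_power_div_exp_0)
 ultimately have "((%y::real. a * (y^0 / exp y) + y * (\<Sum>i\<le>degree p. coeff p i * y^i) * exp (-y)) \<longlongrightarrow> 0) at_top"
 using tendsto_add by fastforce
 then show ?case by (simp add: poly_altdef[of p] exp_minus field_simps)
 qed
 have "((%s. poly p (inverse s) * exp (- inverse s)) \<longlongrightarrow> 0) (at_right 0)"
 using filterlim_compose[OF * filterlim_inverse_at_top_right] by simp
 then show ?thesis
 by (rule Lim_transform_eventually)
 (auto simp: flat_poly_def eventually_at_filter inverse_eq_divide)
qed

text \<open>Differentiating p(1/s) exp(-1/s) gives s^(-2) (p - p')(1/s) exp(-1/s), and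
  multiplication by s^(-2) is multiplication of the polynomial by \<open>[:0,0,1:]\<close>. The
  family is thus closed under differentiation, which makes smoothness an induction over all
  \<open>p\<close> at once.\<close>

lemma flat_poly_has_field_derivative:
 "(flat_poly p has_field_derivative flat_poly ([:0,0,1:] * (p - pderiv p)) s) (at s)"
proof (cases s "0::real" rule: linorder_cases)
 case less
 then show ?thesis
 using less by - (rule has_field_derivative_transform_within_open[of "%s. 0" _ s "{..<0}"], auto simp: flat_poly_def)
next
 case greater
 have "((%s. poly p (1/s) * exp (- (1/s))) has_field_derivative
 poly ([:0,0,1:] * (p - pderiv p)) (1/s) * exp (- (1/s))) (at s)"
 apply (rule derivative_eq_intros poly_DERIV[THEN DERIV_chain2] refl | use greater in force)+
 using greater by (simp add: field_simps power2_eq_square)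
 then show ?thesis
 using greater
 by - (rule has_field_derivative_transform_within_open[of "%s. poly p (1/s) * exp (- (1/s))" _ s "{0<..}"],
 auto simp: flat_poly_def)
next
 case equal
 \<comment> \<open>Division by \<open>h\<close> amounts to multiplying the polynomial by its
   variable, so the right difference quotient at 0 is again a \<open>flat_poly\<close> and tends to
   0.\<close>
 have "((%h. flat_poly p h / h) \<longlongrightarrow> 0) (at_right 0)"
 by (rule Lim_transform_eventually[OF flat_poly_tendsto_0[of "[:0,1:] * p"]])
 (auto simp: flat_poly_def eventually_at_filter)
 moreover have "((%h. flat_poly p h / h) \<longlongrightarrow> 0) (at_left 0)"
 by (rule Lim_transform_eventually[OF tendsto_const]) (auto simp: flat_poly_def eventually_at_filter)
 ultimately have "((%h. flat_poly p h / h) \<longlongrightarrow> 0) (at 0)"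
 by (simp add: filterlim_split_at)
 then show ?thesis
 using equal by (simp add: DERIV_def flat_poly_def)
qed

lemma Ck_flat_poly: "Ck k (flat_poly p)"
proof (induction k arbitrary: p)
 case 0
 show ?case using DERIV_isCont[OF flat_poly_has_field_derivative] by (auto intro: continuous_at_imp_continuous_on)
next
 case (Suc k)
 show ?case
 proof (rule Ck_SucI)
 show "(flat_poly p has_derivative (%h. flat_poly ([:0,0,1:] * (p - pderiv p)) s * h)) (at s)" for s
 using flat_poly_has_field_derivative by (simp add: has_field_derivative_def)
 fix b :: real assume "b \<in> Basis"
 then show "Ck k (%x. flat_poly ([:0,0,1:] * (p - pderiv p)) x * b)"
 using Suc by simp
 qed
qed

definition flat :: "real => real" where "flat s = flat_poly 1 s"

lemma flat_simps: "s <= 0 ==> flat s = 0" "s > 0 ==> flat s = exp (- (1/s))"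
 by (auto simp: flat_def flat_poly_def)

lemma flat_bounds: "0 <= flat s" "flat s <= 1"
 by (auto simp: flat_def flat_poly_def)

lemma smooth_flat: "smooth flat"
 unfolding smooth_def flat_def[abs_def] by (simp add: Ck_flat_poly)

text \<open>As \<open>flat\<close> tends to 1 at infinity, the factor \<open>n\<close> pushes the
  product to the indicator of the open box without any normalising constant, while the values stay
  in [0, 1] for dominated convergence.\<close>

definition box_bump :: "nat => 'a::euclidean_space => 'a => 'a => real" where
 "box_bump n a b x = (\<Prod>i\<in>Basis. flat (real n * (x \<bullet> i - a \<bullet> i)) * flat (real n * (b \<bullet> i - x \<bullet> i)))"

lemma smooth_box_bump: "smooth (box_bump n a b :: 'a::euclidean_space => real)"
proof -
 have "smooth (%x::'a. flat (x \<bullet> (real n *\<^sub>R i) + (- real n * (a \<bullet> i))) * flat (x \<bullet> (- real n *\<^sub>R i) + (real n * (b \<bullet> i))))" for i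
 by (intro smooth_mult smooth_affine_compose smooth_flat)
 then have "smooth (%x. \<Prod>i\<in>Basis. flat (x \<bullet> (real n *\<^sub>R i) + (- real n * (a \<bullet> i))) * flat (x \<bullet> (- real n *\<^sub>R i) + (real n * (b \<bullet> i))))"
 by (rule smooth_prod)
 moreover have "(%x. \<Prod>i\<in>Basis. flat (x \<bullet> (real n *\<^sub>R i) + (- real n * (a \<bullet> i))) * flat (x \<bullet> (- real n *\<^sub>R i) + (real n * (b \<bullet> i)))) = box_bump n a b"
 unfolding box_bump_def[abs_def] by (intro ext prod.cong) (auto simp: algebra_simps)
 ultimately show ?thesis by simp
qed

lemma box_bump_bounds: "0 <= box_bump n a b x" "box_bump n a b x <= 1"
 unfolding box_bump_def
 by (auto intro!: prod_nonneg prod_le_1 mult_nonneg_nonneg mult_le_one flat_bounds)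

lemma box_bump_eq_0: "x \<notin> box a b ==> box_bump n a b x = 0"
 unfolding box_bump_def by (force simp: box_def flat_simps mult_nonneg_nonpos)

lemma box_bump_tendsto: "(%n. box_bump n a b x) \<longlonglongrightarrow> indicator (box a b) x"
proof (cases "x \<in> box a b")
 case False
 then show ?thesis by (simp add: box_bump_eq_0)
next
 case True
 have *: "(%n. flat (real n * s)) \<longlonglongrightarrow> 1" if "s > 0" for s
 proof -
 have "(%n. exp (- (1/s * inverse (real n)))) \<longlonglongrightarrow> exp (- (1/s * 0))"
 by (intro tendsto_intros lim_inverse_n)
 then have "(%n. exp (- (1/s * inverse (real n)))) \<longlonglongrightarrow> 1" by simp
 moreover have "eventually (%n. exp (- (1/s * inverse (real n))) = flat (real n * s)) sequentially"
 by (rule eventually_mono[OF eventually_gt_at_top[of 0]]) (use that in \<open>auto simp: flat_simps field_simps\<close>)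
 ultimately show ?thesis by (rule Lim_transform_eventually)
 qed
 have "(%n. box_bump n a b x) \<longlonglongrightarrow> (\<Prod>i\<in>(Basis::'a set). 1 * 1)"
 unfolding box_bump_def using True by (intro tendsto_prod tendsto_mult *) (auto simp: box_def)
 then show ?thesis using True by simp
qed

lemma test_function_box_bump:
 assumes "cbox a b \<subseteq> U" shows "test_function U (box_bump n a b)"
proof -
 have "closure {x. box_bump n a b x ~= 0} \<subseteq> cbox a b"
 using box_bump_eq_0 box_subset_cbox by (intro closure_minimal) blast+
 moreover have "bounded {x. box_bump n a b x ~= 0}"
 by (rule bounded_subset[OF bounded_cbox[of a b]]) (use box_bump_eq_0 box_subset_cbox in blast)
 ultimately show ?thesis
 using assms smooth_box_bump[of n a b] by (auto simp: test_function_def compact_closure)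
qed

text \<open>Applied with coordinate functions as multipliers, to test against components of the
  linear field \<open>rot_field\<close>.\<close>

lemma test_function_mult:
 assumes "test_function U \<psi>" "smooth c" shows "test_function U (%x. \<psi> x * c x)"
proof -
 have "closure {x. \<psi> x * c x ~= 0} \<subseteq> closure {x. \<psi> x ~= 0}"
 by (intro closure_mono) auto
 moreover have "bounded {x. \<psi> x * c x ~= 0}"
 by (rule bounded_subset[of "{x. \<psi> x ~= 0}"]) (use assms in \<open>auto simp: test_function_def compact_closure\<close>)
 ultimately show ?thesis
 using assms smooth_mult[of \<psi> c] by (auto simp: test_function_def compact_closure)
qed

lemma test_function_frechet_eq_0:
 assumes "test_function U \<psi>" "x \<notin> closure {x. \<psi> x ~= 0}"
 shows "\<psi> x = 0" "frechet_derivative \<psi> (at x) = (%h. 0)"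
proof -
 have z: "\<psi> y = 0" if "y \<notin> closure {x. \<psi> x ~= 0}" for y
 using that subsetD[OF closure_subset, of y "{x. \<psi> x ~= 0}"] by auto
 show "\<psi> x = 0" by (rule z[OF assms(2)])
 have "((%x. 0) has_derivative (%h. 0)) (at x)" by simp
 then have "(\<psi> has_derivative (%h. 0)) (at x)"
 proof (rule has_derivative_transform_within_open[of _ _ _ _ "- closure {x. \<psi> x ~= 0}"])
 show "0 = \<psi> y" if "y \<in> - closure {x. \<psi> x ~= 0}" for y
 using z[of y] that by (metis ComplD)
 qed (use assms(2) in \<open>simp_all add: open_Compl\<close>)
 then show "frechet_derivative \<psi> (at x) = (%h. 0)" by (metis frechet_derivative_at)
qed

section \<open>Square-integrable functions and convergence in mean square\<close>

definition l2 :: "'a measure => ('a => 'b::euclidean_space) => bool" where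
 "l2 M f \<longleftrightarrow> f \<in> borel_measurable M \<and> integrable M (%x. (norm (f x))^2)"

text \<open>Membership in L2 belongs to the notion: a Bochner integral that does not exist has the
  value 0, so the limit alone would say nothing.\<close>

definition l2lim :: "'a measure => (nat => 'a => 'b::euclidean_space) => ('a => 'b) => bool" where
 "l2lim M F f \<longleftrightarrow> (\<forall>n. l2 M (F n)) \<and> l2 M f \<and> (%n. LINT x|M. (norm (F n x - f x))^2) \<longlonglongrightarrow> 0"

lemma l2_measurable [measurable_dest]: "l2 M f ==> f \<in> borel_measurable M"
 by (simp add: l2_def)

lemma norm_add_sq_le: "(norm (a + b))^2 <= 2 * (norm a)^2 + 2 * (norm (b::'b::real_normed_vector))^2"
proof -
 have "(norm (a + b))^2 <= (norm a + norm b)^2"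
 by (intro power_mono norm_triangle_ineq) auto
 also have "... <= 2 * (norm a)^2 + 2 * (norm b)^2"
 using sum_squares_bound[of "norm a" "norm b"] by (simp add: power2_sum)
 finally show ?thesis .
qed

lemma l2_dominated:
 assumes "f \<in> borel_measurable M" "integrable M g" "AE x in M. (norm (f x))^2 <= g x"
 shows "l2 M f"
 unfolding l2_def
proof
 show "integrable M (%x. (norm (f x))^2)"
 by (rule Bochner_Integration.integrable_bound[OF assms(2)]) (use assms in auto)
qed (use assms in auto)

lemma l2_add: "l2 M f ==> l2 M g ==> l2 M (%x. f x + g x)"
 by (rule l2_dominated[where g="%x. 2 * (norm (f x))^2 + 2 * (norm (g x))^2"])
 (auto simp: l2_def norm_add_sq_le)

lemma l2_scaleR:
 fixes c :: "'a => real"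
 assumes "l2 M f" "c \<in> borel_measurable M" "AE x in M. \<bar>c x\<bar> <= C"
 shows "l2 M (%x. c x *\<^sub>R f x)"
proof (rule l2_dominated[where g="%x. C^2 * (norm (f x))^2"])
 show "AE x in M. (norm (c x *\<^sub>R f x))^2 <= C^2 * (norm (f x))^2"
 using assms(3)
 proof eventually_elim
 case (elim x)
 then have "\<bar>c x\<bar>^2 <= C^2" by (intro power_mono) auto
 then show ?case by (auto simp: power_mult_distrib intro!: mult_right_mono)
 qed
qed (use assms in \<open>auto simp: l2_def\<close>)

lemma l2_inner_bounded:
 assumes "l2 M f" "e \<in> borel_measurable M" "AE x in M. norm (e x) <= C"
 shows "l2 M (%x. f x \<bullet> e x)"
proof (rule l2_dominated[where g="%x. C^2 * (norm (f x))^2"])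
 show "AE x in M. (norm (f x \<bullet> e x))^2 <= C^2 * (norm (f x))^2"
 using assms(3)
 proof eventually_elim
 case (elim x)
 have "\<bar>f x \<bullet> e x\<bar> <= norm (f x) * C"
 using Cauchy_Schwarz_ineq2[of "f x" "e x"] mult_left_mono[OF elim, of "norm (f x)"] by auto
 then have "\<bar>f x \<bullet> e x\<bar>^2 <= (norm (f x) * C)^2" by (intro power_mono) auto
 then show ?case by (auto simp: power_mult_distrib mult.commute)
 qed
qed (use assms in \<open>auto simp: l2_def\<close>)

lemma l2_uminus: "l2 M f ==> l2 M (%x. - f x)"
 by (simp add: l2_def)

lemma l2_diff: "l2 M f ==> l2 M g ==> l2 M (%x. f x - g x)"
 using l2_add[of M f "%x. - g x"] l2_uminus by fastforce

lemma l2_bounded: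
 assumes "finite_measure M" "f \<in> borel_measurable M" "AE x in M. norm (f x) <= C"
 shows "l2 M f"
proof (rule l2_dominated[where g="%x. C^2"])
 show "integrable M (%x. C^2)" using assms(1) by (simp add: finite_measure.integrable_const)
 show "AE x in M. (norm (f x))^2 <= C^2"
 using assms(3) by eventually_elim (auto intro: power_mono)
qed (use assms in auto)

lemma l2_inner_integrable:
 assumes "l2 M f" "l2 M g" shows "integrable M (%x. f x \<bullet> g x)"
proof (rule Bochner_Integration.integrable_bound[where f="%x. (norm (f x))^2 + (norm (g x))^2"])
 show "AE x in M. norm (f x \<bullet> g x) <= norm ((norm (f x))^2 + (norm (g x))^2)"
 proof (intro AE_I2)
 fix x
 have "\<bar>f x \<bullet> g x\<bar> <= norm (f x) * norm (g x)" by (rule Cauchy_Schwarz_ineq2)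
 also have "... <= (norm (f x))^2 + (norm (g x))^2"
 using sum_squares_bound[of "norm (f x)" "norm (g x)"] mult_nonneg_nonneg[of "norm (f x)" "norm (g x)"]
 by (simp add: mult.assoc del: zero_le_mult_iff mult_nonneg_nonneg)
 finally show "norm (f x \<bullet> g x) <= norm ((norm (f x))^2 + (norm (g x))^2)" by simp
 qed
qed (use assms in \<open>auto simp: l2_def\<close>)

lemma l2_mult_integrable:
 fixes f g :: "'a => real"
 assumes "l2 M f" "l2 M g" shows "integrable M (%x. f x * g x)"
 using l2_inner_integrable[OF assms] by simp

lemma l2_integrable:
 assumes "finite_measure M" "l2 M f" shows "integrable M f"
proof (rule Bochner_Integration.integrable_bound[where f="%x. 1 + (norm (f x))^2"])
 show "AE x in M. norm (f x) <= norm (1 + (norm (f x))^2)"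
 proof (intro AE_I2)
 fix x show "norm (f x) <= norm (1 + (norm (f x))^2)"
 using sum_squares_bound[of 1 "norm (f x)"] by (simp add: le_minus_iff) (metis add.commute dual_order.trans le_add_same_cancel2 mult_2 norm_ge_zero)
 qed
qed (use assms in \<open>auto simp: l2_def finite_measure.integrable_const\<close>)

text \<open>The squared norm of s f + g is a nonnegative quadratic polynomial in s; its value at the
  minimiser gives the discriminant bound.\<close>

lemma l2_Cauchy_Schwarz:
 assumes "l2 M f" "l2 M g"
 shows "\<bar>LINT x|M. f x \<bullet> g x\<bar> <= sqrt (LINT x|M. (norm (f x))^2) * sqrt (LINT x|M. (norm (g x))^2)"
proof -
 let ?a = "LINT x|M. (norm (f x))^2" and ?b = "LINT x|M. f x \<bullet> g x" and ?c = "LINT x|M. (norm (g x))^2"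
 have i: "integrable M (%x. (norm (f x))^2)" "integrable M (%x. (norm (g x))^2)"
 using assms by (auto simp: l2_def)
 note ii = l2_inner_integrable[OF assms]
 have "0 <= ?a * s^2 + 2 * ?b * s + ?c" for s
 proof -
 have "0 <= (LINT x|M. (norm (s *\<^sub>R f x + g x))^2)" by simp
 also have "... = (LINT x|M. s^2 * (norm (f x))^2 + 2 * s * (f x \<bullet> g x) + (norm (g x))^2)"
 by (intro BI_cong refl)
 (unfold power2_norm_eq_inner, simp add: inner_add_left inner_add_right inner_commute power2_eq_square
 algebra_simps del: dot_square_norm)
 also have "... = ?a * s^2 + 2 * ?b * s + ?c"
 using i ii by simp
 finally show ?thesis .
 qed
 note q = this
 have "?b^2 <= ?a * ?c"
 proof (cases "?a = 0")
 case True
 have "?b = 0"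
 proof (rule ccontr)
 assume "?b ~= 0"
 \<comment> \<open>With zero leading coefficient the polynomial is affine, and at this point it
   takes the value -1.\<close>
 then show False using q[of "- (?c + 1) / (2 * ?b)"] True by (auto simp: field_simps)
 qed
 then show ?thesis using True by simp
 next
 case False
 moreover have "?a >= 0" by simp
 ultimately have a: "?a > 0" by linarith
 have "0 <= ?a * (?a * (- ?b / ?a)^2 + 2 * ?b * (- ?b / ?a) + ?c)"
 by (rule mult_nonneg_nonneg[OF less_imp_le[OF a] q])
 also have "... = ?a * ?c - ?b^2"
 using a by (simp add: field_simps power2_eq_square)
 finally show ?thesis by simp
 qed
 then have "sqrt (?b^2) <= sqrt (?a * ?c)" by (rule real_sqrt_le_mono)
 then show ?thesis by (simp add: real_sqrt_mult)
qed

lemma l2lim_l2: "l2lim M F f ==> l2 M (F n)" "l2lim M F f ==> l2 M f"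
 by (auto simp: l2lim_def)

lemma l2lim_const: "l2 M f ==> l2lim M (%n. f) f"
 by (simp add: l2lim_def)

text \<open>The common pattern behind the closure rules for \<open>l2lim\<close>: a pointwise
  Lipschitz estimate between the differences transfers the convergence.\<close>

lemma l2lim_bound:
 assumes "l2lim M F f" "!!n. l2 M (G n)" "l2 M g"
 "!!n. AE x in M. (norm (G n x - g x))^2 <= C * (norm (F n x - f x))^2"
 shows "l2lim M G g"
 unfolding l2lim_def
proof (intro conjI allI)
 show "(%n. LINT x|M. (norm (G n x - g x))^2) \<longlonglongrightarrow> 0"
 proof (rule tendsto_sandwich[where f="%n. 0" and h="%n. C * (LINT x|M. (norm (F n x - f x))^2)"])
 show "\<forall>\<^sub>F n in sequentially. (LINT x|M. (norm (G n x - g x))^2) <= C * (LINT x|M. (norm (F n x - f x))^2)"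
 proof (intro always_eventually allI)
 fix n
 have "(LINT x|M. (norm (G n x - g x))^2) <= (LINT x|M. C * (norm (F n x - f x))^2)"
 using l2_diff[OF assms(2)[of n] assms(3)] l2_diff[OF l2lim_l2(1)[OF assms(1), of n] l2lim_l2(2)[OF assms(1)]] assms(4)[of n]
 by (intro integral_mono_AE) (auto simp: l2_def)
 then show "(LINT x|M. (norm (G n x - g x))^2) <= C * (LINT x|M. (norm (F n x - f x))^2)" by simp
 qed
 have "(%n. LINT x|M. (norm (F n x - f x))^2) \<longlonglongrightarrow> 0" using assms(1) by (simp add: l2lim_def)
 from tendsto_mult[OF tendsto_const[of C] this]
 show "(%n. C * (LINT x|M. (norm (F n x - f x))^2)) \<longlonglongrightarrow> 0" by simp
 qed auto
qed (use assms in auto)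

lemma l2lim_scaleR:
 fixes c :: "'a => real"
 assumes "l2lim M F f" "c \<in> borel_measurable M" "AE x in M. \<bar>c x\<bar> <= C"
 shows "l2lim M (%n x. c x *\<^sub>R F n x) (%x. c x *\<^sub>R f x)"
proof (rule l2lim_bound[OF assms(1), where C="C^2"])
 fix n
 show "AE x in M. (norm (c x *\<^sub>R F n x - c x *\<^sub>R f x))^2 <= C^2 * (norm (F n x - f x))^2"
 using assms(3)
 proof eventually_elim
 case (elim x)
 then have "\<bar>c x\<bar>^2 <= C^2" by (intro power_mono) auto
 then show ?case
 by (auto simp: power_mult_distrib scaleR_diff_right[symmetric] simp del: scaleR_diff_right intro!: mult_right_mono)
 qed
qed (auto intro: l2_scaleR assms l2lim_l2[OF assms(1)])

lemma l2lim_mult: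
 fixes c :: "'a => real"
 assumes "l2lim M F f" "c \<in> borel_measurable M" "AE x in M. \<bar>c x\<bar> <= C"
 shows "l2lim M (%n x. c x * F n x) (%x. c x * f x)"
 using l2lim_scaleR[OF assms] by simp

lemma l2lim_inner_bounded:
 assumes "l2lim M F f" "e \<in> borel_measurable M" "AE x in M. norm (e x) <= C"
 shows "l2lim M (%n x. F n x \<bullet> e x) (%x. f x \<bullet> e x)"
proof (rule l2lim_bound[OF assms(1), where C="C^2"])
 fix n
 show "AE x in M. (norm (F n x \<bullet> e x - f x \<bullet> e x))^2 <= C^2 * (norm (F n x - f x))^2"
 using assms(3)
 proof eventually_elim
 case (elim x)
 have "\<bar>(F n x - f x) \<bullet> e x\<bar> <= norm (F n x - f x) * C"
 using Cauchy_Schwarz_ineq2[of "F n x - f x" "e x"] mult_left_mono[OF elim, of "norm (F n x - f x)"] by auto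
 then have "\<bar>(F n x - f x) \<bullet> e x\<bar>^2 <= (norm (F n x - f x) * C)^2" by (intro power_mono) auto
 then show ?case by (auto simp: power_mult_distrib inner_diff_left mult.commute)
 qed
qed (auto intro: l2_inner_bounded assms l2lim_l2[OF assms(1)])

lemma l2lim_scaleR_bounded:
 assumes "l2lim M F f" "e \<in> borel_measurable M" "AE x in M. norm (e x :: 'b::euclidean_space) <= C"
 shows "l2lim M (%n x. F n x *\<^sub>R e x) (%x. f x *\<^sub>R e x)"
proof -
 have "l2 M (%x. h x *\<^sub>R e x)" if "l2 M h" for h :: "'a => real"
 proof (rule l2_dominated[where g="%x. C^2 * (norm (h x))^2"])
 show "AE x in M. (norm (h x *\<^sub>R e x))^2 <= C^2 * (norm (h x))^2"
 using assms(3)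
 by eventually_elim (auto simp: power_mult_distrib mult.commute[of "C^2"] intro!: mult_left_mono power_mono)
 qed (use assms that in \<open>auto simp: l2_def\<close>)
 note * = this
 show ?thesis
 proof (rule l2lim_bound[OF assms(1), where C="C^2"])
 fix n
 show "AE x in M. (norm (F n x *\<^sub>R e x - f x *\<^sub>R e x))^2 <= C^2 * (norm (F n x - f x))^2"
 using assms(3)
 by eventually_elim
 (auto simp: power_mult_distrib scaleR_diff_left[symmetric] mult.commute[of "C^2"] simp del: scaleR_diff_left
 intro!: mult_left_mono power_mono)
 qed (auto intro: * l2lim_l2[OF assms(1)])
qed

lemma l2lim_add:
 assumes "l2lim M F f" "l2lim M G g"
 shows "l2lim M (%n x. F n x + G n x) (%x. f x + g x)"
 unfolding l2lim_def
proof (intro conjI allI)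
 have d: "l2 M (%x. F n x - f x)" "l2 M (%x. G n x - g x)" for n
 by (auto intro: l2_diff l2lim_l2[OF assms(1)] l2lim_l2[OF assms(2)])
 show "(%n. LINT x|M. (norm (F n x + G n x - (f x + g x)))^2) \<longlonglongrightarrow> 0"
 proof (rule tendsto_sandwich[where f="%n. 0" and
 h="%n. 2 * (LINT x|M. (norm (F n x - f x))^2) + 2 * (LINT x|M. (norm (G n x - g x))^2)"])
 show "\<forall>\<^sub>F n in sequentially. (LINT x|M. (norm (F n x + G n x - (f x + g x)))^2)
 <= 2 * (LINT x|M. (norm (F n x - f x))^2) + 2 * (LINT x|M. (norm (G n x - g x))^2)"
 proof (intro always_eventually allI)
 fix n
 have "(LINT x|M. (norm (F n x + G n x - (f x + g x)))^2)
 <= (LINT x|M. 2 * (norm (F n x - f x))^2 + 2 * (norm (G n x - g x))^2)"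
 proof (rule integral_mono_AE)
 show "integrable M (%x. (norm (F n x + G n x - (f x + g x)))^2)"
 using l2_add[OF d[of n]] by (simp add: l2_def algebra_simps)
 show "AE x in M. (norm (F n x + G n x - (f x + g x)))^2
 <= 2 * (norm (F n x - f x))^2 + 2 * (norm (G n x - g x))^2"
 proof (intro AE_I2)
 fix x
 have "F n x + G n x - (f x + g x) = (F n x - f x) + (G n x - g x)" by simp
 then show "(norm (F n x + G n x - (f x + g x)))^2 <= 2 * (norm (F n x - f x))^2 + 2 * (norm (G n x - g x))^2"
 using norm_add_sq_le by metis
 qed
 qed (use d[of n] in \<open>auto simp: l2_def\<close>)
 then show "(LINT x|M. (norm (F n x + G n x - (f x + g x)))^2)
 <= 2 * (LINT x|M. (norm (F n x - f x))^2) + 2 * (LINT x|M. (norm (G n x - g x))^2)"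
 using d[of n] by (simp add: l2_def)
 qed
 show "(%n. 2 * (LINT x|M. (norm (F n x - f x))^2) + 2 * (LINT x|M. (norm (G n x - g x))^2)) \<longlonglongrightarrow> 0"
 using assms by (auto simp: l2lim_def intro!: tendsto_eq_intros)
 qed auto
qed (use assms in \<open>auto intro: l2_add l2lim_l2\<close>)

lemma l2lim_uminus: "l2lim M F f ==> l2lim M (%n x. - F n x) (%x. - f x)"
 by (rule l2lim_bound[where C=1]) (auto simp: norm_minus_commute intro: l2_uminus l2lim_l2)

lemma l2lim_diff:
 assumes "l2lim M F f" "l2lim M G g"
 shows "l2lim M (%n x. F n x - G n x) (%x. f x - g x)"
 using l2lim_add[OF assms(1) l2lim_uminus[OF assms(2)]] by simp

lemma l2lim_cong_AE:
 assumes "l2lim M F f" "AE x in M. f x = g x" "g \<in> borel_measurable M"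
 shows "l2lim M F g"
proof -
 have g: "l2 M g"
 by (rule l2_dominated[where g="%x. (norm (f x))^2"])
 (use assms l2lim_l2(2)[OF assms(1)] in \<open>auto simp: l2_def elim: eventually_mono\<close>)
 show ?thesis
 by (rule l2lim_bound[OF assms(1), where C=1])
 (use assms g in \<open>auto intro: l2lim_l2 elim: eventually_mono\<close>)
qed

text \<open>The difference of the integrals splits into the terms (F - f)(G - g), (F - f) g and f (G
  - g), each of which Cauchy-Schwarz sends to 0.\<close>

lemma l2lim_inner:
 assumes "l2lim M F f" "l2lim M G g"
 shows "(%n. LINT x|M. F n x \<bullet> G n x) \<longlonglongrightarrow> (LINT x|M. f x \<bullet> g x)"
proof -
 let ?N = "%h. sqrt (LINT x|M. (norm (h x))^2)"
 have d: "l2 M (%x. F n x - f x)" "l2 M (%x. G n x - g x)" for n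
 by (auto intro: l2_diff l2lim_l2[OF assms(1)] l2lim_l2[OF assms(2)])
 note l = l2lim_l2[OF assms(1)] l2lim_l2[OF assms(2)]
 have eq: "(LINT x|M. F n x \<bullet> G n x) - (LINT x|M. f x \<bullet> g x)
 = (LINT x|M. (F n x - f x) \<bullet> (G n x - g x)) + (LINT x|M. (F n x - f x) \<bullet> g x) + (LINT x|M. f x \<bullet> (G n x - g x))" for n
 using l2_inner_integrable[OF d(1)[of n] d(2)[of n]] l2_inner_integrable[OF d(1)[of n] l(4)]
 l2_inner_integrable[OF l(2) d(2)[of n]] l2_inner_integrable[OF l(1)[of n] l(3)[of n]] l2_inner_integrable[OF l(2) l(4)]
 by (simp flip: BI_diff BI_add)
 (simp add: inner_diff_left inner_diff_right algebra_simps)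
 have "(%n. (LINT x|M. F n x \<bullet> G n x) - (LINT x|M. f x \<bullet> g x)) \<longlonglongrightarrow> 0"
 proof (rule Lim_null_comparison)
 let ?h = "%n. ?N (%x. F n x - f x) * ?N (%x. G n x - g x) + ?N (%x. F n x - f x) * ?N g + ?N f * ?N (%x. G n x - g x)"
 show "\<forall>\<^sub>F n in sequentially. norm ((LINT x|M. F n x \<bullet> G n x) - (LINT x|M. f x \<bullet> g x)) <= ?h n"
 proof (intro always_eventually allI)
 fix n
 show "norm ((LINT x|M. F n x \<bullet> G n x) - (LINT x|M. f x \<bullet> g x)) <= ?h n"
 unfolding eq
 using l2_Cauchy_Schwarz[OF d(1)[of n] d(2)[of n]] l2_Cauchy_Schwarz[OF d(1)[of n] l(4)]
 l2_Cauchy_Schwarz[OF l(2) d(2)[of n]] by (auto simp: abs_le_iff)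
 qed
 have "(%n. ?N (%x. F n x - f x)) \<longlonglongrightarrow> 0" "(%n. ?N (%x. G n x - g x)) \<longlonglongrightarrow> 0"
 using assms by (auto simp: l2lim_def intro!: tendsto_eq_intros)
 from tendsto_add[OF tendsto_add[OF tendsto_mult[OF this] tendsto_mult[OF this(1) tendsto_const[where k="?N g"]]]
 tendsto_mult[OF tendsto_const[where k="?N f"] this(2)]]
 show "?h \<longlonglongrightarrow> 0" by simp
 qed
 then show ?thesis by (simp add: LIM_zero_iff)
qed

lemma l2lim_mult_real:
 fixes F G :: "nat => 'a => real"
 assumes "l2lim M F f" "l2lim M G g"
 shows "(%n. LINT x|M. F n x * G n x) \<longlonglongrightarrow> (LINT x|M. f x * g x)"
 using l2lim_inner[OF assms] by simp

lemma l2lim_integral: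
 fixes F :: "nat => 'a => real"
 assumes "finite_measure M" "l2lim M F f"
 shows "(%n. LINT x|M. F n x) \<longlonglongrightarrow> (LINT x|M. f x)"
 using l2lim_mult_real[OF assms(2) l2lim_const[OF l2_bounded[OF assms(1), of "%x. 1" 1]]] by simp

lemma l2lim_norm_sq:
 assumes "l2lim M F f"
 shows "(%n. LINT x|M. (norm (F n x))^2) \<longlonglongrightarrow> (LINT x|M. (norm (f x))^2)"
 using l2lim_inner[OF assms assms] by (simp add: power2_norm_eq_inner)

lemma l2lim_abs:
 fixes F :: "nat => 'a => real"
 assumes "l2lim M F f"
 shows "l2lim M (%n x. \<bar>F n x\<bar>) (%x. \<bar>f x\<bar>)"
proof (rule l2lim_bound[OF assms, where C=1])
 have "(\<bar>a\<bar> - \<bar>b\<bar>)^2 <= (a - b)^2" for a b :: real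
 by (metis abs_triangle_ineq3 abs_le_square_iff)
 then show "AE x in M. (norm (\<bar>F n x\<bar> - \<bar>f x\<bar>))^2 <= 1 * (norm (F n x - f x))^2" for n
 by auto
qed (use l2lim_l2[OF assms] in \<open>auto simp: l2_def intro!: borel_measurable_abs\<close>)

lemma l2lim_subseq:
 assumes "l2lim M F f" "strict_mono r" shows "l2lim M (%n. F (r n)) f"
 using assms LIMSEQ_subseq_LIMSEQ[of "%n. LINT x|M. (norm (F n x - f x))^2" 0 r]
 by (auto simp: l2lim_def o_def)

lemma l2lim_AE_subseq:
 assumes "l2lim M F f"
 obtains r where "strict_mono r" "AE x in M. (%n. F (r n) x) \<longlonglongrightarrow> f x"
proof -
 have d: "l2 M (%x. F n x - f x)" for n
 by (auto intro: l2_diff l2lim_l2[OF assms(1)])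
 have "(%n. LINT x|M. norm ((norm (F n x - f x))^2)) \<longlonglongrightarrow> 0"
 using assms by (simp add: l2lim_def)
 then obtain r where r: "strict_mono r" "AE x in M. (%n. (norm (F (r n) x - f x))^2) \<longlonglongrightarrow> 0"
 using tendsto_L1_AE_subseq[where M=M and u="%n x. (norm (F n x - f x))^2"] d by (auto simp: l2_def)
 have "AE x in M. (%n. F (r n) x) \<longlonglongrightarrow> f x"
 using r(2)
 proof eventually_elim
 case (elim x)
 from tendsto_real_sqrt[OF this] have "(%n. norm (F (r n) x - f x)) \<longlonglongrightarrow> 0" by simp
 then show ?case by (metis LIM_zero_iff tendsto_norm_zero_iff)
 qed
 with r(1) show ?thesis by (rule that)
qed

text \<open>The two factors converge in different ways: a bounded one almost everywhere, the other in $L^2$.\<close>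

lemma l2lim_mult_AE:
 fixes c :: "nat => 'a => real"
 assumes F: "l2lim M F f" and c: "!!n. c n \<in> borel_measurable M" "c' \<in> borel_measurable M"
 "!!n. AE x in M. \<bar>c n x\<bar> <= C" "AE x in M. (%n. c n x) \<longlonglongrightarrow> c' x"
 shows "l2lim M (%n x. c n x *\<^sub>R F n x) (%x. c' x *\<^sub>R f x)"
proof -
 note l = l2lim_l2[OF F]
 have all: "AE x in M. \<forall>n. \<bar>c n x\<bar> <= C" using c(3) by (simp add: AE_all_countable)
 have c': "AE x in M. \<bar>c' x\<bar> <= C"
 using all c(4)
 by eventually_elim (rule tendsto_upperbound[OF tendsto_rabs], auto)
 have 1: "l2lim M (%n x. c n x *\<^sub>R F n x - c n x *\<^sub>R f x) (%x. 0)"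
 proof (rule l2lim_bound[OF F, where C="C^2"])
 fix n
 show "AE x in M. (norm (c n x *\<^sub>R F n x - c n x *\<^sub>R f x - 0))^2 <= C^2 * (norm (F n x - f x))^2"
 using c(3)[of n]
 proof eventually_elim
 case (elim x)
 then have "\<bar>c n x\<bar>^2 <= C^2" by (intro power_mono) auto
 then show ?case
 by (auto simp: power_mult_distrib scaleR_diff_right[symmetric] simp del: scaleR_diff_right intro!: mult_right_mono)
 qed
 show "l2 M (%x. c n x *\<^sub>R F n x - c n x *\<^sub>R f x)"
 by (intro l2_diff l2_scaleR[OF _ c(1) c(3)] l)
 qed (simp add: l2_def)
 \<comment> \<open>With the L2 factor frozen, almost everywhere convergence of the bounded factor
   suffices: the difference of the factors is at most \<open>2*C\<close>, which supplies the
   dominating function.\<close>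
 have 2: "l2lim M (%n x. c n x *\<^sub>R f x) (%x. c' x *\<^sub>R f x)"
 unfolding l2lim_def
 proof (intro conjI allI)
 show "l2 M (%x. c n x *\<^sub>R f x)" for n by (intro l2_scaleR[OF _ c(1) c(3)] l)
 show "l2 M (%x. c' x *\<^sub>R f x)" by (intro l2_scaleR[OF _ c(2) c'] l)
 have "(%n. LINT x|M. (norm (c n x *\<^sub>R f x - c' x *\<^sub>R f x))^2) \<longlonglongrightarrow> (LINT x|M. 0)"
 proof (rule integral_dominated_convergence[where w="%x. (2*C)^2 * (norm (f x))^2"])
 show "AE x in M. (%n. (norm (c n x *\<^sub>R f x - c' x *\<^sub>R f x))^2) \<longlonglongrightarrow> 0"
 using c(4)
 proof eventually_elim
 case (elim x)
 have "(%n. (norm (c n x *\<^sub>R f x - c' x *\<^sub>R f x))^2) \<longlonglongrightarrow> (norm (c' x *\<^sub>R f x - c' x *\<^sub>R f x))^2"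
 by (intro tendsto_intros elim)
 then show ?case by simp
 qed
 show "AE x in M. norm ((norm (c n x *\<^sub>R f x - c' x *\<^sub>R f x))^2) <= (2*C)^2 * (norm (f x))^2" for n
 using c(3)[of n] c'
 proof eventually_elim
 case (elim x)
 then have "\<bar>c n x - c' x\<bar>^2 <= (2*C)^2" by (intro power_mono) auto
 then show ?case
 by (auto simp: power_mult_distrib scaleR_diff_left[symmetric] simp del: scaleR_diff_left intro!: mult_right_mono)
 qed
 qed (use l c in \<open>auto simp: l2_def\<close>)
 then show "(%n. LINT x|M. (norm (c n x *\<^sub>R f x - c' x *\<^sub>R f x))^2) \<longlonglongrightarrow> 0" by simp
 qed
 from l2lim_add[OF 1 2] show ?thesis by simp
qed

lemma L2_on_iff_l2: "L2_on U f \<longleftrightarrow> l2 (lebesgue_on U) f"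
 by (auto simp: L2_on_def l2_def L2_norm_sq_def integrable_iff_bounded)

lemma L2_norm_sq_eq:
 "l2 (lebesgue_on U) f ==> L2_norm_sq U f = ennreal (LINT x|lebesgue_on U. (norm (f x))^2)"
 by (simp add: L2_norm_sq_def l2_def nn_integral_eq_integral)

lemma l2lim_if_L2_norm_sq:
 assumes "!!n. l2 (lebesgue_on U) (F n)" "l2 (lebesgue_on U) f"
 "(%n. L2_norm_sq U (%x. F n x - f x)) \<longlonglongrightarrow> 0"
 shows "l2lim (lebesgue_on U) F f"
 using assms(3) unfolding l2lim_def
 by (auto simp: L2_norm_sq_eq[OF l2_diff[OF assms(1,2)]] assms simp flip: ennreal_0)

section \<open>Weak derivatives: testing, uniqueness, agreement with classical derivatives\<close>

lemma open_in_sets_lebesgue: "open (U::'a::euclidean_space set) ==> U \<in> sets lebesgue"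
 by simp

lemma continuous_on_if_has_derivative:
 "(!!x. x \<in> S ==> (f has_derivative f' x) (at x)) ==> continuous_on S f"
 by (rule continuous_at_imp_continuous_on, rule ballI, rule has_derivative_continuous)

lemma AE_lebesgue_on_iff:
 "U \<in> sets lebesgue ==> (AE x in lebesgue_on U. P x) \<longleftrightarrow> (AE x in lebesgue. x \<in> U --> P x)"
 by (intro AE_restrict_space_iff) simp

lemma integral_lebesgue_on_indicator:
 fixes f :: "'a::euclidean_space => 'b::{banach, second_countable_topology}"
 assumes "U \<in> sets lebesgue"
 shows "(LINT x|lebesgue_on U. f x) = (LINT x|lebesgue. indicator U x *\<^sub>R f x)"
 "integrable (lebesgue_on U) f \<longleftrightarrow> integrable lebesgue (%x. indicator U x *\<^sub>R f x)"
 using assms by (auto intro!: integral_restrict_space integrable_restrict_space)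

lemma locally_integrable_indicator:
 assumes "locally_integrable U g" "compact K" "K \<subseteq> U"
 shows "integrable lebesgue (%x. indicator K x *\<^sub>R g x)"
 using assms unfolding locally_integrable_def set_integrable_def by blast

text \<open>Local integrability controls compact subsets only; the support of \<open>c\<close>
  brings the integral over \<open>U\<close> down to \<open>K\<close>, where it becomes an integral
  over the whole space.\<close>

lemma integrable_compact_support:
 fixes g :: "'a::euclidean_space => 'b::euclidean_space" and c :: "'a => real"
 assumes g: "locally_integrable U g" and K: "compact K" "K \<subseteq> U" and U: "open U"
 and c: "c \<in> borel_measurable lebesgue" "!!x. \<bar>c x\<bar> <= C" "!!x. x \<notin> K ==> c x = 0"
 shows "integrable (lebesgue_on U) (%x. c x *\<^sub>R g x)"
 "(LINT x|lebesgue_on U. c x *\<^sub>R g x) = (LINT x|lebesgue. c x *\<^sub>R (indicator K x *\<^sub>R g x))"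
proof -
 have eq: "indicator U x *\<^sub>R c x *\<^sub>R g x = c x *\<^sub>R (indicator K x *\<^sub>R g x)" for x
 using K c(3)[of x] by (auto simp: indicator_def)
 have "integrable lebesgue (%x. c x *\<^sub>R (indicator K x *\<^sub>R g x))"
 proof (rule Bochner_Integration.integrable_bound)
 show "integrable lebesgue (%x. C *\<^sub>R (indicator K x *\<^sub>R g x))"
 using locally_integrable_indicator[OF g K] by (rule integrable_scaleR_right)
 show "(%x. c x *\<^sub>R indicat_real K x *\<^sub>R g x) \<in> borel_measurable lebesgue"
 using borel_measurable_integrable[OF locally_integrable_indicator[OF g K]] c(1)
 by (rule borel_measurable_scaleR[rotated])
 have "\<bar>c x\<bar> <= \<bar>C\<bar>" for x using c(2)[of x] by linarith
 then show "AE x in lebesgue. norm (c x *\<^sub>R indicat_real K x *\<^sub>R g x) <= norm (C *\<^sub>R indicat_real K x *\<^sub>R g x)"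
 by (intro AE_I2) (auto simp: indicator_def intro!: mult_right_mono)
 qed
 then show "integrable (lebesgue_on U) (%x. c x *\<^sub>R g x)"
 unfolding integral_lebesgue_on_indicator[OF open_in_sets_lebesgue[OF U]] eq by simp
 show "(LINT x|lebesgue_on U. c x *\<^sub>R g x) = (LINT x|lebesgue. c x *\<^sub>R (indicator K x *\<^sub>R g x))"
 unfolding integral_lebesgue_on_indicator[OF open_in_sets_lebesgue[OF U]] eq by simp
qed

lemma continuous_compact_support_bounded:
 fixes c :: "'a::euclidean_space => real"
 assumes "continuous_on UNIV c" "compact K" "!!x. x \<notin> K ==> c x = 0"
 obtains C where "!!x. \<bar>c x\<bar> <= C"
proof -
 have "bounded (c ` K)"
 using assms by (meson compact_continuous_image compact_imp_bounded continuous_on_subset subset_UNIV)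
 then obtain C where C: "!!x. x \<in> K ==> \<bar>c x\<bar> <= C" by (auto simp: bounded_iff)
 have "\<bar>c x\<bar> <= \<bar>C\<bar>" for x
 using C[of x] assms(3)[of x] by (cases "x \<in> K") auto
 then show ?thesis by (rule that)
qed

lemma continuous_imp_lebesgue_measurable:
 "continuous_on UNIV (c :: 'a::euclidean_space => real) ==> c \<in> borel_measurable lebesgue"
 by (intro measurable_completion) (simp add: borel_measurable_continuous_onI)

lemma integrable_continuous_support:
 fixes g :: "'a::euclidean_space => 'b::euclidean_space" and c :: "'a => real"
 assumes g: "locally_integrable U g" and K: "compact K" "K \<subseteq> U" and U: "open U"
 and c: "continuous_on UNIV c" "!!x. x \<notin> K ==> c x = 0"
 shows "integrable (lebesgue_on U) (%x. c x *\<^sub>R g x)"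
 using continuous_compact_support_bounded[OF c(1) K(1) c(2)] integrable_compact_support(1)[OF g K U]
 continuous_imp_lebesgue_measurable[OF c(1)] c(2) by metis

text \<open>Box bumps increase to the indicators of boxes, so $h$ has vanishing integral over every box;
 the averages over shrinking boxes then recover \<open>h\<close>.\<close>

lemma fundamental_lemma_box:
 fixes h :: "'a::euclidean_space => real"
 assumes U: "open U" and h: "locally_integrable U h"
 and z: "!!n a b. cbox a b \<subseteq> U ==> (LINT x|lebesgue_on U. box_bump n a b x * h x) = 0"
 shows "AE x in lebesgue_on U. h x = 0"
proof -
 have int0: "integral (cbox a b) h = 0" if ab: "cbox a b \<subseteq> U" for a b
 proof -
 note hi = locally_integrable_indicator[OF h compact_cbox ab]
 have m: "box_bump n a b \<in> borel_measurable lebesgue" for n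
 by (intro continuous_imp_lebesgue_measurable smooth_continuous smooth_box_bump)
 have out: "box_bump n a b x = 0" if "x \<notin> cbox a b" for n x
 using that box_subset_cbox box_bump_eq_0 by blast
 have eq: "(LINT x|lebesgue. box_bump n a b x *\<^sub>R (indicator (cbox a b) x *\<^sub>R h x)) = 0" for n
 using z[OF ab, of n] integrable_compact_support(2)[OF h compact_cbox ab U m[of n], of 1] out
 box_bump_bounds[of n a b] by simp
 have "(%n. LINT x|lebesgue. box_bump n a b x *\<^sub>R (indicator (cbox a b) x *\<^sub>R h x))
 \<longlonglongrightarrow> (LINT x|lebesgue. indicator (box a b) x *\<^sub>R (indicator (cbox a b) x *\<^sub>R h x))"
 proof (rule integral_dominated_convergence[where w="%x. norm (indicator (cbox a b) x *\<^sub>R h x)"])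
 show "AE x in lebesgue. norm (box_bump n a b x *\<^sub>R indicat_real (cbox a b) x *\<^sub>R h x)
 <= norm (indicat_real (cbox a b) x *\<^sub>R h x)" for n
 using box_bump_bounds[of n a b] by (intro AE_I2) (auto simp: abs_mult intro!: mult_left_le_one_le)
 show "AE x in lebesgue. (%n. box_bump n a b x *\<^sub>R indicat_real (cbox a b) x *\<^sub>R h x)
 \<longlonglongrightarrow> indicat_real (box a b) x *\<^sub>R indicat_real (cbox a b) x *\<^sub>R h x"
 by (intro AE_I2 tendsto_scaleR box_bump_tendsto tendsto_const)
 show "integrable lebesgue (%x. norm (indicat_real (cbox a b) x *\<^sub>R h x))"
 using hi by (rule integrable_norm)
 show "(%x. box_bump n a b x *\<^sub>R indicat_real (cbox a b) x *\<^sub>R h x) \<in> borel_measurable lebesgue" for n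
 using borel_measurable_integrable[OF hi] m by (rule borel_measurable_scaleR[rotated])
 show "(%x. indicat_real (box a b) x *\<^sub>R indicat_real (cbox a b) x *\<^sub>R h x) \<in> borel_measurable lebesgue"
 by (rule borel_measurable_scaleR[OF borel_measurable_indicator borel_measurable_integrable[OF hi]]) simp
 qed
 then have "(LINT x|lebesgue. indicator (box a b) x *\<^sub>R (indicator (cbox a b) x *\<^sub>R h x)) = 0"
 unfolding eq by (simp add: LIMSEQ_const_iff)
 moreover have eq': "indicator (box a b) x *\<^sub>R (indicator (cbox a b) x *\<^sub>R h x) = indicator (box a b) x *\<^sub>R h x" for x
 using box_subset_cbox[of a b] by (auto simp: indicator_def)
 ultimately have "set_lebesgue_integral lebesgue (box a b) h = 0"
 unfolding set_lebesgue_integral_def by (simp only: eq')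
 moreover have "h absolutely_integrable_on box a b"
 using h ab unfolding locally_integrable_def
 by (meson absolutely_integrable_on_subinterval box_subset_cbox compact_cbox fmeasurableD lmeasurable_box set_integrable_subset)
 ultimately have "integral (box a b) h = 0"
 by (simp add: set_lebesgue_integral_eq_integral(2))
 then show ?thesis
 by (simp add: integral_open_interval)
 qed
 have loc: "AE x in lebesgue. x \<in> cbox c d --> h x = 0" if cd: "cbox c d \<subseteq> U" for c d
 proof -
 \<comment> \<open>Extension by zero makes the averages over all boxes meaningful; as two boxes meet
   in a box, \<open>f\<close> integrates to 0 over every box.\<close>
 define f where "f x = (if x \<in> cbox c d then h x else 0)" for x
 have hI: "h integrable_on cbox c d"
 by (rule set_lebesgue_integral_eq_integral(1)) (use h cd in \<open>simp add: locally_integrable_def\<close>)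
 have f_int: "(f has_integral 0) (cbox a b)" for a b
 proof -
 obtain u v where uv: "cbox a b \<inter> cbox c d = cbox u v" using Int_interval[of a b c d] by blast
 have uvU: "cbox u v \<subseteq> U" using uv cd by blast
 have "h integrable_on cbox u v"
 by (rule integrable_on_subcbox[OF hI]) (use uv in auto)
 then have "(h has_integral 0) (cbox u v)"
 using int0[of u v] uvU has_integral_integral[of h "cbox u v"] by simp
 then have "((%x. if x \<in> cbox c d then h x else 0) has_integral 0) (cbox a b)"
 unfolding has_integral_restrict_Int uv by (simp add: uv Int_commute)
 then show ?thesis by (simp add: f_def[abs_def])
 qed
 then have "f integrable_on cbox a b" for a b by blast
 \<comment> \<open>The Lebesgue differentiation theorem for cubes with corner \<open>x\<close>:
   outside the negligible set \<open>N\<close> the vanishing averages converge to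
   \<open>f x\<close>.\<close>
 from integrable_ccontinuous_explicit[OF this] obtain N where N: "negligible N"
 "!!x e. [|x \<notin> N; 0 < e|] ==> \<exists>d>0. \<forall>h. 0 < h \<and> h < d -->
 norm(integral (cbox x (x + h *\<^sub>R One)) f /\<^sub>R h ^ DIM('a) - f x) < e" by metis
 have "f x = 0" if xN: "x \<notin> N" for x
 proof (rule ccontr)
 assume "f x ~= 0"
 then have pos: "norm (f x) > 0" by simp
 obtain d where d: "d > 0" "\<forall>h. 0 < h \<and> h < d -->
 norm(integral (cbox x (x + h *\<^sub>R One)) f /\<^sub>R h ^ DIM('a) - f x) < norm (f x)"
 using N(2)[OF xN pos] by blast
 have "integral (cbox x (x + (d/2) *\<^sub>R One)) f = 0" using f_int by (rule integral_unique)
 then show False using d(2)[rule_format, of "d/2"] d(1) by simp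
 qed
 then have "h x = 0" if "x \<notin> N" "x \<in> cbox c d" for x
 using that unfolding f_def by (metis (full_types))
 then have "{x \<in> space lebesgue. \<not> (x \<in> cbox c d --> h x = 0)} \<subseteq> N"
 by blast
 then show ?thesis
 by (rule AE_I'[OF N(1)[unfolded negligible_iff_null_sets]])
 qed
 obtain D where D: "countable D" "\<Union>D = U" "!!X. X \<in> D ==> X \<subseteq> U" "!!X. X \<in> D ==> \<exists>a b. X = cbox a b"
 by (rule open_countable_Union_open_cbox[OF U]) blast
 have "AE x in lebesgue. \<forall>X\<in>D. x \<in> X --> h x = 0"
 using loc D by (subst AE_ball_countable) metis+
 then have "AE x in lebesgue. x \<in> U --> h x = 0"
 by eventually_elim (use D(2) in blast)
 then show ?thesis using U by (simp add: AE_lebesgue_on_iff)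
qed

lemma fundamental_lemma:
 fixes h :: "'a::euclidean_space => real"
 assumes "open U" "locally_integrable U h"
 "!!\<psi>. test_function U \<psi> ==> (LINT x|lebesgue_on U. \<psi> x * h x) = 0"
 shows "AE x in lebesgue_on U. h x = 0"
 using assms(1,2) assms(3)[OF test_function_box_bump] by (rule fundamental_lemma_box)

lemma test_function_support:
 assumes "test_function U \<psi>"
 obtains K where "compact K" "K \<subseteq> U" "!!x. x \<notin> K ==> \<psi> x = 0"
 "!!x b. x \<notin> K ==> frechet_derivative \<psi> (at x) b = 0"
 using assms test_function_frechet_eq_0[OF assms] unfolding test_function_def by metis

lemma test_function_integrable:
 assumes "test_function U \<psi>" "locally_integrable U g" "open U"
 shows "integrable (lebesgue_on U) (%x. \<psi> x *\<^sub>R g x)"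
proof -
 obtain K where K: "compact K" "K \<subseteq> U" "!!x. x \<notin> K ==> \<psi> x = 0"
 using test_function_support[OF assms(1)] by metis
 show ?thesis
 using assms(1) by (intro integrable_continuous_support[OF assms(2) K(1,2) assms(3)] smooth_continuous K(3))
 (auto simp: test_function_def)
qed

lemma test_function_deriv_integrable:
 assumes "test_function U \<psi>" "locally_integrable U g" "open U" "b \<in> Basis"
 shows "integrable (lebesgue_on U) (%x. frechet_derivative \<psi> (at x) b *\<^sub>R g x)"
proof -
 obtain K where K: "compact K" "K \<subseteq> U" "!!x. x \<notin> K ==> frechet_derivative \<psi> (at x) b = 0"
 using test_function_support[OF assms(1)] by metis
 show ?thesis
 using assms(1,4)
 by (intro integrable_continuous_support[OF assms(2) K(1,2) assms(3)] smooth_continuous[OF smooth_frechet] K(3))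
 (auto simp: test_function_def)
qed

lemma weak_deriv_unique:
 assumes U: "open U" and g: "has_weak_deriv U b f g" "has_weak_deriv U b f g'"
 shows "AE x in lebesgue_on U. g x = g' x"
proof -
 note li = g[unfolded has_weak_deriv_def, THEN conjunct2, THEN conjunct1]
 have "AE x in lebesgue_on U. (g x - g' x) \<bullet> e = 0" if "e \<in> Basis" for e
 proof (rule fundamental_lemma[OF U])
 show "locally_integrable U (%x. (g x - g' x) \<bullet> e)"
 using li unfolding locally_integrable_def
 by (auto intro!: absolutely_integrable_component set_integral_diff)
 fix \<psi> assume \<psi>: "test_function U \<psi>"
 note i = test_function_integrable[OF \<psi> li(1) U] test_function_integrable[OF \<psi> li(2) U]
 have "(LINT x|lebesgue_on U. \<psi> x *\<^sub>R g x) = (LINT x|lebesgue_on U. \<psi> x *\<^sub>R g' x)"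
 using g[unfolded has_weak_deriv_def, THEN conjunct2, THEN conjunct2, rule_format, OF \<psi>] by simp
 then have "(LINT x|lebesgue_on U. \<psi> x *\<^sub>R g x - \<psi> x *\<^sub>R g' x) = 0"
 using i by simp
 then have "(LINT x|lebesgue_on U. (\<psi> x *\<^sub>R g x - \<psi> x *\<^sub>R g' x) \<bullet> e) = 0"
 using i by (subst integral_inner_left) auto
 then show "(LINT x|lebesgue_on U. \<psi> x * ((g x - g' x) \<bullet> e)) = 0"
 by (simp add: inner_diff_left algebra_simps)
 qed
 then have "AE x in lebesgue_on U. \<forall>e\<in>Basis. (g x - g' x) \<bullet> e = 0"
 by (subst AE_ball_countable) (auto simp: countable_finite)
 then show ?thesis
 by eventually_elim (auto intro: euclidean_eqI simp: inner_diff_left)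
qed

lemma has_weak_deriv_wderiv: "has_weak_deriv U b f g ==> has_weak_deriv U b f (wderiv U b f)"
 unfolding wderiv_def by (rule someI_ex[of "has_weak_deriv U b f"]) blast

lemma wderiv_AE:
 "open U ==> has_weak_deriv U b f g ==> AE x in lebesgue_on U. wderiv U b f x = g x"
 by (rule weak_deriv_unique[OF _ has_weak_deriv_wderiv])

lemma has_weak_deriv_diff:
 assumes U: "open U" "b \<in> Basis" and f: "has_weak_deriv U b f g" and f': "has_weak_deriv U b f' g'"
 shows "has_weak_deriv U b (%x. f x - f' x) (%x. g x - g' x)"
 unfolding has_weak_deriv_def
proof (intro conjI allI impI)
 note li = f[unfolded has_weak_deriv_def] f'[unfolded has_weak_deriv_def]
 show "locally_integrable U (%x. f x - f' x)" "locally_integrable U (%x. g x - g' x)"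
 using li unfolding locally_integrable_def by (auto intro!: set_integral_diff)
 fix \<psi> assume \<psi>: "test_function U \<psi>"
 show "(LINT x|lebesgue_on U. frechet_derivative \<psi> (at x) b *\<^sub>R (f x - f' x)) =
 - (LINT x|lebesgue_on U. \<psi> x *\<^sub>R (g x - g' x))"
 using li \<psi> test_function_integrable[OF \<psi> _ U(1), of g] test_function_integrable[OF \<psi> _ U(1), of g']
 test_function_deriv_integrable[OF \<psi> _ U, of f] test_function_deriv_integrable[OF \<psi> _ U, of f']
 by (simp add: scaleR_diff_right)
qed

text \<open>The integral of a compactly supported derivative vanishes: difference quotients have integral
 zero by translation invariance.\<close>

lemma integral_deriv_compact_support:
 fixes G :: "'a::euclidean_space => real"
 assumes G: "!!x. (G has_derivative G' x) (at x)" and c: "continuous_on UNIV (%x. G' x b)"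
 and K: "compact K" "!!x. x \<notin> K ==> G x = 0"
 shows "(LINT x|lborel. G' x b) = 0"
proof -
 have G'0: "G' x b = 0" if "x \<notin> K" for x
 proof -
 have "((%x. 0) has_derivative (%h. 0)) (at x)" by simp
 then have "(G has_derivative (%h. 0)) (at x)"
 by (rule has_derivative_transform_within_open[of _ _ _ _ "- K"])
 (use K that compact_imp_closed[OF K(1)] in \<open>auto simp: open_Compl\<close>)
 then have "G' x = (%h. 0)" using has_derivative_unique[OF G] by blast
 then show ?thesis by simp
 qed
 obtain C where C: "!!x. \<bar>G' x b\<bar> <= C"
 using continuous_compact_support_bounded[OF c K(1) G'0] by metis
 obtain R where R: "R > 0" "!!x. x \<in> K ==> norm x <= R"
 using K(1) compact_imp_bounded bounded_pos by metis
 define s where "s n = 1 / real (Suc n)" for n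
 have s: "s n > 0" "s n <= 1" for n by (auto simp: s_def)
 have Gc: "continuous_on UNIV G"
 by (rule continuous_on_if_has_derivative[OF G])
 define q where "q n x = (G (x + s n *\<^sub>R b) - G x) / s n" for n x
 have mvt: "\<exists>t\<in>{0..1}. G (x + r *\<^sub>R b) - G x = r * G' (x + (t * r) *\<^sub>R b) b" for x r
 proof -
 have d: "((%t. G (x + (t * r) *\<^sub>R b)) has_derivative (%h. G' (x + (t * r) *\<^sub>R b) ((h * r) *\<^sub>R b))) (at t within S)" for t S
 by (rule has_derivative_compose[of "%t. x + (t * r) *\<^sub>R b" "%h. (h * r) *\<^sub>R b" _ _ G, OF _ G])
 (auto intro!: derivative_eq_intros)
 have "\<exists>t\<in>{0<..<1}. G (x + (1 * r) *\<^sub>R b) - G (x + (0 * r) *\<^sub>R b) = G' (x + (t * r) *\<^sub>R b) (((1 - 0) * r) *\<^sub>R b)"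
 by (rule mvt_simple) (auto intro: d)
 moreover have "G' y ((1 * r) *\<^sub>R b) = r * G' y b" for y
 using linear_scale[OF has_derivative_linear[OF G[of y]], of r b] by simp
 ultimately show ?thesis by (auto intro: less_imp_le)
 qed
 \<comment> \<open>By the mean value theorem \<open>q n x\<close> is a value of the derivative at a
   point no farther than \<open>norm b\<close> from \<open>x\<close>. It is hence bounded by
   \<open>C\<close> and vanishes outside the ball of radius \<open>R + norm b\<close>, which gives
   an integrable majorant.\<close>
 have "(%n. LINT x|lborel. q n x) \<longlonglongrightarrow> (LINT x|lborel. G' x b)"
 proof (rule integral_dominated_convergence[where w="%x. indicator (cball 0 (R + norm b)) x *\<^sub>R C"])
 show "(%x. G' x b) \<in> borel_measurable lborel" using c by (simp add: borel_measurable_continuous_onI)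
 show "q n \<in> borel_measurable lborel" for n
 proof -
 have "continuous_on UNIV (q n)"
 unfolding q_def[abs_def] using s(1)[of n]
 by (intro continuous_intros continuous_on_compose2[OF Gc]) auto
 then show ?thesis by (simp add: borel_measurable_continuous_onI)
 qed
 show "integrable lborel (%x. indicator (cball 0 (R + norm b)) x *\<^sub>R C)"
 by (rule borel_integrable_compact) auto
 show "AE x in lborel. norm (q n x) <= indicat_real (cball 0 (R + norm b)) x *\<^sub>R C" for n
 proof (intro AE_I2)
 fix x
 obtain t where t: "t \<in> {0..1}" "q n x = G' (x + (t * s n) *\<^sub>R b) b"
 using mvt[of x "s n"] s(1)[of n] by (auto simp: q_def)
 show "norm (q n x) <= indicat_real (cball 0 (R + norm b)) x *\<^sub>R C"
 proof (cases "x + (t * s n) *\<^sub>R b \<in> K")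
 case True
 have "norm x <= norm (x + (t * s n) *\<^sub>R b) + norm ((t * s n) *\<^sub>R b)"
 using norm_triangle_ineq4[of "x + (t * s n) *\<^sub>R b" "(t * s n) *\<^sub>R b"] by simp
 also have "... <= R + norm b"
 using R(2)[OF True] t(1) s[of n] mult_le_one[of t "s n"]
 by (auto intro!: add_mono mult_left_le_one_le simp: abs_mult)
 finally show ?thesis using t C by simp
 next
 case False
 then show ?thesis using t G'0 order_trans[OF abs_ge_zero C] by (simp add: indicator_def)
 qed
 qed
 show "AE x in lborel. (%n. q n x) \<longlonglongrightarrow> G' x b"
 proof (intro AE_I2)
 fix x
 have "((%t. G (x + t *\<^sub>R b)) has_derivative (%h. G' (x + 0 *\<^sub>R b) (h *\<^sub>R b))) (at 0)"
 by (rule has_derivative_compose[of "%t. x + t *\<^sub>R b" "%h. h *\<^sub>R b" _ _ G, OF _ G])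
 (auto intro!: derivative_eq_intros)
 moreover have "(%h. G' (x + 0 *\<^sub>R b) (h *\<^sub>R b)) = (*) (G' x b)"
 using linear_scale[OF has_derivative_linear[OF G[of x]], of _ b] by (auto simp: mult.commute)
 ultimately have "DERIV (%t. G (x + t *\<^sub>R b)) 0 :> G' x b"
 by (simp add: has_field_derivative_def)
 then have "(%h. (G (x + h *\<^sub>R b) - G x) / h) \<midarrow>0\<rightarrow> G' x b" by (simp add: DERIV_def)
 moreover have "filterlim s (at 0) sequentially"
 unfolding s_def filterlim_at using LIMSEQ_inverse_real_of_nat by (auto simp: inverse_eq_divide)
 ultimately show "(%n. q n x) \<longlonglongrightarrow> G' x b"
 unfolding q_def by (rule filterlim_compose)
 qed
 qed
 moreover have "(LINT x|lborel. q n x) = 0" for n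
 proof -
 have Gi: "integrable lborel G"
 proof -
 have "indicator K x *\<^sub>R G x = G x" for x using K(2) by (cases "x \<in> K") auto
 then show ?thesis using borel_integrable_compact[OF K(1) continuous_on_subset[OF Gc subset_UNIV]] by (simp only:)
 qed
 have sh: "integrable lborel (%x. G (x + s n *\<^sub>R b))" "(LINT x|lborel. G (x + s n *\<^sub>R b)) = (LINT x|lborel. G x)"
 proof -
 have e: "lborel = distr lborel borel ((+) (s n *\<^sub>R b))" by (simp add: lborel_distr_plus)
 have m: "G \<in> borel_measurable borel" using Gc by (rule borel_measurable_continuous_onI)
 show "integrable lborel (%x. G (x + s n *\<^sub>R b))"
 using Gi by (subst (asm) e) (simp add: integrable_distr_eq m add.commute)
 have "(LINT x|lborel. G x) = (\<integral>x. G x \<partial>distr lborel borel ((+) (s n *\<^sub>R b)))" using e by simp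
 also have "... = (LINT x|lborel. G (x + s n *\<^sub>R b))" using m by (simp add: integral_distr add.commute)
 finally show "(LINT x|lborel. G (x + s n *\<^sub>R b)) = (LINT x|lborel. G x)" by simp
 qed
 show ?thesis unfolding q_def using Gi sh by simp
 qed
 ultimately show ?thesis by (simp add: LIMSEQ_const_iff)
qed

lemma ibp_compact_support:
 fixes zet F :: "'a::euclidean_space => real"
 assumes U: "open U" and K: "compact K" "K \<subseteq> U" "!!x. x \<notin> K ==> zet x = 0" "!!x. x \<notin> K ==> zet' x = (%h. 0)"
 and zet: "!!x. x \<in> U ==> (zet has_derivative zet' x) (at x)" "continuous_on U (%x. zet' x b)"
 and F: "!!x. x \<in> U ==> (F has_derivative F' x) (at x)" "continuous_on U (%x. F' x b)"
 shows "(LINT x|lebesgue_on U. zet' x b * F x) = - (LINT x|lebesgue_on U. zet x * F' x b)"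
proof -
 define G where "G x = (if x \<in> U then zet x * F x else 0)" for x
 define G' where "G' x h = (if x \<in> U then zet x * F' x h + zet' x h * F x else 0)" for x h
 have K': "open (- K)" using compact_imp_closed[OF K(1)] by (simp add: open_Compl)
 have cU: "continuous_on U zet" "continuous_on U F"
 by (rule continuous_on_if_has_derivative[OF zet(1)], assumption) (rule continuous_on_if_has_derivative[OF F(1)])
 have ext: "continuous_on UNIV (%x. if x \<in> U then g x else 0)"
 if "continuous_on U g" "!!x. x \<notin> K ==> g x = 0" for g :: "'a => real"
 proof -
 have "continuous_on (U \<union> - K) (%x. if x \<in> U then g x else 0)"
 proof (rule continuous_on_open_Un[OF U K'])
 show "continuous_on U (%x. if x \<in> U then g x else 0)"
 using that(1) by (auto cong: continuous_on_cong_simp)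
 have "continuous_on (-K) (%x. 0::real)" by simp
 then show "continuous_on (- K) (%x. if x \<in> U then g x else 0)"
 by (rule continuous_on_eq) (use that(2) in auto)
 qed
 moreover have "U \<union> - K = UNIV" using K(2) by auto
 ultimately show ?thesis by simp
 qed
 have dG: "(G has_derivative G' x) (at x)" for x
 proof (cases "x \<in> U")
 case True
 have "((%x. zet x * F x) has_derivative (%h. zet x * F' x h + zet' x h * F x)) (at x)"
 by (rule has_derivative_mult[OF zet(1)[OF True] F(1)[OF True]])
 then have "(G has_derivative (%h. zet x * F' x h + zet' x h * F x)) (at x)"
 by (rule has_derivative_transform_within_open[OF _ U True]) (simp add: G_def)
 then show ?thesis using True by (simp add: G'_def[abs_def])
 next
 case False
 then have x: "x \<in> - K" using K(2) by auto
 have "((%x. 0) has_derivative (%h. 0)) (at x)" by simp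
 then have "(G has_derivative (%h. 0)) (at x)"
 by (rule has_derivative_transform_within_open[OF _ K' x]) (simp add: G_def K(3))
 then show ?thesis using False by (simp add: G'_def[abs_def])
 qed
 have c1: "continuous_on UNIV (%x. if x \<in> U then zet x * F' x b else 0)"
 by (rule ext) (auto intro!: continuous_intros cU F(2) simp: K(3))
 have c2: "continuous_on UNIV (%x. if x \<in> U then zet' x b * F x else 0)"
 by (rule ext) (auto intro!: continuous_intros cU zet(2) simp: K(4))
 have eqG: "(%x. G' x b) = (%x. (if x \<in> U then zet x * F' x b else 0) + (if x \<in> U then zet' x b * F x else 0))"
 by (auto simp: G'_def)
 have "(LINT x|lborel. G' x b) = 0"
 by (rule integral_deriv_compact_support[OF dG continuous_on_add[OF c1 c2, folded eqG] K(1)])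
 (simp add: G_def K(3))
 moreover have i: "integrable lborel g" if "continuous_on UNIV g" "!!x. x \<notin> K ==> g x = 0" for g :: "'a => real"
 proof -
 have "indicator K x *\<^sub>R g x = g x" for x using that(2) by (cases "x \<in> K") auto
 then show ?thesis using borel_integrable_compact[OF K(1) continuous_on_subset[OF that(1) subset_UNIV]] by (simp only:)
 qed
 moreover note i[OF c1] i[OF c2]
 ultimately have "(LINT x|lborel. (if x \<in> U then zet' x b * F x else 0)) = - (LINT x|lborel. (if x \<in> U then zet x * F' x b else 0))"
 unfolding eqG by (simp add: K)
 moreover have "(LINT x|lebesgue_on U. g x) = (LINT x|lborel. (if x \<in> U then g x else 0))"
 if "continuous_on UNIV (%x. if x \<in> U then g x else 0)" for g :: "'a => real"
 proof -
 have "(LINT x|lebesgue_on U. g x) = (LINT x|lebesgue. (if x \<in> U then g x else 0))"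
 unfolding integral_lebesgue_on_indicator[OF open_in_sets_lebesgue[OF U]]
 by (intro BI_cong refl) simp
 also have "... = (LINT x|lborel. (if x \<in> U then g x else 0))"
 using that by (intro integral_completion) (simp add: borel_measurable_continuous_onI)
 finally show ?thesis .
 qed
 ultimately show ?thesis using c1 c2 by simp
qed

lemma locally_integrable_continuous:
 assumes "continuous_on U f" shows "locally_integrable U (f :: 'a::euclidean_space => real)"
 unfolding locally_integrable_def set_integrable_def
proof (intro allI impI)
 fix K assume K: "compact K \<and> K \<subseteq> U"
 then have "integrable lborel (%x. indicator K x *\<^sub>R f x)"
 using borel_integrable_compact assms continuous_on_subset by metis
 then show "integrable lebesgue (%x. indicat_real K x *\<^sub>R f x)"
 using integrable_completion borel_measurable_integrable by metis
qed

lemma locally_integrable_if_integrable: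
 assumes "integrable (lebesgue_on U) f" "open U" shows "locally_integrable U f"
 unfolding locally_integrable_def
proof (intro allI impI)
 fix K assume K: "compact K \<and> K \<subseteq> U"
 have "f absolutely_integrable_on U"
 using assms by (simp add: set_integrable_def integral_lebesgue_on_indicator)
 then show "f absolutely_integrable_on K"
 by (rule set_integrable_subset) (use K in \<open>auto intro: fmeasurableD lmeasurable_compact\<close>)
qed

lemma has_weak_deriv_classical:
 fixes F :: "'a::euclidean_space => real"
 assumes U: "open U"
 and F: "!!x. x \<in> U ==> (F has_derivative F' x) (at x)" "continuous_on U (%x. F' x b)" and b: "b \<in> Basis"
 shows "has_weak_deriv U b F (%x. F' x b)"
 unfolding has_weak_deriv_def
proof (intro conjI allI impI)
 show "locally_integrable U F"
 by (rule locally_integrable_continuous[OF continuous_on_if_has_derivative[OF F(1)]])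
 show "locally_integrable U (%x. F' x b)" by (intro locally_integrable_continuous F)
 fix \<psi> assume \<psi>: "test_function U \<psi>"
 then obtain K where K: "compact K" "K \<subseteq> U" "!!x. x \<notin> K ==> \<psi> x = 0"
 "!!x b. x \<notin> K ==> frechet_derivative \<psi> (at x) b = 0" by (rule test_function_support) blast
 have s: "smooth \<psi>" using \<psi> by (simp add: test_function_def)
 show "(LINT x|lebesgue_on U. frechet_derivative \<psi> (at x) b *\<^sub>R F x) = - (LINT x|lebesgue_on U. \<psi> x *\<^sub>R F' x b)"
 using ibp_compact_support[OF U K(1-3) _ smooth_has_derivative[OF s] smooth_continuous[OF smooth_frechet[OF s b]] F]
 K(4) by fastforce
qed

section \<open>The spherical frame off the axis\<close>

definition off_axis :: "(real^3) set" where "off_axis = {x. x $ 1 ~= 0 \<or> x $ 2 ~= 0}"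

definition cyl :: "real^3 => real" where "cyl x = sqrt ((x $ 1)^2 + (x $ 2)^2)"

text \<open>The generator of rotations about the third axis, equal to \<open>cyl x\<close> times
  \<open>e_theta x\<close>. Unlike \<open>e_theta\<close> it is linear in \<open>x\<close>, so
  products with weakly differentiable fields are easy to differentiate, and pairing with it gives
  \<open>Gamma_of\<close> without a singular factor.\<close>

definition rot_field :: "real^3 => real^3" where "rot_field x = vector [- x $ 2, x $ 1, 0]"

lemma norm_3: "norm (x :: real^3) = sqrt ((x $ 1)^2 + (x $ 2)^2 + (x $ 3)^2)"
 by (simp add: norm_eq_sqrt_inner inner_vec_def sum_3 power2_eq_square)

lemma inner_3: "x \<bullet> (y :: real^3) = x $ 1 * y $ 1 + x $ 2 * y $ 2 + x $ 3 * y $ 3"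
 by (simp add: inner_vec_def sum_3)

lemma norm_sq_3: "(norm (x :: real^3))^2 = (x $ 1)^2 + (x $ 2)^2 + (x $ 3)^2"
 by (simp add: norm_3)

lemma cyl_sq: "(cyl x)^2 = (x $ 1)^2 + (x $ 2)^2"
 by (simp add: cyl_def)

lemma norm_sq_cyl: "(norm x)^2 = (cyl x)^2 + (x $ 3)^2"
 by (simp add: norm_sq_3 cyl_sq)

lemma cyl_pos: "x \<in> off_axis ==> cyl x > 0"
 unfolding off_axis_def cyl_def by (auto simp: add_pos_nonneg add_nonneg_pos)

lemma norm_pos_off_axis: "x \<in> off_axis ==> norm x > 0"
 by (auto simp: off_axis_def)

lemma spherical_coordinates:
 assumes "x \<in> off_axis"
 shows "cos (phi x) = x $ 3 / norm x" "sin (phi x) = cyl x / norm x"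
 "cos (theta x) = x $ 1 / cyl x" "sin (theta x) = x $ 2 / cyl x"
proof -
 note pos = cyl_pos[OF assms] norm_pos_off_axis[OF assms]
 have "\<bar>x $ 3\<bar> <= norm x" by (rule component_le_norm_cart)
 then have b: "-1 <= x $ 3 / norm x" "x $ 3 / norm x <= 1"
 using pos by (auto simp: field_simps)
 show "cos (phi x) = x $ 3 / norm x" using b by (simp add: phi_def)
 have "sin (phi x) = sqrt (1 - (x $ 3 / norm x)^2)" using b by (simp add: phi_def sin_arccos)
 also have "1 - (x $ 3 / norm x)^2 = (cyl x / norm x)^2"
 using pos norm_sq_cyl[of x] by (simp add: power_divide field_simps)
 finally show "sin (phi x) = cyl x / norm x" using pos by simp
 have c: "cmod (Complex (x $ 1) (x $ 2)) = cyl x" by (simp add: cmod_def cyl_def)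
 show "cos (theta x) = x $ 1 / cyl x" "sin (theta x) = x $ 2 / cyl x"
 using cos_Arg2pi[of "Complex (x $ 1) (x $ 2)"] sin_Arg2pi[of "Complex (x $ 1) (x $ 2)"] pos
 unfolding c theta_def by (auto simp: field_simps)
qed

lemma e_rho_eq: "x \<in> off_axis ==> e_rho x = x /\<^sub>R norm x"
 using cyl_pos[of x] by (auto simp: e_rho_def spherical_coordinates vec_eq_iff forall_3 field_simps)

lemma e_phi_eq: "x \<in> off_axis ==>
 e_phi x = vector [x $ 1 * x $ 3 / (cyl x * norm x), x $ 2 * x $ 3 / (cyl x * norm x), - cyl x / norm x]"
 by (auto simp: e_phi_def spherical_coordinates vec_eq_iff forall_3 field_simps)

lemma e_theta_eq: "x \<in> off_axis ==> e_theta x = rot_field x /\<^sub>R cyl x"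
 by (auto simp: e_theta_def rot_field_def spherical_coordinates vec_eq_iff forall_3 field_simps)

lemma frame_expansion:
 assumes "x \<in> off_axis"
 shows "a \<bullet> b = (a \<bullet> e_rho x) * (b \<bullet> e_rho x) + (a \<bullet> e_phi x) * (b \<bullet> e_phi x) + (a \<bullet> e_theta x) * (b \<bullet> e_theta x)"
proof -
 define c s d t where "c = cos (phi x)" and "s = sin (phi x)" and "d = cos (theta x)" and "t = sin (theta x)"
 have "c^2 + s^2 = 1" "d^2 + t^2 = 1" by (simp_all add: c_def s_def d_def t_def)
 then show ?thesis
 unfolding inner_3 e_rho_def e_phi_def e_theta_def vector_3
 unfolding c_def[symmetric] s_def[symmetric] d_def[symmetric] t_def[symmetric]
 by algebra
qed

lemma Gamma_of_eq: "x \<in> off_axis ==> Gamma_of u x = u x \<bullet> rot_field x"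
 using cyl_pos[of x] norm_pos_off_axis[of x]
 by (simp add: Gamma_of_def rho_def comp_theta_def e_theta_eq spherical_coordinates)

subsection \<open>Polar parametrization\<close>

lemma vector_3_axis: "vector [a, b, c] = a *\<^sub>R axis 1 1 + b *\<^sub>R axis 2 1 + c *\<^sub>R (axis 3 1 :: real^3)"
 by (simp add: vec_eq_iff forall_3 axis_def)

lemma has_derivative_vector_3:
 assumes "(f has_derivative f') F" "(g has_derivative g') F" "(h has_derivative h') F"
 shows "((%x. vector [f x, g x, h x] :: real^3) has_derivative (%y. vector [f' y, g' y, h' y])) F"
 unfolding vector_3_axis by (intro has_derivative_add has_derivative_scaleR_left assms)

lemma continuous_on_vector_3:
 assumes "continuous_on S f" "continuous_on S g" "continuous_on S h"
 shows "continuous_on S (%x. vector [f x, g x, h x] :: real^3)"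
 unfolding vector_3_axis by (intro continuous_intros assms)

lemma spherical_nth: "spherical r p q $ 1 = r * sin p * cos q" "spherical r p q $ 2 = r * sin p * sin q"
 "spherical r p q $ 3 = r * cos p"
 by (simp_all add: spherical_def)

lemma cyl_spherical: "r > 0 ==> sin p > 0 ==> cyl (spherical r p q) = r * sin p"
proof -
 assume *: "r > 0" "sin p > 0"
 have "(r * sin p * cos q)^2 + (r * sin p * sin q)^2 = (r * sin p)^2 * ((sin q)^2 + (cos q)^2)" by algebra
 then show ?thesis using * by (simp add: cyl_def spherical_nth)
qed

lemma norm_spherical: "r >= 0 ==> norm (spherical r p q) = r"
proof -
 assume *: "r >= 0"
 have "(r * sin p * cos q)^2 + (r * sin p * sin q)^2 + (r * cos p)^2
 = r^2 * ((sin p)^2 * ((sin q)^2 + (cos q)^2) + (cos p)^2)" by algebra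
 then show ?thesis using * by (simp add: norm_3 spherical_nth)
qed

lemma spherical_off_axis: "r > 0 ==> sin p > 0 ==> spherical r p q \<in> off_axis"
proof -
 assume *: "r > 0" "sin p > 0"
 have "cos q ~= 0 \<or> sin q ~= 0" using sin_cos_squared_add[of q] by fastforce
 then show ?thesis using * by (auto simp: off_axis_def spherical_nth)
qed

lemma frame_spherical:
 assumes "r > 0" "sin p > 0"
 shows "e_rho (spherical r p q) = vector [sin p * cos q, sin p * sin q, cos p]"
 "e_phi (spherical r p q) = vector [cos p * cos q, cos p * sin q, - sin p]"
 "rot_field (spherical r p q) = vector [- (r * sin p * sin q), r * sin p * cos q, 0]"
 using assms
 by (simp_all add: e_rho_eq e_phi_eq spherical_off_axis norm_spherical cyl_spherical rot_field_def vec_eq_iff forall_3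
 spherical_nth field_simps)

lemma continuous_on_spherical [continuous_intros]:
 fixes f g h :: "'a::euclidean_space => real"
 assumes "continuous_on S f" "continuous_on S g" "continuous_on S h"
 shows "continuous_on S (%x. spherical (f x) (g x) (h x))"
 unfolding spherical_def by (intro continuous_on_vector_3 continuous_on_mult continuous_on_sin continuous_on_cos assms)

lemma Basis_3: "(Basis :: (real^3) set) = {axis 1 1, axis 2 1, axis 3 1}"
 by (auto simp: Basis_vec_def UNIV_3)

lemma prod_Basis_3: "(\<Prod>b\<in>Basis. f b) = f (axis 1 1) * f (axis 2 1) * f (axis 3 1 :: real^3)" for f :: "_ => real"
proof -
 have "axis 1 1 ~= (axis 2 1 :: real^3)" "axis 1 1 ~= (axis 3 1 :: real^3)" "axis 2 1 ~= (axis 3 1 :: real^3)"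
 by (simp_all add: axis_eq_axis)
 then show ?thesis unfolding Basis_3 by (simp add: mult.assoc)
qed

lemma sum_Basis_3: "(\<Sum>b\<in>Basis. f b) = f (axis 1 1) + f (axis 2 1) + f (axis 3 1 :: real^3)"
 for f :: "_ => 'b::comm_monoid_add"
proof -
 have "axis 1 1 ~= (axis 2 1 :: real^3)" "axis 1 1 ~= (axis 3 1 :: real^3)" "axis 2 1 ~= (axis 3 1 :: real^3)"
 by (simp_all add: axis_eq_axis)
 then show ?thesis unfolding Basis_3 by (simp add: add.assoc)
qed

text \<open>A bridge between \<open>real^3\<close>, where Jacobian determinants live, and nested
  pairs, where Fubini is applied; a measure is determined by its values on boxes.\<close>

lemma lborel_distr_triple:
 "distr lborel borel (%x :: real^3. (x $ 1, x $ 2, x $ 3)) = (lborel :: (real \<times> real \<times> real) measure)"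
proof (rule lborel_eqI[symmetric])
 show "sets (distr lborel borel (%x :: real^3. (x $ 1, x $ 2, x $ 3))) = sets borel" by simp
 fix l u :: "real \<times> real \<times> real" assume le: "!!b. b \<in> Basis ==> l \<bullet> b <= u \<bullet> b"
 obtain l1 l2 l3 u1 u2 u3 where lu: "l = (l1, l2, l3)" "u = (u1, u2, u3)" by (metis prod_cases3)
 have le': "l1 <= u1" "l2 <= u2" "l3 <= u3"
 using le[of "(1,0,0)"] le[of "(0,1,0)"] le[of "(0,0,1)"] by (auto simp: lu Basis_prod_def zero_prod_def)
 have m: "(%x :: real^3. (x $ 1, x $ 2, x $ 3)) \<in> borel_measurable borel"
 by (intro borel_measurable_continuous_onI continuous_intros)
 have pre: "(%x :: real^3. (x $ 1, x $ 2, x $ 3)) -` box l u = box (vector [l1, l2, l3]) (vector [u1, u2, u3])"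
 proof -
 have "y \<in> box (vector [l1, l2, l3]) (vector [u1, u2, u3] :: real^3) \<longleftrightarrow>
 l1 < y $ 1 \<and> y $ 1 < u1 \<and> l2 < y $ 2 \<and> y $ 2 < u2 \<and> l3 < y $ 3 \<and> y $ 3 < u3" for y
 by (auto simp: mem_box_cart forall_3)
 moreover have "(a, b, c) \<in> box l u \<longleftrightarrow> l1 < a \<and> a < u1 \<and> l2 < b \<and> b < u2 \<and> l3 < c \<and> c < u3" for a b c
 by (auto simp: box_def lu Basis_prod_def)
 ultimately show ?thesis by auto
 qed
 let ?l = "vector [l1, l2, l3] :: real^3" and ?u = "vector [u1, u2, u3] :: real^3"
 have "emeasure (distr lborel borel (%x :: real^3. (x $ 1, x $ 2, x $ 3))) (box l u) = emeasure lborel (box ?l ?u)"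
 using m by (subst emeasure_distr) (simp_all add: pre)
 also have "... = ennreal (\<Prod>b\<in>Basis. (?u - ?l) \<bullet> b)"
 by (rule emeasure_lborel_box) (use le' in \<open>auto simp: Basis_3 inner_axis\<close>)
 also have "(\<Prod>b\<in>Basis. (?u - ?l) \<bullet> b) = (u1 - l1) * (u2 - l2) * (u3 - l3)"
 unfolding prod_Basis_3 by (simp add: inner_axis)
 also have "... = (\<Prod>b\<in>Basis. (u - l) \<bullet> b)"
 by (simp add: lu Basis_prod_def zero_prod_def)
 finally show "emeasure (distr lborel borel (%x :: real^3. (x $ 1, x $ 2, x $ 3))) (box l u) = ennreal (\<Prod>b\<in>Basis. (u - l) \<bullet> b)" .
qed

lemma integral_triple:
 fixes f :: "real \<times> real \<times> real => real"
 assumes f: "continuous_on (cbox (a1, a2, a3) (b1, b2, b3)) f"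
 shows "integral (cbox (vector [a1, a2, a3]) (vector [b1, b2, b3])) (%y :: real^3. f (y $ 1, y $ 2, y $ 3))
 = integral (cbox (a1, a2, a3) (b1, b2, b3)) f"
proof -
 let ?T = "%x :: real^3. (x $ 1, x $ 2, x $ 3)"
 let ?A = "cbox (vector [a1, a2, a3]) (vector [b1, b2, b3]) :: (real^3) set"
 let ?B = "cbox (a1, a2, a3) (b1, b2, b3)"
 have mem: "?T y \<in> ?B \<longleftrightarrow> y \<in> ?A" for y by (auto simp: mem_box_cart forall_3 cbox_Pair_eq)
 have iB: "set_integrable lborel ?B f"
 unfolding set_integrable_def by (rule borel_integrable_compact[OF compact_cbox f])
 have m: "?T \<in> borel_measurable borel" by (intro borel_measurable_continuous_onI continuous_intros)
 have "set_integrable lborel ?A (%y. f (?T y))"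
 unfolding set_integrable_def
 proof (rule borel_integrable_compact[OF compact_cbox])
 show "continuous_on ?A (%y. f (?T y))"
 by (intro continuous_on_compose2[OF f] continuous_intros) (use mem in blast)
 qed
 then have "integral ?A (%y. f (?T y)) = set_lebesgue_integral lborel ?A (%y. f (?T y))"
 by (simp add: set_borel_integral_eq_integral)
 also have "... = (LINT y|lborel. indicator ?B (?T y) *\<^sub>R f (?T y))"
 unfolding set_lebesgue_integral_def by (intro BI_cong refl) (simp only: indicator_def mem)
 also have "... = (\<integral>z. indicator ?B z *\<^sub>R f z \<partial>distr lborel borel ?T)"
 using m iB by (subst integral_distr) (auto simp: set_integrable_def)
 also have "... = integral ?B f"
 unfolding lborel_distr_triple using set_borel_integral_eq_integral(2)[OF iB]
 by (simp add: set_lebesgue_integral_def)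
 finally show ?thesis .
qed


text \<open>Continuous differentiability off the axis, with the gradient carried along as a vector
  field. The closed region \<open>D_closed\<close> avoids the axis, so such functions are C1 up to
  its boundary and have boundary integrals.\<close>

definition C1 :: "(real^3 => real) => (real^3 => real^3) => bool" where
 "C1 F F' \<longleftrightarrow> (\<forall>x\<in>off_axis. (F has_derivative (%h. F' x \<bullet> h)) (at x)) \<and> continuous_on off_axis F'"

lemma C1D: "C1 F F' ==> x \<in> off_axis ==> (F has_derivative (%h. F' x \<bullet> h)) (at x)"
 "C1 F F' ==> continuous_on off_axis F'"
 by (auto simp: C1_def)

lemma C1_continuous: "C1 F F' ==> continuous_on off_axis F"
 by (rule continuous_on_if_has_derivative[OF C1D(1)])

lemma C1_deriv_spherical:
 assumes F: "C1 F F'" and rp: "r > 0" "sin p > 0"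
 shows "((%r. F (spherical r p q)) has_real_derivative F' (spherical r p q) \<bullet> e_rho (spherical r p q)) (at r within X)"
 "((%p. F (spherical r p q)) has_real_derivative r * (F' (spherical r p q) \<bullet> e_phi (spherical r p q))) (at p within X)"
 "((%q. F (spherical r p q)) has_real_derivative F' (spherical r p q) \<bullet> rot_field (spherical r p q)) (at q within X)"
proof -
 note d = C1D(1)[OF F spherical_off_axis[OF rp, of q]]
 have "((%r. spherical r p q) has_derivative (%h. h *\<^sub>R e_rho (spherical r p q))) (at r within X)"
 unfolding frame_spherical[OF rp] unfolding spherical_def
 by (rule has_derivative_eq_rhs[OF has_derivative_vector_3])
 (auto intro!: derivative_eq_intros simp: vec_eq_iff forall_3 algebra_simps)
 from has_derivative_compose[OF this d]
 show "((%r. F (spherical r p q)) has_real_derivative F' (spherical r p q) \<bullet> e_rho (spherical r p q)) (at r within X)"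
 unfolding has_field_derivative_def by (rule has_derivative_eq_rhs) (simp add: fun_eq_iff)
 have "((%p. spherical r p q) has_derivative (%h. h *\<^sub>R (r *\<^sub>R e_phi (spherical r p q)))) (at p within X)"
 unfolding frame_spherical[OF rp] unfolding spherical_def
 by (rule has_derivative_eq_rhs[OF has_derivative_vector_3])
 (auto intro!: derivative_eq_intros simp: vec_eq_iff forall_3 algebra_simps)
 from has_derivative_compose[OF this d]
 show "((%p. F (spherical r p q)) has_real_derivative r * (F' (spherical r p q) \<bullet> e_phi (spherical r p q))) (at p within X)"
 unfolding has_field_derivative_def by (rule has_derivative_eq_rhs) (simp add: fun_eq_iff)
 have "((%q. spherical r p q) has_derivative (%h. h *\<^sub>R rot_field (spherical r p q))) (at q within X)"
 unfolding frame_spherical[OF rp] unfolding spherical_def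
 by (rule has_derivative_eq_rhs[OF has_derivative_vector_3])
 (auto intro!: derivative_eq_intros simp: vec_eq_iff forall_3 algebra_simps)
 from has_derivative_compose[OF this d]
 show "((%q. F (spherical r p q)) has_real_derivative F' (spherical r p q) \<bullet> rot_field (spherical r p q)) (at q within X)"
 unfolding has_field_derivative_def by (rule has_derivative_eq_rhs) (simp add: fun_eq_iff)
qed

text \<open>The change of variables theorem is applied to integrands with values in a Cartesian
  space; real integrands pass through \<open>real^1\<close>.\<close>

lemma integral_vec_1:
 fixes f :: "real^3 => real"
 assumes "f absolutely_integrable_on S"
 shows "(%x. vec (f x) :: real^1) absolutely_integrable_on S" "integral S (%x. vec (f x) :: real^1) = vec (integral S f)"
proof -
 have bl: "bounded_linear (vec :: real => real^1)"
 by (rule bounded_linear_intro[where K=1]) (auto simp: vec_eq_iff norm_vec_def L2_set_def)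
 show "(%x. vec (f x) :: real^1) absolutely_integrable_on S"
 using absolutely_integrable_linear[OF assms bl] by (simp add: o_def)
 show "integral S (%x. vec (f x) :: real^1) = vec (integral S f)"
 using integral_linear[OF set_lebesgue_integral_eq_integral(1)[OF assms] bl] by (simp add: o_def)
qed

lemma change_of_variables_3:
 fixes f :: "real^3 => real" and g :: "real^3 => real^3"
 assumes S: "S \<in> sets lebesgue"
 and der_g: "!!x. x \<in> S ==> (g has_derivative g' x) (at x within S)"
 and inj: "inj_on g S"
 and ai: "(%x. \<bar>det (matrix (g' x))\<bar> * f (g x)) absolutely_integrable_on S"
 shows "f absolutely_integrable_on (g ` S)"
 "integral (g ` S) f = integral S (%x. \<bar>det (matrix (g' x))\<bar> * f (g x))"
proof -
 have eq: "(%x. \<bar>det (matrix (g' x))\<bar> *\<^sub>R (vec (f (g x)) :: real^1)) = (%x. vec (\<bar>det (matrix (g' x))\<bar> * f (g x)))"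
 by (auto simp: vec_eq_iff)
 have *: "(%x. vec (f x) :: real^1) absolutely_integrable_on (g ` S) \<and>
 integral (g ` S) (%x. vec (f x) :: real^1) = vec (integral S (%x. \<bar>det (matrix (g' x))\<bar> * f (g x)))"
 using has_absolute_integral_change_of_variables[OF S der_g inj, of "%x. vec (f x) :: real^1"
 "vec (integral S (%x. \<bar>det (matrix (g' x))\<bar> * f (g x)))"] integral_vec_1[OF ai]
 unfolding eq by blast
 have bl: "bounded_linear (%x :: real^1. x $ 1)" by (rule bounded_linear_vec_nth)
 show "f absolutely_integrable_on (g ` S)"
 using absolutely_integrable_linear[OF conjunct1[OF *] bl] by (simp add: o_def)
 from integral_vec_1(2)[OF this] * show "integral (g ` S) f = integral S (%x. \<bar>det (matrix (g' x))\<bar> * f (g x))"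
 by (simp add: vec_eq_iff)
qed

lemma axis_3_nth:
 "axis 1 (1::real) $ (1::3) = 1" "axis 1 (1::real) $ (2::3) = 0" "axis 1 (1::real) $ (3::3) = 0"
 "axis 2 (1::real) $ (1::3) = 0" "axis 2 (1::real) $ (2::3) = 1" "axis 2 (1::real) $ (3::3) = 0"
 "axis 3 (1::real) $ (1::3) = 0" "axis 3 (1::real) $ (2::3) = 0" "axis 3 (1::real) $ (3::3) = 1"
 by (simp_all add: axis_def)

section \<open>The region and integration over it in spherical coordinates\<close>

locale cone =
 fixes m :: nat and \<alpha> :: real
 assumes m_ge: "m >= 10^3" and \<alpha>_pos: "0 < \<alpha>" and \<alpha>_le: "\<alpha> <= pi/6"
begin

abbreviation D :: "(real^3) set" where "D \<equiv> Dm m \<alpha>"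

definition r0 :: real where "r0 = 1 / real m"
definition p0 :: real where "p0 = pi/2 - \<alpha>"
definition p1 :: real where "p1 = pi/2 + \<alpha>"

text \<open>The polar angle is within \<alpha> of pi/2 exactly when the absolute value of its cosine
  is at most \<open>sin \<alpha>\<close>. Written this way, closedness and invariance under
  rotations can be read off without \<open>arccos\<close>.\<close>

definition D_closed :: "(real^3) set" where
 "D_closed = {x. r0 <= norm x \<and> norm x <= 1 \<and> \<bar>x $ 3\<bar> <= sin \<alpha> * norm x}"

lemma r0_bounds: "0 < r0" "r0 <= 1/1000" "r0 < 1"
proof -
 have "real m >= 1000" using m_ge by simp
 then show "0 < r0" "r0 <= 1/1000" "r0 < 1" unfolding r0_def by (auto simp: field_simps)
qed

lemma \<alpha>_bounds: "0 < sin \<alpha>" "sin \<alpha> <= 1/2" "\<alpha> < pi/2" "cos \<alpha> >= sqrt 3 / 2"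
proof -
 show lt: "\<alpha> < pi/2" using \<alpha>_le pi_gt_zero by linarith
 show "0 < sin \<alpha>" using \<alpha>_pos lt by (intro sin_gt_zero) auto
 have "sin \<alpha> <= sin (pi/6)" using \<alpha>_pos \<alpha>_le pi_gt_zero by (intro sin_monotone_2pi_le) auto
 then show "sin \<alpha> <= 1/2" by (simp add: sin_30)
 have "cos \<alpha> >= cos (pi/6)" using \<alpha>_pos \<alpha>_le pi_gt_zero by (intro cos_monotone_0_pi_le) auto
 then show "cos \<alpha> >= sqrt 3 / 2" by (simp add: cos_30)
qed

lemma p_bounds: "0 < p0" "p0 < p1" "p1 < pi" "p1 - p0 = 2 * \<alpha>"
 using \<alpha>_bounds(3) \<alpha>_pos by (auto simp: p0_def p1_def)

lemma sin_p:
 assumes "p \<in> {p0..p1}" shows "sin p >= sqrt 3 / 2" "sin p > 0" "sin p >= 1/2" "\<bar>cos p\<bar> <= sin \<alpha>"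
proof -
 have a: "\<bar>p - pi/2\<bar> <= \<alpha>" using assms by (auto simp: p0_def p1_def abs_le_iff)
 have "cos \<bar>p - pi/2\<bar> >= cos \<alpha>"
 using a \<alpha>_bounds(3) by (intro cos_monotone_0_pi_le) auto
 moreover have "cos \<bar>p - pi/2\<bar> = sin p" by (simp add: sin_cos_eq abs_if cos_minus[of "p - pi/2", symmetric] del: cos_minus)
 ultimately show "sin p >= sqrt 3 / 2" using \<alpha>_bounds(4) by linarith
 moreover have "sqrt 3 >= 1" by simp
 ultimately show "sin p >= 1/2" "sin p > 0" by linarith+
 have "sin (p - pi/2) <= sin \<alpha>" by (rule sin_monotone_2pi_le) (use a \<alpha>_bounds(3) in auto)
 moreover have "sin (- \<alpha>) <= sin (p - pi/2)" by (rule sin_monotone_2pi_le) (use a \<alpha>_bounds(3) in auto)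
 moreover have "sin (p - pi/2) = - cos p" by (simp add: sin_diff)
 ultimately show "\<bar>cos p\<bar> <= sin \<alpha>" by auto
qed

lemma sin_p_strict:
 assumes "p0 < p" "p < p1" shows "\<bar>cos p\<bar> < sin \<alpha>"
proof -
 have "sin (p - pi/2) < sin \<alpha>"
 by (rule sin_monotone_2pi) (use assms \<alpha>_bounds(3) in \<open>auto simp: p0_def p1_def\<close>)
 moreover have "sin (- \<alpha>) < sin (p - pi/2)"
 by (rule sin_monotone_2pi) (use assms \<alpha>_bounds(3) in \<open>auto simp: p0_def p1_def\<close>)
 moreover have "sin (p - pi/2) = - cos p" by (simp add: sin_diff)
 ultimately show ?thesis by auto
qed

lemma D_eq: "D = {x. r0 < norm x \<and> norm x < 1 \<and> \<bar>x $ 3\<bar> < sin \<alpha> * norm x}"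
proof -
 have "(pi/2 - \<alpha> < phi x \<and> phi x < pi/2 + \<alpha>) \<longleftrightarrow> \<bar>x $ 3\<bar> < sin \<alpha> * norm x" if n: "norm x > 0" for x :: "real^3"
 proof -
 define t where "t = x $ 3 / norm x"
 have "\<bar>x $ 3\<bar> <= norm x" by (rule component_le_norm_cart)
 then have t: "\<bar>t\<bar> <= 1" using n by (auto simp: t_def field_simps)
 have c: "cos (phi x) = t" and ph: "0 <= phi x" "phi x <= pi"
 using t by (auto simp: phi_def t_def[symmetric] cos_arccos abs_le_iff intro: arccos_lbound arccos_ubound)
 have "pi/2 - \<alpha> < phi x \<longleftrightarrow> cos (phi x) < cos (pi/2 - \<alpha>)"
 using ph \<alpha>_pos \<alpha>_bounds(3) by (subst cos_mono_less_eq) auto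
 moreover have "phi x < pi/2 + \<alpha> \<longleftrightarrow> cos (pi/2 + \<alpha>) < cos (phi x)"
 using ph \<alpha>_pos \<alpha>_bounds(3) by (subst cos_mono_less_eq) auto
 ultimately have "(pi/2 - \<alpha> < phi x \<and> phi x < pi/2 + \<alpha>) \<longleftrightarrow> \<bar>t\<bar> < sin \<alpha>"
 unfolding c by (auto simp: cos_add cos_diff abs_less_iff)
 also have "... \<longleftrightarrow> \<bar>x $ 3\<bar> < sin \<alpha> * norm x"
 using n by (simp add: t_def field_simps)
 finally show ?thesis .
 qed
 then show ?thesis
 using r0_bounds(1) unfolding Dm_def rho_def r0_def[symmetric] by (smt (verit) Collect_cong)
qed

lemma D_subset: "D \<subseteq> D_closed"
 by (auto simp: D_eq D_closed_def)

text \<open>As \<open>sin \<alpha>\<close> is at most 1/2, the third coordinate carries at most a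
  quarter of the squared norm. The region therefore keeps a positive distance from the axis, where
  the frame is singular.\<close>

lemma D_closed_cyl: assumes "x \<in> D_closed" shows "cyl x >= norm x / 2" "norm x > 0" "cyl x > 0" "x \<in> off_axis"
proof -
 have n: "norm x > 0" using assms r0_bounds(1) by (auto simp: D_closed_def)
 then show "norm x > 0" .
 have "\<bar>x $ 3\<bar> <= 1/2 * norm x"
 using assms mult_right_mono[OF \<alpha>_bounds(2), of "norm x"] by (auto simp: D_closed_def)
 then have "\<bar>x $ 3\<bar>^2 <= (1/2 * norm x)^2" by (intro power_mono) auto
 then have h: "4 * (x $ 3)^2 <= (norm x)^2" by (simp add: power_divide)
 have e: "(norm x / 2)^2 = (norm x)^2 / 4" by (simp add: power_divide)
 have "(norm x / 2)^2 <= (cyl x)^2"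
 unfolding e using h norm_sq_cyl[of x] zero_le_power2[of "x $ 3"] zero_le_power2[of "norm x"] by linarith
 then show c: "cyl x >= norm x / 2" by (rule power2_le_imp_le) (simp add: cyl_def)
 then show "cyl x > 0" using n by linarith
 then show "x \<in> off_axis" unfolding off_axis_def cyl_def by auto
qed

lemma D_closed_off_axis: "D_closed \<subseteq> off_axis"
 using D_closed_cyl by blast

lemma D_off_axis: "D \<subseteq> off_axis"
 using D_subset D_closed_off_axis by blast

lemma compact_D_closed: "compact D_closed"
proof -
 have "closed D_closed"
 unfolding D_closed_def by (intro closed_Collect_conj closed_Collect_le continuous_intros)
 moreover have "D_closed \<subseteq> cball 0 1" by (auto simp: D_closed_def)
 ultimately show ?thesis using compact_Int_closed[OF compact_cball, of D_closed 0 1] by (simp add: inf.absorb2)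
qed

lemma open_D: "open D"
 unfolding D_eq by (intro open_Collect_conj open_Collect_less continuous_intros)

lemma D_sets: "D \<in> sets lebesgue"
 using open_D by simp

lemma D_lmeasurable: "D \<in> lmeasurable"
 by (rule bounded_set_imp_lmeasurable[OF bounded_subset[OF compact_imp_bounded[OF compact_D_closed] D_subset] D_sets])

lemma finite_measure_D: "finite_measure (lebesgue_on D)"
 using D_lmeasurable by (rule finite_measure_lebesgue_on)

lemma spherical_in_D_closed:
 assumes "r \<in> {r0..1}" "p \<in> {p0..p1}" shows "spherical r p q \<in> D_closed"
proof -
 have r: "r > 0" using assms r0_bounds by auto
 then show ?thesis
 using assms sin_p(4)[OF assms(2)] by (auto simp: D_closed_def norm_spherical spherical_nth abs_mult)
qed

lemma continuous_bounded_D: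
 fixes f :: "real^3 => 'b::euclidean_space"
 assumes "continuous_on off_axis f"
 obtains C where "!!x. x \<in> D_closed ==> norm (f x) <= C"
proof -
 have "bounded (f ` D_closed)"
 by (intro compact_imp_bounded compact_continuous_image compact_D_closed continuous_on_subset[OF assms D_closed_off_axis])
 then have "\<exists>C. \<forall>x\<in>D_closed. norm (f x) <= C" by (simp add: bounded_iff)
 then show ?thesis using that by blast
qed

lemma continuous_measurable_D:
 fixes f :: "real^3 => 'b::euclidean_space"
 assumes "continuous_on off_axis f" shows "f \<in> borel_measurable (lebesgue_on D)"
 using continuous_imp_measurable_on_sets_lebesgue[OF continuous_on_subset[OF assms D_off_axis] D_sets] .

lemma continuous_AE_bounded_D:
 fixes f :: "real^3 => 'b::euclidean_space"
 assumes "continuous_on off_axis f"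
 obtains C where "AE x in lebesgue_on D. norm (f x) <= C"
proof -
 obtain C where "!!x. x \<in> D_closed ==> norm (f x) <= C" using continuous_bounded_D[OF assms] by blast
 then have "AE x in lebesgue_on D. norm (f x) <= C" using D_subset by (intro AE_I2) auto
 then show ?thesis by (rule that)
qed

lemma continuous_l2_D:
 fixes f :: "real^3 => 'b::euclidean_space"
 assumes "continuous_on off_axis f" shows "l2 (lebesgue_on D) f"
proof -
 obtain C where "AE x in lebesgue_on D. norm (f x) <= C" using continuous_AE_bounded_D[OF assms] by blast
 then show ?thesis by (rule l2_bounded[OF finite_measure_D continuous_measurable_D[OF assms]])
qed

lemma continuous_integrable_D:
 fixes f :: "real^3 => 'b::euclidean_space"
 assumes "continuous_on off_axis f" shows "integrable (lebesgue_on D) f"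
 by (rule l2_integrable[OF finite_measure_D continuous_l2_D[OF assms]])

definition coord_box :: "(real \<times> real \<times> real) set" where
 "coord_box = cbox (0, p0, r0) (2 * pi, p1, 1)"

lemma mem_coord_box: "(q, p, r) \<in> coord_box \<longleftrightarrow> q \<in> {0..2*pi} \<and> p \<in> {p0..p1} \<and> r \<in> {r0..1}"
 by (auto simp: coord_box_def cbox_Pair_eq)

lemma continuous_on_coord:
 fixes f :: "real^3 => 'b::euclidean_space"
 assumes "continuous_on off_axis f"
 shows "continuous_on coord_box (%(q, p, r). f (spherical r p q))"
 unfolding case_prod_beta
proof (rule continuous_on_compose2[OF continuous_on_subset[OF assms D_closed_off_axis]])
 show "continuous_on coord_box (%x. spherical (snd (snd x)) (fst (snd x)) (fst x))"
 by (intro continuous_intros)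
 show "(%x. spherical (snd (snd x)) (fst (snd x)) (fst x)) ` coord_box \<subseteq> D_closed"
 using mem_coord_box spherical_in_D_closed by auto
qed

text \<open>The substitution is made on the open box, where the map is injective; its image misses
  only points of the plane \<open>x $ 2 = 0\<close>, a null set. The azimuth is listed first so that
  Fubini later cuts the region into meridian rectangles.\<close>

lemma integral_D_spherical:
 fixes f :: "real^3 => real"
 assumes f: "continuous_on off_axis f"
 shows "(LINT x|lebesgue_on D. f x) = integral coord_box (%(q, p, r). f (spherical r p q) * (r^2 * sin p))"
proof -
 let ?g = "%y :: real^3. spherical (y $ 3) (y $ 2) (y $ 1)"
 let ?a = "vector [0, p0, r0] :: real^3" and ?b = "vector [2 * pi, p1, 1] :: real^3"
 define g' where "g' x y = y $ 3 *\<^sub>R vector [sin (x $ 2) * cos (x $ 1), sin (x $ 2) * sin (x $ 1), cos (x $ 2)]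
 + (x $ 3 * y $ 2) *\<^sub>R vector [cos (x $ 2) * cos (x $ 1), cos (x $ 2) * sin (x $ 1), - sin (x $ 2)]
 + y $ 1 *\<^sub>R (vector [- (x $ 3 * sin (x $ 2) * sin (x $ 1)), x $ 3 * sin (x $ 2) * cos (x $ 1), 0] :: real^3)"
 for x y :: "real^3"
 have mem: "y \<in> box ?a ?b \<longleftrightarrow> 0 < y $ 1 \<and> y $ 1 < 2*pi \<and> p0 < y $ 2 \<and> y $ 2 < p1 \<and> r0 < y $ 3 \<and> y $ 3 < 1" for y
 by (auto simp: mem_box_cart forall_3)
 have der: "(?g has_derivative g' x) (at x within S)" for x S
 unfolding spherical_def
 by (rule has_derivative_eq_rhs[OF has_derivative_vector_3])
 (auto intro!: derivative_eq_intros bounded_linear_imp_has_derivative[OF bounded_linear_vec_nth] simp: g'_def vec_eq_iff forall_3 algebra_simps fun_eq_iff)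
 have det: "\<bar>det (matrix (g' x))\<bar> = (x $ 3)^2 * sin (x $ 2)" if x: "x \<in> cbox ?a ?b" for x
 proof -
 define c s d t r where "c = cos (x $ 2)" and "s = sin (x $ 2)" and "d = cos (x $ 1)" and "t = sin (x $ 1)" and "r = x $ 3"
 have 1: "c^2 + s^2 = 1" "d^2 + t^2 = 1" by (simp_all add: c_def s_def d_def t_def)
 let ?A = "matrix (g' x)"
 have A: "?A $ 1 $ 1 = - (r * s * t)" "?A $ 1 $ 2 = r * c * d" "?A $ 1 $ 3 = s * d"
 "?A $ 2 $ 1 = r * s * d" "?A $ 2 $ 2 = r * c * t" "?A $ 2 $ 3 = s * t"
 "?A $ 3 $ 1 = 0" "?A $ 3 $ 2 = - (r * s)" "?A $ 3 $ 3 = c"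
 by (simp_all add: matrix_def g'_def axis_3_nth c_def s_def d_def t_def r_def)
 have "det ?A = - (r^2 * s * ((c^2 + s^2) * (d^2 + t^2)))"
 unfolding det_3 A by (simp add: power2_eq_square algebra_simps)
 then have "det (matrix (g' x)) = - (r^2 * s)" unfolding 1 by simp
 moreover have "x $ 2 \<in> {p0..p1}" using x by (auto simp: mem_box_cart forall_3)
 ultimately show ?thesis using sin_p(2)[of "x $ 2"] by (simp add: r_def s_def abs_mult)
 qed
 have inj: "inj_on ?g (box ?a ?b)"
 proof (rule inj_onI)
 fix x y assume xy: "x \<in> box ?a ?b" "y \<in> box ?a ?b" and eq: "?g x = ?g y"
 have r: "x $ 3 > 0" "y $ 3 > 0" using xy r0_bounds(1) unfolding mem by linarith+
 then have 3: "x $ 3 = y $ 3" using arg_cong[OF eq, of norm] by (simp add: norm_spherical)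
 have "cos (x $ 2) = cos (y $ 2)" using arg_cong[OF eq, of "%v. v $ 3"] r 3 by (simp add: spherical_nth)
 moreover have b: "p0 < x $ 2" "x $ 2 < p1" "p0 < y $ 2" "y $ 2 < p1"
 using xy unfolding mem by linarith+
 moreover have "0 <= x $ 2" "x $ 2 <= pi" "0 <= y $ 2" "y $ 2 <= pi" using b p_bounds by linarith+
 ultimately have 2: "x $ 2 = y $ 2" by (metis arccos_cos)
 have "sin (x $ 2) > 0" by (rule sin_p(2)) (use b in simp)
 then have "cos (x $ 1) = cos (y $ 1)" "sin (x $ 1) = sin (y $ 1)"
 using arg_cong[OF eq, of "%v. v $ 1"] arg_cong[OF eq, of "%v. v $ 2"] r 3 2 by (simp_all add: spherical_nth)
 \<comment> \<open>Equal sine and cosine mean equal points on the unit circle, and an azimuth in [0,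
   2 pi) is determined by its point through \<open>Arg2pi\<close>.\<close>
 then have "exp (\<i> * of_real (x $ 1)) = exp (\<i> * of_real (y $ 1))"
 by (simp add: exp_Euler cos_of_real sin_of_real)
 then have 1: "x $ 1 = y $ 1"
 proof -
 have "0 <= x $ 1" "x $ 1 < 2*pi" "0 <= y $ 1" "y $ 1 < 2*pi" using xy unfolding mem by linarith+
 then show ?thesis
 using \<open>exp _ = _\<close> Arg2pi_unique[of 1 "x $ 1" "exp (\<i> * of_real (x $ 1))"]
 Arg2pi_unique[of 1 "y $ 1" "exp (\<i> * of_real (x $ 1))"] by simp
 qed
 show "x = y" using 1 2 3 by (simp add: vec_eq_iff forall_3)
 qed
 have cont: "continuous_on (cbox ?a ?b) (%y. f (?g y) * ((y $ 3)^2 * sin (y $ 2)))"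
 proof (intro continuous_intros continuous_on_compose2[OF continuous_on_subset[OF f D_closed_off_axis]])
 show "(%y. ?g y) ` cbox ?a ?b \<subseteq> D_closed"
 using spherical_in_D_closed by (auto simp: mem_box_cart forall_3)
 qed
 have ai: "(%y. \<bar>det (matrix (g' y))\<bar> * f (?g y)) absolutely_integrable_on box ?a ?b"
 proof (rule set_integrable_subset)
 show "(%y. \<bar>det (matrix (g' y))\<bar> * f (?g y)) absolutely_integrable_on cbox ?a ?b"
 using absolutely_integrable_continuous[OF cont] det
 by (subst set_integrable_cong[OF refl refl]) (auto simp: mult.commute)
 qed (auto simp: box_subset_cbox)
 note cov = change_of_variables_3[OF _ der inj ai]
 have img: "?g ` box ?a ?b \<subseteq> D"
 proof safe
 fix y assume y: "y \<in> box ?a ?b"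
 then have "r0 < y $ 3" "y $ 3 < 1" "\<bar>cos (y $ 2)\<bar> < sin \<alpha>"
 using sin_p_strict[of "y $ 2"] unfolding mem by auto
 then show "?g y \<in> D" using r0_bounds(1) by (auto simp: D_eq norm_spherical spherical_nth abs_mult)
 qed
 have img2: "D - ?g ` box ?a ?b \<subseteq> {x. x $ 2 = 0}"
 proof safe
 fix x assume x: "x \<in> D" "x \<notin> ?g ` box ?a ?b"
 show "x $ 2 = 0"
 proof (rule ccontr)
 assume 2: "x $ 2 ~= 0"
 have oa: "x \<in> off_axis" using x(1) D_off_axis by blast
 note sc = spherical_coordinates[OF oa] and pos = cyl_pos[OF oa] norm_pos_off_axis[OF oa]
 have "sin (theta x) ~= 0" using sc(4) 2 pos by simp
 then have th: "0 < theta x" "theta x < 2 * pi"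
 using Arg2pi[of "Complex (x $ 1) (x $ 2)"] unfolding theta_def[symmetric]
 by (auto simp: order_less_le)
 have eq: "x = ?g (vector [theta x, phi x, norm x])"
 using pos by (simp add: vec_eq_iff forall_3 spherical_nth sc)
 have "vector [theta x, phi x, norm x] \<in> box ?a ?b"
 using x(1) th unfolding mem by (auto simp: Dm_def rho_def p0_def p1_def r0_def)
 then show False using x(2) eq by blast
 qed
 qed
 have neg: "negligible {x :: real^3. x $ 2 = 0}" by (rule negligible_standard_hyperplane_cart)
 have "(LINT x|lebesgue_on D. f x) = integral D f"
 by (rule lebesgue_integral_eq_integral[OF continuous_integrable_D[OF f] D_sets])
 also have "... = integral (?g ` box ?a ?b) f"
 proof (rule integral_spike_set)
 show "negligible {x \<in> D - ?g ` box ?a ?b. f x ~= 0}"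
 by (rule negligible_subset[OF neg]) (use img2 in blast)
 show "negligible {x \<in> ?g ` box ?a ?b - D. f x ~= 0}"
 by (rule negligible_subset[OF neg]) (use img in blast)
 qed
 also have "... = integral (box ?a ?b) (%y. \<bar>det (matrix (g' y))\<bar> * f (?g y))"
 by (rule cov(2)) simp
 also have "... = integral (cbox ?a ?b) (%y. \<bar>det (matrix (g' y))\<bar> * f (?g y))"
 by (rule integral_open_interval)
 also have "... = integral (cbox ?a ?b) (%y. (%(q, p, r). f (spherical r p q) * (r^2 * sin p)) (y $ 1, y $ 2, y $ 3))"
 by (rule integral_cong) (simp add: det mult.commute)
 also have "... = integral (cbox (0, p0, r0) (2 * pi, p1, 1)) (%(q, p, r). f (spherical r p q) * (r^2 * sin p))"
 proof (rule integral_triple)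
 have "continuous_on coord_box (%x. (%(q, p, r). f (spherical r p q)) x * ((snd (snd x))^2 * sin (fst (snd x))))"
 by (intro continuous_on_mult continuous_on_coord f continuous_intros)
 then show "continuous_on (cbox (0, p0, r0) (2 * pi, p1, 1)) (%(q, p, r). f (spherical r p q) * (r^2 * sin p))"
 by (simp add: coord_box_def case_prod_beta)
 qed
 finally show ?thesis by (simp add: coord_box_def)
qed

end

section \<open>Surface integrals and integration by parts along the frame\<close>

lemma continuous_l2_cbox:
 fixes f :: "'a::euclidean_space => real"
 assumes "continuous_on (cbox a b) f" shows "l2 (lebesgue_on (cbox a b)) f"
proof -
 have "bounded (f ` cbox a b)" by (intro compact_imp_bounded compact_continuous_image assms compact_cbox)
 then obtain C where "!!x. x \<in> cbox a b ==> \<bar>f x\<bar> <= C" by (auto simp: bounded_iff)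
 then show ?thesis
 by (intro l2_bounded[where C=C] finite_measure_lebesgue_on continuous_imp_measurable_on_sets_lebesgue assms AE_I2) auto
qed

lemma integral_cbox_lebesgue:
 fixes f :: "'a::euclidean_space => real"
 assumes "continuous_on (cbox a b) f"
 shows "integral (cbox a b) f = (LINT x|lebesgue_on (cbox a b). f x)"
 by (rule lebesgue_integral_eq_integral[symmetric, OF l2_integrable[OF _ continuous_l2_cbox[OF assms]]])
 (auto intro: finite_measure_lebesgue_on)

lemma Cauchy_Schwarz_cbox:
 fixes f g :: "'a::euclidean_space => real"
 assumes "continuous_on (cbox a b) f" "continuous_on (cbox a b) g"
 shows "\<bar>integral (cbox a b) (%x. f x * g x)\<bar>
 <= sqrt (integral (cbox a b) (%x. (f x)^2)) * sqrt (integral (cbox a b) (%x. (g x)^2))"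
 using l2_Cauchy_Schwarz[OF continuous_l2_cbox[OF assms(1)] continuous_l2_cbox[OF assms(2)]]
 by (subst (1 2 3) integral_cbox_lebesgue) (auto intro!: continuous_intros assms)

lemma Cauchy_Schwarz_cbox_sq:
 fixes f g :: "'a::euclidean_space => real"
 assumes "continuous_on (cbox a b) f" "continuous_on (cbox a b) g"
 shows "(integral (cbox a b) (%x. f x * g x))^2
 <= integral (cbox a b) (%x. (f x)^2) * integral (cbox a b) (%x. (g x)^2)"
proof -
 have "\<bar>integral (cbox a b) (%x. f x * g x)\<bar>^2 <=
 (sqrt (integral (cbox a b) (%x. (f x)^2)) * sqrt (integral (cbox a b) (%x. (g x)^2)))^2"
 by (rule power_mono[OF Cauchy_Schwarz_cbox[OF assms]]) simp
 moreover have "0 <= integral (cbox a b) (%x. (f x)^2)" "0 <= integral (cbox a b) (%x. (g x)^2)"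
 by (auto intro!: integral_nonneg integrable_continuous continuous_intros assms)
 ultimately show ?thesis by (simp add: power_mult_distrib)
qed

lemma Cauchy_Schwarz_cbox_weighted:
 fixes f g w :: "'a::euclidean_space => real"
 assumes "continuous_on (cbox a b) f" "continuous_on (cbox a b) g" "continuous_on (cbox a b) w"
 "!!x. x \<in> cbox a b ==> 0 <= w x"
 shows "\<bar>integral (cbox a b) (%x. f x * g x * w x)\<bar>
 <= sqrt (integral (cbox a b) (%x. (f x)^2 * w x)) * sqrt (integral (cbox a b) (%x. (g x)^2 * w x))"
proof -
 have e1: "integral (cbox a b) (%x. f x * g x * w x) = integral (cbox a b) (%x. (f x * sqrt (w x)) * (g x * sqrt (w x)))"
 by (rule integral_cong) (use assms(4) in \<open>simp add: algebra_simps real_sqrt_mult_self flip: power2_eq_square\<close>)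
 have e2: "integral (cbox a b) (%x. (h x)^2 * w x) = integral (cbox a b) (%x. (h x * sqrt (w x))^2)" for h
 by (rule integral_cong) (use assms(4) in \<open>simp add: power_mult_distrib\<close>)
 show ?thesis
 unfolding e1 e2 by (rule Cauchy_Schwarz_cbox) (intro continuous_intros assms)+
qed

lemma integral_swap_cbox:
 fixes f :: "real \<times> real => real"
 assumes "continuous_on (cbox (a, c) (b, d)) f"
 shows "integral (cbox (a, c) (b, d)) f = integral (cbox (c, a) (d, b)) (%(y, x). f (x, y))"
proof -
 have c: "continuous_on (cbox (c, a) (d, b)) (%(y, x). f (x, y))"
 unfolding case_prod_beta
 by (rule continuous_on_compose2[OF assms]) (auto intro!: continuous_intros simp: cbox_Pair_eq)
 show ?thesis
 using integral_swap_continuous[of a c b d "%x y. f (x, y)"] integral_prod_continuous[OF assms] integral_prod_continuous[OF c] assms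
 by simp
qed

lemma lebesgue_on_measurable_continuous:
 fixes f :: "'a::euclidean_space => 'b::euclidean_space"
 assumes "continuous_on UNIV f" shows "f \<in> borel_measurable (lebesgue_on A)"
proof -
 have "f \<in> borel_measurable lborel" using borel_measurable_continuous_onI[OF assms] by simp
 then show ?thesis by (intro measurable_restrict_space1 measurable_completion)
qed

lemma continuous_cyl: "continuous_on S cyl"
 unfolding cyl_def[abs_def] by (intro continuous_intros)

lemma continuous_rot_field: "continuous_on S rot_field"
 unfolding rot_field_def[abs_def] by (intro continuous_on_vector_3 continuous_intros)

lemma continuous_frame: "continuous_on off_axis e_rho" "continuous_on off_axis e_phi" "continuous_on off_axis e_theta"
proof -
 have n: "norm x ~= 0" "cyl x ~= 0" if "x \<in> off_axis" for x
 using that cyl_pos[of x] norm_pos_off_axis[of x] by auto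
 have "continuous_on off_axis (%x. x /\<^sub>R norm x)"
 using n by (intro continuous_intros) auto
 then show "continuous_on off_axis e_rho" by (rule continuous_on_eq) (simp add: e_rho_eq)
 have "continuous_on off_axis (%x. vector [x $ 1 * x $ 3 / (cyl x * norm x), x $ 2 * x $ 3 / (cyl x * norm x), - cyl x / norm x] :: real^3)"
 using n by (intro continuous_on_vector_3 continuous_intros continuous_cyl) auto
 then show "continuous_on off_axis e_phi" by (rule continuous_on_eq) (simp add: e_phi_eq)
 have "continuous_on off_axis (%x. rot_field x /\<^sub>R cyl x)"
 using n by (intro continuous_intros continuous_cyl continuous_rot_field) auto
 then show "continuous_on off_axis e_theta" by (rule continuous_on_eq) (simp add: e_theta_eq)
qed

context cone begin

text \<open>The constant factor \<open>r^2\<close> of the surface measure is left out, as is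
  \<open>sin p\<close> in \<open>cone_int\<close>; the two factors reappear explicitly wherever
  these integrals are compared with a volume or a surface measure.\<close>

definition sphere_int :: "real => (real^3 => real) => real" where
 "sphere_int r F = integral (cbox (0, p0) (2 * pi, p1)) (%(q, p). F (spherical r p q) * sin p)"

definition cone_int :: "real => (real^3 => real) => real" where
 "cone_int p F = integral (cbox (0, r0) (2 * pi, 1)) (%(q, r). F (spherical r p q) * r)"

lemma continuous_on_sphere:
 assumes "continuous_on off_axis F" "r \<in> {r0..1}"
 shows "continuous_on (cbox (0, p0) (2 * pi, p1)) (%(q, p). F (spherical r p q) :: 'b::euclidean_space)"
 unfolding case_prod_beta
proof (rule continuous_on_compose2[OF continuous_on_subset[OF assms(1) D_closed_off_axis]])
 show "continuous_on (cbox (0, p0) (2 * pi, p1)) (%x. spherical r (snd x) (fst x))"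
 by (intro continuous_intros)
 show "(%x. spherical r (snd x) (fst x)) ` cbox (0, p0) (2 * pi, p1) \<subseteq> D_closed"
 using spherical_in_D_closed assms(2) by (auto simp: cbox_Pair_eq)
qed

lemma continuous_on_cone:
 assumes "continuous_on off_axis F" "p \<in> {p0..p1}"
 shows "continuous_on (cbox (0, r0) (2 * pi, 1)) (%(q, r). F (spherical r p q) :: 'b::euclidean_space)"
 unfolding case_prod_beta
proof (rule continuous_on_compose2[OF continuous_on_subset[OF assms(1) D_closed_off_axis]])
 show "continuous_on (cbox (0, r0) (2 * pi, 1)) (%x. spherical (snd x) p (fst x))"
 by (intro continuous_intros)
 show "(%x. spherical (snd x) p (fst x)) ` cbox (0, r0) (2 * pi, 1) \<subseteq> D_closed"
 using spherical_in_D_closed assms(2) by (auto simp: cbox_Pair_eq)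
qed

lemma coord_slice_continuous:
 assumes "continuous_on coord_box g" "q \<in> {0..2*pi}"
 shows "continuous_on (cbox (p0, r0) (p1, 1)) (%(p, r). g (q, p, r))"
 unfolding case_prod_beta
 by (rule continuous_on_compose2[OF assms(1)])
 (use assms(2) in \<open>auto intro!: continuous_intros simp: coord_box_def cbox_Pair_eq\<close>)

lemma coord_integral_nested:
 fixes g :: "real \<times> real \<times> real => real"
 assumes g: "continuous_on coord_box g"
 shows "integral coord_box g = integral {0..2*pi} (%q. integral (cbox (p0, r0) (p1, 1)) (%(p, r). g (q, p, r)))"
 "integral coord_box g = integral {0..2*pi} (%q. integral {p0..p1} (%p. integral {r0..1} (%r. g (q, p, r))))"
 "integral coord_box g = integral {0..2*pi} (%q. integral {r0..1} (%r. integral {p0..p1} (%p. g (q, p, r))))"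
proof -
 show 1: "integral coord_box g = integral {0..2*pi} (%q. integral (cbox (p0, r0) (p1, 1)) (%(p, r). g (q, p, r)))"
 proof -
 have "(%(p, r). g (q, p, r)) = (%y. g (q, y))" for q by auto
 then show ?thesis
 using integral_prod_continuous[OF g[unfolded coord_box_def]] by (simp add: coord_box_def)
 qed
 show 2: "integral coord_box g = integral {0..2*pi} (%q. integral {p0..p1} (%p. integral {r0..1} (%r. g (q, p, r))))"
 unfolding 1
 by (rule integral_cong) (subst integral_prod_continuous[OF coord_slice_continuous[OF g]], auto)
 show "integral coord_box g = integral {0..2*pi} (%q. integral {r0..1} (%r. integral {p0..p1} (%p. g (q, p, r))))"
 unfolding 2
 proof (rule integral_cong)
 fix q assume "q \<in> {0..2*pi}"
 from coord_slice_continuous[OF g this]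
 have "continuous_on (cbox (p0, r0) (p1, 1)) (%(p, r). g (q, p, r))" .
 from integral_swap_continuous[OF this]
 show "integral {p0..p1} (%p. integral {r0..1} (%r. g (q, p, r))) = integral {r0..1} (%r. integral {p0..p1} (%p. g (q, p, r)))"
 by simp
 qed
qed

lemma coord_weight_continuous:
 assumes "continuous_on off_axis f"
 shows "continuous_on coord_box (%(q, p, r). f (spherical r p q) * (r^2 * sin p) :: real)"
proof -
 have "continuous_on coord_box (%x. (%(q, p, r). f (spherical r p q)) x * ((snd (snd x))^2 * sin (fst (snd x))))"
 by (intro continuous_on_mult continuous_on_coord assms continuous_intros)
 then show ?thesis by (simp add: case_prod_beta)
qed

text \<open>The coefficient \<open>2 / norm x\<close> is the divergence of \<open>e_rho\<close>. In
  coordinates the weighted integrand is the \<open>r\<close>-derivative of r^2 F sin p, so the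
  fundamental theorem leaves the two spheres.\<close>

lemma ibp_rho:
 assumes F: "C1 F F'"
 shows "(LINT x|lebesgue_on D. F' x \<bullet> e_rho x + 2 / norm x * F x) = sphere_int 1 F - r0^2 * sphere_int r0 F"
proof -
 let ?f = "%x. F' x \<bullet> e_rho x + 2 / norm x * F x"
 have c: "continuous_on off_axis ?f"
 using norm_pos_off_axis by (intro continuous_intros C1D(2)[OF F] C1_continuous[OF F] continuous_frame) auto
 have ftc: "integral {r0..1} (%r. ?f (spherical r p q) * (r^2 * sin p))
 = F (spherical 1 p q) * sin p - r0^2 * (F (spherical r0 p q) * sin p)" if p: "p \<in> {p0..p1}" for p q
 proof -
 have "((%r. ?f (spherical r p q) * (r^2 * sin p)) has_integral
 (1^2 * F (spherical 1 p q) * sin p - r0^2 * F (spherical r0 p q) * sin p)) {r0..1}"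
 proof (rule fundamental_theorem_of_calculus)
 fix r assume r: "r \<in> {r0..1}"
 then have rp: "r > 0" using r0_bounds by auto
 have "((%r. r^2 * F (spherical r p q) * sin p) has_real_derivative
 ?f (spherical r p q) * (r^2 * sin p)) (at r within {r0..1})"
 using rp by (auto intro!: derivative_eq_intros C1_deriv_spherical(1)[OF F rp sin_p(2)[OF p]]
 simp: norm_spherical power2_eq_square algebra_simps)
 then show "((%r. r^2 * F (spherical r p q) * sin p) has_vector_derivative
 ?f (spherical r p q) * (r^2 * sin p)) (at r within {r0..1})"
 by (simp add: has_real_derivative_iff_has_vector_derivative)
 qed (use r0_bounds in auto)
 then show ?thesis by (simp add: integral_unique mult.assoc)
 qed
 have cs: "continuous_on (cbox (0, p0) (2 * pi, p1)) (%(q, p). F (spherical r p q) * sin p)" if "r \<in> {r0..1}" for r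
 proof -
 have "continuous_on (cbox (0, p0) (2 * pi, p1)) (%x. (%(q, p). F (spherical r p q)) x * sin (snd x))"
 by (intro continuous_on_mult continuous_on_sphere that C1_continuous[OF F] continuous_intros)
 then show ?thesis by (simp add: case_prod_beta)
 qed
 have "(LINT x|lebesgue_on D. ?f x) = integral {0..2*pi} (%q. integral {p0..p1} (%p.
 F (spherical 1 p q) * sin p - r0^2 * (F (spherical r0 p q) * sin p)))"
 unfolding integral_D_spherical[OF c] coord_integral_nested(2)[OF coord_weight_continuous[OF c]] prod.case
 by (intro integral_cong ftc)
 also have "... = integral (cbox (0, p0) (2 * pi, p1)) (%z. (%(q, p). F (spherical 1 p q) * sin p) z
 - r0^2 * (%(q, p). F (spherical r0 p q) * sin p) z)"
 by (subst integral_prod_continuous) (auto intro!: continuous_intros cs simp: less_imp_le r0_bounds)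
 also have "... = sphere_int 1 F - r0^2 * sphere_int r0 F"
 unfolding sphere_int_def using cs[of 1] cs[of r0] r0_bounds
 by (subst HKI_integral_diff)
 (auto intro!: integrable_continuous continuous_intros cs)
 finally show ?thesis .
qed

text \<open>The coefficient is the divergence of \<open>e_phi\<close>, that is, cot(phi)/rho. The
  weighted integrand is the \<open>p\<close>-derivative of r F sin p, so the fundamental theorem
  leaves the two cones.\<close>

lemma ibp_phi:
 assumes F: "C1 F F'"
 shows "(LINT x|lebesgue_on D. F' x \<bullet> e_phi x + x $ 3 / (cyl x * norm x) * F x)
 = sin p1 * cone_int p1 F - sin p0 * cone_int p0 F"
proof -
 let ?f = "%x. F' x \<bullet> e_phi x + x $ 3 / (cyl x * norm x) * F x"
 have n: "cyl x * norm x ~= 0" if "x \<in> off_axis" for x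
 using that cyl_pos[of x] norm_pos_off_axis[of x] by auto
 have c: "continuous_on off_axis ?f"
 using n by (intro continuous_intros C1D(2)[OF F] C1_continuous[OF F] continuous_frame continuous_cyl) auto
 have ftc: "integral {p0..p1} (%p. ?f (spherical r p q) * (r^2 * sin p))
 = sin p1 * (F (spherical r p1 q) * r) - sin p0 * (F (spherical r p0 q) * r)" if r: "r \<in> {r0..1}" for r q
 proof -
 have rp: "r > 0" using r r0_bounds by auto
 have "((%p. ?f (spherical r p q) * (r^2 * sin p)) has_integral
 (r * F (spherical r p1 q) * sin p1 - r * F (spherical r p0 q) * sin p0)) {p0..p1}"
 proof (rule fundamental_theorem_of_calculus)
 fix p assume p: "p \<in> {p0..p1}"
 have sp: "sin p > 0" by (rule sin_p(2)[OF p])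
 have "((%p. r * F (spherical r p q) * sin p) has_real_derivative
 ?f (spherical r p q) * (r^2 * sin p)) (at p within {p0..p1})"
 using rp sp by (auto intro!: derivative_eq_intros C1_deriv_spherical(2)[OF F rp sp]
 simp: norm_spherical cyl_spherical spherical_nth power2_eq_square field_simps)
 then show "((%p. r * F (spherical r p q) * sin p) has_vector_derivative
 ?f (spherical r p q) * (r^2 * sin p)) (at p within {p0..p1})"
 by (simp add: has_real_derivative_iff_has_vector_derivative)
 qed (use p_bounds in auto)
 then show ?thesis by (simp add: integral_unique mult_ac)
 qed
 have cs: "continuous_on (cbox (0, r0) (2 * pi, 1)) (%(q, r). F (spherical r p q) * r)" if "p \<in> {p0..p1}" for p
 proof -
 have "continuous_on (cbox (0, r0) (2 * pi, 1)) (%x. (%(q, r). F (spherical r p q)) x * snd x)"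
 by (intro continuous_on_mult continuous_on_cone that C1_continuous[OF F] continuous_intros)
 then show ?thesis by (simp add: case_prod_beta)
 qed
 have "(LINT x|lebesgue_on D. ?f x) = integral {0..2*pi} (%q. integral {r0..1} (%r.
 sin p1 * (F (spherical r p1 q) * r) - sin p0 * (F (spherical r p0 q) * r)))"
 unfolding integral_D_spherical[OF c] coord_integral_nested(3)[OF coord_weight_continuous[OF c]] prod.case
 by (intro integral_cong ftc)
 also have "... = integral (cbox (0, r0) (2 * pi, 1)) (%z. sin p1 * (%(q, r). F (spherical r p1 q) * r) z
 - sin p0 * (%(q, r). F (spherical r p0 q) * r) z)"
 using p_bounds by (subst integral_prod_continuous) (auto intro!: continuous_intros cs)
 also have "... = sin p1 * cone_int p1 F - sin p0 * cone_int p0 F"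
 unfolding cone_int_def using cs[of p1] cs[of p0] p_bounds
 by (subst HKI_integral_diff)
 (auto intro!: integrable_continuous continuous_intros cs)
 finally show ?thesis .
qed

lemma sphere_int_CS:
 assumes "continuous_on off_axis F" "continuous_on off_axis G" "r \<in> {r0..1}"
 shows "\<bar>sphere_int r (%x. F x * G x)\<bar> <= sqrt (sphere_int r (%x. (F x)^2)) * sqrt (sphere_int r (%x. (G x)^2))"
 unfolding sphere_int_def case_prod_beta
proof (rule Cauchy_Schwarz_cbox_weighted)
 show "0 <= sin (snd x)" if "x \<in> cbox (0, p0) (2 * pi, p1)" for x
 using that sin_p(2)[of "snd x"] by (cases x) (auto simp: cbox_Pair_eq)
qed (use continuous_on_sphere[OF assms(1,3)] continuous_on_sphere[OF assms(2,3)] in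
 \<open>auto simp: case_prod_beta intro!: continuous_intros\<close>)

lemma cone_int_CS:
 assumes "continuous_on off_axis F" "continuous_on off_axis G" "p \<in> {p0..p1}"
 shows "\<bar>cone_int p (%x. F x * G x)\<bar> <= sqrt (cone_int p (%x. (F x)^2)) * sqrt (cone_int p (%x. (G x)^2))"
 unfolding cone_int_def case_prod_beta
proof (rule Cauchy_Schwarz_cbox_weighted)
 show "0 <= snd x" if "x \<in> cbox (0, r0) (2 * pi, 1)" for x
 using that r0_bounds(1) by (cases x) (auto simp: cbox_Pair_eq)
qed (use continuous_on_cone[OF assms(1,3)] continuous_on_cone[OF assms(2,3)] in
 \<open>auto simp: case_prod_beta intro!: continuous_intros\<close>)

end

lemma nn_integral_rectangle:
 fixes h :: "real \<times> real => real"
 assumes h: "continuous_on (cbox (a, c) (b, d)) h" "!!z. z \<in> cbox (a, c) (b, d) ==> 0 <= h z"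
 shows "(\<integral>\<^sup>+z. ennreal (h z) \<partial>lebesgue_on ({a<..<b} \<times> {c..<d})) = ennreal (integral (cbox (a, c) (b, d)) h)"
proof -
 let ?A = "{a<..<b} \<times> {c..<d}" and ?B = "cbox (a, c) (b, d)"
 have sub: "?A \<subseteq> ?B" by (auto simp: cbox_Pair_eq)
 have "?A \<in> sets borel" by (intro borel_Times) auto
 then have A: "?A \<in> sets lebesgue" by (simp add: sets_completionI_sets)
 have ai: "h absolutely_integrable_on ?A"
 by (rule set_integrable_subset[OF absolutely_integrable_continuous[OF h(1)] A sub])
 then have i: "integrable (lebesgue_on ?A) h"
 using A by (simp add: set_integrable_def integral_lebesgue_on_indicator)
 have "(\<integral>\<^sup>+z. ennreal (h z) \<partial>lebesgue_on ?A) = ennreal (\<integral>z. h z \<partial>lebesgue_on ?A)"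
 using sub h(2) A by (intro nn_integral_eq_integral[OF i] AE_I2) auto
 also have "(\<integral>z. h z \<partial>lebesgue_on ?A) = integral ?A h"
 by (rule lebesgue_integral_eq_integral[OF i A])
 also have "... = integral ?B h"
 proof (rule integral_spike_set)
 have "?B - box (a, c) (b, d) \<subseteq> frontier ?B" by (auto simp: frontier_def interior_cbox)
 moreover have "box (a, c) (b, d) \<subseteq> ?A" by (auto simp: box_def Basis_prod_def)
 ultimately show "negligible {z \<in> ?B - ?A. h z ~= 0}"
 by (intro negligible_subset[OF negligible_frontier_interval(1)[of "(a,c)" "(b,d)"]]) auto
 show "negligible {z \<in> ?A - ?B. h z ~= 0}"
 by (rule negligible_subset[OF negligible_empty]) (use sub in auto)
 qed
 finally show ?thesis .
qed

context cone begin

text \<open>Makes the trace norm of \<open>has_trace\<close> computable for its smooth approximants.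
  The parameter range in the surface measure and the closed rectangle of \<open>sphere_int\<close>
  differ by a null set.\<close>

lemma spherical_trace:
 assumes F: "continuous_on UNIV F" and r: "r \<in> {r0..1}"
 shows "(\<integral>\<^sup>+x. ennreal ((F x)^2) \<partial>sphere_piece \<alpha> r) = ennreal (r^2 * sphere_int r (%x. (F x)^2))"
proof -
 let ?A = "{pi/2 - \<alpha><..<pi/2 + \<alpha>} \<times> {0..<2*pi}"
 let ?N = "lebesgue_on ?A"
 have [measurable]: "F \<in> borel_measurable borel" using F by (rule borel_measurable_continuous_onI)
 have 1: "(%(p, q). spherical r p q) \<in> measurable ?N borel"
 unfolding case_prod_beta
 by (intro lebesgue_on_measurable_continuous continuous_intros)
 have 2: "(%(p, q). ennreal (r^2 * sin p)) \<in> borel_measurable ?N"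
 unfolding case_prod_beta
 by (intro measurable_compose[OF _ measurable_ennreal] lebesgue_on_measurable_continuous continuous_intros)
 have "(\<integral>\<^sup>+x. ennreal ((F x)^2) \<partial>sphere_piece \<alpha> r)
 = (\<integral>\<^sup>+z. (%(p, q). ennreal (r^2 * sin p)) z * ennreal ((F ((%(p, q). spherical r p q) z))^2) \<partial>?N)"
 unfolding sphere_piece_def using 1 2 
 by (subst nn_integral_distr) (auto intro!: nn_integral_density measurable_compose[OF 1])
 also have "... = (\<integral>\<^sup>+z. ennreal ((%(p, q). r^2 * ((F (spherical r p q))^2 * sin p)) z) \<partial>?N)"
 by (intro nn_integral_cong) (use sin_p(2) in \<open>auto simp: p0_def p1_def less_imp_le algebra_simps simp flip: ennreal_mult''\<close>)
 also have "... = ennreal (integral (cbox (p0, 0) (p1, 2*pi)) (%(p, q). r^2 * ((F (spherical r p q))^2 * sin p)))"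
 unfolding p0_def[symmetric] p1_def[symmetric]
 proof (rule nn_integral_rectangle)
 show "continuous_on (cbox (p0, 0) (p1, 2 * pi)) (%(p, q). r^2 * ((F (spherical r p q))^2 * sin p))"
 unfolding case_prod_beta by (intro continuous_intros continuous_on_compose2[OF F]) auto
 show "0 <= (case z of (p, q) => r^2 * ((F (spherical r p q))^2 * sin p))" if "z \<in> cbox (p0, 0) (p1, 2 * pi)" for z
 using that sin_p(2)[of "fst z"] by (cases z) (auto simp: cbox_Pair_eq)
 qed
 also have "integral (cbox (p0, 0) (p1, 2*pi)) (%(p, q). r^2 * ((F (spherical r p q))^2 * sin p))
 = integral (cbox (0, p0) (2*pi, p1)) (%z. r^2 * (%(q, p). (F (spherical r p q))^2 * sin p) z)"
 by (subst integral_swap_cbox)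
 (auto simp: case_prod_beta intro!: continuous_intros continuous_on_compose2[OF F])
 finally show ?thesis by (simp add: sphere_int_def)
qed

lemma cone_trace:
 assumes F: "continuous_on UNIV F" and p: "p \<in> {p0..p1}"
 shows "(\<integral>\<^sup>+x. ennreal ((F x)^2) \<partial>cone_piece m p) = ennreal (sin p * cone_int p (%x. (F x)^2))"
proof -
 let ?A = "{1 / real m<..<1} \<times> {0..<2*pi}"
 let ?N = "lebesgue_on ?A"
 have sp: "sin p > 0" by (rule sin_p(2)[OF p])
 have [measurable]: "F \<in> borel_measurable borel" using F by (rule borel_measurable_continuous_onI)
 have 1: "(%(r, q). spherical r p q) \<in> measurable ?N borel"
 unfolding case_prod_beta
 by (intro lebesgue_on_measurable_continuous continuous_intros)
 have 2: "(%(r, q). ennreal (r * sin p)) \<in> borel_measurable ?N"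
 unfolding case_prod_beta
 by (intro measurable_compose[OF _ measurable_ennreal] lebesgue_on_measurable_continuous continuous_intros)
 have "(\<integral>\<^sup>+x. ennreal ((F x)^2) \<partial>cone_piece m p)
 = (\<integral>\<^sup>+z. (%(r, q). ennreal (r * sin p)) z * ennreal ((F ((%(r, q). spherical r p q) z))^2) \<partial>?N)"
 unfolding cone_piece_def using 1 2
 by (subst nn_integral_distr) (auto intro!: nn_integral_density measurable_compose[OF 1])
 also have "... = (\<integral>\<^sup>+z. ennreal ((%(r, q). sin p * ((F (spherical r p q))^2 * r)) z) \<partial>?N)"
 by (intro nn_integral_cong) (use sp r0_bounds(1) in \<open>auto simp: r0_def less_imp_le algebra_simps simp flip: ennreal_mult''\<close>)
 also have "... = ennreal (integral (cbox (r0, 0) (1, 2*pi)) (%(r, q). sin p * ((F (spherical r p q))^2 * r)))"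
 unfolding r0_def[symmetric]
 proof (rule nn_integral_rectangle)
 show "continuous_on (cbox (r0, 0) (1, 2 * pi)) (%(r, q). sin p * ((F (spherical r p q))^2 * r))"
 unfolding case_prod_beta by (intro continuous_intros continuous_on_compose2[OF F]) auto
 show "0 <= (case z of (r, q) => sin p * ((F (spherical r p q))^2 * r))" if "z \<in> cbox (r0, 0) (1, 2 * pi)" for z
 using that sp r0_bounds(1) by (cases z) (auto simp: cbox_Pair_eq)
 qed
 also have "integral (cbox (r0, 0) (1, 2*pi)) (%(r, q). sin p * ((F (spherical r p q))^2 * r))
 = integral (cbox (0, r0) (2*pi, 1)) (%z. sin p * (%(q, r). (F (spherical r p q))^2 * r) z)"
 by (subst integral_swap_cbox)
 (auto simp: case_prod_beta intro!: continuous_intros continuous_on_compose2[OF F])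
 finally show ?thesis by (simp add: cone_int_def)
qed

end

lemma C1I_frame:
 assumes "!!x. x \<in> off_axis ==> (F has_derivative (%h. F' x \<bullet> h)) (at x)" "continuous_on off_axis F'"
 shows "C1 F F'"
 using assms by (simp add: C1_def)

lemma C1_mult:
 assumes "C1 F F'" "C1 G G'" shows "C1 (%x. F x * G x) (%x. F x *\<^sub>R G' x + G x *\<^sub>R F' x)"
proof (rule C1I_frame)
 fix x assume x: "x \<in> off_axis"
 show "((%x. F x * G x) has_derivative (%h. (F x *\<^sub>R G' x + G x *\<^sub>R F' x) \<bullet> h)) (at x)"
 by (rule has_derivative_eq_rhs[OF has_derivative_mult[OF C1D(1)[OF assms(1) x] C1D(1)[OF assms(2) x]]])
 (simp add: fun_eq_iff inner_add_left algebra_simps)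
qed (intro continuous_intros C1D(2)[OF assms(1)] C1D(2)[OF assms(2)] C1_continuous[OF assms(1)] C1_continuous[OF assms(2)])

lemma C1_add:
 assumes "C1 F F'" "C1 G G'" shows "C1 (%x. F x + G x) (%x. F' x + G' x)"
proof (rule C1I_frame)
 fix x assume x: "x \<in> off_axis"
 show "((%x. F x + G x) has_derivative (%h. (F' x + G' x) \<bullet> h)) (at x)"
 by (rule has_derivative_eq_rhs[OF has_derivative_add[OF C1D(1)[OF assms(1) x] C1D(1)[OF assms(2) x]]])
 (simp add: fun_eq_iff inner_add_left)
qed (intro continuous_intros C1D(2)[OF assms(1)] C1D(2)[OF assms(2)])

lemma C1_const: "C1 (%x. c) (%x. 0)"
 by (rule C1I_frame) auto

lemma C1_inner: "C1 (%x. x \<bullet> c) (%x. c)"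
 by (rule C1I_frame) (auto intro!: derivative_eq_intros simp: inner_commute)

lemma C1_compose:
 assumes F: "C1 F F'" and g: "!!x. x \<in> off_axis ==> (g has_real_derivative g' (F x)) (at (F x))"
 "continuous_on (F ` off_axis) g'"
 shows "C1 (%x. g (F x)) (%x. g' (F x) *\<^sub>R F' x)"
proof (rule C1I_frame)
 fix x assume x: "x \<in> off_axis"
 show "((%x. g (F x)) has_derivative (%h. (g' (F x) *\<^sub>R F' x) \<bullet> h)) (at x)"
 by (rule has_derivative_eq_rhs[OF has_derivative_compose[OF C1D(1)[OF F x] g(1)[OF x, unfolded has_field_derivative_def]]])
 (simp add: fun_eq_iff)
qed (intro continuous_intros continuous_on_compose2[OF g(2)] C1D(2)[OF F] C1_continuous[OF F], auto)

lemma C1_smooth: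
 assumes "smooth F" shows "C1 F (%x. \<Sum>b\<in>Basis. frechet_derivative F (at x) b *\<^sub>R b)"
proof (rule C1I_frame)
 fix x :: "real^3"
 have lin: "linear (frechet_derivative F (at x))"
 by (rule has_derivative_linear[OF smooth_has_derivative[OF assms]])
 have "frechet_derivative F (at x) h = (\<Sum>b\<in>Basis. frechet_derivative F (at x) b *\<^sub>R b) \<bullet> h" for h
 proof -
 have "frechet_derivative F (at x) h = frechet_derivative F (at x) (\<Sum>b\<in>Basis. (h \<bullet> b) *\<^sub>R b)"
 by (simp add: euclidean_representation)
 also have "... = (\<Sum>b\<in>Basis. (h \<bullet> b) * frechet_derivative F (at x) b)"
 by (simp add: linear_sum[OF lin] linear_scale[OF lin])
 finally show ?thesis by (simp add: inner_sum_left inner_commute[of h] mult.commute)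
 qed
 then show "(F has_derivative (%h. (\<Sum>b\<in>Basis. frechet_derivative F (at x) b *\<^sub>R b) \<bullet> h)) (at x)"
 by (intro has_derivative_eq_rhs[OF smooth_has_derivative[OF assms, of x]] ext)
qed (intro continuous_intros smooth_continuous smooth_frechet assms)

lemma C1_norm: "C1 norm (%x. x /\<^sub>R norm x)"
proof (rule C1I_frame)
 fix x :: "real^3" assume "x \<in> off_axis"
 then have "x ~= 0" using norm_pos_off_axis by force
 then show "(norm has_derivative (%h. (x /\<^sub>R norm x) \<bullet> h)) (at x)"
 using has_derivative_norm[of x] by (simp add: sgn_div_norm inner_commute)
next
 show "continuous_on off_axis (%x :: real^3. x /\<^sub>R norm x)"
 using norm_pos_off_axis by (intro continuous_intros) auto
qed

lemma C1_cyl: "C1 cyl (%x. vector [x $ 1, x $ 2, 0] /\<^sub>R cyl x)"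
proof (rule C1I_frame)
 fix x :: "real^3" assume x: "x \<in> off_axis"
 have p: "(x $ 1)^2 + (x $ 2)^2 > 0" using cyl_pos[OF x] by (simp add: cyl_def)
 have n: "((%x :: real^3. x $ i) has_derivative (%h. h $ i)) (at x)" for i
 by (rule bounded_linear_imp_has_derivative[OF bounded_linear_vec_nth])
 have "((%x :: real^3. (x $ 1)^2 + (x $ 2)^2) has_derivative (%h. 2 * (x $ 1 * h $ 1 + x $ 2 * h $ 2))) (at x)"
 by (auto intro!: derivative_eq_intros n simp: algebra_simps)
 from has_derivative_compose[OF this DERIV_real_sqrt[OF p, unfolded has_field_derivative_def]]
 show "(cyl has_derivative (%h. (vector [x $ 1, x $ 2, 0] /\<^sub>R cyl x) \<bullet> h)) (at x)"
 unfolding cyl_def[abs_def]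
 by (rule has_derivative_eq_rhs) (auto simp: fun_eq_iff inner_3 cyl_def field_simps, simp add: add_divide_distrib)
next
 show "continuous_on off_axis (%x. vector [x $ 1, x $ 2, 0] /\<^sub>R cyl x :: real^3)"
 by (intro continuous_intros continuous_on_vector_3 continuous_cyl ballI less_imp_neq[OF cyl_pos, symmetric])
qed

lemma C1_inverse:
 assumes "C1 F F'" "!!x. x \<in> off_axis ==> F x > 0"
 shows "C1 (%x. 1 / F x) (%x. (- 1 / (F x)^2) *\<^sub>R F' x)"
 using assms(2) by (intro C1_compose[OF assms(1), of "%y. 1 / y" "%y. - 1 / y^2"])
 (force intro!: derivative_eq_intros continuous_intros simp: power2_eq_square)+

section \<open>Rotations about the axis and axial symmetry\<close>

definition rot3 :: "real => real^3 => real^3" where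
 "rot3 s x = vector [cos s * x $ 1 - sin s * x $ 2, sin s * x $ 1 + cos s * x $ 2, x $ 3]"

lemma rot3_props:
 "norm (rot3 s x) = norm x" "rot3 s x $ 3 = x $ 3" "linear (rot3 s)" "rot3 s (rot3 t x) = rot3 (s + t) x"
 "rot3 0 x = x" "rho (rot3 s x) = rho x" "phi (rot3 s x) = phi x" "\<bar>det (matrix (rot3 s))\<bar> = 1"
proof -
 have "(cos s * x $ 1 - sin s * x $ 2)^2 + (sin s * x $ 1 + cos s * x $ 2)^2
 = ((sin s)^2 + (cos s)^2) * ((x $ 1)^2 + (x $ 2)^2)" by algebra
 then show n: "norm (rot3 s x) = norm x" by (simp add: norm_3 rot3_def)
 show 3: "rot3 s x $ 3 = x $ 3" by (simp add: rot3_def)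
 show "linear (rot3 s)"
 by (rule linearI) (auto simp: rot3_def vec_eq_iff forall_3 algebra_simps)
 show "rot3 s (rot3 t x) = rot3 (s + t) x"
 by (simp add: rot3_def vec_eq_iff forall_3 cos_add sin_add algebra_simps)
 show "rot3 0 x = x" by (simp add: rot3_def vec_eq_iff forall_3)
 show "rho (rot3 s x) = rho x" "phi (rot3 s x) = phi x" by (simp_all add: rho_def phi_def n 3)
 have A: "matrix (rot3 s) $ 1 $ 1 = cos s" "matrix (rot3 s) $ 1 $ 2 = - sin s" "matrix (rot3 s) $ 1 $ 3 = 0"
 "matrix (rot3 s) $ 2 $ 1 = sin s" "matrix (rot3 s) $ 2 $ 2 = cos s" "matrix (rot3 s) $ 2 $ 3 = 0"
 "matrix (rot3 s) $ 3 $ 1 = 0" "matrix (rot3 s) $ 3 $ 2 = 0" "matrix (rot3 s) $ 3 $ 3 = 1"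
 by (simp_all add: matrix_def rot3_def axis_3_nth)
 have "det (matrix (rot3 s)) = 1"
 unfolding det_3 A by simp
 then show "\<bar>det (matrix (rot3 s))\<bar> = 1" by simp
qed

context cone begin

lemma rotate_image_D: "rot3 s ` D = D"
proof -
 have sub: "rot3 t ` D \<subseteq> D" for t by (auto simp: D_eq rot3_props)
 have "x \<in> rot3 s ` D" if "x \<in> D" for x
 proof
 show "x = rot3 s (rot3 (-s) x)" by (simp add: rot3_props)
 show "rot3 (-s) x \<in> D" using sub that by blast
 qed
 then show ?thesis using sub by blast
qed

lemma integral_rotate_D:
 fixes f :: "real^3 => real"
 assumes "integrable (lebesgue_on D) f"
 shows "integrable (lebesgue_on D) (%x. f (rot3 s x))" "(LINT x|lebesgue_on D. f (rot3 s x)) = (LINT x|lebesgue_on D. f x)"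
proof -
 have ai: "f absolutely_integrable_on D"
 using assms D_sets by (simp add: set_integrable_def integral_lebesgue_on_indicator)
 have lin: "linear (rot3 t)" for t by (rule rot3_props(3))
 have der: "(rot3 t has_derivative rot3 t) (at x within D)" for t x
 by (rule linear_imp_has_derivative[OF lin])
 have inj: "inj_on (rot3 t) D" for t
 by (rule inj_on_inverseI[of _ "rot3 (- t)"]) (simp add: rot3_props)
 have "(%x. \<bar>det (matrix (rot3 (-s)))\<bar> * f (rot3 s (rot3 (-s) x))) absolutely_integrable_on D"
 using ai by (simp add: rot3_props)
 note cov = change_of_variables_3[OF D_sets der inj this, unfolded rotate_image_D]
 have ai': "(%x. f (rot3 s x)) absolutely_integrable_on D" by (rule cov(1))
 then show i: "integrable (lebesgue_on D) (%x. f (rot3 s x))"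
 using D_sets by (simp add: set_integrable_def integral_lebesgue_on_indicator)
 show "(LINT x|lebesgue_on D. f (rot3 s x)) = (LINT x|lebesgue_on D. f x)"
 using cov(2) unfolding lebesgue_integral_eq_integral[OF i D_sets] lebesgue_integral_eq_integral[OF assms D_sets]
 by (simp add: rot3_props)
qed

lemma AE_rotate_D:
 assumes "AE x in lebesgue_on D. P x" shows "AE x in lebesgue_on D. P (rot3 s x)"
proof -
 have "AE x in lebesgue. x \<in> D --> P x" using assms D_sets by (simp add: AE_lebesgue_on_iff)
 then obtain N where N: "N \<in> null_sets lebesgue" "{x. \<not> (x \<in> D --> P x)} \<subseteq> N"
 by (auto simp: eventually_ae_filter)
 have "negligible (rot3 (-s) ` N)"
 using N(1) rot3_props(3)
 by (intro negligible_differentiable_image_negligible linear_imp_differentiable_on) (auto simp: negligible_iff_null_sets)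
 moreover have "x \<in> rot3 (-s) ` N" if "x \<in> D" "\<not> P (rot3 s x)" for x
 proof
 show "x = rot3 (- s) (rot3 s x)" by (simp add: rot3_props)
 have "rot3 s x \<in> D" using that(1) rotate_image_D by blast
 then show "rot3 s x \<in> N" using N(2) that(2) by blast
 qed
 ultimately have "AE x in lebesgue. x \<in> D --> P (rot3 s x)"
 by (intro AE_I'[of "rot3 (-s) ` N"]) (auto simp: negligible_iff_null_sets)
 then show ?thesis using D_sets by (simp add: AE_lebesgue_on_iff)
qed

lemma axisymmetric_rotate:
 assumes "axisymmetric D u" shows "AE x in lebesgue_on D. u (rot3 s x) = u x"
proof -
 obtain F where F: "AE x in lebesgue_on D. u x = F (rho x) (phi x)" using assms by (auto simp: axisymmetric_def)
 from F AE_rotate_D[OF F, of s] show ?thesis by eventually_elim (simp add: rot3_props)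
qed

lemma rot3_D_closed: "x \<in> D_closed ==> rot3 s x \<in> D_closed"
 by (simp add: D_closed_def rot3_props)

text \<open>Rotating the whole integrand shows that the integral of \<open>u\<close> against a
  rotation difference quotient of \<psi> is 0, because \<open>u\<close> is almost everywhere
  unchanged; dominated convergence passes to the derivative. Rotations preserve the region, so
  \<psi> may be nonzero on the boundary, and no differentiability of \<open>u\<close>
  enters.\<close>

lemma axisymmetric_ibp:
 fixes u :: "real^3 => real"
 assumes ax: "axisymmetric D u" and u: "integrable (lebesgue_on D) u" and \<psi>: "C1 \<psi> \<psi>'"
 shows "(LINT x|lebesgue_on D. u x * (\<psi>' x \<bullet> rot_field x)) = 0"
proof -
 define s where "s n = 1 / real (Suc n)" for n
 have s: "s n > 0" for n by (auto simp: s_def)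
 have cd: "continuous_on off_axis (%x. \<psi>' x \<bullet> rot_field x)"
 by (intro continuous_intros C1D(2)[OF \<psi>] continuous_rot_field)
 have rd: "((%s. rot3 s x) has_derivative (%h. h *\<^sub>R rot_field (rot3 t x))) (at t within X)" for x t X
 unfolding rot3_def rot_field_def
 by (rule has_derivative_eq_rhs[OF has_derivative_vector_3])
 (auto intro!: derivative_eq_intros simp: vec_eq_iff forall_3 algebra_simps)
 have d: "((%s. \<psi> (rot3 s x)) has_real_derivative \<psi>' (rot3 t x) \<bullet> rot_field (rot3 t x)) (at t within X)"
 if "x \<in> D_closed" for x t X
 unfolding has_field_derivative_def
 by (rule has_derivative_eq_rhs[OF has_derivative_compose[OF rd C1D(1)[OF \<psi>]]])
 (use that rot3_D_closed D_closed_off_axis in \<open>auto simp: fun_eq_iff\<close>)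
 obtain C where C: "!!x. x \<in> D_closed ==> \<bar>\<psi>' x \<bullet> rot_field x\<bar> <= C"
 using continuous_bounded_D[OF cd] by auto
 obtain C2 where C2: "AE x in lebesgue_on D. norm (\<psi> x) <= C2"
 using continuous_AE_bounded_D[OF C1_continuous[OF \<psi>]] by blast
 have m: "\<psi> \<in> borel_measurable (lebesgue_on D)" by (rule continuous_measurable_D[OF C1_continuous[OF \<psi>]])
 have i1: "integrable (lebesgue_on D) (%x. u x * \<psi> x)"
 proof (rule Bochner_Integration.integrable_bound[where f="%x. C2 * u x"])
 show "AE x in lebesgue_on D. norm (u x * \<psi> x) <= norm (C2 * u x)"
 using C2 by eventually_elim (auto simp: abs_mult mult.commute[of "\<bar>u _\<bar>"] intro!: mult_right_mono)
 qed (use u m in auto)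
 have mr: "(%x. \<psi> (rot3 (s n) x)) \<in> borel_measurable (lebesgue_on D)" for n
 proof -
 have "continuous_on off_axis (%x. \<psi> (rot3 (s n) x))"
 proof (rule continuous_on_compose2[OF C1_continuous[OF \<psi>]])
 show "continuous_on off_axis (rot3 (s n))"
 by (rule linear_continuous_on) (simp add: linear_conv_bounded_linear[symmetric] rot3_props)
 show "rot3 (s n) ` off_axis \<subseteq> off_axis"
 proof safe
 fix x :: "real^3" assume "x \<in> off_axis"
 then have "(cyl x)^2 > 0" using cyl_pos[of x] by simp
 moreover have "(cyl (rot3 (s n) x))^2 = (cyl x)^2"
 using norm_sq_cyl[of x] norm_sq_cyl[of "rot3 (s n) x"] by (simp add: rot3_props)
 ultimately have "(cyl (rot3 (s n) x))^2 > 0" by (simp only:)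
 then show "rot3 (s n) x \<in> off_axis" unfolding off_axis_def cyl_def by auto
 qed
 qed
 then show ?thesis by (rule continuous_measurable_D)
 qed
 have eqz: "(LINT x|lebesgue_on D. u x * ((\<psi> (rot3 (s n) x) - \<psi> x) / s n)) = 0" for n
 proof -
 have ae: "AE x in lebesgue_on D. u (rot3 (s n) x) * \<psi> (rot3 (s n) x) = u x * \<psi> (rot3 (s n) x)"
 using axisymmetric_rotate[OF ax, of "s n"] by eventually_elim simp
 have i2: "integrable (lebesgue_on D) (%x. u x * \<psi> (rot3 (s n) x))"
 by (rule integrable_cong_AE_imp[OF integral_rotate_D(1)[OF i1, of "s n"]])
 (use ae u mr in \<open>auto elim: eventually_mono\<close>)
 have "(LINT x|lebesgue_on D. u x * \<psi> (rot3 (s n) x)) = (LINT x|lebesgue_on D. u (rot3 (s n) x) * \<psi> (rot3 (s n) x))"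
 by (rule integral_cong_AE)
 (use ae i2 integral_rotate_D(1)[OF i1, of "s n"] in \<open>auto elim: eventually_mono dest: borel_measurable_integrable\<close>)
 also have "... = (LINT x|lebesgue_on D. u x * \<psi> x)" by (rule integral_rotate_D(2)[OF i1])
 finally have "(LINT x|lebesgue_on D. (u x * \<psi> (rot3 (s n) x) - u x * \<psi> x) / s n) = 0"
 using i1 i2 by simp
 then show ?thesis by (simp add: algebra_simps diff_divide_distrib)
 qed
 have "(%n. LINT x|lebesgue_on D. u x * ((\<psi> (rot3 (s n) x) - \<psi> x) / s n)) \<longlonglongrightarrow> (LINT x|lebesgue_on D. u x * (\<psi>' x \<bullet> rot_field x))"
 proof (rule integral_dominated_convergence[where w="%x. C * \<bar>u x\<bar>"])
 show "integrable (lebesgue_on D) (%x. C * \<bar>u x\<bar>)" using u by auto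
 show meas: "(%x. u x * (\<psi>' x \<bullet> rot_field x)) \<in> borel_measurable (lebesgue_on D)"
 using continuous_measurable_D[OF cd] u by auto
 show "AE x in lebesgue_on D. norm (u x * ((\<psi> (rot3 (s n) x) - \<psi> x) / s n)) <= C * \<bar>u x\<bar>" for n
 proof (intro AE_I2)
 fix x assume "x \<in> space (lebesgue_on D)"
 then have x: "x \<in> D_closed" using D_subset by auto
 have "\<exists>t\<in>{0<..<s n}. \<psi> (rot3 (s n) x) - \<psi> (rot3 0 x) = (\<psi>' (rot3 t x) \<bullet> rot_field (rot3 t x)) * (s n - 0)"
 by (rule mvt_simple[OF s, where f="%s. \<psi> (rot3 s x)" and f'="%t h. (\<psi>' (rot3 t x) \<bullet> rot_field (rot3 t x)) * h"])
 (use d[OF x] in \<open>auto simp: has_field_derivative_def\<close>)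
 then obtain t where "(\<psi> (rot3 (s n) x) - \<psi> x) / s n = \<psi>' (rot3 t x) \<bullet> rot_field (rot3 t x)"
 using s[of n] by (auto simp: rot3_props field_simps)
 then show "norm (u x * ((\<psi> (rot3 (s n) x) - \<psi> x) / s n)) <= C * \<bar>u x\<bar>"
 using mult_left_mono[OF C[OF rot3_D_closed[OF x, of t]], of "\<bar>u x\<bar>"]
 by (simp add: abs_mult mult.commute)
 qed
 show "AE x in lebesgue_on D. (%n. u x * ((\<psi> (rot3 (s n) x) - \<psi> x) / s n)) \<longlonglongrightarrow> u x * (\<psi>' x \<bullet> rot_field x)"
 proof (intro AE_I2)
 fix x assume "x \<in> space (lebesgue_on D)"
 then have x: "x \<in> D_closed" using D_subset by auto
 have "DERIV (%s. \<psi> (rot3 s x)) 0 :> \<psi>' x \<bullet> rot_field x" using d[OF x, of 0 UNIV] by (simp add: rot3_props)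
 then have "(%h. (\<psi> (rot3 h x) - \<psi> x) / h) \<midarrow>0\<rightarrow> \<psi>' x \<bullet> rot_field x" by (simp add: DERIV_def rot3_props)
 moreover have "filterlim s (at 0) sequentially"
 unfolding s_def filterlim_at using LIMSEQ_inverse_real_of_nat by (auto simp: inverse_eq_divide)
 ultimately have "(%n. (\<psi> (rot3 (s n) x) - \<psi> x) / s n) \<longlonglongrightarrow> \<psi>' x \<bullet> rot_field x"
 by (rule filterlim_compose)
 then show "(%n. u x * ((\<psi> (rot3 (s n) x) - \<psi> x) / s n)) \<longlonglongrightarrow> u x * (\<psi>' x \<bullet> rot_field x)"
 by (intro tendsto_intros)
 qed
 show "(%x. u x * ((\<psi> (rot3 (s n) x) - \<psi> x) / s n)) \<in> borel_measurable (lebesgue_on D)" for n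
 using u m mr[of n] by auto
 qed
 then show ?thesis unfolding eqz by (simp add: LIMSEQ_const_iff)
qed

end

section \<open>Trace inequalities at the outer sphere\<close>

context cone begin

text \<open>Inequalities on the meridian rectangle, with angle \<open>p\<close> and radius \<open>r\<close>; the volume element is
 $r^2 \sin p$.\<close>

abbreviation "Rect \<equiv> cbox (p0, r0) (p1, 1)"

lemma \<alpha>_sq_bounds: "\<alpha>^2 <= 0.2742" "\<alpha> <= 0.53"
proof -
 have a: "\<alpha> <= 0.52361" using \<alpha>_le pi_approx(2) by simp
 then have "\<alpha>^2 <= 0.52361^2" using \<alpha>_pos by (intro power_mono) auto
 then show "\<alpha>^2 <= 0.2742" "\<alpha> <= 0.53" using a by (simp_all add: power2_eq_square)
qed

lemma Rect_slice:
 assumes "continuous_on Rect f"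
 shows "p \<in> {p0..p1} ==> continuous_on {r0..1} (%r. f (p, r))" "r \<in> {r0..1} ==> continuous_on {p0..p1} (%p. f (p, r))"
 by (rule continuous_on_compose2[OF assms]; auto intro!: continuous_intros simp: cbox_Pair_eq)+

lemma Rect_integral:
 fixes f :: "real \<times> real => real"
 assumes "continuous_on Rect f"
 shows "integral Rect f = integral {p0..p1} (%p. integral {r0..1} (%r. f (p, r)))"
 "integral Rect f = integral {r0..1} (%r. integral {p0..p1} (%p. f (p, r)))"
 "continuous_on {p0..p1} (%p. integral {r0..1} (%r. f (p, r)))"
proof -
 show 1: "integral Rect f = integral {p0..p1} (%p. integral {r0..1} (%r. f (p, r)))"
 using integral_prod_continuous[OF assms] by simp
 have c: "continuous_on Rect (%(p, r). f (p, r))" using assms by simp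
 show "integral Rect f = integral {r0..1} (%r. integral {p0..p1} (%p. f (p, r)))"
 unfolding 1 using integral_swap_continuous[OF c] by simp
 show "continuous_on {p0..p1} (%p. integral {r0..1} (%r. f (p, r)))"
 using integral_continuous_on_param[where U="{p0..p1}" and a=r0 and b=1 and f="%p r. f (p, r)"] c
 by (simp add: cbox_Pair_eq)
qed

lemma integral_sin_bounds: "integral {p0..p1} sin >= \<alpha>" "integral {p0..p1} sin <= 2 * \<alpha>"
proof -
 have i: "sin integrable_on {p0..p1}" for p0 p1 :: real by (intro integrable_continuous_interval continuous_intros)
 have "integral {p0..p1} (%p. 1/2) <= integral {p0..p1} sin"
 by (rule integral_le) (use i sin_p(3) in auto)
 then show "integral {p0..p1} sin >= \<alpha>" using p_bounds by simp
 have "integral {p0..p1} sin <= integral {p0..p1} (%p. 1)"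
 by (rule integral_le) (use i in auto)
 then show "integral {p0..p1} sin <= 2 * \<alpha>" using p_bounds by simp
qed

context
 fixes f fp fr :: "real \<times> real => real"
 assumes cf: "continuous_on Rect f" and cfp: "continuous_on Rect fp" and cfr: "continuous_on Rect fr"
 and dp: "!!p r. p \<in> {p0..p1} ==> r \<in> {r0..1} ==>
 ((%p. f (p, r)) has_real_derivative fp (p, r)) (at p within {p0..p1})"
 and dr: "!!p r. p \<in> {p0..p1} ==> r \<in> {r0..1} ==>
 ((%r. f (p, r)) has_real_derivative fr (p, r)) (at r within {r0..1})"
begin

definition "top_sq = integral {p0..p1} (%p. (f (p, 1))^2 * sin p)"
definition "energy_r = integral Rect (%z. (fr z)^2 * (snd z)^2 * sin (fst z))"
text \<open>No power of the radius appears: the angular part of the gradient is \<open>fp\<close>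
  divided by r, and its square cancels the r^2 of the volume element.\<close>

definition "energy_p = integral Rect (%z. (fp z)^2 * sin (fst z))"

lemmas Rect_cont = cf cfp cfr continuous_on_fst continuous_on_snd continuous_on_sin continuous_on_cos continuous_on_id
 continuous_on_mult continuous_on_add continuous_on_diff continuous_on_power continuous_on_const continuous_on_rabs continuous_on_minus

lemma int_Rect: "continuous_on Rect g ==> g integrable_on Rect" for g :: "real \<times> real => real"
 by (rule integrable_continuous)

lemma mem_Rect: "z \<in> Rect ==> fst z \<in> {p0..p1} \<and> snd z \<in> {r0..1} \<and> sin (fst z) >= 1/2 \<and> 0 < snd z"
 using sin_p(3)[of "fst z"] r0_bounds(1) by (cases z) (auto simp: cbox_Pair_eq)

lemma FTC_r:
 assumes h: "continuous_on Rect h'" and d: "!!p r. p \<in> {p0..p1} ==> r \<in> {r0..1} ==>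
 ((%r. h (p, r)) has_real_derivative h' (p, r)) (at r within {r0..1})"
 shows "integral Rect h' = integral {p0..p1} (%p. h (p, 1) - h (p, r0))"
 "p \<in> {p0..p1} ==> integral {r0..1} (%r. h' (p, r)) = h (p, 1) - h (p, r0)"
proof -
 have *: "integral {r0..1} (%r. h' (p, r)) = h (p, 1) - h (p, r0)" if "p \<in> {p0..p1}" for p
 by (rule integral_unique, rule fundamental_theorem_of_calculus)
 (use r0_bounds d[OF that] in \<open>auto simp: has_real_derivative_iff_has_vector_derivative\<close>)
 then show "p \<in> {p0..p1} ==> integral {r0..1} (%r. h' (p, r)) = h (p, 1) - h (p, r0)" .
 show "integral Rect h' = integral {p0..p1} (%p. h (p, 1) - h (p, r0))"
 unfolding Rect_integral(1)[OF h] by (intro integral_cong *)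
qed

lemma FTC_p:
 assumes h: "continuous_on Rect h'" and d: "!!p r. p \<in> {p0..p1} ==> r \<in> {r0..1} ==>
 ((%p. h (p, r)) has_real_derivative h' (p, r)) (at p within {p0..p1})"
 shows "integral Rect h' = integral {r0..1} (%r. h (p1, r) - h (p0, r))"
proof -
 have *: "integral {p0..p1} (%p. h' (p, r)) = h (p1, r) - h (p0, r)" if "r \<in> {r0..1}" for r
 by (rule integral_unique, rule fundamental_theorem_of_calculus)
 (use p_bounds d[OF _ that] in \<open>auto simp: has_real_derivative_iff_has_vector_derivative\<close>)
 show ?thesis unfolding Rect_integral(2)[OF h] by (intro integral_cong *)
qed

lemma f_slice_cont: "r \<in> {r0..1} ==> continuous_on {p0..p1} (%p. f (p, r))"
 using Rect_slice(2)[OF cf] .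

text \<open>The integrand is the derivative of f^2 along \<open>swirl_field\<close> times the volume
  weight. Adding and subtracting f^2 sin p splits it into the exact derivatives of f^2 r sin p in r
  and of f^2 cos p in p. The inner sphere contributes with a negative sign, and so do the cones
  because \<open>cos p1\<close> \<le> 0 \<le> \<open>cos p0\<close>; only the outer sphere
  remains.\<close>

lemma top_sq_bounds_J:
 "integral Rect (%z. 2 * f z * (snd z * fr z * sin (fst z) + fp z * cos (fst z))) <= top_sq"
proof -
 let ?h1 = "%z. (f z)^2 * sin (fst z) + 2 * f z * fr z * snd z * sin (fst z)"
 let ?h2 = "%z. 2 * f z * fp z * cos (fst z) - (f z)^2 * sin (fst z)"
 have c1: "continuous_on Rect ?h1" and c2: "continuous_on Rect ?h2" by (intro Rect_cont)+
 have "integral Rect (%z. 2 * f z * (snd z * fr z * sin (fst z) + fp z * cos (fst z))) = integral Rect ?h1 + integral Rect ?h2"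
 by (subst HKI_integral_add[symmetric, OF int_Rect[OF c1] int_Rect[OF c2]])
 (auto intro!: integral_cong simp: algebra_simps)
 also have "integral Rect ?h1 = integral {p0..p1} (%p. (f (p, 1))^2 * 1 * sin p - (f (p, r0))^2 * r0 * sin p)"
 by (rule FTC_r(1)[OF c1, where h="%z. (f z)^2 * snd z * sin (fst z)", unfolded fst_conv snd_conv])
 (auto intro!: derivative_eq_intros dr simp: algebra_simps)
 also have "... <= top_sq"
 unfolding top_sq_def
 proof (rule integral_le)
 show "(%p. (f (p, 1))^2 * 1 * sin p - (f (p, r0))^2 * r0 * sin p) integrable_on {p0..p1}"
 "(%p. (f (p, 1))^2 * sin p) integrable_on {p0..p1}"
 using r0_bounds by (intro integrable_continuous_interval continuous_intros f_slice_cont; auto)+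
 show "(f (p, 1))^2 * 1 * sin p - (f (p, r0))^2 * r0 * sin p <= (f (p, 1))^2 * sin p" if "p \<in> {p0..p1}" for p
 using r0_bounds sin_p(2)[OF that] by simp
 qed
 also have "integral Rect ?h2 = integral {r0..1} (%r. (f (p1, r))^2 * cos p1 - (f (p0, r))^2 * cos p0)"
 by (rule FTC_p[OF c2, where h="%z. (f z)^2 * cos (fst z)", unfolded fst_conv snd_conv])
 (auto intro!: derivative_eq_intros dp simp: algebra_simps)
 also have "... <= integral {r0..1} (%r. 0)"
 proof (rule integral_le)
 have c: "cos p1 <= 0" "cos p0 >= 0"
 using \<alpha>_bounds(1) by (auto simp: p1_def p0_def cos_add cos_diff)
 show "(f (p1, r))^2 * cos p1 - (f (p0, r))^2 * cos p0 <= 0" for r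
 using mult_nonneg_nonpos[OF zero_le_power2[of "f (p1, r)"] c(1)] mult_nonneg_nonneg[OF zero_le_power2[of "f (p0, r)"] c(2)]
 by linarith
 show "(%r. (f (p1, r))^2 * cos p1 - (f (p0, r))^2 * cos p0) integrable_on {r0..1}"
 using p_bounds by (intro integrable_continuous_interval continuous_intros Rect_slice(1)[OF cf]) auto
 qed (rule integrable_0)
 finally show ?thesis by simp
qed

text \<open>The \<open>r\<close>-derivative of f^2 r^3 sin p contains three copies of the bulk
  integrand. The cross term is absorbed by one of them and by \<open>energy_r\<close>, using r \<le>
  1, which leaves two copies below \<open>top_sq + energy_r\<close>.\<close>

lemma bulk_le:
 "integral Rect (%z. (f z)^2 * (snd z)^2 * sin (fst z)) <= top_sq / 2 + energy_r / 2"
proof -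
 let ?h = "%z. 3 * (f z)^2 * (snd z)^2 * sin (fst z) + 2 * f z * fr z * (snd z)^3 * sin (fst z)"
 let ?N = "%z. (f z)^2 * (snd z)^2 * sin (fst z)" and ?E = "%z. (fr z)^2 * (snd z)^2 * sin (fst z)"
 have c: "continuous_on Rect ?h" "continuous_on Rect ?N" "continuous_on Rect ?E" by (intro Rect_cont)+
 have "integral Rect ?h = integral {p0..p1} (%p. (f (p, 1))^2 * 1^3 * sin p - (f (p, r0))^2 * r0^3 * sin p)"
 by (rule FTC_r(1)[OF c(1), where h="%z. (f z)^2 * (snd z)^3 * sin (fst z)", unfolded fst_conv snd_conv])
 (auto intro!: derivative_eq_intros dr simp: algebra_simps power2_eq_square power3_eq_cube)
 also have "... <= top_sq"
 unfolding top_sq_def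
 proof (rule integral_le)
 show "(%p. (f (p, 1))^2 * 1^3 * sin p - (f (p, r0))^2 * r0^3 * sin p) integrable_on {p0..p1}"
 "(%p. (f (p, 1))^2 * sin p) integrable_on {p0..p1}"
 using r0_bounds by (intro integrable_continuous_interval continuous_intros f_slice_cont; auto)+
 show "(f (p, 1))^2 * 1^3 * sin p - (f (p, r0))^2 * r0^3 * sin p <= (f (p, 1))^2 * sin p" if "p \<in> {p0..p1}" for p
 using r0_bounds sin_p(2)[OF that] by simp
 qed
 finally have 1: "integral Rect ?h <= top_sq" .
 have "integral Rect (%z. 2 * ?N z - ?E z) <= integral Rect ?h"
 proof (rule integral_le)
 show "(%z. 2 * ?N z - ?E z) integrable_on Rect" by (intro int_Rect Rect_cont)
 show "?h integrable_on Rect" by (rule int_Rect[OF c(1)])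
 fix z assume "z \<in> Rect"
 then have z: "0 < snd z" "snd z <= 1" "sin (fst z) >= 0" using mem_Rect[of z] by auto
 define F r G where "F = f z" and "r = snd z" and "G = fr z"
 have "0 <= (F + G * r)^2" by simp
 moreover have "(G * r)^2 <= G^2"
 using z mult_left_mono[OF power_le_one[of r 2], of "G^2"] by (simp add: r_def power_mult_distrib)
 ultimately have "2 * F^2 - G^2 <= 3 * F^2 + 2 * F * G * r" by (simp add: power2_sum algebra_simps)
 then have "(2 * F^2 - G^2) * (r^2 * sin (fst z)) <= (3 * F^2 + 2 * F * G * r) * (r^2 * sin (fst z))"
 using z by (intro mult_right_mono) auto
 then show "2 * ?N z - ?E z <= ?h z"
 by (simp add: F_def r_def G_def algebra_simps power2_eq_square power3_eq_cube)
 qed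
 also have "integral Rect (%z. 2 * ?N z - ?E z) = 2 * integral Rect ?N - energy_r"
 unfolding energy_r_def using c int_Rect
 by (subst HKI_integral_diff) (auto intro!: integrable_on_cmult_left)
 finally show ?thesis using 1 by simp
qed

text \<open>The number 1.1548 is an upper bound of 2 / sqrt 3, and \<open>sin p\<close> is at least
  sqrt 3 / 2 on the angular range.\<close>

lemma energy_p_flat: "integral Rect (%z. (fp z)^2) <= 1.1548 * energy_p"
proof -
 have "integral Rect (%z. (fp z)^2) <= integral Rect (%z. 1.1548 * ((fp z)^2 * sin (fst z)))"
 proof (rule integral_le)
 show "(%z. (fp z)^2) integrable_on Rect" "(%z. 1.1548 * ((fp z)^2 * sin (fst z))) integrable_on Rect"
 by (intro int_Rect Rect_cont)+
 fix z assume "z \<in> Rect"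
 then have "sin (fst z) >= sqrt 3 / 2" using mem_Rect sin_p(1) by blast
 moreover have "sqrt 3 >= 1.732" by (rule real_le_rsqrt) (simp add: power2_eq_square)
 ultimately have "1 <= 1.1548 * sin (fst z)" by simp
 from mult_left_mono[OF this, of "(fp z)^2"]
 show "(fp z)^2 <= 1.1548 * ((fp z)^2 * sin (fst z))" by simp
 qed
 then show ?thesis unfolding energy_p_def by simp
qed

lemma energy_p_nonneg: "0 <= energy_p" and energy_r_nonneg: "0 <= energy_r"
 unfolding energy_p_def energy_r_def
 by (intro integral_nonneg int_Rect Rect_cont; use mem_Rect in fastforce)+

text \<open>$f(p,1) = G + A$ with $G = \int w f_r\,dr$, $A = \int w' f\,dr$ for the weight
 $w = (r^k - r_0^k)/(1 - r_0^k)$, which vanishes on the inner sphere.\<close>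

context
 fixes k :: nat
 assumes k: "k >= 3"
begin

definition "kk = real k / (1 - r0 ^ k)"
definition "wgt r = (r ^ k - r0 ^ k) / (1 - r0 ^ k)"
text \<open>The factor \<open>kk\<close> gives the weight \<open>r^(k-1)\<close> total mass 1, as it
  is the derivative of \<open>wgt\<close>, which rises from 0 to 1. For \<open>k = 3\<close> this is
  the radial part of the volume weight.\<close>

definition "avg p = integral {r0..1} (%r. kk * r ^ (k - 1) * f (p, r))"
definition "dev p = f (p, 1) - avg p"

lemma r0k: "0 < r0 ^ k" "r0 ^ k <= r0 ^ 3" "r0 ^ 3 <= 1/1000000000"
proof -
 show "0 < r0 ^ k" using r0_bounds by simp
 show "r0 ^ k <= r0 ^ 3" using r0_bounds k by (intro power_decreasing) auto
 have "r0 ^ 3 <= (1/1000) ^ 3" using r0_bounds by (intro power_mono) auto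
 then show "r0 ^ 3 <= 1/1000000000" by (simp add: power3_eq_cube)
qed

lemma r0k_less: "1 - r0 ^ k > 0" "1 / (1 - r0 ^ k) <= 1.0001"
proof -
 have "r0 ^ k <= 1/1000000000" using r0k by linarith
 then show "1 - r0 ^ k > 0" "1 / (1 - r0 ^ k) <= 1.0001" by (auto simp: field_simps)
qed

lemma kk_bounds: "0 < kk" "kk <= 1.0001 * real k"
 using r0k_less k mult_left_mono[OF r0k_less(2), of "real k"] by (auto simp: kk_def)

lemma wgt_bounds: "r \<in> {r0..1} ==> 0 <= wgt r \<and> wgt r <= r ^ k"
proof -
 assume r: "r \<in> {r0..1}"
 have "r0 ^ k <= r ^ k" using r r0_bounds by (intro power_mono) auto
 moreover have "r ^ k <= 1" using r r0_bounds by (intro power_le_one) auto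
 ultimately show ?thesis
 using r0k_less r0k mult_left_mono[of "r^k" 1 "r0^k"] by (auto simp: wgt_def field_simps)
qed

lemma power_integral: "integral {r0..1} (%r. r ^ (2 * (k - 1))) <= 1 / (2 * real k - 1)"
proof -
 let ?j = "2 * (k - 1)"
 have j: "real (Suc ?j) = 2 * real k - 1" using k by auto
 have "((%r. r ^ ?j) has_integral (1 ^ Suc ?j / real (Suc ?j) - r0 ^ Suc ?j / real (Suc ?j))) {r0..1}"
 proof (rule fundamental_theorem_of_calculus)
 fix r
 have "((%r. r ^ Suc ?j / real (Suc ?j)) has_real_derivative r ^ ?j) (at r within {r0..1})"
 by (rule derivative_eq_intros refl | simp)+
 then show "((%r. r ^ Suc ?j / real (Suc ?j)) has_vector_derivative r ^ ?j) (at r within {r0..1})"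
 by (simp add: has_real_derivative_iff_has_vector_derivative)
 qed (use r0_bounds in auto)
 then have "integral {r0..1} (%r. r ^ ?j) = (1 - r0 ^ Suc ?j) / (2 * real k - 1)"
 unfolding j[symmetric] by (simp add: integral_unique diff_divide_distrib)
 also have "... <= 1 / (2 * real k - 1)"
 using k r0_bounds by (intro divide_right_mono) auto
 finally show ?thesis .
qed

lemma avg_cont: "continuous_on Rect (%z. kk * snd z ^ (k - 1) * f z)" by (intro Rect_cont)

lemma continuous_avg: "continuous_on {p0..p1} avg"
 unfolding avg_def[abs_def] using Rect_integral(3)[OF avg_cont] by simp

lemma continuous_dev: "continuous_on {p0..p1} dev"
 unfolding dev_def[abs_def] using r0_bounds by (intro continuous_intros continuous_avg f_slice_cont) auto

lemma dev_eq:
 assumes p: "p \<in> {p0..p1}"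
 shows "dev p = integral {r0..1} (%r. wgt r * fr (p, r))"
proof -
 have wc: "continuous_on Rect (%z. wgt (snd z) * fr z)"
 unfolding wgt_def divide_inverse by (intro Rect_cont)
 have "integral {r0..1} (%r. kk * r ^ (k - 1) * f (p, r) + wgt r * fr (p, r)) = wgt 1 * f (p, 1) - wgt r0 * f (p, r0)"
 proof (rule FTC_r(2)[where h'="%z. kk * snd z ^ (k - 1) * f z + wgt (snd z) * fr z" and h="%z. wgt (snd z) * f z",
 unfolded fst_conv snd_conv, OF _ _ p])
 show "continuous_on Rect (%z. kk * snd z ^ (k - 1) * f z + wgt (snd z) * fr z)"
 by (intro continuous_on_add wc avg_cont)
 fix p r assume pr: "p \<in> {p0..p1}" "r \<in> {r0..1}"
 have "(wgt has_real_derivative kk * r ^ (k - 1)) (at r within {r0..1})"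
 unfolding wgt_def[abs_def] kk_def using r0k_less by (auto intro!: derivative_eq_intros)
 from DERIV_mult[OF this dr[OF pr]]
 show "((%r. wgt r * f (p, r)) has_real_derivative kk * r ^ (k - 1) * f (p, r) + wgt r * fr (p, r)) (at r within {r0..1})"
 by (simp add: mult.commute)
 qed
 moreover have "wgt 1 = 1" "wgt r0 = 0" using r0k_less by (auto simp: wgt_def)
 moreover have "integral {r0..1} (%r. kk * r ^ (k - 1) * f (p, r) + wgt r * fr (p, r)) = avg p + integral {r0..1} (%r. wgt r * fr (p, r))"
 unfolding avg_def using Rect_slice(1)[OF avg_cont p] Rect_slice(1)[OF wc p]
 by (intro HKI_integral_add integrable_continuous_interval) auto
 ultimately show ?thesis by (simp add: dev_def)
qed

text \<open>Cauchy-Schwarz on the product of \<open>wgt r / r\<close> and \<open>r * fr\<close>;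
  since \<open>wgt r\<close> \<le> r^k, the first factor has squared norm at most 1/(2k-1). A large
  \<open>k\<close> thus makes the radial deviation as small as desired compared with the
  energy.\<close>

lemma dev_sq_le:
 assumes p: "p \<in> {p0..p1}"
 shows "(dev p)^2 <= integral {r0..1} (%r. (fr (p, r))^2 * r^2) / (2 * real k - 1)"
proof -
 have r: "r ~= 0" if "r \<in> {r0..1}" for r using that r0_bounds by auto
 have frc: "continuous_on {r0..1} (%r. fr (p, r))" by (rule Rect_slice(1)[OF cfr p])
 have cw: "continuous_on {r0..1} (%r. wgt r / r)" unfolding wgt_def using r r0k_less by (intro continuous_intros) auto
 have c2: "continuous_on {r0..1} (%r. r * fr (p, r))" by (intro continuous_intros frc)
 have "dev p = integral {r0..1} (%r. (wgt r / r) * (r * fr (p, r)))"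
 unfolding dev_eq[OF p] by (rule integral_cong) (use r in auto)
 then have "(dev p)^2 <= integral {r0..1} (%r. (wgt r / r)^2) * integral {r0..1} (%r. (r * fr (p, r))^2)"
 using Cauchy_Schwarz_cbox_sq[of r0 1 "%r. wgt r / r" "%r. r * fr (p, r)"] cw c2 by simp
 also have "... <= 1 / (2 * real k - 1) * integral {r0..1} (%r. (r * fr (p, r))^2)"
 proof (rule mult_right_mono)
 have "integral {r0..1} (%r. (wgt r / r)^2) <= integral {r0..1} (%r. r ^ (2 * (k - 1)))"
 proof (rule integral_le)
 show "(%r. (wgt r / r)^2) integrable_on {r0..1}"
 by (intro integrable_continuous_interval continuous_on_power cw)
 show "(%r. r ^ (2 * (k - 1))) integrable_on {r0..1}"
 by (intro integrable_continuous_interval continuous_intros)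
 fix r assume rr: "r \<in> {r0..1}"
 have "r ^ k = r ^ (k - 1) * r" using k by (metis One_nat_def Suc_pred less_le_trans mult.commute power_Suc zero_less_numeral)
 then have "wgt r / r <= r ^ (k - 1)" using wgt_bounds[OF rr] rr r0_bounds by (auto simp: field_simps)
 then have "(wgt r / r)^2 <= (r ^ (k - 1))^2" using wgt_bounds[OF rr] rr r0_bounds by (intro power_mono) auto
 then show "(wgt r / r)^2 <= r ^ (2 * (k - 1))" by (simp add: power_even_eq)
 qed
 then show "integral {r0..1} (%r. (wgt r / r)^2) <= 1 / (2 * real k - 1)" using power_integral by linarith
 show "0 <= integral {r0..1} (%r. (r * fr (p, r))^2)"
 by (intro integral_nonneg integrable_continuous_interval continuous_intros frc) auto
 qed
 finally show ?thesis by (simp add: power_mult_distrib mult.commute)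
qed

lemma dev_integral_le: "integral {p0..p1} (%p. (dev p)^2 * sin p) <= energy_r / (2 * real k - 1)"
proof -
 have c: "continuous_on Rect (%z. (fr z)^2 * (snd z)^2 * sin (fst z))" "continuous_on Rect (%z. (fr z)^2 * (snd z)^2)"
 by (intro Rect_cont)+
 have "integral {p0..p1} (%p. (dev p)^2 * sin p) <= integral {p0..p1} (%p. 1 / (2 * real k - 1) * integral {r0..1} (%r. (fr (p, r))^2 * r^2 * sin p))"
 proof (rule integral_le)
 show "(%p. (dev p)^2 * sin p) integrable_on {p0..p1}" by (intro integrable_continuous_interval continuous_intros continuous_dev)
 show "(%p. 1 / (2 * real k - 1) * integral {r0..1} (%r. (fr (p, r))^2 * r^2 * sin p)) integrable_on {p0..p1}"
 using Rect_integral(3)[OF c(1)] by (intro integrable_continuous_interval continuous_on_mult continuous_on_const) simp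
 fix p assume p: "p \<in> {p0..p1}"
 have "(dev p)^2 * sin p <= integral {r0..1} (%r. (fr (p, r))^2 * r^2) / (2 * real k - 1) * sin p"
 using dev_sq_le[OF p] sin_p(2)[OF p] by (intro mult_right_mono) auto
 then show "(dev p)^2 * sin p <= 1 / (2 * real k - 1) * integral {r0..1} (%r. (fr (p, r))^2 * r^2 * sin p)"
 by simp
 qed
 also have "... = energy_r / (2 * real k - 1)"
 unfolding energy_r_def Rect_integral(1)[OF c(1)] by simp
 finally show ?thesis .
qed

text \<open>A Hoelder-1/2 bound in the angle. The difference is an integral of the weight times
  \<open>fp\<close> over the strip between the two angles, and Cauchy-Schwarz extracts the width of
  the strip.\<close>

lemma avg_diff_le:
 assumes pq: "p \<in> {p0..p1}" "q \<in> {p0..p1}"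
 shows "(avg p - avg q)^2 <= \<bar>p - q\<bar> * (kk^2 / (2 * real k - 1) * (1.1548 * energy_p))"
proof -
 have main: "(avg p - avg q)^2 <= (p - q) * (kk^2 / (2 * real k - 1) * (1.1548 * energy_p))"
 if pq: "p \<in> {p0..p1}" "q \<in> {p0..p1}" "q <= p" for p q
 proof -
 let ?S = "cbox (q, r0) (p, 1)"
 have sub: "?S \<subseteq> Rect" using pq by (auto simp: cbox_Pair_eq)
 note cS = continuous_on_subset[OF _ sub]
 have ftc: "integral {q..p} (%p. fp (p, r)) = f (p, r) - f (q, r)" if r: "r \<in> {r0..1}" for r
 by (rule integral_unique, rule fundamental_theorem_of_calculus[OF pq(3)])
 (use pq DERIV_subset[OF dp[OF _ r]] in \<open>auto simp flip: has_real_derivative_iff_has_vector_derivative\<close>)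
 have c1: "continuous_on ?S (%z. kk * snd z ^ (k - 1) * fp z)" "continuous_on ?S (%z. kk * snd z ^ (k - 1))" "continuous_on ?S fp"
 by (intro cS Rect_cont)+
 have "avg p - avg q = integral {r0..1} (%r. kk * r ^ (k - 1) * f (p, r) - kk * r ^ (k - 1) * f (q, r))"
 unfolding avg_def using Rect_slice(1)[OF avg_cont pq(1)] Rect_slice(1)[OF avg_cont pq(2)]
 by (intro HKI_integral_diff[symmetric] integrable_continuous_interval) auto
 also have "... = integral {r0..1} (%r. integral {q..p} (%p. kk * r ^ (k - 1) * fp (p, r)))"
 by (rule integral_cong) (simp add: ftc right_diff_distrib)
 also have "... = integral ?S (%z. kk * snd z ^ (k - 1) * fp z)"
 using integral_prod_continuous[OF c1(1)] integral_swap_continuous[of q r0 p 1 "%p r. kk * r ^ (k - 1) * fp (p, r)"] c1(1)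
 by (simp add: split_def)
 finally have "(avg p - avg q)^2 <= integral ?S (%z. (kk * snd z ^ (k - 1))^2) * integral ?S (%z. (fp z)^2)"
 using Cauchy_Schwarz_cbox_sq[OF c1(2,3)] by simp
 also have "integral ?S (%z. (kk * snd z ^ (k - 1))^2) = integral {q..p} (%p. integral {r0..1} (%r. (kk * r ^ (k - 1))^2))"
 using integral_prod_continuous[OF continuous_on_power[OF c1(2), of 2]] unfolding box_real snd_conv .
 also have "... = (p - q) * (kk^2 * integral {r0..1} (%r. r ^ (2 * (k - 1))))"
 using pq(3) by (simp add: power_mult_distrib power_even_eq)
 also have "... * integral ?S (%z. (fp z)^2) <= (p - q) * (kk^2 * (1 / (2 * real k - 1))) * (1.1548 * energy_p)"
 proof (rule mult_mono)
 show "(p - q) * (kk^2 * integral {r0..1} (%r. r ^ (2 * (k - 1)))) <= (p - q) * (kk^2 * (1 / (2 * real k - 1)))"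
 using power_integral pq(3) by (intro mult_left_mono) auto
 have "integral ?S (%z. (fp z)^2) <= integral Rect (%z. (fp z)^2)"
 by (rule integral_subset_le[OF sub]) (auto intro!: integrable_continuous continuous_on_power c1(3) cfp)
 then show "integral ?S (%z. (fp z)^2) <= 1.1548 * energy_p" using energy_p_flat by linarith
 show "0 <= (p - q) * (kk^2 * (1 / (2 * real k - 1)))" using pq(3) k by auto
 show "0 <= integral ?S (%z. (fp z)^2)"
 by (intro integral_nonneg integrable_continuous continuous_on_power c1(3)) auto
 qed
 finally show ?thesis by simp
 qed
 show ?thesis
 using main[of p q] main[of q p] pq by (cases "q <= p") (auto simp: power2_commute abs_if)
qed

end

text \<open>The exponent 3 makes the angular mean of \<open>avg\<close> a multiple of the volume
  mean of \<open>f\<close>. Splitting (G + A)^2 with weights 4 and 4/3 costs 4/5 of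
  \<open>energy_r\<close>; the angular oscillation costs 4/3 * 9.002/5 * 1.1548 * 7/6 * 0.2742,
  about 0.89, of \<open>energy_p\<close>. Both stay below 0.95, and 0.2742 is the bound of
  \<alpha>^2 that comes from \<alpha> \<le> pi/6.\<close>

lemma top_sq_le_mean:
 "top_sq <= 0.95 * (energy_r + energy_p) + 13 / \<alpha> * (integral Rect (%z. f z * (snd z)^2 * sin (fst z)))^2"
proof -
 define A G where "A = avg 3" and "G = dev 3"
 let ?k = "kk 3"
 define S where "S = integral {p0..p1} sin"
 define c where "c = integral Rect (%z. f z * (snd z)^2 * sin (fst z))"
 have k3: "(3::nat) >= 3" by simp
 have cA: "continuous_on {p0..p1} A" and cG: "continuous_on {p0..p1} G"
 unfolding A_def G_def by (rule continuous_avg[OF k3], rule continuous_dev[OF k3])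
 have i: "h integrable_on {p0..p1}" if "continuous_on {p0..p1} h" for h :: "real => real"
 using that by (rule integrable_continuous_interval)
 note ci = continuous_intros cA cG
 have S: "S >= \<alpha>" "S > 0" using integral_sin_bounds(1) \<alpha>_pos by (auto simp: S_def)
 have kb: "0 < ?k" "?k^2 <= 9.002"
 proof -
 show "0 < ?k" by (rule kk_bounds(1)[OF k3])
 have "?k^2 <= (1.0001 * 3)^2" using kk_bounds[OF k3] by (intro power_mono) auto
 then show "?k^2 <= 9.002" by (simp add: power2_eq_square)
 qed
 have G_le: "integral {p0..p1} (%p. (G p)^2 * sin p) <= energy_r / 5"
 using dev_integral_le[OF k3] by (simp add: G_def)
 define b where "b = ?k * c / S"
 have Asin: "integral {p0..p1} (%p. A p * sin p) = ?k * c"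
 proof -
 have cc: "continuous_on Rect (%z. f z * (snd z)^2 * sin (fst z))" by (intro Rect_cont)
 have "integral {p0..p1} (%p. A p * sin p) = integral {p0..p1} (%p. ?k * integral {r0..1} (%r. f (p, r) * r^2 * sin p))"
 proof (rule integral_cong)
 fix p
 have "A p * sin p = integral {r0..1} (%r. ?k * r ^ (3 - 1) * f (p, r) * sin p)"
 unfolding A_def avg_def[OF k3] by (rule integral_mult_left[symmetric])
 also have "... = integral {r0..1} (%r. ?k * (f (p, r) * r^2 * sin p))"
 by (rule integral_cong) simp
 finally show "A p * sin p = ?k * integral {r0..1} (%r. f (p, r) * r^2 * sin p)" by simp
 qed
 then show ?thesis unfolding c_def Rect_integral(1)[OF cc] by simp
 qed
 define E where "E = 9.002 / 5 * (1.1548 * energy_p)"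
 have E0: "E >= 0" using energy_p_nonneg by (simp add: E_def)
 have Adiff: "(A p - A (pi/2))^2 <= \<bar>p - pi/2\<bar> * E" if p: "p \<in> {p0..p1}" for p
 proof -
 have "pi/2 \<in> {p0..p1}" using \<alpha>_pos by (auto simp: p0_def p1_def)
 from avg_diff_le[OF k3 p this]
 have "(A p - A (pi/2))^2 <= \<bar>p - pi/2\<bar> * (?k^2 / 5 * (1.1548 * energy_p))" by (simp add: A_def)
 also have "... <= \<bar>p - pi/2\<bar> * E"
 unfolding E_def using kb energy_p_nonneg by (intro mult_left_mono mult_right_mono divide_right_mono) auto
 finally show ?thesis .
 qed
 have sq: "integral {p0..p1} (%p. (p - pi/2)^2) = 2 * \<alpha>^3 / 3"
 proof -
 have "((%p. (p - pi/2)^2) has_integral ((p1 - pi/2)^3 / 3 - (p0 - pi/2)^3 / 3)) {p0..p1}"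
 proof (rule fundamental_theorem_of_calculus)
 fix p
 have "((%p. (p - pi/2)^3 / 3) has_real_derivative (p - pi/2)^2) (at p within {p0..p1})"
 by (auto intro!: derivative_eq_intros)
 then show "((%p. (p - pi/2)^3 / 3) has_vector_derivative (p - pi/2)^2) (at p within {p0..p1})"
 by (simp add: has_real_derivative_iff_has_vector_derivative)
 qed (use p_bounds in auto)
 then have "integral {p0..p1} (%p. (p - pi/2)^2) = (p1 - pi/2)^3 / 3 - (p0 - pi/2)^3 / 3" by (rule integral_unique)
 also have "... = 2 * \<alpha>^3 / 3" by (simp add: p0_def p1_def power3_eq_cube)
 finally show ?thesis .
 qed
 have "integral {p0..p1} (%p. (A p - A (pi/2))^2 * sin p)
 <= integral {p0..p1} (%p. E * ((p - pi/2)^2 * (1 / \<alpha>) + \<alpha> / 4))"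
 proof (rule integral_le)
 show "(%p. (A p - A (pi/2))^2 * sin p) integrable_on {p0..p1}" by (intro i ci)
 show "(%p. E * ((p - pi/2)^2 * (1 / \<alpha>) + \<alpha> / 4)) integrable_on {p0..p1}" by (intro i ci)
 fix p assume p: "p \<in> {p0..p1}"
 \<comment> \<open>The absolute value is replaced by a quadratic majorant so that only a polynomial
   is integrated; the price is 7/6 \<alpha>^2 instead of the exact value \<alpha>^2.\<close>
 have "0 <= (\<bar>p - pi/2\<bar> - \<alpha> / 2)^2" by simp
 then have "\<alpha> * \<bar>p - pi/2\<bar> <= (p - pi/2)^2 + \<alpha> * (\<alpha> / 4)" by (simp add: power2_diff algebra_simps power2_eq_square)
 then have y: "\<bar>p - pi/2\<bar> <= (p - pi/2)^2 * (1 / \<alpha>) + \<alpha> / 4" using \<alpha>_pos by (simp add: field_simps)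
 have "(A p - A (pi/2))^2 * sin p <= (A p - A (pi/2))^2 * 1" by (intro mult_left_mono) auto
 also have "... <= E * \<bar>p - pi/2\<bar>" using Adiff[OF p] by (simp add: mult.commute)
 also have "... <= E * ((p - pi/2)^2 * (1 / \<alpha>) + \<alpha> / 4)" using y E0 by (rule mult_left_mono)
 finally show "(A p - A (pi/2))^2 * sin p <= E * ((p - pi/2)^2 * (1 / \<alpha>) + \<alpha> / 4)" .
 qed
 also have "... = E * (2 * \<alpha>^3 / 3 * (1 / \<alpha>) + 2 * \<alpha> * (\<alpha> / 4))"
 proof -
 have "integral {p0..p1} (%p. (p - pi/2)^2 * (1 / \<alpha>) + \<alpha> / 4)
 = integral {p0..p1} (%p. (p - pi/2)^2 * (1 / \<alpha>)) + integral {p0..p1} (%p. \<alpha> / 4)"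
 by (intro HKI_integral_add i continuous_intros)
 also have "integral {p0..p1} (%p. (p - pi/2)^2 * (1 / \<alpha>)) = 2 * \<alpha>^3 / 3 * (1 / \<alpha>)"
 unfolding integral_mult_left sq ..
 also have "integral {p0..p1} (%p. \<alpha> / 4) = 2 * \<alpha> * (\<alpha> / 4)" using p_bounds by simp
 finally show ?thesis unfolding integral_mult_right by (rule arg_cong)
 qed
 also have "... = E * (7 / 6 * \<alpha>^2)" using \<alpha>_pos by (simp add: power3_eq_cube power2_eq_square field_simps)
 also have "... <= E * (7 / 6 * 0.2742)" using \<alpha>_sq_bounds E0 by (intro mult_left_mono) auto
 finally have V: "integral {p0..p1} (%p. (A p - A (pi/2))^2 * sin p) <= E * (7 / 6 * 0.2742)" .
 have A2: "integral {p0..p1} (%p. (A p)^2 * sin p) <= E * (7 / 6 * 0.2742) + ?k^2 * c^2 / S"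
 proof -
 let ?a = "A (pi/2)"
 have "integral {p0..p1} (%p. (A p - ?a)^2 * sin p)
 = integral {p0..p1} (%p. (A p)^2 * sin p + ((- 2 * ?a) * (A p * sin p) + ?a^2 * sin p))"
 by (rule integral_cong) (simp add: power2_diff algebra_simps)
 also have "... = integral {p0..p1} (%p. (A p)^2 * sin p) + (integral {p0..p1} (%p. (- 2 * ?a) * (A p * sin p)) + integral {p0..p1} (%p. ?a^2 * sin p))"
 by (subst HKI_integral_add, (intro i ci)+)+ simp
 also have "... = integral {p0..p1} (%p. (A p)^2 * sin p) + (- 2 * ?a * (?k * c) + ?a^2 * S)"
 unfolding integral_mult_right Asin S_def ..
 finally have e: "integral {p0..p1} (%p. (A p)^2 * sin p)
 = integral {p0..p1} (%p. (A p - ?a)^2 * sin p) + 2 * ?a * (?k * c) - ?a^2 * S" by simp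
 \<comment> \<open>The second moment about any value dominates the one about the weighted mean
   \<open>?k * c / S\<close>, so the midpoint value \<open>A (pi/2)\<close> can be traded for the
   mean.\<close>
 have "0 <= (?a * S - ?k * c)^2 / S" using S by simp
 also have "... = ?a^2 * S - 2 * ?a * (?k * c) + ?k^2 * c^2 / S"
 using S by (simp add: power2_diff field_simps power2_eq_square)
 finally show ?thesis using e V by linarith
 qed
 have "top_sq <= integral {p0..p1} (%p. 4 * ((G p)^2 * sin p) + 4/3 * ((A p)^2 * sin p))"
 unfolding top_sq_def
 proof (rule integral_le)
 show "(%p. (f (p, 1))^2 * sin p) integrable_on {p0..p1}"
 using r0_bounds by (intro i continuous_intros f_slice_cont) auto
 show "(%p. 4 * ((G p)^2 * sin p) + 4/3 * ((A p)^2 * sin p)) integrable_on {p0..p1}" by (intro i ci)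
 fix p assume p: "p \<in> {p0..p1}"
 have "f (p, 1) = G p + A p" by (simp add: G_def A_def dev_def[OF k3])
 moreover have "(G p + A p)^2 <= 4 * (G p)^2 + 4/3 * (A p)^2"
 using zero_le_power2[of "3 * G p - A p"] by (simp add: power2_sum power2_diff power_mult_distrib algebra_simps)
 ultimately have "(f (p, 1))^2 * sin p <= (4 * (G p)^2 + 4/3 * (A p)^2) * sin p"
 using sin_p(2)[OF p] by (intro mult_right_mono) auto
 then show "(f (p, 1))^2 * sin p <= 4 * ((G p)^2 * sin p) + 4/3 * ((A p)^2 * sin p)" by (simp add: algebra_simps)
 qed
 also have "... = integral {p0..p1} (%p. 4 * ((G p)^2 * sin p)) + integral {p0..p1} (%p. 4/3 * ((A p)^2 * sin p))"
 by (intro HKI_integral_add i ci)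
 also have "... = 4 * integral {p0..p1} (%p. (G p)^2 * sin p) + 4/3 * integral {p0..p1} (%p. (A p)^2 * sin p)"
 unfolding integral_mult_right ..
 also have "... <= 4 * (energy_r / 5) + 4/3 * (E * (7 / 6 * 0.2742) + ?k^2 * c^2 / S)"
 using G_le A2 by (intro add_mono mult_left_mono) auto
 finally have 1: "top_sq <= 4 * (energy_r / 5) + 4/3 * (E * (7 / 6 * 0.2742) + ?k^2 * c^2 / S)" .
 have 2: "4/3 * (E * (7 / 6 * 0.2742) + ?k^2 * c^2 / S) <= 0.95 * energy_p + 13 / \<alpha> * c^2"
 proof -
 have "?k^2 * c^2 / S <= 9.002 * c^2 / \<alpha>" using kb S \<alpha>_pos by (intro frac_le mult_right_mono) auto
 also have "4/3 * (9.002 * c^2 / \<alpha>) <= 13 / \<alpha> * c^2" using \<alpha>_pos by (simp add: field_simps)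
 finally have "4/3 * (?k^2 * c^2 / S) <= 13 / \<alpha> * c^2" by simp
 moreover have "4/3 * (E * (7 / 6 * 0.2742)) <= 0.95 * energy_p"
 unfolding E_def using energy_p_nonneg by simp
 ultimately show ?thesis by (simp add: distrib_left)
 qed
 have 3: "4 * (energy_r / 5) <= 0.95 * energy_r" using energy_r_nonneg by simp
 show ?thesis unfolding c_def[symmetric] distrib_left using 1 2 3 by linarith
qed

text \<open>Without mean zero the radial average is interpolated: its square integral is at most its
  L1 norm \<open>a\<close> times its supremum, and the supremum is at most the mean of the absolute
  value plus the oscillation. The fifth power of \<open>x\<close> arises as one factor from the left
  side, two from Young's inequality and two from the square of the weight constant in
  \<open>a_le\<close>.\<close>

lemma top_sq_le_abs:
 fixes x :: nat
 assumes x: "x >= 1"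
 shows "x * top_sq <= (energy_r + energy_p) / 4
 + 10^6 * x^5 / \<alpha> * (integral Rect (%z. \<bar>f z\<bar> * (snd z)^2 * sin (fst z)))^2"
proof -
 \<comment> \<open>This makes 2x/(2k-1) at most 1/4, the share of \<open>energy_r\<close> granted to
   the radial deviation.\<close>
 define k where "k = 8 * x"
 have k3: "k >= 3" and kx: "real k = 8 * real x" using x by (auto simp: k_def)
 define A G where "A = avg k" and "G = dev k"
 define c where "c = integral Rect (%z. \<bar>f z\<bar> * (snd z)^2 * sin (fst z))"
 define len where "len = 2 * \<alpha>"
 have len: "len > 0" "len = p1 - p0" "len <= 1.06" using \<alpha>_pos p_bounds \<alpha>_sq_bounds by (auto simp: len_def)
 have cA: "continuous_on {p0..p1} A" and cG: "continuous_on {p0..p1} G"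
 unfolding A_def G_def by (rule continuous_avg[OF k3], rule continuous_dev[OF k3])
 have i: "h integrable_on {p0..p1}" if "continuous_on {p0..p1} h" for h :: "real => real"
 using that by (rule integrable_continuous_interval)
 note ci = continuous_intros cA cG
 define a where "a = integral {p0..p1} (%p. \<bar>A p\<bar>)"
 have a0: "a >= 0" unfolding a_def by (intro integral_nonneg i ci) auto
 have kkb: "0 < kk k" "kk k <= 2 * real k" using kk_bounds[OF k3] by auto
 have c0: "c >= 0" unfolding c_def
 proof (intro integral_nonneg int_Rect Rect_cont)
 show "0 <= \<bar>f z\<bar> * (snd z)^2 * sin (fst z)" if "z \<in> Rect" for z using mem_Rect[OF that] by auto
 qed
 have a_le: "a <= 4 * real k * c"
 proof -
 have cc: "continuous_on Rect (%z. \<bar>f z\<bar> * (snd z)^2 * sin (fst z))" by (intro Rect_cont)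
 have "a <= integral {p0..p1} (%p. 2 * kk k * integral {r0..1} (%r. \<bar>f (p, r)\<bar> * r^2 * sin p))"
 unfolding a_def
 proof (rule integral_le)
 show "(%p. \<bar>A p\<bar>) integrable_on {p0..p1}" by (intro i ci)
 show "(%p. 2 * kk k * integral {r0..1} (%r. \<bar>f (p, r)\<bar> * r^2 * sin p)) integrable_on {p0..p1}"
 using Rect_integral(3)[OF cc] by (intro i continuous_on_mult continuous_on_const) simp
 fix p assume p: "p \<in> {p0..p1}"
 have "\<bar>A p\<bar> <= integral {r0..1} (%r. 2 * kk k * (\<bar>f (p, r)\<bar> * r^2 * sin p))"
 unfolding A_def avg_def[OF k3] real_norm_def[symmetric]
 proof (rule integral_norm_bound_integral)
 show "(%r. kk k * r ^ (k - 1) * f (p, r)) integrable_on {r0..1}"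
 using Rect_slice(1)[OF avg_cont[OF k3] p] by (intro integrable_continuous_interval) simp
 show "(%r. 2 * kk k * (norm (f (p, r)) * r^2 * sin p)) integrable_on {r0..1}"
 using Rect_slice(1)[OF cf p] by (intro integrable_continuous_interval continuous_intros)
 fix r assume r: "r \<in> {r0..1}"
 have "r ^ (k - 1) <= r^2" using r r0_bounds k3 by (intro power_decreasing) auto
 moreover have "1 <= 2 * sin p" using sin_p(3)[OF p] by simp
 ultimately have "r ^ (k - 1) * 1 <= r^2 * (2 * sin p)" by (intro mult_mono) auto
 then have "kk k * \<bar>f (p, r)\<bar> * (r ^ (k - 1)) <= kk k * \<bar>f (p, r)\<bar> * (r^2 * (2 * sin p))"
 using kkb by (intro mult_left_mono) auto
 then show "norm (kk k * r ^ (k - 1) * f (p, r)) <= 2 * kk k * (norm (f (p, r)) * r^2 * sin p)"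
 using kkb r r0_bounds by (simp add: abs_mult mult_ac)
 qed
 then show "\<bar>A p\<bar> <= 2 * kk k * integral {r0..1} (%r. \<bar>f (p, r)\<bar> * r^2 * sin p)" by simp
 qed
 also have "... = 2 * kk k * c" unfolding c_def Rect_integral(1)[OF cc] by simp
 also have "... <= 4 * real k * c" using kkb c0 mult_right_mono[of "2 * kk k" "4 * real k" c] by simp
 finally show ?thesis .
 qed
 define X where "X = sqrt (len * (8 * real k * energy_p))"
 have X0: "X >= 0" and X2: "X^2 = len * (8 * real k * energy_p)"
 using len energy_p_nonneg by (auto simp: X_def)
 have Adiff: "\<bar>A p - A q\<bar> <= X" if pq: "p \<in> {p0..p1}" "q \<in> {p0..p1}" for p q
 proof -
 have "(A p - A q)^2 <= \<bar>p - q\<bar> * ((kk k)^2 / (2 * real k - 1) * (1.1548 * energy_p))"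
 using avg_diff_le[OF k3 pq] by (simp add: A_def)
 also have "... <= len * ((4 * real k) * (2 * energy_p))"
 proof (intro mult_mono)
 show "\<bar>p - q\<bar> <= len" using pq len(2) by auto
 have "(kk k)^2 <= (2 * real k)^2" using kkb by (intro power_mono) auto
 also have "... <= 4 * real k * (2 * real k - 1)" using k3 by (simp add: power2_eq_square algebra_simps)
 finally show "(kk k)^2 / (2 * real k - 1) <= 4 * real k" using k3 by (simp add: divide_le_eq)
 qed (use len energy_p_nonneg k3 in auto)
 also have "... = X^2" by (simp add: X2)
 finally show ?thesis using X0 by (metis abs_le_square_iff abs_of_nonneg)
 qed
 \<comment> \<open>Average the bound of the value at \<open>p\<close> by the value at
   \<open>q\<close> plus \<open>X\<close> over all \<open>q\<close>.\<close>
 have sup: "\<bar>A p\<bar> <= a / len + X" if p: "p \<in> {p0..p1}" for p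
 proof -
 have l: "integral {p0..p1} (%q. z) = len * z" for z using p_bounds(2) unfolding len(2) by simp
 have "integral {p0..p1} (%q. \<bar>A p\<bar>) <= integral {p0..p1} (%q. \<bar>A q\<bar> + X)"
 proof (rule integral_le)
 show "\<bar>A p\<bar> <= \<bar>A q\<bar> + X" if "q \<in> {p0..p1}" for q using Adiff[OF p that] by linarith
 qed (intro i ci)+
 also have "... = integral {p0..p1} (%q. \<bar>A q\<bar>) + integral {p0..p1} (%q. X)"
 by (intro HKI_integral_add i ci)
 finally have "len * \<bar>A p\<bar> <= a + len * X" unfolding l a_def .
 then show ?thesis using len(1) by (simp add: field_simps)
 qed
 have A2: "integral {p0..p1} (%p. (A p)^2 * sin p) <= a * (a / len + X)"
 proof -
 have "integral {p0..p1} (%p. (A p)^2 * sin p) <= integral {p0..p1} (%p. \<bar>A p\<bar> * (a / len + X))"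
 proof (rule integral_le)
 fix p assume p: "p \<in> {p0..p1}"
 have "(A p)^2 * sin p <= (A p)^2 * 1" by (intro mult_left_mono) auto
 also have "... = \<bar>A p\<bar> * \<bar>A p\<bar>" by (simp add: power2_eq_square)
 also have "... <= \<bar>A p\<bar> * (a / len + X)" using sup[OF p] by (intro mult_left_mono) auto
 finally show "(A p)^2 * sin p <= \<bar>A p\<bar> * (a / len + X)" .
 qed (intro i ci)+
 then show ?thesis unfolding integral_mult_left a_def[symmetric] .
 qed
 have G2: "integral {p0..p1} (%p. (G p)^2 * sin p) <= energy_r / (2 * real k - 1)"
 unfolding G_def by (rule dev_integral_le[OF k3])
 have "top_sq <= integral {p0..p1} (%p. 2 * ((G p)^2 * sin p) + 2 * ((A p)^2 * sin p))"
 unfolding top_sq_def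
 proof (rule integral_le)
 show "(%p. (f (p, 1))^2 * sin p) integrable_on {p0..p1}"
 using r0_bounds by (intro i continuous_intros f_slice_cont) auto
 show "(%p. 2 * ((G p)^2 * sin p) + 2 * ((A p)^2 * sin p)) integrable_on {p0..p1}" by (intro i ci)
 fix p assume p: "p \<in> {p0..p1}"
 have "f (p, 1) = G p + A p" by (simp add: G_def A_def dev_def[OF k3])
 moreover have "(G p + A p)^2 <= 2 * (G p)^2 + 2 * (A p)^2"
 using zero_le_power2[of "G p - A p"] by (simp add: power2_sum power2_diff algebra_simps)
 ultimately have "(f (p, 1))^2 * sin p <= (2 * (G p)^2 + 2 * (A p)^2) * sin p"
 using sin_p(2)[OF p] by (intro mult_right_mono) auto
 then show "(f (p, 1))^2 * sin p <= 2 * ((G p)^2 * sin p) + 2 * ((A p)^2 * sin p)" by (simp add: algebra_simps)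
 qed
 also have "... = integral {p0..p1} (%p. 2 * ((G p)^2 * sin p)) + integral {p0..p1} (%p. 2 * ((A p)^2 * sin p))"
 by (intro HKI_integral_add i ci)
 also have "... = 2 * integral {p0..p1} (%p. (G p)^2 * sin p) + 2 * integral {p0..p1} (%p. (A p)^2 * sin p)"
 unfolding integral_mult_right ..
 finally have "top_sq <= 2 * (energy_r / (2 * real k - 1)) + 2 * (a * (a / len + X))"
 using G2 A2 by linarith
 then have "x * top_sq <= x * (2 * (energy_r / (2 * real k - 1)) + 2 * (a * (a / len + X)))"
 by (rule mult_left_mono) simp
 also have "... = 2 * real x / (2 * real k - 1) * energy_r + 2 * real x * (a^2 / len + a * X)"
 by (simp add: algebra_simps power2_eq_square)
 finally have 1: "x * top_sq <= 2 * real x / (2 * real k - 1) * energy_r + 2 * real x * (a^2 / len + a * X)" .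
 have 2: "2 * real x / (2 * real k - 1) * energy_r <= 1/4 * energy_r"
 proof (rule mult_right_mono[OF _ energy_r_nonneg])
 show "2 * real x / (2 * real k - 1) <= 1/4" using x by (simp add: kx field_simps)
 qed
 have 3: "2 * real x * (a^2 / len + a * X) <= 1/4 * energy_p + 10^6 * x^5 / \<alpha> * c^2"
 proof -
 \<comment> \<open>The parameter of Young's inequality for \<open>a * X\<close>, chosen so that
   \<open>2 * x * s * X^2\<close> is exactly a quarter of \<open>energy_p\<close>.\<close>
 define s where "s = 1 / (64 * real k * len * real x)"
 have s: "s > 0" using len x k3 by (auto simp: s_def)
 have "0 <= (2 * s * X - a)^2 / (4 * s)" using s by simp
 also have "... = s * X^2 - a * X + a^2 / (4 * s)"
 using s by (simp add: power2_diff field_simps power2_eq_square)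
 finally have "a * X <= s * X^2 + a^2 / (4 * s)" by simp
 then have "2 * real x * (a^2 / len + a * X) <= 2 * real x * (a^2 / len + (s * X^2 + a^2 / (4 * s)))"
 by (intro mult_left_mono add_left_mono) auto
 also have "... = 2 * real x * s * X^2 + 2 * real x * (1 / len + 1 / (4 * s)) * a^2" by (simp add: algebra_simps)
 also have "2 * real x * s * X^2 = 1/4 * energy_p"
 unfolding X2 s_def using len x k3 by (simp add: field_simps)
 also have "2 * real x * (1 / len + 1 / (4 * s)) = 2 * real x / len * (1 + 128 * (real x)^2 * len^2)"
 unfolding s_def kx using len x by (simp add: field_simps power2_eq_square)
 finally have 4: "2 * real x * (a^2 / len + a * X)
 <= 1/4 * energy_p + 2 * real x / len * (1 + 128 * (real x)^2 * len^2) * a^2" .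
 have "2 * real x / len * (1 + 128 * (real x)^2 * len^2) * a^2 <= 2 * real x / len * (150 * (real x)^2) * (1024 * (real x)^2 * c^2)"
 proof (intro mult_mono)
 have "len^2 <= 1.06^2" using len by (intro power_mono) auto
 then have "len^2 <= 9/8" by (simp add: power2_eq_square)
 from mult_left_mono[OF this, of "128 * (real x)^2"]
 have "128 * (real x)^2 * len^2 <= 144 * (real x)^2" by simp
 moreover have "1 <= (real x)^2" using x by simp
 ultimately show "1 + 128 * (real x)^2 * len^2 <= 150 * (real x)^2" by linarith
 have "a^2 <= (4 * real k * c)^2" using a_le a0 by (intro power_mono) auto
 then show "a^2 <= 1024 * (real x)^2 * c^2" by (simp add: kx power_mult_distrib)
 qed (use len x in auto)
 also have "... = 153600 * real x ^ 5 / \<alpha> * c^2"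
 unfolding len_def using \<alpha>_pos by (simp add: field_simps power2_eq_square power_numeral_reduce)
 also have "... <= 10^6 * x^5 / \<alpha> * c^2"
 using \<alpha>_pos by (intro mult_right_mono divide_right_mono) auto
 finally show ?thesis using 4 by linarith
 qed
 show ?thesis using 1 2 3 unfolding c_def[symmetric] by (simp add: add_divide_distrib)
qed

end

end

section \<open>Boundary traces and integration by parts up to the boundary\<close>

context cone begin

abbreviation "LD \<equiv> lebesgue_on D"

text \<open>The approximating sequence is kept explicit because estimates are proved for C1
  functions with boundary values and only then passed to the limit; \<open>g\<close> is the weak
  gradient of \<open>f\<close>.\<close>

definition H1lim :: "(nat => real^3 => real) => (nat => real^3 => real^3) => (real^3 => real) => (real^3 => real^3) => bool" where
 "H1lim F F' f g \<longleftrightarrow> (\<forall>n. C1 (F n) (F' n)) \<and> l2lim LD F f \<and> l2lim LD F' g"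

lemma H1limD: "H1lim F F' f g ==> C1 (F n) (F' n)" "H1lim F F' f g ==> l2lim LD F f" "H1lim F F' f g ==> l2lim LD F' g"
 by (auto simp: H1lim_def)

lemma H1lim_l2: "H1lim F F' f g ==> l2 LD f" "H1lim F F' f g ==> l2 LD g"
 by (auto simp: H1lim_def dest: l2lim_l2)

lemma H1lim_diff:
 assumes "H1lim F F' f g" "H1lim G G' f2 g2"
 shows "H1lim (%n x. F n x - G n x) (%n x. F' n x - G' n x) (%x. f x - f2 x) (%x. g x - g2 x)"
 unfolding H1lim_def
proof (intro conjI allI)
 fix n
 show "C1 (%x. F n x - G n x) (%x. F' n x - G' n x)"
 using C1_add[OF H1limD(1)[OF assms(1), of n] C1_mult[OF C1_const[of "-1"] H1limD(1)[OF assms(2), of n]]] by simp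
qed (intro l2lim_diff H1limD(2,3)[OF assms(1)] H1limD(2,3)[OF assms(2)])+

lemma H1lim_mult_C1:
 assumes "C1 c c'" "H1lim F F' f g"
 shows "H1lim (%n x. c x * F n x) (%n x. c x *\<^sub>R F' n x + F n x *\<^sub>R c' x) (%x. c x * f x) (%x. c x *\<^sub>R g x + f x *\<^sub>R c' x)"
 unfolding H1lim_def
proof (intro conjI allI)
 show "C1 (%x. c x * F n x) (%x. c x *\<^sub>R F' n x + F n x *\<^sub>R c' x)" for n
 by (rule C1_mult[OF assms(1) H1limD(1)[OF assms(2)]])
 obtain C where C: "AE x in LD. norm (c x) <= C" using continuous_AE_bounded_D[OF C1_continuous[OF assms(1)]] by blast
 then have C: "AE x in LD. \<bar>c x\<bar> <= C" by simp
 obtain C' where C': "AE x in LD. norm (c' x) <= C'" using continuous_AE_bounded_D[OF C1D(2)[OF assms(1)]] by blast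
 note m = continuous_measurable_D[OF C1_continuous[OF assms(1)]] continuous_measurable_D[OF C1D(2)[OF assms(1)]]
 show "l2lim LD (%n x. c x * F n x) (%x. c x * f x)"
 by (rule l2lim_mult[OF H1limD(2)[OF assms(2)] m(1) C])
 show "l2lim LD (%n x. c x *\<^sub>R F' n x + F n x *\<^sub>R c' x) (%x. c x *\<^sub>R g x + f x *\<^sub>R c' x)"
 by (intro l2lim_add l2lim_scaleR[OF H1limD(3)[OF assms(2)] m(1) C] l2lim_scaleR_bounded[OF H1limD(2)[OF assms(2)] m(2) C'])
qed

lemma test_C1: assumes "test_function D \<psi>" shows "C1 \<psi> (%x. \<Sum>b\<in>Basis. frechet_derivative \<psi> (at x) b *\<^sub>R b)"
 using assms by (intro C1_smooth) (simp add: test_function_def)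

lemma grad_inner_Basis:
 "b \<in> Basis ==> (\<Sum>i\<in>Basis. h i *\<^sub>R i) \<bullet> b = h b" for b :: "'a::euclidean_space"
 by (simp add: inner_sum_left inner_Basis if_distrib cong: if_cong)

lemma H1lim_ibp_compact:
 assumes F: "H1lim F F' f g" and \<psi>: "C1 \<psi> \<psi>'"
 and K: "compact K" "K \<subseteq> D" "!!x. x \<notin> K ==> \<psi> x = 0" "!!x. x \<notin> K ==> \<psi>' x = 0"
 shows "(LINT x|LD. (\<psi>' x \<bullet> b) * f x) = - (LINT x|LD. \<psi> x * (g x \<bullet> b))"
proof -
 have eq: "(LINT x|LD. (\<psi>' x \<bullet> b) * F n x) = - (LINT x|LD. \<psi> x * (F' n x \<bullet> b))" for n
 proof (rule ibp_compact_support[OF open_D K(1-3), where zet'="%x h. \<psi>' x \<bullet> h" and F'="%x h. F' n x \<bullet> h"])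
 show "continuous_on D (%x. \<psi>' x \<bullet> b)" "continuous_on D (%x. F' n x \<bullet> b)"
 using D_off_axis continuous_on_subset[OF C1D(2)[OF \<psi>]] continuous_on_subset[OF C1D(2)[OF H1limD(1)[OF F]]]
 by (auto intro!: continuous_intros)
 qed (use C1D(1)[OF \<psi>] C1D(1)[OF H1limD(1)[OF F]] D_off_axis K(4) in auto)
 have c: "continuous_on off_axis (%x. \<psi>' x \<bullet> b)" "continuous_on off_axis (%x. \<psi> x *\<^sub>R b)"
 by (intro continuous_intros C1D(2)[OF \<psi>] C1_continuous[OF \<psi>])+
 have 1: "(%n. LINT x|LD. (\<psi>' x \<bullet> b) * F n x) \<longlonglongrightarrow> (LINT x|LD. (\<psi>' x \<bullet> b) * f x)"
 by (rule l2lim_mult_real[OF l2lim_const[OF continuous_l2_D[OF c(1)]] H1limD(2)[OF F]])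
 have 2: "(%n. LINT x|LD. \<psi> x * (F' n x \<bullet> b)) \<longlonglongrightarrow> (LINT x|LD. \<psi> x * (g x \<bullet> b))"
 using l2lim_inner[OF H1limD(3)[OF F] l2lim_const[OF continuous_l2_D[OF c(2)]]] by simp
 show ?thesis
 using LIMSEQ_unique[OF 1[unfolded eq] tendsto_minus[OF 2]] .
qed

lemma l2_locally_integrable: "l2 LD f ==> locally_integrable D f"
 by (rule locally_integrable_if_integrable[OF l2_integrable[OF finite_measure_D] open_D])

lemma H1lim_weak_deriv:
 assumes F: "H1lim F F' f g" and b: "b \<in> Basis"
 shows "has_weak_deriv D b f (%x. g x \<bullet> b)"
 unfolding has_weak_deriv_def
proof (intro conjI allI impI)
 show "locally_integrable D f" "locally_integrable D (%x. g x \<bullet> b)"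
 using l2_inner_bounded[OF H1lim_l2(2)[OF F], of "%x. b" "norm b"] H1lim_l2(1)[OF F] by (auto intro: l2_locally_integrable)
 fix \<psi> assume \<psi>: "test_function D \<psi>"
 obtain K where K: "compact K" "K \<subseteq> D" "!!x. x \<notin> K ==> \<psi> x = 0" "!!x b. x \<notin> K ==> frechet_derivative \<psi> (at x) b = 0"
 using test_function_support[OF \<psi>] by blast
 show "(LINT x|LD. frechet_derivative \<psi> (at x) b *\<^sub>R f x) = - (LINT x|LD. \<psi> x *\<^sub>R (g x \<bullet> b))"
 using H1lim_ibp_compact[OF F test_C1[OF \<psi>] K(1-3), of b] K(4) b by (simp add: grad_inner_Basis)
qed

lemma H1lim_wgrad:
 assumes F: "H1lim F F' f g" shows "AE x in LD. wgrad D f x = g x"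
proof -
 have "AE x in LD. \<forall>b\<in>Basis. wderiv D b f x = g x \<bullet> b"
 using wderiv_AE[OF open_D H1lim_weak_deriv[OF F]] by (subst AE_ball_countable) (auto simp: countable_finite)
 then show ?thesis
 by eventually_elim (simp add: wgrad_def euclidean_representation)
qed

text \<open>\<open>has_trace\<close> measures convergence through \<open>wderiv\<close> of a
  difference, which is an arbitrary representative. Uniqueness of weak derivatives turns this into
  L2 convergence of the classical gradients.\<close>

lemma has_trace_H1lim:
 assumes tr: "has_trace D S f h"
 obtains F F' g where "H1lim F F' f g" "!!n. continuous_on UNIV (F n)"
 "(%n. \<integral>\<^sup>+x. ennreal ((F n x - h x)^2) \<partial>S) \<longlonglongrightarrow> 0" "h \<in> borel_measurable S"
proof -
 from tr obtain F where sob: "sobolev 1 D f" and h: "h \<in> borel_measurable S" and F: "!!n. smooth (F n)"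
 "(%n. sobolev_norm_sq 1 D (%x. F n x - f x)) \<longlonglongrightarrow> 0"
 "(%n. \<integral>\<^sup>+x. ennreal ((F n x - h x)^2) \<partial>S) \<longlonglongrightarrow> 0"
 unfolding has_trace_def by blast
 from sob have f: "l2 LD f" and ex: "\<forall>b\<in>Basis. \<exists>g. has_weak_deriv D b f g \<and> l2 LD g"
 by (simp_all add: L2_on_iff_l2)
 from bchoice[OF ex] obtain gb where gb: "!!b. b \<in> Basis ==> has_weak_deriv D b f (gb b)" "!!b. b \<in> Basis ==> l2 LD (gb b)"
 by blast
 let ?d = "%n b x. frechet_derivative (F n) (at x) b"
 have Fl2: "l2 LD (F n)" for n by (rule continuous_l2_D[OF smooth_continuous[OF F(1)]])
 have dl2: "l2 LD (?d n b)" if "b \<in> Basis" for n b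
 by (rule continuous_l2_D[OF smooth_continuous[OF smooth_frechet[OF F(1) that]]])
 have le: "L2_norm_sq D (%x. F n x - f x) <= sobolev_norm_sq 1 D (%x. F n x - f x)"
 "b \<in> Basis ==> L2_norm_sq D (%x. ?d n b x - gb b x) <= sobolev_norm_sq 1 D (%x. F n x - f x)" for n b
 proof -
 show "L2_norm_sq D (%x. F n x - f x) <= sobolev_norm_sq 1 D (%x. F n x - f x)" by simp
 assume b: "b \<in> Basis"
 have "has_weak_deriv D b (F n) (?d n b)"
 using has_weak_deriv_classical[OF open_D smooth_has_derivative[OF F(1)] smooth_continuous[OF smooth_frechet[OF F(1) b]] b] .
 from wderiv_AE[OF open_D has_weak_deriv_diff[OF open_D b this gb(1)[OF b]]]
 have "L2_norm_sq D (%x. ?d n b x - gb b x) = L2_norm_sq D (wderiv D b (%x. F n x - f x))"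
 unfolding L2_norm_sq_def by (intro nn_integral_cong_AE) (auto elim: eventually_mono)
 also have "... <= (\<Sum>b\<in>Basis. L2_norm_sq D (wderiv D b (%x. F n x - f x)))"
 by (rule member_le_sum[OF b]) auto
 also have "... <= sobolev_norm_sq 1 D (%x. F n x - f x)" by simp
 finally show "L2_norm_sq D (%x. ?d n b x - gb b x) <= sobolev_norm_sq 1 D (%x. F n x - f x)" .
 qed
 have lF: "l2lim LD F f"
 by (rule l2lim_if_L2_norm_sq[OF Fl2 f tendsto_sandwich[OF _ _ tendsto_const F(2)]]) (use le(1) in auto)
 have ld: "l2lim LD (%n. ?d n b) (gb b)" if b: "b \<in> Basis" for b
 by (rule l2lim_if_L2_norm_sq[OF dl2[OF b] gb(2)[OF b] tendsto_sandwich[OF _ _ tendsto_const F(2)]]) (use le(2)[OF b] in auto)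
 have lv: "l2lim LD (%n x. ?d n b x *\<^sub>R b) (%x. gb b x *\<^sub>R b)" if b: "b \<in> Basis" for b
 by (rule l2lim_scaleR_bounded[OF ld[OF b], where C="norm b"]) auto
 have "l2lim LD (%n x. \<Sum>b\<in>Basis. ?d n b x *\<^sub>R b) (%x. \<Sum>b\<in>Basis. gb b x *\<^sub>R b)"
 unfolding sum_Basis_3 by (intro l2lim_add lv) (auto simp: Basis_3)
 then have "H1lim F (%n x. \<Sum>b\<in>Basis. ?d n b x *\<^sub>R b) f (%x. \<Sum>b\<in>Basis. gb b x *\<^sub>R b)"
 unfolding H1lim_def using lF C1_smooth[OF F(1)] by blast
 then show ?thesis by (rule that[OF _ smooth_continuous[OF F(1)] F(3) h])
qed

text \<open>Subtracting the approximants of the two sides cancels the common trace \<open>h\<close>,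
  so an equality of traces becomes a zero trace of one function.\<close>

lemma trace_eq_H1lim:
 assumes tr: "trace_eq D S f g" and S: "sets S = sets borel"
 obtains F F' w where "H1lim F F' (%x. f x - g x) w" "!!n. continuous_on UNIV (F n)"
 "(%n. \<integral>\<^sup>+x. ennreal ((F n x)^2) \<partial>S) \<longlonglongrightarrow> 0"
proof -
 obtain h where h: "has_trace D S f h" "has_trace D S g h" using tr by (auto simp: trace_eq_def)
 obtain F F' a where F: "H1lim F F' f a" "!!n. continuous_on UNIV (F n)"
 "(%n. \<integral>\<^sup>+x. ennreal ((F n x - h x)^2) \<partial>S) \<longlonglongrightarrow> 0" "h \<in> borel_measurable S"
 by (rule has_trace_H1lim[OF h(1)], rule that)
 obtain G G' b where G: "H1lim G G' g b" "!!n. continuous_on UNIV (G n)"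
 "(%n. \<integral>\<^sup>+x. ennreal ((G n x - h x)^2) \<partial>S) \<longlonglongrightarrow> 0" "h \<in> borel_measurable S"
 by (rule has_trace_H1lim[OF h(2)], rule that)
 have mS: "F n \<in> borel_measurable S" "G n \<in> borel_measurable S" for n
 using borel_measurable_continuous_onI[OF F(2)[of n]] borel_measurable_continuous_onI[OF G(2)[of n]]
 by (simp_all add: measurable_cong_sets[OF S refl])
 have "(%n. \<integral>\<^sup>+x. ennreal ((F n x - G n x)^2) \<partial>S) \<longlonglongrightarrow> 0"
 proof (rule tendsto_sandwich[OF _ _ tendsto_const])
 let ?u = "%n. 2 * (\<integral>\<^sup>+x. ennreal ((F n x - h x)^2) \<partial>S) + 2 * (\<integral>\<^sup>+x. ennreal ((G n x - h x)^2) \<partial>S)"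
 show "?u \<longlonglongrightarrow> 0"
 using tendsto_add[OF ennreal_tendsto_cmult[OF _ F(3), of 2] ennreal_tendsto_cmult[OF _ G(3), of 2]] by simp
 show "\<forall>\<^sub>F n in sequentially. (\<integral>\<^sup>+x. ennreal ((F n x - G n x)^2) \<partial>S) <= ?u n"
 proof (intro always_eventually allI)
 fix n
 have "(\<integral>\<^sup>+x. ennreal ((F n x - G n x)^2) \<partial>S)
 <= (\<integral>\<^sup>+x. 2 * ennreal ((F n x - h x)^2) + 2 * ennreal ((G n x - h x)^2) \<partial>S)"
 proof (rule nn_integral_mono)
 fix x
 have "(F n x - G n x)^2 <= 2 * (F n x - h x)^2 + 2 * (G n x - h x)^2"
 using norm_add_sq_le[of "F n x - h x" "h x - G n x"] by (simp add: power2_commute)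
 then have "ennreal ((F n x - G n x)^2) <= ennreal (2 * (F n x - h x)^2 + 2 * (G n x - h x)^2)" by (rule ennreal_leI)
 also have "... = 2 * ennreal ((F n x - h x)^2) + 2 * ennreal ((G n x - h x)^2)"
 by (simp add: ennreal_plus ennreal_mult)
 finally show "ennreal ((F n x - G n x)^2) <= 2 * ennreal ((F n x - h x)^2) + 2 * ennreal ((G n x - h x)^2)" .
 qed
 also have "... = ?u n"
 using mS[of n] F(4) by (subst nn_integral_add) (auto simp: nn_integral_cmult)
 finally show "(\<integral>\<^sup>+x. ennreal ((F n x - G n x)^2) \<partial>S) <= ?u n" .
 qed
 qed auto
 then show ?thesis
 using that[OF H1lim_diff[OF F(1) G(1)]] continuous_on_diff[OF F(2) G(2)] by blast
qed

lemma sphere_piece_trace: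
 assumes "trace_eq D (sphere_piece \<alpha> r) f g" "r \<in> {r0..1}"
 obtains F F' w where "H1lim F F' (%x. f x - g x) w" "(%n. sphere_int r (%x. (F n x)^2)) \<longlonglongrightarrow> 0"
proof -
 have "sets (sphere_piece \<alpha> r) = sets borel" by (simp add: sphere_piece_def)
 from trace_eq_H1lim[OF assms(1) this] obtain F F' w where F: "H1lim F F' (%x. f x - g x) w" "!!n. continuous_on UNIV (F n)"
 "(%n. \<integral>\<^sup>+x. ennreal ((F n x)^2) \<partial>sphere_piece \<alpha> r) \<longlonglongrightarrow> 0" by blast
 have nn: "0 <= sphere_int r (%x. (F n x)^2)" for n
 unfolding sphere_int_def case_prod_beta
 proof (rule integral_nonneg)
 show "(%z. (F n (spherical r (snd z) (fst z)))^2 * sin (snd z)) integrable_on cbox (0, p0) (2 * pi, p1)"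
 by (intro integrable_continuous continuous_intros continuous_on_compose2[OF F(2)]) auto
 show "0 <= (F n (spherical r (snd z) (fst z)))^2 * sin (snd z)" if "z \<in> cbox (0, p0) (2 * pi, p1)" for z
 using that sin_p(2)[of "snd z"] by (cases z) (auto simp: cbox_Pair_eq)
 qed
 have r: "r^2 > 0" using assms(2) r0_bounds by auto
 have "(%n. ennreal (r^2 * sphere_int r (%x. (F n x)^2))) \<longlonglongrightarrow> ennreal 0"
 using F(3) by (simp add: spherical_trace[OF F(2) assms(2)])
 then have "(%n. r^2 * sphere_int r (%x. (F n x)^2)) \<longlonglongrightarrow> 0"
 by (subst (asm) tendsto_ennreal_iff) (use nn in auto)
 from tendsto_mult[OF tendsto_const[of "1 / r^2"] this] have "(%n. sphere_int r (%x. (F n x)^2)) \<longlonglongrightarrow> 0"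
 using r by simp
 then show ?thesis using that F(1) by blast
qed

lemma cone_piece_trace:
 assumes "trace_eq D (cone_piece m p) f g" "p \<in> {p0..p1}"
 obtains F F' w where "H1lim F F' (%x. f x - g x) w" "(%n. cone_int p (%x. (F n x)^2)) \<longlonglongrightarrow> 0"
proof -
 have "sets (cone_piece m p) = sets borel" by (simp add: cone_piece_def)
 from trace_eq_H1lim[OF assms(1) this] obtain F F' w where F: "H1lim F F' (%x. f x - g x) w" "!!n. continuous_on UNIV (F n)"
 "(%n. \<integral>\<^sup>+x. ennreal ((F n x)^2) \<partial>cone_piece m p) \<longlonglongrightarrow> 0" by blast
 have nn: "0 <= cone_int p (%x. (F n x)^2)" for n
 unfolding cone_int_def case_prod_beta
 proof (rule integral_nonneg)
 show "(%z. (F n (spherical (snd z) p (fst z)))^2 * snd z) integrable_on cbox (0, r0) (2 * pi, 1)"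
 by (intro integrable_continuous continuous_intros continuous_on_compose2[OF F(2)]) auto
 show "0 <= (F n (spherical (snd z) p (fst z)))^2 * snd z" if "z \<in> cbox (0, r0) (2 * pi, 1)" for z
 using that r0_bounds(1) by (cases z) (auto simp: cbox_Pair_eq)
 qed
 have s: "sin p > 0" by (rule sin_p(2)[OF assms(2)])
 have "(%n. ennreal (sin p * cone_int p (%x. (F n x)^2))) \<longlonglongrightarrow> ennreal 0"
 using F(3) by (simp add: cone_trace[OF F(2) assms(2)])
 then have "(%n. sin p * cone_int p (%x. (F n x)^2)) \<longlonglongrightarrow> 0"
 by (subst (asm) tendsto_ennreal_iff) (use nn s in auto)
 from tendsto_mult[OF tendsto_const[of "1 / sin p"] this] have "(%n. cone_int p (%x. (F n x)^2)) \<longlonglongrightarrow> 0"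
 using s by simp
 then show ?thesis using that F(1) by blast
qed

text \<open>Zero traces on two opposite boundary pieces are known through two unrelated approximating
 sequences; the cutoff \<open>\<eta>\<close>, equal to 1 on one piece and 0 on the other, separates them.\<close>

lemma zero_trace_half:
 assumes e: "continuous_on off_axis e" and \<kappa>: "continuous_on off_axis \<kappa>" and \<eta>: "C1 \<eta> \<eta>'"
 and ibp: "!!F F'. C1 F F' ==> (LINT x|LD. (\<eta> x *\<^sub>R F' x + F x *\<^sub>R \<eta>' x) \<bullet> e x + \<kappa> x * (\<eta> x * F x)) = B F"
 and CS: "!!F G. continuous_on off_axis F ==> continuous_on off_axis G ==>
 \<bar>B (%x. F x * G x)\<bar> <= sqrt (N (%x. (F x)^2)) * sqrt (N (%x. (G x)^2))"
 and F: "H1lim F F' y g" "(%n. N (%x. (F n x)^2)) \<longlonglongrightarrow> 0" and \<psi>: "C1 \<psi> \<psi>'"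
 shows "(LINT x|LD. g x \<bullet> ((\<eta> x * \<psi> x) *\<^sub>R e x))
 + (LINT x|LD. y x * (\<eta> x * (\<psi>' x \<bullet> e x) + \<psi> x * (\<eta>' x \<bullet> e x) + \<kappa> x * \<eta> x * \<psi> x)) = 0"
proof -
 let ?a = "%x. (\<eta> x * \<psi> x) *\<^sub>R e x"
 let ?b = "%x. \<eta> x * (\<psi>' x \<bullet> e x) + \<psi> x * (\<eta>' x \<bullet> e x) + \<kappa> x * \<eta> x * \<psi> x"
 note c = C1_continuous[OF \<eta>] C1D(2)[OF \<eta>] C1_continuous[OF \<psi>] C1D(2)[OF \<psi>] e \<kappa>
 have a: "l2 LD ?a" and b: "l2 LD ?b" by (intro continuous_l2_D continuous_intros c)+
 have eq: "(LINT x|LD. F' n x \<bullet> ?a x) + (LINT x|LD. F n x * ?b x) = B (%x. F n x * \<psi> x)" for n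
 proof -
 have "(LINT x|LD. F' n x \<bullet> ?a x) + (LINT x|LD. F n x * ?b x) = (LINT x|LD. F' n x \<bullet> ?a x + F n x * ?b x)"
 by (intro BI_add[symmetric] l2_inner_integrable[OF l2lim_l2(1)[OF H1limD(3)[OF F(1)]] a]
 l2_mult_integrable[OF l2lim_l2(1)[OF H1limD(2)[OF F(1)]] b])
 also have "... = (LINT x|LD. (\<eta> x *\<^sub>R (F n x *\<^sub>R \<psi>' x + \<psi> x *\<^sub>R F' n x) + (F n x * \<psi> x) *\<^sub>R \<eta>' x) \<bullet> e x
 + \<kappa> x * (\<eta> x * (F n x * \<psi> x)))"
 by (intro BI_cong refl) (simp add: inner_add_left algebra_simps)
 also have "... = B (%x. F n x * \<psi> x)"
 by (rule ibp[OF C1_mult[OF H1limD(1)[OF F(1)] \<psi>]])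
 finally show ?thesis .
 qed
 have "(%n. (LINT x|LD. F' n x \<bullet> ?a x) + (LINT x|LD. F n x * ?b x)) \<longlonglongrightarrow> (LINT x|LD. g x \<bullet> ?a x) + (LINT x|LD. y x * ?b x)"
 by (intro tendsto_add l2lim_inner l2lim_mult_real l2lim_const a b H1limD(2,3)[OF F(1)])
 \<comment> \<open>The boundary term of the approximants is controlled by their trace norm, which
   tends to 0, times the fixed boundary norm of \<psi>.\<close>
 moreover have "(%n. B (%x. F n x * \<psi> x)) \<longlonglongrightarrow> 0"
 proof (rule Lim_null_comparison)
 show "\<forall>\<^sub>F n in sequentially. norm (B (%x. F n x * \<psi> x)) <= sqrt (N (%x. (F n x)^2)) * sqrt (N (%x. (\<psi> x)^2))"
 using CS[OF C1_continuous[OF H1limD(1)[OF F(1)]] C1_continuous[OF \<psi>]] by simp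
 show "(%n. sqrt (N (%x. (F n x)^2)) * sqrt (N (%x. (\<psi> x)^2))) \<longlonglongrightarrow> 0"
 using tendsto_mult[OF tendsto_real_sqrt[OF F(2)] tendsto_const[of "sqrt (N (%x. (\<psi> x)^2))"]] by simp
 qed
 ultimately show ?thesis unfolding eq by (rule LIMSEQ_unique)
qed

text \<open>A partition of unity: \<eta> uses the gradient \<open>g\<close> of the first sequence,
  and 1 - \<eta> the gradient \<open>h\<close> of the second. Each half-identity loses its boundary
  term, and their sum is valid for test functions that do not vanish on the boundary. The function
  \<open>q\<close> plays the role of the divergence of \<open>y\<close> times
  \<open>e\<close>.\<close>

lemma zero_trace_ibp:
 assumes e: "continuous_on off_axis e" and \<kappa>: "continuous_on off_axis \<kappa>" and \<eta>: "C1 \<eta> \<eta>'"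
 and ibp: "!!F F'. C1 F F' ==> (LINT x|LD. F' x \<bullet> e x + \<kappa> x * F x) = c1 * N1 F - c0 * N0 F"
 and N: "!!F. N1 (%x. \<eta> x * F x) = N1 F" "!!F. N0 (%x. \<eta> x * F x) = 0"
 "!!F. N1 (%x. (1 - \<eta> x) * F x) = 0" "!!F. N0 (%x. (1 - \<eta> x) * F x) = N0 F"
 and c: "\<bar>c1\<bar> <= 1" "\<bar>c0\<bar> <= 1"
 and CS: "!!F G. continuous_on off_axis F ==> continuous_on off_axis G ==>
 \<bar>N1 (%x. F x * G x)\<bar> <= sqrt (N1 (%x. (F x)^2)) * sqrt (N1 (%x. (G x)^2))"
 "!!F G. continuous_on off_axis F ==> continuous_on off_axis G ==>
 \<bar>N0 (%x. F x * G x)\<bar> <= sqrt (N0 (%x. (F x)^2)) * sqrt (N0 (%x. (G x)^2))"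
 and F: "H1lim F F' y g" "(%n. N1 (%x. (F n x)^2)) \<longlonglongrightarrow> 0"
 and G: "H1lim G G' y h" "(%n. N0 (%x. (G n x)^2)) \<longlonglongrightarrow> 0"
 shows "\<exists>q. l2 LD q \<and> (\<forall>\<psi> \<psi>'. C1 \<psi> \<psi>' --> (LINT x|LD. q x * \<psi> x) = - (LINT x|LD. y x * (\<psi>' x \<bullet> e x)))"
proof -
 define q where "q x = g x \<bullet> (\<eta> x *\<^sub>R e x) + h x \<bullet> ((1 - \<eta> x) *\<^sub>R e x) + \<kappa> x * y x" for x
 note cc = C1_continuous[OF \<eta>] C1D(2)[OF \<eta>] e \<kappa>
 have \<eta>2: "C1 (%x. 1 - \<eta> x) (%x. - \<eta>' x)"
 using C1_add[OF C1_const[of 1] C1_mult[OF C1_const[of "-1"] \<eta>]] by simp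
 have b1: "l2 LD (%x. u x \<bullet> w x)" if u: "l2 LD u" and w: "continuous_on off_axis w" for u w :: "real^3 => real^3"
 proof -
 obtain C where "AE x in LD. norm (w x) <= C" using continuous_AE_bounded_D[OF w] by blast
 then show ?thesis by (rule l2_inner_bounded[OF u continuous_measurable_D[OF w]])
 qed
 have b2: "l2 LD (%x. w x * u x)" if u: "l2 LD u" and w: "continuous_on off_axis w" for u w :: "real^3 => real"
 proof -
 obtain C where "AE x in LD. norm (w x) <= C" using continuous_AE_bounded_D[OF w] by blast
 then show ?thesis using l2_scaleR[OF u continuous_measurable_D[OF w], of C] by simp
 qed
 note l = H1lim_l2[OF F(1)] H1lim_l2[OF G(1)]
 have lq: "l2 LD q"
 unfolding q_def[abs_def] by (intro l2_add b1 b2 l continuous_intros cc)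
 have "(LINT x|LD. q x * \<psi> x) = - (LINT x|LD. y x * (\<psi>' x \<bullet> e x))" if \<psi>: "C1 \<psi> \<psi>'" for \<psi> \<psi>'
 proof -
 note c\<psi> = C1_continuous[OF \<psi>] C1D(2)[OF \<psi>]
 have 1: "(LINT x|LD. g x \<bullet> ((\<eta> x * \<psi> x) *\<^sub>R e x))
 + (LINT x|LD. y x * (\<eta> x * (\<psi>' x \<bullet> e x) + \<psi> x * (\<eta>' x \<bullet> e x) + \<kappa> x * \<eta> x * \<psi> x)) = 0"
 proof (rule zero_trace_half[OF e \<kappa> \<eta> _ _ F \<psi>, where B="%F. c1 * N1 F"])
 show "(LINT x|LD. (\<eta> x *\<^sub>R F' x + F x *\<^sub>R \<eta>' x) \<bullet> e x + \<kappa> x * (\<eta> x * F x)) = c1 * N1 F" if "C1 F F'" for F F'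
 using ibp[OF C1_mult[OF \<eta> that]] by (simp add: N)
 show "\<bar>c1 * N1 (%x. F x * G x)\<bar> <= sqrt (N1 (%x. (F x)^2)) * sqrt (N1 (%x. (G x)^2))"
 if "continuous_on off_axis F" "continuous_on off_axis G" for F G
 using CS(1)[OF that] mult_mono[OF c(1) order_refl[of "\<bar>N1 (%x. F x * G x)\<bar>"]] by (simp add: abs_mult)
 qed
 have 2: "(LINT x|LD. h x \<bullet> (((1 - \<eta> x) * \<psi> x) *\<^sub>R e x))
 + (LINT x|LD. y x * ((1 - \<eta> x) * (\<psi>' x \<bullet> e x) + \<psi> x * (- \<eta>' x \<bullet> e x) + \<kappa> x * (1 - \<eta> x) * \<psi> x)) = 0"
 proof (rule zero_trace_half[OF e \<kappa> \<eta>2 _ _ G \<psi>, where B="%F. - c0 * N0 F"])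
 show "(LINT x|LD. ((1 - \<eta> x) *\<^sub>R F' x + F x *\<^sub>R - \<eta>' x) \<bullet> e x + \<kappa> x * ((1 - \<eta> x) * F x)) = - c0 * N0 F" if "C1 F F'" for F F'
 using ibp[OF C1_mult[OF \<eta>2 that]] by (simp add: N)
 show "\<bar>- c0 * N0 (%x. F x * G x)\<bar> <= sqrt (N0 (%x. (F x)^2)) * sqrt (N0 (%x. (G x)^2))"
 if "continuous_on off_axis F" "continuous_on off_axis G" for F G
 using CS(2)[OF that] mult_mono[OF c(2) order_refl[of "\<bar>N0 (%x. F x * G x)\<bar>"]] by (simp add: abs_mult)
 qed
 have i: "integrable LD (%x. g x \<bullet> ((\<eta> x * \<psi> x) *\<^sub>R e x))" "integrable LD (%x. h x \<bullet> (((1 - \<eta> x) * \<psi> x) *\<^sub>R e x))"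
 "integrable LD (%x. y x * (\<eta> x * (\<psi>' x \<bullet> e x) + \<psi> x * (\<eta>' x \<bullet> e x) + \<kappa> x * \<eta> x * \<psi> x))"
 "integrable LD (%x. y x * ((1 - \<eta> x) * (\<psi>' x \<bullet> e x) + \<psi> x * (- \<eta>' x \<bullet> e x) + \<kappa> x * (1 - \<eta> x) * \<psi> x))"
 "integrable LD (%x. q x * \<psi> x)" "integrable LD (%x. y x * (\<psi>' x \<bullet> e x))"
 by (intro l2_inner_integrable l2_mult_integrable l lq continuous_l2_D continuous_intros cc c\<psi>)+
 have "(LINT x|LD. q x * \<psi> x) + (LINT x|LD. y x * (\<psi>' x \<bullet> e x)) = (LINT x|LD. q x * \<psi> x + y x * (\<psi>' x \<bullet> e x))"
 using i by simp
 also have "... = (LINT x|LD. (g x \<bullet> ((\<eta> x * \<psi> x) *\<^sub>R e x) + y x * (\<eta> x * (\<psi>' x \<bullet> e x) + \<psi> x * (\<eta>' x \<bullet> e x) + \<kappa> x * \<eta> x * \<psi> x))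
 + (h x \<bullet> (((1 - \<eta> x) * \<psi> x) *\<^sub>R e x) + y x * ((1 - \<eta> x) * (\<psi>' x \<bullet> e x) + \<psi> x * (- \<eta>' x \<bullet> e x) + \<kappa> x * (1 - \<eta> x) * \<psi> x)))"
 by (intro BI_cong refl) (simp add: q_def algebra_simps)
 also have "... = 0"
 unfolding BI_add[OF Bochner_Integration.integrable_add[OF i(1) i(3)] Bochner_Integration.integrable_add[OF i(2) i(4)]]
 BI_add[OF i(1) i(3)] BI_add[OF i(2) i(4)] 1 2 by simp
 finally show ?thesis by linarith
 qed
 then show ?thesis using lq by blast
qed

lemma sphere_int_cong:
 assumes "!!p q. p \<in> {p0..p1} ==> F (spherical r p q) = G (spherical r p q)" shows "sphere_int r F = sphere_int r G"
 unfolding sphere_int_def by (rule integral_cong) (use assms in \<open>auto simp: cbox_Pair_eq\<close>)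

lemma cone_int_cong:
 assumes "!!r q. r \<in> {r0..1} ==> F (spherical r p q) = G (spherical r p q)" shows "cone_int p F = cone_int p G"
 unfolding cone_int_def by (rule integral_cong) (use assms in \<open>auto simp: cbox_Pair_eq\<close>)

lemma rho_zero_trace:
 assumes F: "H1lim F F' y g" "(%n. sphere_int 1 (%x. (F n x)^2)) \<longlonglongrightarrow> 0"
 and G: "H1lim G G' y h" "(%n. sphere_int r0 (%x. (G n x)^2)) \<longlonglongrightarrow> 0"
 shows "\<exists>q. l2 LD q \<and> (\<forall>\<psi> \<psi>'. C1 \<psi> \<psi>' --> (LINT x|LD. q x * \<psi> x) = - (LINT x|LD. y x * (\<psi>' x \<bullet> e_rho x)))"
proof -
 \<comment> \<open>Affine in the radius, from 0 on the inner to 1 on the outer sphere.\<close>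
 define \<eta> where "\<eta> x = (1 / (1 - r0)) * (norm x + (- r0))" for x :: "real^3"
 have 0: "sphere_int r (%x. 0) = 0" for r 
 proof -
 have "(%(q, p). 0 * sin p) = (%z :: real \<times> real. 0 :: real)" by auto
 then show ?thesis unfolding sphere_int_def by (simp only: integral_0)
 qed
 have \<eta>: "C1 \<eta> (%x. (1 / (1 - r0)) *\<^sub>R ((x /\<^sub>R norm x) + 0) + (norm x + (- r0)) *\<^sub>R 0)"
 unfolding \<eta>_def[abs_def] by (intro C1_mult C1_add C1_const C1_norm)
 have v: "\<eta> (spherical 1 p q) = 1" "\<eta> (spherical r0 p q) = 0" for p q
 using r0_bounds by (auto simp: \<eta>_def norm_spherical field_simps)
 show ?thesis
 proof (rule zero_trace_ibp[OF continuous_frame(1) _ \<eta> _ _ _ _ _ _ _ _ _ F G, where \<kappa>="%x. 2 / norm x" and ?c1.0=1 and ?c0.0="r0^2"])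
 show "continuous_on off_axis (%x :: real^3. 2 / norm x)" using norm_pos_off_axis by (intro continuous_intros) auto
 show "(LINT x|LD. F' x \<bullet> e_rho x + 2 / norm x * F x) = 1 * sphere_int 1 F - r0^2 * sphere_int r0 F" if "C1 F F'" for F F'
 using ibp_rho[OF that] by simp
 show "sphere_int 1 (%x. \<eta> x * F x) = sphere_int 1 F" "sphere_int r0 (%x. (1 - \<eta> x) * F x) = sphere_int r0 F" for F
 by (rule sphere_int_cong, simp add: v)+
 show "sphere_int r0 (%x. \<eta> x * F x) = 0" "sphere_int 1 (%x. (1 - \<eta> x) * F x) = 0" for F
 by (subst 0[symmetric], rule sphere_int_cong, simp add: v)+
 show "\<bar>r0^2\<bar> <= 1" using r0_bounds power_le_one[of r0 2] by simp
 qed (use sphere_int_CS r0_bounds in auto)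
qed

lemma phi_zero_trace:
 assumes F: "H1lim F F' y g" "(%n. cone_int p1 (%x. (F n x)^2)) \<longlonglongrightarrow> 0"
 and G: "H1lim G G' y h" "(%n. cone_int p0 (%x. (G n x)^2)) \<longlonglongrightarrow> 0"
 shows "\<exists>q. l2 LD q \<and> (\<forall>\<psi> \<psi>'. C1 \<psi> \<psi>' --> (LINT x|LD. q x * \<psi> x) = - (LINT x|LD. y x * (\<psi>' x \<bullet> e_phi x)))"
proof -
 \<comment> \<open>Affine in cos(phi): the cosine is \<open>sin \<alpha>\<close> at
   \<open>p0\<close> and \<open>- sin \<alpha>\<close> at \<open>p1\<close>, so the values there are
   0 and 1.\<close>
 define \<eta> where "\<eta> x = 1/2 + (- 1 / (2 * sin \<alpha>)) * ((x \<bullet> axis 3 1) * (1 / norm x))" for x :: "real^3"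
 obtain \<eta>' where \<eta>: "C1 \<eta> \<eta>'"
 unfolding \<eta>_def[abs_def] using C1_add[OF C1_const C1_mult[OF C1_const C1_mult[OF C1_inner C1_inverse[OF C1_norm norm_pos_off_axis]]]]
 by blast
 have 0: "cone_int p (%x. 0) = 0" for p 
 proof -
 have "(%(q, r). 0 * r) = (%z :: real \<times> real. 0 :: real)" by auto
 then show ?thesis unfolding cone_int_def by (simp only: integral_0)
 qed
 have v: "\<eta> (spherical r p1 q) = 1" "\<eta> (spherical r p0 q) = 0" if "r \<in> {r0..1}" for r q
 using that r0_bounds \<alpha>_bounds(1)
 by (auto simp: \<eta>_def norm_spherical inner_axis spherical_nth p0_def p1_def cos_add cos_diff)
 show ?thesis
 proof (rule zero_trace_ibp[OF continuous_frame(2) _ \<eta> _ _ _ _ _ _ _ _ _ F G, where \<kappa>="%x. x $ 3 / (cyl x * norm x)" and ?c1.0="sin p1" and ?c0.0="sin p0"])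
 have "cyl x * norm x ~= 0" if "x \<in> off_axis" for x
 using that cyl_pos[of x] norm_pos_off_axis[of x] by auto
 then show "continuous_on off_axis (%x :: real^3. x $ 3 / (cyl x * norm x))" by (intro continuous_intros continuous_cyl) auto
 show "(LINT x|LD. F' x \<bullet> e_phi x + x $ 3 / (cyl x * norm x) * F x) = sin p1 * cone_int p1 F - sin p0 * cone_int p0 F" if "C1 F F'" for F F'
 by (rule ibp_phi[OF that])
 show "cone_int p1 (%x. \<eta> x * F x) = cone_int p1 F" "cone_int p0 (%x. (1 - \<eta> x) * F x) = cone_int p0 F" for F
 by (rule cone_int_cong, simp add: v)+
 show "cone_int p0 (%x. \<eta> x * F x) = 0" "cone_int p1 (%x. (1 - \<eta> x) * F x) = 0" for F
 by (subst 0[symmetric], rule cone_int_cong, simp add: v)+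
 qed (use cone_int_CS p_bounds in auto)
qed

text \<open>\<open>d\<close> is known to be the divergence only against compactly supported
  functions, whereas \<open>qr + qp\<close> is one up to the boundary. The fundamental lemma shows
  that they agree almost everywhere, so \<open>d\<close> inherits the identity for every C1 test
  function. This is how vanishing normal traces remove the boundary term.\<close>

lemma divergence_ibp:
 assumes yr: "l2 LD yr" "l2 LD qr" "!!\<psi> \<psi>'. C1 \<psi> \<psi>' ==> (LINT x|LD. qr x * \<psi> x) = - (LINT x|LD. yr x * (\<psi>' x \<bullet> e_rho x))"
 and yp: "l2 LD yp" "l2 LD qp" "!!\<psi> \<psi>'. C1 \<psi> \<psi>' ==> (LINT x|LD. qp x * \<psi> x) = - (LINT x|LD. yp x * (\<psi>' x \<bullet> e_phi x))"
 and d: "l2 LD d" "!!\<psi> \<psi>'. test_function D \<psi> ==> C1 \<psi> \<psi>' ==>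
 (LINT x|LD. d x * \<psi> x) = - (LINT x|LD. yr x * (\<psi>' x \<bullet> e_rho x) + yp x * (\<psi>' x \<bullet> e_phi x))"
 and \<psi>: "C1 \<psi> \<psi>'"
 shows "(LINT x|LD. d x * \<psi> x) = - (LINT x|LD. yr x * (\<psi>' x \<bullet> e_rho x) + yp x * (\<psi>' x \<bullet> e_phi x))"
proof -
 have sum: "(LINT x|LD. (qr x + qp x) * \<psi> x) = - (LINT x|LD. yr x * (\<psi>' x \<bullet> e_rho x) + yp x * (\<psi>' x \<bullet> e_phi x))"
 if \<psi>: "C1 \<psi> \<psi>'" for \<psi> \<psi>'
 proof -
 note c = C1_continuous[OF \<psi>] C1D(2)[OF \<psi>] continuous_frame
 have i: "integrable LD (%x. qr x * \<psi> x)" "integrable LD (%x. qp x * \<psi> x)"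
 "integrable LD (%x. yr x * (\<psi>' x \<bullet> e_rho x))" "integrable LD (%x. yp x * (\<psi>' x \<bullet> e_phi x))"
 by (intro l2_mult_integrable yr yp continuous_l2_D continuous_intros c)+
 then show ?thesis using yr(3)[OF \<psi>] yp(3)[OF \<psi>] by (simp add: distrib_right)
 qed
 have "AE x in LD. d x - (qr x + qp x) = 0"
 proof (rule fundamental_lemma[OF open_D])
 show "locally_integrable D (%x. d x - (qr x + qp x))" by (intro l2_locally_integrable l2_diff l2_add d yr yp)
 fix \<phi> assume t: "test_function D \<phi>"
 note C = test_C1[OF t]
 have i: "integrable LD (%x. d x * \<phi> x)" "integrable LD (%x. (qr x + qp x) * \<phi> x)"
 by (intro l2_mult_integrable d l2_add yr yp continuous_l2_D C1_continuous[OF C])+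
 have "(LINT x|LD. \<phi> x * (d x - (qr x + qp x))) = (LINT x|LD. d x * \<phi> x - (qr x + qp x) * \<phi> x)"
 by (simp add: algebra_simps)
 also have "... = 0" using i d(2)[OF t C] sum[OF C] by simp
 finally show "(LINT x|LD. \<phi> x * (d x - (qr x + qp x))) = 0" .
 qed
 then have "(LINT x|LD. d x * \<psi> x) = (LINT x|LD. (qr x + qp x) * \<psi> x)"
 using l2_measurable d yr yp continuous_measurable_D[OF C1_continuous[OF \<psi>]]
 by (intro integral_cong_AE) (auto elim: eventually_mono)
 then show ?thesis using sum[OF \<psi>] by simp
qed

end

text \<open>Completeness of Lebesgue measure; it carries measurability to the arbitrary
  representative that \<open>wderiv\<close> selects.\<close>

lemma borel_measurable_lebesgue_on_AE:
 fixes f g :: "'a::euclidean_space => 'b::euclidean_space"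
 assumes U: "U \<in> sets lebesgue" and f: "f \<in> borel_measurable (lebesgue_on U)" and ae: "AE x in lebesgue_on U. f x = g x"
 shows "g \<in> borel_measurable (lebesgue_on U)"
proof -
 have "(%x. indicator U x *\<^sub>R f x) \<in> borel_measurable lebesgue"
 using f U by (simp add: borel_measurable_restrict_space_iff)
 moreover have "AE x in lebesgue. indicator U x *\<^sub>R f x = indicator U x *\<^sub>R g x"
 using ae unfolding AE_lebesgue_on_iff[OF U] by eventually_elim (auto simp: indicator_def)
 ultimately have "(%x. indicator U x *\<^sub>R g x) \<in> borel_measurable lebesgue"
 by (rule borel_measurable_AE)
 then show ?thesis using U by (simp add: borel_measurable_restrict_space_iff)
qed

lemma l2_cong_AE:
 fixes f g :: "'a::euclidean_space => 'b::euclidean_space"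
 assumes "U \<in> sets lebesgue" "l2 (lebesgue_on U) f" "AE x in lebesgue_on U. f x = g x"
 shows "l2 (lebesgue_on U) g"
 by (rule l2_dominated[where g="%x. (norm (f x))^2"])
 (use assms borel_measurable_lebesgue_on_AE[OF assms(1) _ assms(3)] in \<open>auto simp: l2_def elim: eventually_mono\<close>)

text \<open>The gradient of \<open>ln (cyl x)\<close>, hence divergence free off the axis.\<close>

definition swirl_field :: "real^3 => real^3" where
 "swirl_field x = (1 / (cyl x)^2) *\<^sub>R vector [x $ 1, x $ 2, 0]"

lemma continuous_swirl_field: "continuous_on off_axis swirl_field"
 unfolding swirl_field_def[abs_def] using cyl_pos
 by (intro continuous_intros continuous_on_vector_3 continuous_cyl) fastforce

text \<open>The volume weight cancels the singular denominators and produces exactly the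
  coefficients of \<open>top_sq_bounds_J\<close>; there the \<open>p\<close>-derivative already
  contains a factor r.\<close>

lemma swirl_field_spherical:
 assumes "r > 0" "sin p > 0"
 shows "(v \<bullet> swirl_field (spherical r p q)) * (r^2 * sin p)
 = r * sin p * (v \<bullet> e_rho (spherical r p q)) + r * cos p * (v \<bullet> e_phi (spherical r p q))"
proof -
 have "(r^2 * sin p) *\<^sub>R swirl_field (spherical r p q)
 = (r * sin p) *\<^sub>R e_rho (spherical r p q) + (r * cos p) *\<^sub>R e_phi (spherical r p q)"
 proof -
 have a: "cos q * (r * (sin p * sin p)) + cos q * (r * (cos p * cos p)) = r * cos q"
 "sin q * (r * (sin p * sin p)) + sin q * (r * (cos p * cos p)) = r * sin q"
 using sin_cos_squared_add[of p] by (auto simp: power2_eq_square distrib_left[symmetric])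
 have s: "(r^2 * sin p) *\<^sub>R swirl_field (spherical r p q) = vector [r * cos q, r * sin q, 0]"
 using assms by (simp add: swirl_field_def cyl_spherical vec_eq_iff forall_3 spherical_nth power2_eq_square field_simps)
 show ?thesis unfolding s frame_spherical[OF assms] using a by (simp add: vec_eq_iff forall_3 mult_ac)
 qed
 from arg_cong[OF this, of "%z. v \<bullet> z"] show ?thesis by (simp add: inner_add_right mult.commute)
qed

section \<open>Volume inequalities assembled from meridian slices\<close>

context cone begin

lemma coord_slice_integral_continuous:
 assumes "continuous_on coord_box g"
 shows "continuous_on {0..2*pi} (%q. integral Rect (%z. g (q, z)) :: real)"
proof (rule integral_continuous_on_param)
 show "continuous_on ({0..2*pi} \<times> Rect) (%(x, t). g (x, t))"
 using assms by (simp add: coord_box_def cbox_Pair_eq)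
qed

context
 fixes F F' assumes F: "C1 F F'"
begin

abbreviation (input) "fs q z \<equiv> F (spherical (snd z) (fst z) q)"
abbreviation (input) "fps q z \<equiv> snd z * (F' (spherical (snd z) (fst z) q) \<bullet> e_phi (spherical (snd z) (fst z) q))"
abbreviation (input) "frs q z \<equiv> F' (spherical (snd z) (fst z) q) \<bullet> e_rho (spherical (snd z) (fst z) q)"
abbreviation (input) "fqs q z \<equiv> F' (spherical (snd z) (fst z) q) \<bullet> rot_field (spherical (snd z) (fst z) q)"

lemma slice_continuous:
 assumes "continuous_on off_axis (g :: real^3 => 'b::euclidean_space)"
 shows "continuous_on Rect (%z. g (spherical (snd z) (fst z) q))"
proof (rule continuous_on_compose2[OF continuous_on_subset[OF assms D_closed_off_axis]])
 show "continuous_on Rect (%z. spherical (snd z) (fst z) q)" by (intro continuous_intros)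
 show "(%z. spherical (snd z) (fst z) q) ` Rect \<subseteq> D_closed"
 using spherical_in_D_closed by (auto simp: cbox_Pair_eq)
qed

lemma slice_assms:
 "continuous_on Rect (fs q)" "continuous_on Rect (fps q)" "continuous_on Rect (frs q)"
 "!!p r. p \<in> {p0..p1} ==> r \<in> {r0..1} ==> ((%p. fs q (p, r)) has_real_derivative fps q (p, r)) (at p within {p0..p1})"
 "!!p r. p \<in> {p0..p1} ==> r \<in> {r0..1} ==> ((%r. fs q (p, r)) has_real_derivative frs q (p, r)) (at r within {r0..1})"
proof -
 show "continuous_on Rect (fs q)" by (rule slice_continuous[OF C1_continuous[OF F]])
 have c: "continuous_on off_axis (%x. F' x \<bullet> e_phi x)" "continuous_on off_axis (%x. F' x \<bullet> e_rho x)"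
 by (intro continuous_intros C1D(2)[OF F] continuous_frame)+
 show "continuous_on Rect (frs q)" by (rule slice_continuous[OF c(2)])
 show "continuous_on Rect (fps q)" by (rule continuous_on_mult[OF continuous_on_snd[OF continuous_on_id] slice_continuous[OF c(1)]])
 fix p r assume pr: "p \<in> {p0..p1}" "r \<in> {r0..1}"
 have r: "r > 0" using pr r0_bounds by auto
 show "((%p. fs q (p, r)) has_real_derivative fps q (p, r)) (at p within {p0..p1})"
 "((%r. fs q (p, r)) has_real_derivative frs q (p, r)) (at r within {r0..1})"
 using C1_deriv_spherical(1,2)[OF F r sin_p(2)[OF pr(1)]] by simp_all
qed

lemma slice_defs:
 "top_sq (fs q) = integral {p0..p1} (%p. (fs q (p, 1))^2 * sin p)"
 "energy_r (frs q) = integral Rect (%z. (frs q z)^2 * (snd z)^2 * sin (fst z))"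
 "energy_p (fps q) = integral Rect (%z. (fps q z)^2 * sin (fst z))"
 by (rule top_sq_def[where f="fs q" and fp="fps q" and fr="frs q"] energy_r_def[where f="fs q" and fp="fps q" and fr="frs q"]
 energy_p_def[where f="fs q" and fp="fps q" and fr="frs q"]; rule slice_assms; assumption)+

definition "DD = (LINT x|LD. (F' x \<bullet> e_rho x)^2 + (F' x \<bullet> e_phi x)^2)"
definition "NN = (LINT x|LD. (F x)^2)"
definition "JJ = (LINT x|LD. 2 * F x * (F' x \<bullet> swirl_field x))"
text \<open>Measures the failure of axial symmetry. Approximants of an axisymmetric function need
  not be axisymmetric, but this quantity tends to 0 along them.\<close>

definition "TT = (LINT x|LD. \<bar>F' x \<bullet> rot_field x\<bar>)"

lemma volume_slices:
 assumes "continuous_on off_axis g"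
 shows "(LINT x|LD. g x) = integral {0..2*pi} (%q. integral Rect (%z. g (spherical (snd z) (fst z) q) * ((snd z)^2 * sin (fst z))))"
 "continuous_on {0..2*pi} (%q. integral Rect (%z. g (spherical (snd z) (fst z) q) * ((snd z)^2 * sin (fst z))))"
 using coord_integral_nested(1)[OF coord_weight_continuous[OF assms]]
 coord_slice_integral_continuous[OF coord_weight_continuous[OF assms]] integral_D_spherical[OF assms]
 by (simp_all add: split_beta')

lemma Rect_z: "z \<in> Rect ==> snd z > 0 \<and> sin (fst z) > 0 \<and> fst z \<in> {p0..p1} \<and> snd z \<in> {r0..1}"
 using sin_p(2)[of "fst z"] r0_bounds(1) by (cases z) (auto simp: cbox_Pair_eq)

lemma slices:
 "NN = integral {0..2*pi} (%q. integral Rect (%z. (fs q z)^2 * (snd z)^2 * sin (fst z)))"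
 "continuous_on {0..2*pi} (%q. integral Rect (%z. (fs q z)^2 * (snd z)^2 * sin (fst z)))"
 "JJ = integral {0..2*pi} (%q. integral Rect (%z. 2 * fs q z * (snd z * frs q z * sin (fst z) + fps q z * cos (fst z))))"
 "continuous_on {0..2*pi} (%q. integral Rect (%z. 2 * fs q z * (snd z * frs q z * sin (fst z) + fps q z * cos (fst z))))"
 "DD = integral {0..2*pi} (%q. energy_r (frs q) + energy_p (fps q))"
 "continuous_on {0..2*pi} (%q. energy_r (frs q) + energy_p (fps q))"
proof -
 note c = C1D(2)[OF F] C1_continuous[OF F] continuous_frame continuous_swirl_field
 have cN: "continuous_on off_axis (%x. (F x)^2)" by (intro continuous_intros c)
 show "NN = integral {0..2*pi} (%q. integral Rect (%z. (fs q z)^2 * (snd z)^2 * sin (fst z)))"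
 "continuous_on {0..2*pi} (%q. integral Rect (%z. (fs q z)^2 * (snd z)^2 * sin (fst z)))"
 using volume_slices[OF cN] by (simp_all add: NN_def mult.assoc)
 have cJ: "continuous_on off_axis (%x. 2 * F x * (F' x \<bullet> swirl_field x))" by (intro continuous_intros c)
 have eJ: "integral Rect (%z. 2 * F (spherical (snd z) (fst z) q) * (F' (spherical (snd z) (fst z) q) \<bullet> swirl_field (spherical (snd z) (fst z) q)) * ((snd z)^2 * sin (fst z)))
 = integral Rect (%z. 2 * fs q z * (snd z * frs q z * sin (fst z) + fps q z * cos (fst z)))" for q
 proof (rule integral_cong)
 fix z assume "z \<in> Rect"
 then have z: "snd z > 0" "sin (fst z) > 0" using Rect_z by auto
 show "2 * F (spherical (snd z) (fst z) q) * (F' (spherical (snd z) (fst z) q) \<bullet> swirl_field (spherical (snd z) (fst z) q)) * ((snd z)^2 * sin (fst z))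
 = 2 * fs q z * (snd z * frs q z * sin (fst z) + fps q z * cos (fst z))"
 unfolding mult.assoc[of "2 * F (spherical (snd z) (fst z) q)"] swirl_field_spherical[OF z] by (simp add: mult_ac)
 qed
 show "JJ = integral {0..2*pi} (%q. integral Rect (%z. 2 * fs q z * (snd z * frs q z * sin (fst z) + fps q z * cos (fst z))))"
 "continuous_on {0..2*pi} (%q. integral Rect (%z. 2 * fs q z * (snd z * frs q z * sin (fst z) + fps q z * cos (fst z))))"
 using volume_slices[OF cJ] unfolding eJ JJ_def by simp_all
 have cD: "continuous_on off_axis (%x. (F' x \<bullet> e_rho x)^2 + (F' x \<bullet> e_phi x)^2)" by (intro continuous_intros c)
 have eD: "integral Rect (%z. ((F' (spherical (snd z) (fst z) q) \<bullet> e_rho (spherical (snd z) (fst z) q))^2 + (F' (spherical (snd z) (fst z) q) \<bullet> e_phi (spherical (snd z) (fst z) q))^2) * ((snd z)^2 * sin (fst z)))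
 = energy_r (frs q) + energy_p (fps q)" for q
 proof -
 have i: "(%z. (frs q z)^2 * (snd z)^2 * sin (fst z)) integrable_on Rect" "(%z. (fps q z)^2 * sin (fst z)) integrable_on Rect"
 by (intro integrable_continuous slice_assms(2,3) continuous_on_mult continuous_on_power continuous_intros)+
 show ?thesis
 unfolding slice_defs(2,3) HKI_integral_add[OF i, symmetric]
 by (rule integral_cong) (simp add: power_mult_distrib algebra_simps)
 qed
 show "DD = integral {0..2*pi} (%q. energy_r (frs q) + energy_p (fps q))"
 "continuous_on {0..2*pi} (%q. energy_r (frs q) + energy_p (fps q))"
 using volume_slices[OF cD] unfolding eD DD_def by simp_all
qed

lemma slice_oscillation:
 assumes q: "q \<in> {0..2*pi}" "q' \<in> {0..2*pi}" and z: "z \<in> Rect"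
 shows "\<bar>fs q z - fs q' z\<bar> <= integral {0..2*pi} (%s. \<bar>fqs s z\<bar>)"
proof -
 have zz: "snd z > 0" "sin (fst z) > 0" "fst z \<in> {p0..p1}" "snd z \<in> {r0..1}" using Rect_z[OF z] by auto
 have cq: "continuous_on {0..2*pi} (%s. fqs s z)"
 proof (rule continuous_on_compose2[of off_axis "%x. F' x \<bullet> rot_field x"])
 show "continuous_on off_axis (%x. F' x \<bullet> rot_field x)" by (intro continuous_intros C1D(2)[OF F] continuous_rot_field)
 show "continuous_on {0..2*pi} (spherical (snd z) (fst z))" by (intro continuous_intros)
 qed (use spherical_off_axis zz in auto)
 have main: "\<bar>fs b z - fs a z\<bar> <= integral {0..2*pi} (%s. \<bar>fqs s z\<bar>)" if ab: "a <= b" "a \<in> {0..2*pi}" "b \<in> {0..2*pi}" for a b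
 proof -
 have sub: "{a..b} \<subseteq> {0..2*pi}" using ab by auto
 have "((%s. fqs s z) has_integral fs b z - fs a z) {a..b}"
 by (rule fundamental_theorem_of_calculus[OF ab(1)])
 (use C1_deriv_spherical(3)[OF F zz(1,2)] in \<open>auto simp flip: has_real_derivative_iff_has_vector_derivative\<close>)
 then have "\<bar>fs b z - fs a z\<bar> = \<bar>integral {a..b} (%s. fqs s z)\<bar>" by (simp add: integral_unique)
 also have "... <= integral {a..b} (%s. \<bar>fqs s z\<bar>)"
 unfolding real_norm_def[symmetric]
 by (rule integral_norm_bound_integral) (auto intro!: integrable_continuous_interval continuous_intros continuous_on_subset[OF cq sub])
 also have "... <= integral {0..2*pi} (%s. \<bar>fqs s z\<bar>)"
 by (rule integral_subset_le[OF sub]) (auto intro!: integrable_continuous_interval continuous_intros continuous_on_subset[OF cq sub] cq)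
 finally show ?thesis .
 qed
 show ?thesis using main[of q q'] main[of q' q] q by (cases "q <= q'") (auto simp: abs_minus_commute)
qed

lemma TT_eq: "TT = integral Rect (%z. integral {0..2*pi} (%s. \<bar>fqs s z\<bar>) * ((snd z)^2 * sin (fst z)))"
 "continuous_on Rect (%z. integral {0..2*pi} (%s. \<bar>fqs s z\<bar>) * ((snd z)^2 * sin (fst z)))"
proof -
 have cT: "continuous_on off_axis (%x. \<bar>F' x \<bullet> rot_field x\<bar>)"
 by (intro continuous_intros C1D(2)[OF F] continuous_rot_field)
 let ?g = "%s z. \<bar>fqs s z\<bar> * ((snd z)^2 * sin (fst z))"
 have c: "continuous_on coord_box (%(s, z). ?g s z)" using coord_weight_continuous[OF cT] by (simp add: split_beta')
 have "TT = integral {0..2*pi} (%s. integral Rect (?g s))" unfolding TT_def using volume_slices(1)[OF cT] .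
 also have "... = integral Rect (%z. integral {0..2*pi} (%s. ?g s z))"
 using integral_swap_continuous[of 0 "(p0, r0)" "2*pi" "(p1, 1)" ?g] c by (simp add: coord_box_def)
 finally show "TT = integral Rect (%z. integral {0..2*pi} (%s. \<bar>fqs s z\<bar>) * ((snd z)^2 * sin (fst z)))" by simp
 have "continuous_on (Rect \<times> cbox 0 (2*pi)) (%(z, s). ?g s z)"
 using continuous_on_compose2[OF c, of "Rect \<times> cbox 0 (2*pi)" prod.swap] continuous_on_swap
 by (auto simp: coord_box_def cbox_Pair_eq split_beta' image_subset_iff)
 from integral_continuous_on_param[OF this]
 show "continuous_on Rect (%z. integral {0..2*pi} (%s. \<bar>fqs s z\<bar>) * ((snd z)^2 * sin (fst z)))" by simp
qed

text \<open>The mean over one meridian half-plane is close to the mean over all of them.\<close>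

lemma slice_mean:
 assumes h: "continuous_on UNIV h" "!!a b :: real. \<bar>h a - h b\<bar> <= \<bar>a - b\<bar>" and q: "q \<in> {0..2*pi}"
 shows "\<bar>integral Rect (%z. h (fs q z) * (snd z)^2 * sin (fst z))\<bar> <= \<bar>LINT x|LD. h (F x)\<bar> / (2 * pi) + TT"
proof -
 let ?c = "%q. integral Rect (%z. h (fs q z) * ((snd z)^2 * sin (fst z)))"
 have ch: "continuous_on off_axis (%x. h (F x))" by (rule continuous_on_compose2[OF h(1) C1_continuous[OF F]]) auto
 have i: "(%z. h (fs q z) * ((snd z)^2 * sin (fst z))) integrable_on Rect" for q
 by (intro integrable_continuous continuous_on_mult slice_continuous[OF ch] continuous_intros)
 have osc: "\<bar>?c q - ?c q'\<bar> <= TT" if q: "q \<in> {0..2*pi}" "q' \<in> {0..2*pi}" for q q'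
 proof -
 have "?c q - ?c q' = integral Rect (%z. (h (fs q z) - h (fs q' z)) * ((snd z)^2 * sin (fst z)))"
 by (subst HKI_integral_diff[OF i i, symmetric]) (simp add: left_diff_distrib)
 also have "\<bar>...\<bar> <= TT"
 unfolding TT_eq(1) real_norm_def[symmetric]
 proof (rule integral_norm_bound_integral)
 show "(%z. (h (fs q z) - h (fs q' z)) * ((snd z)^2 * sin (fst z))) integrable_on Rect"
 by (intro integrable_continuous continuous_on_mult continuous_on_diff slice_continuous[OF ch] continuous_intros)
 show "(%z. integral {0..2*pi} (%s. norm (fqs s z)) * ((snd z)^2 * sin (fst z))) integrable_on Rect"
 using TT_eq(2) by (intro integrable_continuous) simp
 fix z assume z: "z \<in> Rect"
 have "\<bar>h (fs q z) - h (fs q' z)\<bar> <= integral {0..2*pi} (%s. \<bar>fqs s z\<bar>)"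
 using h(2)[of "fs q z" "fs q' z"] slice_oscillation[OF q z] by linarith
 moreover have "0 <= (snd z)^2 * sin (fst z)" using Rect_z[OF z] by simp
 ultimately show "norm ((h (fs q z) - h (fs q' z)) * ((snd z)^2 * sin (fst z)))
 <= integral {0..2*pi} (%s. norm (fqs s z)) * ((snd z)^2 * sin (fst z))"
 unfolding real_norm_def abs_mult[of "h (fs q z) - h (fs q' z)"] abs_of_nonneg[OF \<open>0 <= (snd z)^2 * sin (fst z)\<close>]
 by (rule mult_right_mono)
 qed
 finally show ?thesis .
 qed
 have v: "(LINT x|LD. h (F x)) = integral {0..2*pi} ?c" and vc: "continuous_on {0..2*pi} ?c"
 using volume_slices[OF ch] .
 have "\<bar>integral {0..2*pi} (%q'. ?c q - ?c q')\<bar> <= integral {0..2*pi} (%q'. TT)"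
 unfolding real_norm_def[symmetric]
 by (rule integral_norm_bound_integral) (use osc[OF q] in \<open>auto intro!: integrable_continuous_interval continuous_intros vc\<close>)
 also have "integral {0..2*pi} (%q'. ?c q - ?c q') = 2 * pi * ?c q - (LINT x|LD. h (F x))"
 unfolding v by (subst HKI_integral_diff) (auto intro!: integrable_continuous_interval vc)
 finally have le: "\<bar>2 * pi * ?c q - (LINT x|LD. h (F x))\<bar> <= 2 * pi * TT" by simp
 then have "2 * pi * \<bar>?c q\<bar> <= \<bar>LINT x|LD. h (F x)\<bar> + 2 * pi * TT" 
 using abs_triangle_ineq2[of "2 * pi * ?c q" "LINT x|LD. h (F x)"] abs_mult[of "2 * pi" "?c q"] by (simp add: mult.assoc)
 then have "\<bar>?c q\<bar> <= \<bar>LINT x|LD. h (F x)\<bar> / (2 * pi) + TT" by (simp add: field_simps)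
 then show ?thesis by (simp add: mult.assoc)
qed

text \<open>On a slice, x J - E + N is at most 3/2 x \<open>top_sq\<close> - E/2 by
  \<open>top_sq_bounds_J\<close> and \<open>bulk_le\<close>, and \<open>top_sq_le_abs\<close> bounds
  the first term by 3/8 E plus the L1 term. What remains of E is negative and is dropped, so the
  bulk norm N survives on the good side. Integration over the azimuth gives 3 pi times 10^6, rounded
  up to 10^7.\<close>

lemma volume_inequality_abs:
 fixes x :: nat
 assumes x: "x >= 1"
 shows "x * JJ - DD <= - NN + 10^7 * x^5 / \<alpha> * ((LINT x|LD. \<bar>F x\<bar>) / (2 * pi) + TT)^2"
proof -
 let ?N = "%q. integral Rect (%z. (fs q z)^2 * (snd z)^2 * sin (fst z))"
 let ?J = "%q. integral Rect (%z. 2 * fs q z * (snd z * frs q z * sin (fst z) + fps q z * cos (fst z)))"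
 let ?E = "%q. energy_r (frs q) + energy_p (fps q)"
 define c where "c = (LINT x|LD. \<bar>F x\<bar>) / (2 * pi) + TT"
 have le: "x * ?J q - ?E q <= - ?N q + 3/2 * (10^6 * x^5 / \<alpha>) * c^2" if q: "q \<in> {0..2*pi}" for q
 proof -
 have a0: "0 <= integral Rect (%z. \<bar>fs q z\<bar> * (snd z)^2 * sin (fst z))"
 proof (intro integral_nonneg integrable_continuous continuous_on_mult continuous_on_rabs slice_assms(1) continuous_intros)
 show "0 <= \<bar>fs q z\<bar> * (snd z)^2 * sin (fst z)" if "z \<in> Rect" for z using Rect_z[OF that] by simp
 qed
 have "\<bar>integral Rect (%z. \<bar>fs q z\<bar> * (snd z)^2 * sin (fst z))\<bar> <= \<bar>LINT x|LD. \<bar>F x\<bar>\<bar> / (2 * pi) + TT"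
 by (rule slice_mean[OF _ _ q]) (auto intro!: continuous_intros)
 then have "(integral Rect (%z. \<bar>fs q z\<bar> * (snd z)^2 * sin (fst z)))^2 <= c^2"
 using a0 by (intro power_mono) (auto simp: c_def)
 then have "10^6 * x^5 / \<alpha> * (integral Rect (%z. \<bar>fs q z\<bar> * (snd z)^2 * sin (fst z)))^2 <= 10^6 * x^5 / \<alpha> * c^2"
 using \<alpha>_pos by (intro mult_left_mono) auto
 moreover note top_sq_le_abs[OF slice_assms x, of q] top_sq_bounds_J[OF slice_assms, of q] bulk_le[OF slice_assms, of q]
 moreover have "x * ?J q <= x * top_sq (fs q)" using top_sq_bounds_J[OF slice_assms, of q] by (intro mult_left_mono) auto
 moreover have t: "top_sq (fs q) <= x * top_sq (fs q)"
 proof -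
 have "0 <= top_sq (fs q)"
 unfolding slice_defs(1)
 proof (rule integral_nonneg)
 show "(%p. (fs q (p, 1))^2 * sin p) integrable_on {p0..p1}"
 using Rect_slice(2)[OF slice_assms(1)[of q], of 1] r0_bounds
 by (intro integrable_continuous_interval continuous_on_mult continuous_on_power continuous_intros) auto
 show "0 <= (fs q (p, 1))^2 * sin p" if "p \<in> {p0..p1}" for p using sin_p(2)[OF that] by simp
 qed
 then show ?thesis using x mult_right_mono[of 1 "real x" "top_sq (fs q)"] by simp
 qed
 moreover note energy_r_nonneg[OF slice_assms, of q] energy_p_nonneg[OF slice_assms, of q]
 ultimately show ?thesis by (simp add: add_divide_distrib)
 qed
 have i: "?J integrable_on {0..2*pi}" "?E integrable_on {0..2*pi}" "?N integrable_on {0..2*pi}"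
 by (intro integrable_continuous_interval slices)+
 have "integral {0..2*pi} (%q. x * ?J q - ?E q) <= integral {0..2*pi} (%q. - ?N q + 3/2 * (10^6 * x^5 / \<alpha>) * c^2)"
 proof (rule integral_le)
 show "(%q. x * ?J q - ?E q) integrable_on {0..2*pi}"
 by (intro integrable_continuous_interval continuous_on_diff continuous_on_mult continuous_on_const slices)
 show "(%q. - ?N q + 3/2 * (10^6 * x^5 / \<alpha>) * c^2) integrable_on {0..2*pi}"
 by (intro integrable_continuous_interval continuous_on_add continuous_on_minus continuous_on_const slices)
 qed (rule le)
 also have "integral {0..2*pi} (%q. x * ?J q - ?E q) = x * JJ - DD"
 unfolding slices(3,5) HKI_integral_diff[OF integrable_on_mult_right[OF i(1)] i(2)]
 HKI_integral_mult_right by simp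
 also have "integral {0..2*pi} (%q. - ?N q + 3/2 * (10^6 * x^5 / \<alpha>) * c^2) = - NN + 2 * pi * (3/2 * (10^6 * x^5 / \<alpha>) * c^2)"
 unfolding slices(1) HKI_integral_add[OF integrable_neg[OF i(3)] integrable_const_ivl] by simp
 finally have *: "x * JJ - DD <= - NN + 2 * pi * (3/2 * (10^6 * x^5 / \<alpha>) * c^2)" .
 have "2 * pi * (3/2 * (10^6 * x^5 / \<alpha>) * c^2) <= 2 * 3.2 * (3/2 * (10^6 * x^5 / \<alpha>) * c^2)"
 using pi_approx(2) \<alpha>_pos by (intro mult_right_mono mult_left_mono) auto
 also have "... = 9.6 * (10^6 * x^5 / \<alpha> * c^2)" by simp
 also have "... <= 10 * (10^6 * x^5 / \<alpha> * c^2)" using \<alpha>_pos by (intro mult_right_mono) auto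
 finally show ?thesis using * unfolding c_def[symmetric] by simp
qed

text \<open>That the factor of \<open>DD\<close> is below 1 is the whole point: for mean zero and
  vanishing \<open>TT\<close> the drift is dominated by the diffusion. The factor 100 rounds up 13
  times 2 pi.\<close>

lemma volume_inequality_mean:
 "JJ <= 0.95 * DD + 100 / \<alpha> * (\<bar>LINT x|LD. F x\<bar> / (2 * pi) + TT)^2"
proof -
 let ?J = "%q. integral Rect (%z. 2 * fs q z * (snd z * frs q z * sin (fst z) + fps q z * cos (fst z)))"
 let ?E = "%q. energy_r (frs q) + energy_p (fps q)"
 define c where "c = \<bar>LINT x|LD. F x\<bar> / (2 * pi) + TT"
 have le: "?J q <= 0.95 * ?E q + 13 / \<alpha> * c^2" if q: "q \<in> {0..2*pi}" for q
 proof -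
 have "\<bar>integral Rect (%z. fs q z * (snd z)^2 * sin (fst z))\<bar> <= c"
 unfolding c_def by (rule slice_mean[OF _ _ q, where h="%x. x"]) auto
 then have "\<bar>integral Rect (%z. fs q z * (snd z)^2 * sin (fst z))\<bar>^2 <= c^2" by (intro power_mono) auto
 then have "13 / \<alpha> * (integral Rect (%z. fs q z * (snd z)^2 * sin (fst z)))^2 <= 13 / \<alpha> * c^2"
 using \<alpha>_pos by (intro mult_left_mono) auto
 then show ?thesis using top_sq_le_mean[OF slice_assms, of q] top_sq_bounds_J[OF slice_assms, of q] by linarith
 qed
 have i: "?J integrable_on {0..2*pi}" "?E integrable_on {0..2*pi}"
 by (intro integrable_continuous_interval slices)+
 have "JJ <= integral {0..2*pi} (%q. 0.95 * ?E q + 13 / \<alpha> * c^2)"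
 unfolding slices(3)
 proof (rule integral_le)
 show "?J integrable_on {0..2*pi}" by (rule i)
 show "(%q. 0.95 * ?E q + 13 / \<alpha> * c^2) integrable_on {0..2*pi}"
 by (rule integrable_add[OF integrable_on_mult_right[OF i(2)] integrable_const_ivl])
 qed (rule le)
 also have "... = 0.95 * DD + 2 * pi * (13 / \<alpha> * c^2)"
 unfolding slices(5) HKI_integral_add[OF integrable_on_mult_right[OF i(2)] integrable_const_ivl]
 HKI_integral_mult_right by simp
 also have "2 * pi * (13 / \<alpha> * c^2) <= 2 * 3.2 * (13 / \<alpha> * c^2)"
 using pi_approx(2) \<alpha>_pos by (intro mult_right_mono mult_left_mono) auto
 finally have *: "JJ <= 0.95 * DD + 83.2 * (1 / \<alpha> * c^2)" by simp
 have "83.2 * (1 / \<alpha> * c^2) <= 100 * (1 / \<alpha> * c^2)" using \<alpha>_pos by (intro mult_right_mono) auto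
 then show ?thesis using * unfolding c_def[symmetric] by simp
qed

end

end

context cone begin

lemma LD_cong: "(!!x. x \<in> D ==> f x = g x) ==> (LINT x|LD. f x) = (LINT x|LD. g x)"
 by (rule BI_cong) auto

lemma AE_LD: "(!!x. x \<in> D ==> Q x) ==> AE x in LD. Q x"
 by (rule AE_I2) auto

lemma l2_inner_continuous:
 assumes "l2 LD g" "continuous_on off_axis e" shows "l2 LD (%x. g x \<bullet> e x)"
proof -
 obtain C where "AE x in LD. norm (e x) <= C" using continuous_AE_bounded_D[OF assms(2)] by blast
 then show ?thesis by (rule l2_inner_bounded[OF assms(1) continuous_measurable_D[OF assms(2)]])
qed

lemma l2_mult_continuous:
 fixes g :: "real^3 => real"
 assumes "l2 LD g" "continuous_on off_axis e" shows "l2 LD (%x. e x * g x)"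
 using l2_inner_continuous[OF assms] by (simp add: mult.commute)

lemma integrable_mult_continuous:
 fixes g :: "real^3 => real"
 assumes "continuous_on off_axis e" "l2 LD g" shows "integrable LD (%x. e x * g x)"
 by (rule l2_integrable[OF finite_measure_D l2_mult_continuous[OF assms(2,1)]])

lemma l2lim_inner_continuous:
 assumes "l2lim LD G g" "continuous_on off_axis e" shows "l2lim LD (%n x. G n x \<bullet> e x) (%x. g x \<bullet> e x)"
proof -
 obtain C where "AE x in LD. norm (e x) <= C" using continuous_AE_bounded_D[OF assms(2)] by blast
 then show ?thesis by (rule l2lim_inner_bounded[OF assms(1) continuous_measurable_D[OF assms(2)]])
qed

lemma H1lim_cong_AE:
 assumes F: "H1lim F F' f g" and e: "AE x in LD. f x = f2 x" "AE x in LD. g x = g2 x"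
 shows "H1lim F F' f2 g2"
 unfolding H1lim_def
 using H1limD(1)[OF F] l2lim_cong_AE[OF H1limD(2)[OF F] e(1) l2_measurable[OF l2_cong_AE[OF D_sets H1lim_l2(1)[OF F] e(1)]]]
 l2lim_cong_AE[OF H1limD(3)[OF F] e(2) l2_measurable[OF l2_cong_AE[OF D_sets H1lim_l2(2)[OF F] e(2)]]]
 by blast

subsection \<open>The volume inequalities for weakly differentiable functions\<close>

text \<open>All quantities are continuous along the approximation, and the error \<open>TT\<close>
  of the approximants tends to 0 because the limiting gradient has no azimuthal part.\<close>

lemma H1lim_inequalities:
 assumes F: "H1lim F F' f g" and ax: "AE x in LD. g x \<bullet> rot_field x = 0"
 defines "J \<equiv> LINT x|LD. 2 * f x * (g x \<bullet> swirl_field x)"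
 and "E \<equiv> LINT x|LD. (g x \<bullet> e_rho x)^2 + (g x \<bullet> e_phi x)^2"
 shows "1 <= k ==> real k * J - E <= - (LINT x|LD. (f x)^2) + 10^7 * real k^5 / \<alpha> * ((LINT x|LD. \<bar>f x\<bar>) / (2 * pi))^2"
 and "J <= 0.95 * E + 100 / \<alpha> * (\<bar>LINT x|LD. f x\<bar> / (2 * pi))^2"
proof -
 note lr = l2lim_inner_continuous[OF H1limD(3)[OF F] continuous_frame(1)]
 note lp = l2lim_inner_continuous[OF H1limD(3)[OF F] continuous_frame(2)]
 note ls = l2lim_inner_continuous[OF H1limD(3)[OF F] continuous_swirl_field]
 note lt = l2lim_inner_continuous[OF H1limD(3)[OF F] continuous_rot_field]
 note C = H1limD(1)[OF F]
 have sq: "(%n. LINT x|LD. (h n x)^2) \<longlonglongrightarrow> (LINT x|LD. (h' x)^2)" if "l2lim LD h h'" for h :: "nat => real^3 => real" and h'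
 using l2lim_norm_sq[OF that] by simp
 have i2: "integrable LD (%x. (h x)^2)" if "l2 LD h" for h :: "real^3 => real"
 using that by (simp add: l2_def)
 have E: "(%n. DD (F' n)) \<longlonglongrightarrow> E"
 proof -
 have "(%n. (LINT x|LD. (F' n x \<bullet> e_rho x)^2) + (LINT x|LD. (F' n x \<bullet> e_phi x)^2)) \<longlonglongrightarrow>
 (LINT x|LD. (g x \<bullet> e_rho x)^2) + (LINT x|LD. (g x \<bullet> e_phi x)^2)"
 by (intro tendsto_intros sq lr lp)
 moreover have "DD (F' n) = (LINT x|LD. (F' n x \<bullet> e_rho x)^2) + (LINT x|LD. (F' n x \<bullet> e_phi x)^2)" for n
 unfolding DD_def[OF C[of n]] by (rule BI_add[OF i2[OF l2lim_l2(1)[OF lr]] i2[OF l2lim_l2(1)[OF lp]]])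
 moreover have "E = (LINT x|LD. (g x \<bullet> e_rho x)^2) + (LINT x|LD. (g x \<bullet> e_phi x)^2)"
 unfolding E_def by (rule BI_add[OF i2[OF l2lim_l2(2)[OF lr]] i2[OF l2lim_l2(2)[OF lp]]])
 ultimately show ?thesis by simp
 qed
 have J: "(%n. JJ (F n) (F' n)) \<longlonglongrightarrow> J"
 proof -
 have "(%n. 2 * (LINT x|LD. F n x * (F' n x \<bullet> swirl_field x))) \<longlonglongrightarrow> 2 * (LINT x|LD. f x * (g x \<bullet> swirl_field x))"
 by (intro tendsto_intros l2lim_mult_real H1limD(2)[OF F] ls)
 moreover have "JJ (F n) (F' n) = 2 * (LINT x|LD. F n x * (F' n x \<bullet> swirl_field x))" for n
 unfolding JJ_def[OF C[of n]] by (simp add: mult.assoc)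
 ultimately show ?thesis unfolding J_def by (simp add: mult.assoc)
 qed
 have N: "(%n. NN (F n)) \<longlonglongrightarrow> (LINT x|LD. (f x)^2)"
 using sq[OF H1limD(2)[OF F]] NN_def[OF C] by simp
 have "(%n. LINT x|LD. \<bar>F' n x \<bullet> rot_field x\<bar>) \<longlonglongrightarrow> (LINT x|LD. \<bar>g x \<bullet> rot_field x\<bar>)"
 by (rule l2lim_integral[OF finite_measure_D l2lim_abs[OF lt]])
 moreover have "(LINT x|LD. \<bar>g x \<bullet> rot_field x\<bar>) = 0"
 by (rule integral_eq_zero_AE) (use ax in \<open>auto elim: eventually_mono\<close>)
 ultimately have T: "(%n. TT (F' n)) \<longlonglongrightarrow> 0" using TT_def[OF C] by simp
 have A: "(%n. LINT x|LD. \<bar>F n x\<bar>) \<longlonglongrightarrow> (LINT x|LD. \<bar>f x\<bar>)" and B: "(%n. LINT x|LD. F n x) \<longlonglongrightarrow> (LINT x|LD. f x)"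
 by (rule l2lim_integral[OF finite_measure_D] l2lim_abs H1limD(2)[OF F])+
 show "real k * J - E <= - (LINT x|LD. (f x)^2) + 10^7 * real k^5 / \<alpha> * ((LINT x|LD. \<bar>f x\<bar>) / (2 * pi))^2" if k: "1 <= k"
 proof (rule LIMSEQ_le)
 show "(%n. real k * JJ (F n) (F' n) - DD (F' n)) \<longlonglongrightarrow> real k * J - E" by (intro tendsto_intros J E)
 have "(%n. - NN (F n) + 10^7 * real k^5 / \<alpha> * ((LINT x|LD. \<bar>F n x\<bar>) / (2 * pi) + TT (F' n))^2)
 \<longlonglongrightarrow> - (LINT x|LD. (f x)^2) + 10^7 * real k^5 / \<alpha> * ((LINT x|LD. \<bar>f x\<bar>) / (2 * pi) + 0)^2"
 by (intro tendsto_intros N A T) simp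
 then show "(%n. - NN (F n) + 10^7 * real k^5 / \<alpha> * ((LINT x|LD. \<bar>F n x\<bar>) / (2 * pi) + TT (F' n))^2)
 \<longlonglongrightarrow> - (LINT x|LD. (f x)^2) + 10^7 * real k^5 / \<alpha> * ((LINT x|LD. \<bar>f x\<bar>) / (2 * pi))^2" by simp
 qed (use volume_inequality_abs[OF C k] in auto)
 show "J <= 0.95 * E + 100 / \<alpha> * (\<bar>LINT x|LD. f x\<bar> / (2 * pi))^2"
 proof (rule LIMSEQ_le[OF J])
 have "(%n. 0.95 * DD (F' n) + 100 / \<alpha> * (\<bar>LINT x|LD. F n x\<bar> / (2 * pi) + TT (F' n))^2)
 \<longlonglongrightarrow> 0.95 * E + 100 / \<alpha> * (\<bar>LINT x|LD. f x\<bar> / (2 * pi) + 0)^2"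
 by (intro tendsto_intros E B T) simp
 then show "(%n. 0.95 * DD (F' n) + 100 / \<alpha> * (\<bar>LINT x|LD. F n x\<bar> / (2 * pi) + TT (F' n))^2)
 \<longlonglongrightarrow> 0.95 * E + 100 / \<alpha> * (\<bar>LINT x|LD. f x\<bar> / (2 * pi))^2" by simp
 qed (use volume_inequality_mean[OF C] in auto)
qed

text \<open>In the gradient h'(F) F' the factor F' converges in L2 only; a subsequence along which F
  converges almost everywhere lets the bounded factor h'(F) converge in the complementary sense of
  \<open>l2lim_mult_AE\<close>.\<close>

lemma H1lim_compose:
 assumes F: "H1lim F F' f g" and h: "!!s. (h has_real_derivative h' s) (at s)" "continuous_on UNIV h'" "!!s. \<bar>h' s\<bar> <= C"
 shows "\<exists>F2 F2'. H1lim F2 F2' (%x. h (f x)) (%x. h' (f x) *\<^sub>R g x)"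
proof -
 obtain r where r: "strict_mono r" "AE x in LD. (%n. F (r n) x) \<longlonglongrightarrow> f x"
 using l2lim_AE_subseq[OF H1limD(2)[OF F]] by blast
 have ch: "continuous_on UNIV h" using h(1) DERIV_isCont by (auto intro!: continuous_at_imp_continuous_on)
 have lip: "\<bar>h a - h b\<bar> <= C * \<bar>a - b\<bar>" for a b
 using field_differentiable_bound[of UNIV h h' C a b] h by auto
 note fm [measurable] = l2_measurable[OF H1lim_l2(1)[OF F]]
 have m: "(%x. h (f x)) \<in> borel_measurable LD" "(%x. h' (f x)) \<in> borel_measurable LD"
 using measurable_compose[OF fm borel_measurable_continuous_onI[OF ch]] measurable_compose[OF fm borel_measurable_continuous_onI[OF h(2)]] by auto
 have C1: "C1 (%x. h (F (r n) x)) (%x. h' (F (r n) x) *\<^sub>R F' (r n) x)" for n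
 by (rule C1_compose[OF H1limD(1)[OF F]]) (auto intro: h(1) continuous_on_subset[OF h(2)])
 have l: "l2 LD (%x. h (f x))"
 proof (rule l2_dominated[OF m(1)])
 show "AE x in LD. (norm (h (f x)))^2 <= 2 * (norm (h 0))^2 + 2 * (C^2 * (norm (f x))^2)"
 proof (rule AE_I2)
 fix x
 have "(norm (h (f x)))^2 <= 2 * (norm (h 0))^2 + 2 * (norm (h (f x) - h 0))^2"
 using norm_add_sq_le[of "h 0" "h (f x) - h 0"] by simp
 moreover have "(norm (h (f x) - h 0))^2 <= (C * \<bar>f x\<bar>)^2" using lip[of "f x" 0] by (intro power_mono) auto
 ultimately show "(norm (h (f x)))^2 <= 2 * (norm (h 0))^2 + 2 * (C^2 * (norm (f x))^2)" by (simp add: power_mult_distrib)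
 qed
 interpret finite_measure LD by (rule finite_measure_D)
 show "integrable LD (%x. 2 * (norm (h 0))^2 + 2 * (C^2 * (norm (f x))^2))"
 using H1lim_l2(1)[OF F] by (auto simp: l2_def)
 qed
 have l1: "l2lim LD (%n x. h (F (r n) x)) (%x. h (f x))"
 proof (rule l2lim_bound[OF l2lim_subseq[OF H1limD(2)[OF F] r(1)] _ l])
 show "l2 LD (%x. h (F (r n) x))" for n by (rule continuous_l2_D[OF C1_continuous[OF C1]])
 show "AE x in LD. (norm (h (F (r n) x) - h (f x)))^2 <= C^2 * (norm (F (r n) x - f x))^2" for n
 proof (rule AE_I2)
 fix x show "(norm (h (F (r n) x) - h (f x)))^2 <= C^2 * (norm (F (r n) x - f x))^2"
 unfolding power_mult_distrib[symmetric] using lip[of "F (r n) x" "f x"] by (intro power_mono) auto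
 qed
 qed
 have l2: "l2lim LD (%n x. h' (F (r n) x) *\<^sub>R F' (r n) x) (%x. h' (f x) *\<^sub>R g x)"
 proof (rule l2lim_mult_AE[OF l2lim_subseq[OF H1limD(3)[OF F] r(1)] _ m(2)])
 show "(%x. h' (F (r n) x)) \<in> borel_measurable LD" for n
 by (rule continuous_measurable_D[OF continuous_on_compose2[OF h(2) C1_continuous[OF H1limD(1)[OF F]]]]) auto
 show "AE x in LD. (%n. h' (F (r n) x)) \<longlonglongrightarrow> h' (f x)"
 using r(2)
 proof eventually_elim
 case (elim x)
 have "isCont h' (f x)" using h(2) by (simp add: continuous_on_eq_continuous_at)
 from isCont_tendsto_compose[OF this elim] show ?case .
 qed
 show "AE x in LD. \<bar>h' (F (r n) x)\<bar> <= C" for n using h(3) by simp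
 qed
 show ?thesis
 by (intro exI[of _ "%n x. h (F (r n) x)"] exI[of _ "%n x. h' (F (r n) x) *\<^sub>R F' (r n) x"]) (simp add: H1lim_def C1 l1 l2)
qed

text \<open>The derivative of a power is unbounded, so it is truncated at the level \<open>N\<close>
  that bounds \<open>f\<close>. The antiderivative of the truncation differs from the power by a
  constant on [-N, N], which is all that \<open>f\<close> sees.\<close>

lemma H1lim_power:
 assumes F: "H1lim F F' f g" and M: "AE x in LD. \<bar>f x\<bar> <= M"
 shows "\<exists>F2 F2'. H1lim F2 F2' (%x. f x ^ k) (%x. (real k * f x ^ (k - 1)) *\<^sub>R g x)"
proof -
 define N where "N = max M 0"
 define cl where "cl s = max (- N) (min N s)" for s :: real
 define h' where "h' s = real k * cl s ^ (k - 1)" for s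
 have clN: "\<bar>cl s\<bar> <= N" "\<bar>s\<bar> <= N ==> cl s = s" for s by (auto simp: cl_def N_def)
 have ch': "continuous_on UNIV h'" unfolding h'_def cl_def by (intro continuous_intros)
 obtain h0 where h0: "!!s. (h0 has_vector_derivative h' s) (at s)"
 using einterval_antiderivative[of "-\<infinity>" "\<infinity>" h'] ch' by (auto simp: continuous_on_eq_continuous_at)
 then have h0: "(h0 has_real_derivative h' s) (at s)" for s
 by (simp add: has_real_derivative_iff_has_vector_derivative)
 have "\<exists>c. \<forall>s\<in>{-N..N}. h0 s - s ^ k = c"
 proof (rule has_field_derivative_zero_constant)
 fix s assume "s \<in> {-N..N}"
 then have "h' s = real k * s ^ (k - 1)" using clN(2)[of s] by (auto simp: h'_def)
 then show "((%s. h0 s - s ^ k) has_field_derivative 0) (at s within {-N..N})"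
 using DERIV_subset[OF h0[of s], of "{-N..N}"] by (auto intro!: derivative_eq_intros)
 qed simp
 then obtain c where c0: "\<forall>s\<in>{-N..N}. h0 s - s ^ k = c" by blast
 have c: "h0 s - c = s ^ k" if "\<bar>s\<bar> <= N" for s
 proof -
 from that have "s \<in> {-N..N}" by auto
 with c0 have "h0 s - s ^ k = c" by blast
 then show ?thesis by simp
 qed
 have "\<bar>h' s\<bar> <= real k * N ^ (k - 1)" for s
 unfolding h'_def abs_mult power_abs using clN(1)[of s] by (intro mult_mono power_mono) auto
 moreover have d: "((%s. h0 s - c) has_real_derivative h' s) (at s)" for s using DERIV_diff[OF h0 DERIV_const] by simp
 ultimately obtain F2 F2' where F2: "H1lim F2 F2' (%x. h0 (f x) - c) (%x. h' (f x) *\<^sub>R g x)"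
 using H1lim_compose[OF F d ch'] by blast
 have "AE x in LD. \<bar>f x\<bar> <= N" using M by eventually_elim (simp add: N_def)
 then have e: "AE x in LD. h0 (f x) - c = f x ^ k" "AE x in LD. h' (f x) *\<^sub>R g x = (real k * f x ^ (k - 1)) *\<^sub>R g x"
 by (eventually_elim, simp add: c clN(2) h'_def)+
 show ?thesis using H1lim_cong_AE[OF F2 e] by blast
qed

end

subsection \<open>Weak derivatives of the angular momentum\<close>

lemma inner_axis_1: "x \<bullet> axis i (1::real) = x $ i" by (simp add: inner_axis)

lemma axis_Basis: "axis i (1::real) \<in> (Basis :: (real^3) set)" by (auto simp: Basis_vec_def)

lemma inner_rot_field: "f \<bullet> rot_field x = x $ 1 * f $ 2 - x $ 2 * f $ 1"
 by (simp add: inner_3 rot_field_def)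

lemma frechet_mult_inner:
 assumes "smooth f"
 shows "frechet_derivative (%x. f x * (x \<bullet> c)) (at x) b = f x * (b \<bullet> c) + frechet_derivative f (at x) b * (x \<bullet> c)"
proof -
 have "((%x. x \<bullet> c) has_derivative (%h. h \<bullet> c)) (at x)" by (auto intro!: derivative_eq_intros)
 from has_derivative_mult[OF smooth_has_derivative[OF assms] this]
 show ?thesis by (simp add: frechet_derivative_at[symmetric])
qed

lemma weak_deriv_inner:
 fixes f g :: "'a::euclidean_space => 'b::euclidean_space"
 assumes U: "open U" and f: "has_weak_deriv U b f g" and t: "test_function U \<psi>" and b: "b \<in> Basis"
 shows "(LINT x|lebesgue_on U. frechet_derivative \<psi> (at x) b * (f x \<bullet> d)) = - (LINT x|lebesgue_on U. \<psi> x * (g x \<bullet> d))"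
 "integrable (lebesgue_on U) (%x. frechet_derivative \<psi> (at x) b * (f x \<bullet> d))"
 "integrable (lebesgue_on U) (%x. \<psi> x * (g x \<bullet> d))" "integrable (lebesgue_on U) (%x. \<psi> x * (f x \<bullet> d))"
proof -
 have li: "locally_integrable U f" "locally_integrable U g" using f by (auto simp: has_weak_deriv_def)
 note i = test_function_deriv_integrable[OF t li(1) U b] test_function_integrable[OF t li(2) U] test_function_integrable[OF t li(1) U]
 show "integrable (lebesgue_on U) (%x. frechet_derivative \<psi> (at x) b * (f x \<bullet> d))"
 "integrable (lebesgue_on U) (%x. \<psi> x * (g x \<bullet> d))" "integrable (lebesgue_on U) (%x. \<psi> x * (f x \<bullet> d))"
 using i[THEN integrable_inner_left[of d]] by simp_all
 have e: "(LINT x|lebesgue_on U. frechet_derivative \<psi> (at x) b *\<^sub>R f x) = - (LINT x|lebesgue_on U. \<psi> x *\<^sub>R g x)"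
 using f t by (simp add: has_weak_deriv_def)
 have "(LINT x|lebesgue_on U. (frechet_derivative \<psi> (at x) b *\<^sub>R f x) \<bullet> d) = - (LINT x|lebesgue_on U. (\<psi> x *\<^sub>R g x) \<bullet> d)"
 using i e by (simp del: inner_scaleR_left)
 then show "(LINT x|lebesgue_on U. frechet_derivative \<psi> (at x) b * (f x \<bullet> d)) = - (LINT x|lebesgue_on U. \<psi> x * (g x \<bullet> d))" by simp
qed

text \<open>The product rule with the linear field \<open>rot_field\<close>, whose derivative in
  direction \<open>b\<close> is \<open>rot_field b\<close>. It is obtained componentwise by using
  the test functions \<psi> x1 and \<psi> x2.\<close>

lemma weak_deriv_rot:
 fixes f g :: "real^3 => real^3"
 assumes U: "open U" and f: "has_weak_deriv U b f g" and t: "test_function U \<psi>" and b: "b \<in> Basis"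
 shows "(LINT x|lebesgue_on U. frechet_derivative \<psi> (at x) b * (f x \<bullet> rot_field x))
 = - (LINT x|lebesgue_on U. \<psi> x * (g x \<bullet> rot_field x + f x \<bullet> rot_field b))"
proof -
 have sm: "smooth \<psi>" using t by (simp add: test_function_def)
 note A = weak_deriv_inner[OF U f test_function_mult[OF t smooth_inner[of "axis 1 1 :: real^3"]] b, of "axis 2 1 :: real^3", unfolded frechet_mult_inner[OF sm], unfolded inner_axis_1]
 note B = weak_deriv_inner[OF U f test_function_mult[OF t smooth_inner[of "axis 2 1 :: real^3"]] b, of "axis 1 1 :: real^3", unfolded frechet_mult_inner[OF sm], unfolded inner_axis_1]
 note R = weak_deriv_inner(4)[OF U f t b, of "rot_field b"]
 let ?I = "integral\<^sup>L (lebesgue_on U)"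
 have 1: "?I (%x. frechet_derivative \<psi> (at x) b * (f x \<bullet> rot_field x))
 = ?I (%x. (\<psi> x * b $ 1 + frechet_derivative \<psi> (at x) b * x $ 1) * f x $ 2
 - (\<psi> x * b $ 2 + frechet_derivative \<psi> (at x) b * x $ 2) * f x $ 1 - \<psi> x * (f x \<bullet> rot_field b))"
 by (rule BI_cong) (auto simp: inner_rot_field algebra_simps)
 have 2: "?I (%x. \<psi> x * (g x \<bullet> rot_field x + f x \<bullet> rot_field b))
 = ?I (%x. \<psi> x * x $ 1 * g x $ 2 - \<psi> x * x $ 2 * g x $ 1 + \<psi> x * (f x \<bullet> rot_field b))"
 by (rule BI_cong) (auto simp: inner_rot_field algebra_simps)
 show ?thesis
 unfolding 1 2 BI_diff[OF Bochner_Integration.integrable_diff[OF A(2) B(2)] R]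
 BI_diff[OF A(2) B(2)] A(1) B(1)
 BI_add[OF Bochner_Integration.integrable_diff[OF A(3) B(3)] R] BI_diff[OF A(3) B(3)]
 by simp
qed

lemma C1_frechet: "C1 F F' ==> x \<in> off_axis ==> frechet_derivative F (at x) b = F' x \<bullet> b"
 using frechet_derivative_at[OF C1D(1)] by metis

lemma swirl_frame:
 assumes "x \<in> off_axis"
 shows "swirl_field x \<bullet> e_rho x = 1 / norm x" "swirl_field x \<bullet> e_phi x = x $ 3 / (cyl x * norm x)" "swirl_field x \<bullet> e_theta x = 0"
proof -
 have p: "cyl x ~= 0" "norm x ~= 0" using cyl_pos[OF assms] norm_pos_off_axis[OF assms] by auto
 have k: "x $ 1 * x $ 1 + x $ 2 * x $ 2 = (cyl x)^2" using cyl_sq[of x] by (simp add: power2_eq_square)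
 have "vector [x $ 1, x $ 2, 0] \<bullet> (x /\<^sub>R norm x) = (x $ 1 * x $ 1 + x $ 2 * x $ 2) / norm x"
 by (simp add: inner_3 field_simps add_divide_distrib)
 then show "swirl_field x \<bullet> e_rho x = 1 / norm x" using p unfolding swirl_field_def e_rho_eq[OF assms] k by simp
 have "vector [x $ 1, x $ 2, 0] \<bullet> e_phi x = (x $ 1 * x $ 1 + x $ 2 * x $ 2) * (x $ 3 / (cyl x * norm x))"
 unfolding e_phi_eq[OF assms] by (simp add: inner_3 algebra_simps add_divide_distrib)
 then show "swirl_field x \<bullet> e_phi x = x $ 3 / (cyl x * norm x)" using p unfolding swirl_field_def k by simp
 show "swirl_field x \<bullet> e_theta x = 0" unfolding swirl_field_def e_theta_eq[OF assms] by (simp add: inner_3 rot_field_def)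
qed

text \<open>The determinant of two horizontal vectors, expanded in the orthogonal radial and
  rotational directions, both of squared length \<open>k\<close>. The first product will be the
  swirl term; the second is the one that axial symmetry removes.\<close>

lemma swirl_algebra:
 fixes k :: real
 assumes k: "k = x1^2 + x2^2" "k > 0"
 shows "a * u2 - b * u1 = (x1 * u2 - x2 * u1) * ((1/k) * (x1 * a + x2 * b)) - ((u1 * x1 + u2 * x2) / k) * (x1 * b - x2 * a)"
proof -
 have "k * (a * u2 - b * u1) = (x1 * u2 - x2 * u1) * (x1 * a + x2 * b) - (u1 * x1 + u2 * x2) * (x1 * b - x2 * a)"
 unfolding k(1) by (simp add: algebra_simps power2_eq_square)
 then have "a * u2 - b * u1 = ((x1 * u2 - x2 * u1) * (x1 * a + x2 * b) - (u1 * x1 + u2 * x2) * (x1 * b - x2 * a)) / k"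
 using k(2) by (simp add: eq_divide_eq mult.commute)
 then show ?thesis by (simp add: diff_divide_distrib)
qed

context cone begin

lemma has_weak_deriv_cong_AE:
 assumes f: "has_weak_deriv D b f g" and e: "AE x in LD. f x = f2 x" and l: "l2 LD f2" and b: "b \<in> Basis"
 shows "has_weak_deriv D b f2 g"
 unfolding has_weak_deriv_def
proof (intro conjI allI impI)
 note li = f[unfolded has_weak_deriv_def]
 show "locally_integrable D f2" by (rule l2_locally_integrable[OF l])
 show "locally_integrable D g" using li by simp
 fix \<psi> assume t: "test_function D \<psi>"
 have "(LINT x|LD. frechet_derivative \<psi> (at x) b *\<^sub>R f2 x) = (LINT x|LD. frechet_derivative \<psi> (at x) b *\<^sub>R f x)"
 proof (rule integral_cong_AE)
 show "(%x. frechet_derivative \<psi> (at x) b *\<^sub>R f2 x) \<in> borel_measurable LD"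
 by (rule borel_measurable_integrable[OF test_function_deriv_integrable[OF t \<open>locally_integrable D f2\<close> open_D b]])
 show "(%x. frechet_derivative \<psi> (at x) b *\<^sub>R f x) \<in> borel_measurable LD"
 by (rule borel_measurable_integrable[OF test_function_deriv_integrable[OF t _ open_D b]]) (use li in simp)
 qed (use e in \<open>auto elim: eventually_mono\<close>)
 then show "(LINT x|LD. frechet_derivative \<psi> (at x) b *\<^sub>R f2 x) = - (LINT x|LD. \<psi> x *\<^sub>R g x)"
 using li t by simp
qed

text \<open>\<open>rot_field\<close> is divergence free, so testing its pairing with the gradient
  moves the azimuthal derivative onto the test function, and \<open>axisymmetric_ibp\<close> gives
  0.\<close>

lemma axisymmetric_gradient:
 assumes ax: "axisymmetric D f" and f: "l2 LD f" "!!b. b \<in> Basis ==> has_weak_deriv D b f (%x. g x \<bullet> b)" and g: "l2 LD g"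
 shows "AE x in LD. g x \<bullet> rot_field x = 0"
proof (rule fundamental_lemma[OF open_D])
 show "locally_integrable D (%x. g x \<bullet> rot_field x)"
 by (rule l2_locally_integrable[OF l2_inner_continuous[OF g continuous_rot_field]])
 fix \<psi> assume t: "test_function D \<psi>"
 have sm: "smooth \<psi>" using t by (simp add: test_function_def)
 note A = weak_deriv_inner[OF open_D f(2)[OF axis_Basis[of 2]] test_function_mult[OF t smooth_inner[of "axis 1 1 :: real^3"]] axis_Basis[of 2], of 1,
 unfolded frechet_mult_inner[OF sm], unfolded inner_axis_1]
 note B = weak_deriv_inner[OF open_D f(2)[OF axis_Basis[of 1]] test_function_mult[OF t smooth_inner[of "axis 2 1 :: real^3"]] axis_Basis[of 1], of 1,
 unfolded frechet_mult_inner[OF sm], unfolded inner_axis_1]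
 let ?p = "%x. \<Sum>b\<in>Basis. frechet_derivative \<psi> (at x) b *\<^sub>R b"
 have p: "?p x $ i = frechet_derivative \<psi> (at x) (axis i 1)" for x i
 using grad_inner_Basis[OF axis_Basis[of i], of "frechet_derivative \<psi> (at x)"] by (simp only: inner_axis_1)
 have z: "(LINT x|LD. f x * (?p x \<bullet> rot_field x)) = 0"
 by (rule axisymmetric_ibp[OF ax l2_integrable[OF finite_measure_D f(1)] test_C1[OF t]])
 have "(LINT x|LD. \<psi> x * (g x \<bullet> rot_field x)) = (LINT x|LD. \<psi> x * x $ 1 * ((g x $ 2) \<bullet> 1) - \<psi> x * x $ 2 * ((g x $ 1) \<bullet> 1))"
 by (rule LD_cong) (simp add: inner_rot_field algebra_simps)
 also have "... = - ((LINT x|LD. (\<psi> x * (axis 2 1 :: real^3) $ 1 + frechet_derivative \<psi> (at x) (axis 2 1) * x $ 1) * (f x \<bullet> 1))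
 - (LINT x|LD. (\<psi> x * (axis 1 1 :: real^3) $ 2 + frechet_derivative \<psi> (at x) (axis 1 1) * x $ 2) * (f x \<bullet> 1)))"
 unfolding BI_diff[OF A(3) B(3)] A(1) B(1) by simp
 also have "... = - (LINT x|LD. f x * (?p x \<bullet> rot_field x))"
 unfolding BI_diff[OF A(2) B(2), symmetric]
 by (intro arg_cong[where f=uminus] LD_cong) (simp only: inner_rot_field p, simp add: axis_3_nth algebra_simps)
 finally show "(LINT x|LD. \<psi> x * (g x \<bullet> rot_field x)) = 0" using z by simp
qed

text \<open>The product rule for fluxes without boundary term. It is used because the boundary
  conditions concern \<open>comp_theta\<close>, while the flux of the angular momentum differs from
  them by a C1 factor.\<close>

lemma zero_flux_mult:
 assumes q: "\<exists>q. l2 LD q \<and> (\<forall>\<psi> \<psi>'. C1 \<psi> \<psi>' --> (LINT x|LD. q x * \<psi> x) = - (LINT x|LD. y x * (\<psi>' x \<bullet> e x)))"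
 and y: "l2 LD y" and c: "C1 c c'" and e: "continuous_on off_axis e"
 shows "\<exists>q. l2 LD q \<and> (\<forall>\<psi> \<psi>'. C1 \<psi> \<psi>' --> (LINT x|LD. q x * \<psi> x) = - (LINT x|LD. (c x * y x) * (\<psi>' x \<bullet> e x)))"
proof -
 from q obtain q where q: "l2 LD q" "!!\<psi> \<psi>'. C1 \<psi> \<psi>' ==> (LINT x|LD. q x * \<psi> x) = - (LINT x|LD. y x * (\<psi>' x \<bullet> e x))" by blast
 note cc = C1_continuous[OF c] C1D(2)[OF c]
 have ce: "continuous_on off_axis (%x. c' x \<bullet> e x)" by (intro continuous_intros cc e)
 define q' where "q' x = c x * q x + (c' x \<bullet> e x) * y x" for x
 have "l2 LD q'" unfolding q'_def[abs_def] by (intro l2_add l2_mult_continuous q(1) y cc(1) ce)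
 moreover have "(LINT x|LD. q' x * \<psi> x) = - (LINT x|LD. (c x * y x) * (\<psi>' x \<bullet> e x))" if \<psi>: "C1 \<psi> \<psi>'" for \<psi> \<psi>'
 proof -
 note pc = C1_continuous[OF \<psi>] C1D(2)[OF \<psi>]
 have 1: "integrable LD (%x. (c x * \<psi> x) * q x)" "integrable LD (%x. ((c' x \<bullet> e x) * \<psi> x) * y x)"
 "integrable LD (%x. (c x * (\<psi>' x \<bullet> e x)) * y x)"
 by (intro integrable_mult_continuous q(1) y continuous_intros cc pc ce e)+
 have "(LINT x|LD. q' x * \<psi> x) = (LINT x|LD. (c x * \<psi> x) * q x) + (LINT x|LD. ((c' x \<bullet> e x) * \<psi> x) * y x)"
 unfolding BI_add[OF 1(1,2), symmetric] by (rule LD_cong) (simp add: q'_def algebra_simps)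
 also have "(LINT x|LD. (c x * \<psi> x) * q x) = (LINT x|LD. q x * (c x * \<psi> x))" by (simp add: mult_ac)
 also have "... = - (LINT x|LD. (c x * (\<psi>' x \<bullet> e x)) * y x + ((c' x \<bullet> e x) * \<psi> x) * y x)"
 unfolding q(2)[OF C1_mult[OF c \<psi>]] by (intro arg_cong[where f=uminus] LD_cong) (simp add: inner_add_left algebra_simps)
 finally show ?thesis unfolding BI_add[OF 1(3,2)] by (simp add: mult_ac)
 qed
 ultimately show ?thesis by blast
qed

end

subsection \<open>A time slice of the solution\<close>

text \<open>One fixed time: \<open>w\<close> stands for the time derivative there. The bound
  \<open>M\<close> is qualitative; it makes powers and the convection term square integrable, and no
  estimate depends on its size.\<close>

locale slice = cone +
 fixes u :: "real^3 => real^3" and P :: "real^3 => real" and w :: "real^3 => real^3" and M :: real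
 assumes sob: "sobolev 2 D u" and ax: "axisymmetric_field D u" and bc: "BC m \<alpha> u"
 and dv: "AE x in LD. wdiv D u x = 0" and bd: "AE x in LD. norm (u x) <= M"
 and sobP: "sobolev 1 D P" and axP: "axisymmetric D P"
 and eq: "AE x in LD. wlaplacian D u x - convection D u u x - wgrad D P x - w x = 0"
begin

abbreviation "wd b \<equiv> wderiv D b u"
abbreviation "dd b \<equiv> wderiv D b (wderiv D b u)"

definition ang :: "real^3 => real" where "ang x = u x \<bullet> rot_field x"

lemma u_l2: "l2 LD u" using sob by (simp add: numeral_2_eq_2 L2_on_iff_l2)

lemma ang_l2: "l2 LD ang" unfolding ang_def[abs_def] by (rule l2_inner_continuous[OF u_l2 continuous_rot_field])

text \<open>Sobolev regularity provides some weak derivatives; uniqueness passes their regularity to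
  the representatives that \<open>wderiv\<close> chooses, first for the field and then for its
  derivative.\<close>

lemma derivs:
 assumes b: "b \<in> Basis"
 shows "has_weak_deriv D b u (wd b)" "l2 LD (wd b)" "has_weak_deriv D b (wd b) (dd b)" "l2 LD (dd b)"
proof -
 from sob b obtain g where g: "has_weak_deriv D b u g" "l2 LD g" "\<forall>b\<in>Basis. \<exists>h. has_weak_deriv D b g h \<and> l2 LD h"
 by (auto simp: numeral_2_eq_2 L2_on_iff_l2)
 with b obtain h where h: "has_weak_deriv D b g h" "l2 LD h" by blast
 show 1: "has_weak_deriv D b u (wd b)" by (rule has_weak_deriv_wderiv[OF g(1)])
 have e: "AE x in LD. g x = wd b x" using wderiv_AE[OF open_D g(1)] by eventually_elim simp
 show 2: "l2 LD (wd b)" by (rule l2_cong_AE[OF D_sets g(2) e])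
 have k: "has_weak_deriv D b (wd b) h" by (rule has_weak_deriv_cong_AE[OF h(1) e 2 b])
 show "has_weak_deriv D b (wd b) (dd b)" by (rule has_weak_deriv_wderiv[OF k])
 have "AE x in LD. h x = dd b x" using wderiv_AE[OF open_D k] by eventually_elim simp
 then show "l2 LD (dd b)" by (rule l2_cong_AE[OF D_sets h(2)])
qed

lemma AE_in_D: "AE x in LD. x \<in> D" by (rule AE_LD)

lemma D_off: "x \<in> D ==> x \<in> off_axis" using D_off_axis by auto

lemma coords:
 assumes "x \<in> D"
 shows "rho x * sin (phi x) = cyl x" "rho x = norm x" "cyl x > 0" "norm x > 0" "sin (phi x) = cyl x / norm x" "cos (phi x) = x $ 3 / norm x"
 "comp_theta u x = ang x / cyl x"
 using spherical_coordinates[OF D_off[OF assms]] cyl_pos[OF D_off[OF assms]] norm_pos_off_axis[OF D_off[OF assms]]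
 by (auto simp: rho_def comp_theta_def e_theta_eq[OF D_off[OF assms]] ang_def divide_inverse)

text \<open>The last two functions are the coefficients that meet azimuthal derivatives of test
  functions later on. The third is the horizontal radial velocity over \<open>cyl\<close>, and that
  velocity is v_rho sin(phi) + v_phi cos(phi).\<close>

lemma axisymmetric_ang: "axisymmetric D ang" "axisymmetric D (%x. ang x / (cyl x)^2)"
 "axisymmetric D (%x. (u x $ 1 * x $ 1 + u x $ 2 * x $ 2) / (cyl x)^2)"
proof -
 from ax obtain Fr Fp Ft where F: "AE x in LD. comp_rho u x = Fr (rho x) (phi x)" "AE x in LD. comp_phi u x = Fp (rho x) (phi x)"
 "AE x in LD. comp_theta u x = Ft (rho x) (phi x)"
 unfolding axisymmetric_field_def axisymmetric_def by blast
 have "AE x in LD. ang x = rho x * sin (phi x) * Ft (rho x) (phi x)"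
 using F(3) AE_in_D
 proof eventually_elim
 case (elim x)
 show ?case unfolding elim(1)[symmetric] coords(1)[OF elim(2)] coords(7)[OF elim(2)] using coords(3)[OF elim(2)] by simp
 qed
 then show "axisymmetric D ang" unfolding axisymmetric_def by (intro exI[of _ "%r p. r * sin p * Ft r p"])
 have "AE x in LD. ang x / (cyl x)^2 = Ft (rho x) (phi x) / (rho x * sin (phi x))"
 using F(3) AE_in_D
 proof eventually_elim
 case (elim x)
 show ?case unfolding elim(1)[symmetric] coords(1)[OF elim(2)] coords(7)[OF elim(2)] by (simp add: power2_eq_square)
 qed
 then show "axisymmetric D (%x. ang x / (cyl x)^2)" unfolding axisymmetric_def by (intro exI[of _ "%r p. Ft r p / (r * sin p)"])
 have "AE x in LD. (u x $ 1 * x $ 1 + u x $ 2 * x $ 2) / (cyl x)^2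
 = (Fr (rho x) (phi x) * sin (phi x) + Fp (rho x) (phi x) * cos (phi x)) / (rho x * sin (phi x))"
 using F(1,2) AE_in_D
 proof eventually_elim
 case (elim x)
 note s = spherical_coordinates[OF D_off[OF elim(3)]]
 have c: "cyl x > 0" using coords[OF elim(3)] by simp
 have "comp_rho u x * sin (phi x) + comp_phi u x * cos (phi x)
 = ((sin (phi x))^2 + (cos (phi x))^2) * (u x $ 1 * cos (theta x) + u x $ 2 * sin (theta x))"
 unfolding comp_rho_def comp_phi_def e_rho_def e_phi_def inner_3 vector_3 by algebra
 also have "... = (u x $ 1 * x $ 1 + u x $ 2 * x $ 2) / cyl x"
 unfolding sin_cos_squared_add using s(3,4) by (simp add: add_divide_distrib)
 finally have "(u x $ 1 * x $ 1 + u x $ 2 * x $ 2) / cyl x / cyl x = (Fr (rho x) (phi x) * sin (phi x) + Fp (rho x) (phi x) * cos (phi x)) / cyl x"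
 using elim by simp
 then show ?case unfolding coords(1)[OF elim(3)] by (simp add: power2_eq_square)
 qed
 then show "axisymmetric D (%x. (u x $ 1 * x $ 1 + u x $ 2 * x $ 2) / (cyl x)^2)"
 unfolding axisymmetric_def by (intro exI[of _ "%r p. (Fr r p * sin p + Fp r p * cos p) / (r * sin p)"])
qed

lemma continuous_cyl_sq: "continuous_on off_axis (%x. 1 / (cyl x)^2)"
 using cyl_pos by (intro continuous_intros continuous_cyl) fastforce

text \<open>The swirl term arises because the Laplacian does not commute with the projection to \<open>rot_field\<close>.\<close>

lemma angular_laplacian_weak:
 assumes g: "l2 LD g" and gb: "!!b. b \<in> Basis ==> AE x in LD. g x \<bullet> b = wd b x \<bullet> rot_field x + u x \<bullet> rot_field b"
 and t: "test_function D zet" and zet: "C1 zet zet'"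
 shows "(LINT x|LD. (wlaplacian D u x \<bullet> rot_field x) * zet x) = - (LINT x|LD. (g x - (2 * ang x) *\<^sub>R swirl_field x) \<bullet> zet' x)"
proof -
 note c = C1_continuous[OF zet] C1D(2)[OF zet]
 have cb: "continuous_on off_axis (%x. zet' x \<bullet> b)" for b by (intro continuous_intros c)
 note rl = l2_inner_continuous[OF _ continuous_rot_field] l2_inner_continuous[OF _ continuous_on_const]
 have fr: "frechet_derivative zet (at x) b = zet' x \<bullet> b" if "x \<in> D" for x b using C1_frechet[OF zet D_off[OF that]] .
 \<comment> \<open>Moving one derivative off the Laplacian leaves the term with
   \<open>wd b x\<close> and \<open>rot_field b\<close>, which a second integration by parts turns
   into one in \<open>u\<close>. As the gradient of the angular momentum contains the same term
   once, it is subtracted twice.\<close>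
 have S: "(LINT x|LD. zet x * (dd b x \<bullet> rot_field x)) = - (LINT x|LD. (zet' x \<bullet> b) * (g x \<bullet> b - 2 * (u x \<bullet> rot_field b)))"
 if b: "b \<in> Basis" for b
 proof -
 have 1: "(LINT x|LD. (zet' x \<bullet> b) * (wd b x \<bullet> rot_field x)) = - (LINT x|LD. zet x * (dd b x \<bullet> rot_field x + wd b x \<bullet> rot_field b))"
 using weak_deriv_rot[OF open_D derivs(3)[OF b] t b] LD_cong[of "%x. (zet' x \<bullet> b) * (wd b x \<bullet> rot_field x)"
 "%x. frechet_derivative zet (at x) b * (wd b x \<bullet> rot_field x)"] fr by simp
 have 2: "(LINT x|LD. (zet' x \<bullet> b) * (u x \<bullet> rot_field b)) = - (LINT x|LD. zet x * (wd b x \<bullet> rot_field b))"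
 using weak_deriv_inner(1)[OF open_D derivs(1)[OF b] t b, of "rot_field b"] LD_cong[of "%x. (zet' x \<bullet> b) * (u x \<bullet> rot_field b)"
 "%x. frechet_derivative zet (at x) b * (u x \<bullet> rot_field b)"] fr by simp
 have i: "integrable LD (%x. zet x * (dd b x \<bullet> rot_field x))" "integrable LD (%x. zet x * (wd b x \<bullet> rot_field b))"
 "integrable LD (%x. (zet' x \<bullet> b) * (wd b x \<bullet> rot_field x))" "integrable LD (%x. (zet' x \<bullet> b) * (u x \<bullet> rot_field b))"
 by (intro integrable_mult_continuous c(1) cb rl derivs[OF b] u_l2)+
 have ig: "integrable LD (%x. (zet' x \<bullet> b) * (g x \<bullet> b - 2 * (u x \<bullet> rot_field b)))"
 by (intro integrable_mult_continuous cb l2_diff l2_mult_continuous continuous_on_const rl g u_l2)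
 have "(LINT x|LD. (zet' x \<bullet> b) * (g x \<bullet> b - 2 * (u x \<bullet> rot_field b)))
 = (LINT x|LD. (zet' x \<bullet> b) * (wd b x \<bullet> rot_field x) - (zet' x \<bullet> b) * (u x \<bullet> rot_field b))"
 proof (rule integral_cong_AE)
 show "AE x in LD. (zet' x \<bullet> b) * (g x \<bullet> b - 2 * (u x \<bullet> rot_field b)) = (zet' x \<bullet> b) * (wd b x \<bullet> rot_field x) - (zet' x \<bullet> b) * (u x \<bullet> rot_field b)"
 using gb[OF b] by eventually_elim (simp add: algebra_simps)
 qed (use ig i in auto)
 also have "... = (LINT x|LD. (zet' x \<bullet> b) * (wd b x \<bullet> rot_field x)) - (LINT x|LD. (zet' x \<bullet> b) * (u x \<bullet> rot_field b))"
 by (rule BI_diff[OF i(3,4)])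
 finally have 3: "(LINT x|LD. (zet' x \<bullet> b) * (g x \<bullet> b - 2 * (u x \<bullet> rot_field b))) = ..." .
 have "(LINT x|LD. zet x * (dd b x \<bullet> rot_field x + wd b x \<bullet> rot_field b))
 = (LINT x|LD. zet x * (dd b x \<bullet> rot_field x)) + (LINT x|LD. zet x * (wd b x \<bullet> rot_field b))"
 unfolding distrib_left by (rule BI_add[OF i(1,2)])
 then show ?thesis using 1 2 3 by linarith
 qed
 \<comment> \<open>The second product of \<open>swirl_algebra\<close>: an axisymmetric coefficient
   times the azimuthal derivative of the test function, so its integral vanishes.\<close>
 define Z where "Z x = ((u x $ 1 * x $ 1 + u x $ 2 * x $ 2) / (cyl x)^2) * (zet' x \<bullet> rot_field x)" for x
 have hl: "l2 LD (%x. (u x $ 1 * x $ 1 + u x $ 2 * x $ 2) / (cyl x)^2)"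
 proof -
 have "l2 LD (%x. u x \<bullet> swirl_field x)" by (rule l2_inner_continuous[OF u_l2 continuous_swirl_field])
 moreover have "u x \<bullet> swirl_field x = (u x $ 1 * x $ 1 + u x $ 2 * x $ 2) / (cyl x)^2" for x
 by (simp add: swirl_field_def inner_3 add_divide_distrib)
 ultimately show ?thesis by simp
 qed
 have Z: "(LINT x|LD. Z x) = 0" unfolding Z_def
 by (rule axisymmetric_ibp[OF axisymmetric_ang(3) l2_integrable[OF finite_measure_D hl] zet])
 have iZ: "integrable LD Z" unfolding Z_def[abs_def] mult.commute[of "_ / _"]
 by (intro integrable_mult_continuous hl continuous_intros c continuous_rot_field)
 have Yl: "l2 LD (%x. g x - (2 * ang x) *\<^sub>R swirl_field x)"
 proof (intro l2_diff g)
 obtain C where C: "AE x in LD. norm (swirl_field x) <= C" using continuous_AE_bounded_D[OF continuous_swirl_field] by blast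
 have "l2lim LD (%n x. 2 * ang x) (%x. 2 * ang x)" by (intro l2lim_const l2_mult_continuous continuous_on_const ang_l2)
 from l2lim_l2(2)[OF l2lim_scaleR_bounded[OF this continuous_measurable_D[OF continuous_swirl_field] C]]
 show "l2 LD (%x. (2 * ang x) *\<^sub>R swirl_field x)" .
 qed
 have iY: "integrable LD (%x. (g x - (2 * ang x) *\<^sub>R swirl_field x) \<bullet> zet' x)"
 by (rule l2_integrable[OF finite_measure_D l2_inner_continuous[OF Yl c(2)]])
 have il: "integrable LD (%x. zet x * (dd b x \<bullet> rot_field x))" if "b \<in> Basis" for b
 by (intro integrable_mult_continuous c(1) rl derivs(4)[OF that])
 have ig: "integrable LD (%x. (zet' x \<bullet> b) * (g x \<bullet> b - 2 * (u x \<bullet> rot_field b)))" for b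
 by (intro integrable_mult_continuous cb l2_diff l2_mult_continuous continuous_on_const rl g u_l2)
 have "(LINT x|LD. (wlaplacian D u x \<bullet> rot_field x) * zet x) = (LINT x|LD. (\<Sum>b\<in>Basis. zet x * (dd b x \<bullet> rot_field x)))"
 by (rule LD_cong) (simp add: wlaplacian_def inner_sum_left sum_distrib_left mult.commute)
 also have "... = (\<Sum>b\<in>Basis. LINT x|LD. zet x * (dd b x \<bullet> rot_field x))"
 by (rule Bochner_Integration.integral_sum) (rule il)
 also have "... = (\<Sum>b\<in>Basis. - (LINT x|LD. (zet' x \<bullet> b) * (g x \<bullet> b - 2 * (u x \<bullet> rot_field b))))"
 by (rule sum.cong) (auto simp: S)
 also have "... = - (LINT x|LD. (\<Sum>b\<in>Basis. (zet' x \<bullet> b) * (g x \<bullet> b - 2 * (u x \<bullet> rot_field b))))"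
 by (subst Bochner_Integration.integral_sum) (auto simp: ig sum_negf)
 also have "(LINT x|LD. (\<Sum>b\<in>Basis. (zet' x \<bullet> b) * (g x \<bullet> b - 2 * (u x \<bullet> rot_field b))))
 = (LINT x|LD. (g x - (2 * ang x) *\<^sub>R swirl_field x) \<bullet> zet' x + 2 * Z x)"
 proof (rule LD_cong)
 fix x assume x: "x \<in> D"
 have k: "(cyl x)^2 = (x $ 1)^2 + (x $ 2)^2" by (rule cyl_sq)
 have k2: "(cyl x)^2 > 0" using coords(3)[OF x] by simp
 have 1: "(\<Sum>b\<in>Basis. (zet' x \<bullet> b) * (g x \<bullet> b - 2 * (u x \<bullet> rot_field b)))
 = g x \<bullet> zet' x - 2 * (zet' x $ 1 * u x $ 2 - zet' x $ 2 * u x $ 1)"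
 unfolding sum_Basis_3 inner_axis_1 inner_rot_field by (simp add: axis_3_nth inner_3 algebra_simps)
 have 2: "swirl_field x \<bullet> zet' x = (1 / (cyl x)^2) * (x $ 1 * zet' x $ 1 + x $ 2 * zet' x $ 2)"
 by (simp add: swirl_field_def inner_3 add_divide_distrib)
 show "(\<Sum>b\<in>Basis. (zet' x \<bullet> b) * (g x \<bullet> b - 2 * (u x \<bullet> rot_field b)))
 = (g x - (2 * ang x) *\<^sub>R swirl_field x) \<bullet> zet' x + 2 * Z x"
 unfolding 1 unfolding inner_diff_left inner_scaleR_left 2 Z_def ang_def inner_rot_field
 swirl_algebra[OF k k2, of "zet' x $ 1" "u x $ 2" "zet' x $ 2" "u x $ 1"] by (simp only: right_diff_distrib mult.assoc) simp
 qed
 also have "... = (LINT x|LD. (g x - (2 * ang x) *\<^sub>R swirl_field x) \<bullet> zet' x)"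
 using iY iZ Z by simp
 finally show ?thesis .
qed

lemma bc_sphere:
 "trace_eq D (sphere_piece \<alpha> 1) (d_rho D (comp_theta u)) (%x. 1 / rho x * comp_theta u x)"
 "trace_eq D (sphere_piece \<alpha> r0) (d_rho D (comp_theta u)) (%x. 1 / rho x * comp_theta u x)"
 "trace_eq D (sphere_piece \<alpha> 1) (comp_rho u) (%x. 0)" "trace_eq D (sphere_piece \<alpha> r0) (comp_rho u) (%x. 0)"
 using bc by (simp_all add: BC_def Let_def A1_def A2_def r0_def)

lemma bc_cone:
 "trace_eq D (cone_piece m p1) (d_phi D (comp_theta u)) (%x. cot (phi x) * comp_theta u x)"
 "trace_eq D (cone_piece m p0) (d_phi D (comp_theta u)) (%x. cot (phi x) * comp_theta u x)"
 "trace_eq D (cone_piece m p1) (comp_phi u) (%x. 0)" "trace_eq D (cone_piece m p0) (comp_phi u) (%x. 0)"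
 using bc by (simp_all add: BC_def Let_def R1_def R2_def p0_def p1_def)

lemma piece_bounds: "1 \<in> {r0..1}" "r0 \<in> {r0..1}" "p1 \<in> {p0..p1}" "p0 \<in> {p0..p1}"
 using r0_bounds p_bounds by auto

text \<open>Smooth approximation up to the boundary is read off the boundary conditions: the trace
  of \<open>comp_theta u\<close> over \<open>rho\<close> on the outer sphere comes with
  approximants, and multiplication by the C1 function \<open>norm x * cyl x\<close> turns them into
  approximants of \<open>ang\<close>.\<close>

lemma angular_H1lim: "\<exists>F F' g. H1lim F F' ang g"
proof -
 obtain h where "has_trace D (sphere_piece \<alpha> 1) (%x. 1 / rho x * comp_theta u x) h"
 using bc_sphere(1) by (auto simp: trace_eq_def)
 then obtain F F' g where F: "H1lim F F' (%x. 1 / rho x * comp_theta u x) g" by (rule has_trace_H1lim)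
 from H1lim_mult_C1[OF C1_mult[OF C1_norm C1_cyl] this]
 obtain F2 F2' g2 where "H1lim F2 F2' (%x. (norm x * cyl x) * (1 / rho x * comp_theta u x)) g2" by blast
 moreover have "AE x in LD. (norm x * cyl x) * (1 / rho x * comp_theta u x) = ang x"
 proof (rule AE_LD)
 fix x assume x: "x \<in> D"
 show "(norm x * cyl x) * (1 / rho x * comp_theta u x) = ang x"
 unfolding coords(2)[OF x] coords(7)[OF x] using coords(3,4)[OF x] by simp
 qed
 ultimately show ?thesis using H1lim_cong_AE by blast
qed

lemma angular_gradient:
 assumes F: "H1lim F F' ang g" and b: "b \<in> Basis"
 shows "AE x in LD. g x \<bullet> b = wd b x \<bullet> rot_field x + u x \<bullet> rot_field b"
proof -
 let ?r = "%x. wd b x \<bullet> rot_field x + u x \<bullet> rot_field b"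
 have l: "l2 LD ?r"
 by (intro l2_add l2_inner_continuous derivs(2)[OF b] u_l2 continuous_rot_field continuous_on_const)
 have "has_weak_deriv D b ang ?r"
 unfolding has_weak_deriv_def
 proof (intro conjI allI impI)
 show "locally_integrable D ang" "locally_integrable D ?r" by (intro l2_locally_integrable ang_l2 l)+
 fix \<psi> assume t: "test_function D \<psi>"
 show "(LINT x|LD. frechet_derivative \<psi> (at x) b *\<^sub>R ang x) = - (LINT x|LD. \<psi> x *\<^sub>R ?r x)"
 using weak_deriv_rot[OF open_D derivs(1)[OF b] t b] by (simp add: ang_def)
 qed
 from weak_deriv_unique[OF open_D H1lim_weak_deriv[OF F b] this] show ?thesis .
qed

lemma angular_gradient_rot:
 assumes F: "H1lim F F' ang g" shows "AE x in LD. g x \<bullet> rot_field x = 0"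
 by (rule axisymmetric_gradient[OF axisymmetric_ang(1) ang_l2 H1lim_weak_deriv[OF F] H1lim_l2(2)[OF F]])

lemma pressure_deriv:
 assumes "b \<in> Basis" shows "has_weak_deriv D b P (wderiv D b P)" "l2 LD (wderiv D b P)"
proof -
 from sobP assms obtain h where h: "has_weak_deriv D b P h" "l2 LD h" by (auto simp: L2_on_iff_l2)
 show "has_weak_deriv D b P (wderiv D b P)" by (rule has_weak_deriv_wderiv[OF h(1)])
 have "AE x in LD. h x = wderiv D b P x" using wderiv_AE[OF open_D h(1)] by eventually_elim simp
 then show "l2 LD (wderiv D b P)" by (rule l2_cong_AE[OF D_sets h(2)])
qed

lemma pressure_gradient_l2: "l2 LD (wgrad D P)"
proof -
 have s: "l2 LD (%x. wderiv D b P x *\<^sub>R b)" if "b \<in> Basis" for b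
 by (rule l2_dominated[where g="%x. (norm (wderiv D b P x))^2"]) (use pressure_deriv(2)[OF that] that in \<open>auto simp: l2_def\<close>)
 show ?thesis unfolding wgrad_def[abs_def] sum_Basis_3 by (intro l2_add s axis_Basis)
qed

text \<open>An axisymmetric pressure exerts no torque about the axis, so it drops out of the
  equation for \<open>ang\<close>.\<close>

lemma pressure_rot: "AE x in LD. wgrad D P x \<bullet> rot_field x = 0"
proof (rule axisymmetric_gradient[OF axP _ _ pressure_gradient_l2])
 show "l2 LD P" using sobP by (simp add: L2_on_iff_l2)
 show "has_weak_deriv D b P (%x. wgrad D P x \<bullet> b)" if "b \<in> Basis" for b
 unfolding wgrad_def grad_inner_Basis[OF that] by (rule pressure_deriv(1)[OF that])
qed

text \<open>Read off the equation, all other terms of which are square integrable; boundedness of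
  \<open>u\<close> is what handles the convection term.\<close>

lemma w_l2: "l2 LD w"
proof -
 have c: "l2 LD (%x. (u x \<bullet> b) *\<^sub>R wd b x)" if b: "b \<in> Basis" for b
 proof (rule l2_scaleR[OF derivs(2)[OF b]])
 show "(%x. u x \<bullet> b) \<in> borel_measurable LD"
 by (rule l2_measurable[OF l2_inner_continuous[OF u_l2 continuous_on_const]])
 show "AE x in LD. \<bar>u x \<bullet> b\<bar> <= M"
 using bd by eventually_elim (use Basis_le_norm[OF b] order_trans in blast)
 qed
 have "l2 LD (%x. wlaplacian D u x - convection D u u x - wgrad D P x)"
 unfolding wlaplacian_def convection_def sum_Basis_3
 by (intro l2_diff l2_add pressure_gradient_l2 derivs(4) c axis_Basis)
 moreover have "AE x in LD. wlaplacian D u x - convection D u u x - wgrad D P x = w x"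
 using eq by eventually_elim simp
 ultimately show ?thesis by (rule l2_cong_AE[OF D_sets])
qed

text \<open>Both boundary conditions on $v_\theta$ say that the flux of the angular momentum,
 $\nabla\Gamma - 2 \Gamma\, \nabla \log(\rho \sin\phi)$, is tangential.\<close>

lemma flux_AE:
 assumes F: "H1lim F F' ang g"
 shows "AE x in LD. cyl x * (d_rho D (comp_theta u) x - 1 / rho x * comp_theta u x) = (g x - (2 * ang x) *\<^sub>R swirl_field x) \<bullet> e_rho x"
 "AE x in LD. (cyl x * (1 / norm x)) * (d_phi D (comp_theta u) x - cot (phi x) * comp_theta u x) = (g x - (2 * ang x) *\<^sub>R swirl_field x) \<bullet> e_phi x"
proof -
 \<comment> \<open>As \<open>comp_theta u\<close> is \<open>ang\<close> divided by
   \<open>cyl\<close>, its gradient comes from the product rule; the second summand is minus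
   \<open>ang x\<close> times \<open>swirl_field x\<close>, divided by \<open>cyl x\<close>.\<close>
 let ?G = "%x. (1 / cyl x) *\<^sub>R g x + ang x *\<^sub>R ((- 1 / (cyl x)^2) *\<^sub>R (vector [x $ 1, x $ 2, 0] /\<^sub>R cyl x))"
 have "H1lim (%n x. 1 / cyl x * F n x) (%n x. (1 / cyl x) *\<^sub>R F' n x + F n x *\<^sub>R ((- 1 / (cyl x)^2) *\<^sub>R (vector [x $ 1, x $ 2, 0] /\<^sub>R cyl x)))
 (%x. 1 / cyl x * ang x) ?G"
 by (rule H1lim_mult_C1[OF C1_inverse[OF C1_cyl cyl_pos] F])
 then have "H1lim (%n x. 1 / cyl x * F n x) (%n x. (1 / cyl x) *\<^sub>R F' n x + F n x *\<^sub>R ((- 1 / (cyl x)^2) *\<^sub>R (vector [x $ 1, x $ 2, 0] /\<^sub>R cyl x)))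
 (comp_theta u) ?G"
 by (rule H1lim_cong_AE) (auto intro!: AE_LD simp: coords)
 from H1lim_wgrad[OF this] have W: "AE x in LD. wgrad D (comp_theta u) x = ?G x" .
 have G: "cyl x * (?G x \<bullet> e) = g x \<bullet> e - ang x * (swirl_field x \<bullet> e)" if "x \<in> D" for x e
 unfolding inner_add_left inner_scaleR_left swirl_field_def using coords(3)[OF that] by (simp add: power2_eq_square field_simps)
 show "AE x in LD. cyl x * (d_rho D (comp_theta u) x - 1 / rho x * comp_theta u x) = (g x - (2 * ang x) *\<^sub>R swirl_field x) \<bullet> e_rho x"
 using W AE_in_D
 proof eventually_elim
 case (elim x)
 have "cyl x * (1 / rho x * comp_theta u x) = ang x * (swirl_field x \<bullet> e_rho x)"
 using coords[OF elim(2)] swirl_frame[OF D_off[OF elim(2)]] by simp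
 moreover have "cyl x * d_rho D (comp_theta u) x = g x \<bullet> e_rho x - ang x * (swirl_field x \<bullet> e_rho x)"
 unfolding d_rho_def elim(1) by (rule G[OF elim(2)])
 ultimately show ?case by (simp add: right_diff_distrib inner_diff_left)
 qed
 show "AE x in LD. (cyl x * (1 / norm x)) * (d_phi D (comp_theta u) x - cot (phi x) * comp_theta u x) = (g x - (2 * ang x) *\<^sub>R swirl_field x) \<bullet> e_phi x"
 using W AE_in_D
 proof eventually_elim
 case (elim x)
 have "(cyl x * (1 / norm x)) * (cot (phi x) * comp_theta u x) = ang x * (swirl_field x \<bullet> e_phi x)"
 using coords[OF elim(2)] swirl_frame[OF D_off[OF elim(2)]] by (simp add: cot_def mult_ac)
 moreover have "(cyl x * (1 / norm x)) * d_phi D (comp_theta u) x = cyl x * (wgrad D (comp_theta u) x \<bullet> e_phi x)"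
 using coords[OF elim(2)] by (simp add: d_phi_def)
 moreover have "... = g x \<bullet> e_phi x - ang x * (swirl_field x \<bullet> e_phi x)"
 unfolding elim(1) by (rule G[OF elim(2)])
 ultimately show ?case by (simp add: right_diff_distrib inner_diff_left)
 qed
qed

end

context cone begin

text \<open>Needed because the test functions of interest are powers of the solution, which are
  limits of C1 functions only.\<close>

lemma flux_H1lim:
 assumes d: "l2 LD d" "l2 LD yr" "l2 LD yp"
 and e: "!!\<psi> \<psi>'. C1 \<psi> \<psi>' ==> (LINT x|LD. d x * \<psi> x) = - (LINT x|LD. yr x * (\<psi>' x \<bullet> e_rho x) + yp x * (\<psi>' x \<bullet> e_phi x))"
 and F: "H1lim F F' f h"
 shows "(LINT x|LD. d x * f x) = - (LINT x|LD. yr x * (h x \<bullet> e_rho x) + yp x * (h x \<bullet> e_phi x))"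
proof -
 note lr = l2lim_inner_continuous[OF H1limD(3)[OF F] continuous_frame(1)]
 note lp = l2lim_inner_continuous[OF H1limD(3)[OF F] continuous_frame(2)]
 have "(%n. LINT x|LD. d x * F n x) \<longlonglongrightarrow> (LINT x|LD. d x * f x)"
 by (rule l2lim_mult_real[OF l2lim_const[OF d(1)] H1limD(2)[OF F]])
 moreover have "(%n. - ((LINT x|LD. yr x * (F' n x \<bullet> e_rho x)) + (LINT x|LD. yp x * (F' n x \<bullet> e_phi x)))) \<longlonglongrightarrow>
 - ((LINT x|LD. yr x * (h x \<bullet> e_rho x)) + (LINT x|LD. yp x * (h x \<bullet> e_phi x)))"
 by (intro tendsto_intros l2lim_mult_real l2lim_const d lr lp)
 moreover have "(LINT x|LD. d x * F n x) = - ((LINT x|LD. yr x * (F' n x \<bullet> e_rho x)) + (LINT x|LD. yp x * (F' n x \<bullet> e_phi x)))" for n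
 unfolding e[OF H1limD(1)[OF F]]
 BI_add[OF l2_mult_integrable[OF d(2) l2lim_l2(1)[OF lr]] l2_mult_integrable[OF d(3) l2lim_l2(1)[OF lp]]] ..
 ultimately show ?thesis
 unfolding BI_add[OF l2_mult_integrable[OF d(2) l2lim_l2(2)[OF lr]] l2_mult_integrable[OF d(3) l2lim_l2(2)[OF lp]]]
 using LIMSEQ_unique by simp
qed

end

context slice begin

lemma lap_l2: "l2 LD (%x. wlaplacian D u x \<bullet> rot_field x)"
 unfolding wlaplacian_def sum_Basis_3
 by (intro l2_inner_continuous l2_add derivs(4) axis_Basis continuous_rot_field)

lemma comp_l2: "l2 LD (comp_rho u)" "l2 LD (comp_phi u)"
 unfolding comp_rho_def[abs_def] comp_phi_def[abs_def] by (intro l2_inner_continuous u_l2 continuous_frame)+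

lemma flux_l2:
 assumes F: "H1lim F F' ang g" shows "l2 LD (%x. g x - (2 * ang x) *\<^sub>R swirl_field x)"
proof (intro l2_diff H1lim_l2(2)[OF F])
 obtain C where C: "AE x in LD. norm (swirl_field x) <= C" using continuous_AE_bounded_D[OF continuous_swirl_field] by blast
 have "l2lim LD (%n x. 2 * ang x) (%x. 2 * ang x)" by (intro l2lim_const l2_mult_continuous continuous_on_const ang_l2)
 from l2lim_l2(2)[OF l2lim_scaleR_bounded[OF this continuous_measurable_D[OF continuous_swirl_field] C]]
 show "l2 LD (%x. (2 * ang x) *\<^sub>R swirl_field x)" .
qed

text \<open>On all four boundary pieces the conditions on v_theta give zero traces for the
  components of the flux \<open>Y\<close>, so the identity known for compactly supported test
  functions extends to any \<open>f\<close> that is a limit of C1 functions, without a boundary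
  term.\<close>

lemma angular_balance:
 assumes F: "H1lim F F' ang g" and f: "H1lim \<Psi> \<Psi>' f h"
 defines "Y \<equiv> %x. g x - (2 * ang x) *\<^sub>R swirl_field x"
 shows "(LINT x|LD. (wlaplacian D u x \<bullet> rot_field x) * f x)
 = - (LINT x|LD. (Y x \<bullet> e_rho x) * (h x \<bullet> e_rho x) + (Y x \<bullet> e_phi x) * (h x \<bullet> e_phi x))"
proof -
 obtain A1 A1' a1 where A1: "H1lim A1 A1' (%x. d_rho D (comp_theta u) x - 1 / rho x * comp_theta u x) a1" "(%n. sphere_int 1 (%x. (A1 n x)^2)) \<longlonglongrightarrow> 0"
 by (rule sphere_piece_trace[OF bc_sphere(1) piece_bounds(1)])
 obtain A0 A0' a0 where A0: "H1lim A0 A0' (%x. d_rho D (comp_theta u) x - 1 / rho x * comp_theta u x) a0" "(%n. sphere_int r0 (%x. (A0 n x)^2)) \<longlonglongrightarrow> 0"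
 by (rule sphere_piece_trace[OF bc_sphere(2) piece_bounds(2)])
 obtain B1 B1' b1 where B1: "H1lim B1 B1' (%x. d_phi D (comp_theta u) x - cot (phi x) * comp_theta u x) b1" "(%n. cone_int p1 (%x. (B1 n x)^2)) \<longlonglongrightarrow> 0"
 by (rule cone_piece_trace[OF bc_cone(1) piece_bounds(3)])
 obtain B0 B0' b0 where B0: "H1lim B0 B0' (%x. d_phi D (comp_theta u) x - cot (phi x) * comp_theta u x) b0" "(%n. cone_int p0 (%x. (B0 n x)^2)) \<longlonglongrightarrow> 0"
 by (rule cone_piece_trace[OF bc_cone(2) piece_bounds(4)])
 note C2 = C1_mult[OF C1_cyl C1_inverse[OF C1_norm norm_pos_off_axis]]
 obtain qr where qr: "l2 LD qr" "!!\<psi> \<psi>'. C1 \<psi> \<psi>' ==> (LINT x|LD. qr x * \<psi> x)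
 = - (LINT x|LD. (cyl x * (d_rho D (comp_theta u) x - 1 / rho x * comp_theta u x)) * (\<psi>' x \<bullet> e_rho x))"
 using zero_flux_mult[OF rho_zero_trace[OF A1 A0] H1lim_l2(1)[OF A1(1)] C1_cyl continuous_frame(1)] by blast
 obtain qp where qp: "l2 LD qp" "!!\<psi> \<psi>'. C1 \<psi> \<psi>' ==> (LINT x|LD. qp x * \<psi> x)
 = - (LINT x|LD. ((cyl x * (1 / norm x)) * (d_phi D (comp_theta u) x - cot (phi x) * comp_theta u x)) * (\<psi>' x \<bullet> e_phi x))"
 using zero_flux_mult[OF phi_zero_trace[OF B1 B0] H1lim_l2(1)[OF B1(1)] C2 continuous_frame(2)] by blast
 have fl: "AE x in LD. cyl x * (d_rho D (comp_theta u) x - 1 / rho x * comp_theta u x) = Y x \<bullet> e_rho x"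
 "AE x in LD. (cyl x * (1 / norm x)) * (d_phi D (comp_theta u) x - cot (phi x) * comp_theta u x) = Y x \<bullet> e_phi x"
 unfolding Y_def by (rule flux_AE[OF F])+
 have Yl: "l2 LD Y" unfolding Y_def by (rule flux_l2[OF F])
 note Yc = l2_inner_continuous[OF Yl continuous_frame(1)] l2_inner_continuous[OF Yl continuous_frame(2)]
 have sw: "(LINT x|LD. y x * c x) = (LINT x|LD. z x * c x)" if "AE x in LD. y x = z x" "l2 LD z" "continuous_on off_axis c" for y z c :: "real^3 => real"
 proof (rule integral_cong_AE)
 have e: "AE x in LD. z x = y x" using that(1) by eventually_elim simp
 have "integrable LD (%x. c x * y x)" "integrable LD (%x. c x * z x)"
 by (intro integrable_mult_continuous that l2_cong_AE[OF D_sets that(2) e])+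
 then show "(%x. y x * c x) \<in> borel_measurable LD" "(%x. z x * c x) \<in> borel_measurable LD"
 by (auto simp: mult.commute)
 show "AE x in LD. y x * c x = z x * c x" using that(1) by eventually_elim simp
 qed
 have fc: "continuous_on off_axis (%x. \<psi>' x \<bullet> e_rho x)" "continuous_on off_axis (%x. \<psi>' x \<bullet> e_phi x)" if "C1 \<psi> \<psi>'" for \<psi> \<psi>'
 by (intro continuous_intros C1D(2)[OF that] continuous_frame)+
 have qr': "(LINT x|LD. qr x * \<psi> x) = - (LINT x|LD. (Y x \<bullet> e_rho x) * (\<psi>' x \<bullet> e_rho x))" if "C1 \<psi> \<psi>'" for \<psi> \<psi>'
 unfolding qr(2)[OF that] by (rule arg_cong[where f=uminus], rule sw[OF fl(1) Yc(1) fc(1)[OF that]])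
 have qp': "(LINT x|LD. qp x * \<psi> x) = - (LINT x|LD. (Y x \<bullet> e_phi x) * (\<psi>' x \<bullet> e_phi x))" if "C1 \<psi> \<psi>'" for \<psi> \<psi>'
 unfolding qp(2)[OF that] by (rule arg_cong[where f=uminus], rule sw[OF fl(2) Yc(2) fc(2)[OF that]])
 have d: "(LINT x|LD. (wlaplacian D u x \<bullet> rot_field x) * \<psi> x)
 = - (LINT x|LD. (Y x \<bullet> e_rho x) * (\<psi>' x \<bullet> e_rho x) + (Y x \<bullet> e_phi x) * (\<psi>' x \<bullet> e_phi x))"
 if t: "test_function D \<psi>" "C1 \<psi> \<psi>'" for \<psi> \<psi>'
 proof -
 have "(LINT x|LD. (wlaplacian D u x \<bullet> rot_field x) * \<psi> x) = - (LINT x|LD. Y x \<bullet> \<psi>' x)"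
 unfolding Y_def by (rule angular_laplacian_weak[OF H1lim_l2(2)[OF F] angular_gradient[OF F] t])
 also have "(LINT x|LD. Y x \<bullet> \<psi>' x) = (LINT x|LD. (Y x \<bullet> e_rho x) * (\<psi>' x \<bullet> e_rho x) + (Y x \<bullet> e_phi x) * (\<psi>' x \<bullet> e_phi x))"
 proof (rule integral_cong_AE)
 show "(%x. Y x \<bullet> \<psi>' x) \<in> borel_measurable LD"
 by (rule l2_measurable[OF l2_inner_continuous[OF Yl C1D(2)[OF t(2)]]])
 have "integrable LD (%x. (\<psi>' x \<bullet> e_rho x) * (Y x \<bullet> e_rho x) + (\<psi>' x \<bullet> e_phi x) * (Y x \<bullet> e_phi x))"
 by (intro Bochner_Integration.integrable_add integrable_mult_continuous Yc fc[OF t(2)])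
 then show "(%x. (Y x \<bullet> e_rho x) * (\<psi>' x \<bullet> e_rho x) + (Y x \<bullet> e_phi x) * (\<psi>' x \<bullet> e_phi x)) \<in> borel_measurable LD"
 by (auto simp: mult.commute)
 \<comment> \<open>Neither the gradient of the axisymmetric \<open>ang\<close> nor
   \<open>swirl_field\<close> has an azimuthal component, so the frame expansion has two terms
   only.\<close>
 show "AE x in LD. Y x \<bullet> \<psi>' x = (Y x \<bullet> e_rho x) * (\<psi>' x \<bullet> e_rho x) + (Y x \<bullet> e_phi x) * (\<psi>' x \<bullet> e_phi x)"
 using angular_gradient_rot[OF F] AE_in_D
 proof eventually_elim
 case (elim x)
 note o = D_off[OF elim(2)]
 have "Y x \<bullet> e_theta x = 0"
 unfolding Y_def inner_diff_left inner_scaleR_left swirl_frame(3)[OF o] using elim(1) by (simp add: e_theta_eq[OF o])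
 then show ?case using frame_expansion[OF o, of "Y x" "\<psi>' x"] by simp
 qed
 qed
 finally show ?thesis .
 qed
 show ?thesis
 by (rule flux_H1lim[OF lap_l2 Yc divergence_ibp[OF Yc(1) qr(1) qr' Yc(2) qp(1) qp' lap_l2 d] f])
qed

text \<open>\<open>divergence_ibp\<close> with divergence 0, the boundary terms vanishing by
  impermeability. The azimuthal velocity may be dropped from the field because it pairs an
  axisymmetric coefficient with the azimuthal derivative of the test function.\<close>

lemma divergence_balance:
 assumes f: "H1lim \<Psi> \<Psi>' f h"
 shows "(LINT x|LD. comp_rho u x * (h x \<bullet> e_rho x) + comp_phi u x * (h x \<bullet> e_phi x)) = 0"
proof -
 obtain A1 A1' a1 where A1: "H1lim A1 A1' (%x. comp_rho u x - 0) a1" "(%n. sphere_int 1 (%x. (A1 n x)^2)) \<longlonglongrightarrow> 0"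
 by (rule sphere_piece_trace[OF bc_sphere(3) piece_bounds(1)])
 obtain A0 A0' a0 where A0: "H1lim A0 A0' (%x. comp_rho u x - 0) a0" "(%n. sphere_int r0 (%x. (A0 n x)^2)) \<longlonglongrightarrow> 0"
 by (rule sphere_piece_trace[OF bc_sphere(4) piece_bounds(2)])
 obtain B1 B1' b1 where B1: "H1lim B1 B1' (%x. comp_phi u x - 0) b1" "(%n. cone_int p1 (%x. (B1 n x)^2)) \<longlonglongrightarrow> 0"
 by (rule cone_piece_trace[OF bc_cone(3) piece_bounds(3)])
 obtain B0 B0' b0 where B0: "H1lim B0 B0' (%x. comp_phi u x - 0) b0" "(%n. cone_int p0 (%x. (B0 n x)^2)) \<longlonglongrightarrow> 0"
 by (rule cone_piece_trace[OF bc_cone(4) piece_bounds(4)])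
 obtain qr where qr: "l2 LD qr" "!!\<psi> \<psi>'. C1 \<psi> \<psi>' ==> (LINT x|LD. qr x * \<psi> x) = - (LINT x|LD. comp_rho u x * (\<psi>' x \<bullet> e_rho x))"
 using rho_zero_trace[OF A1 A0] unfolding diff_0_right by blast
 obtain qp where qp: "l2 LD qp" "!!\<psi> \<psi>'. C1 \<psi> \<psi>' ==> (LINT x|LD. qp x * \<psi> x) = - (LINT x|LD. comp_phi u x * (\<psi>' x \<bullet> e_phi x))"
 using phi_zero_trace[OF B1 B0] unfolding diff_0_right by blast
 have z: "l2 LD (%x. 0 :: real)" by (rule continuous_l2_D) (rule continuous_on_const)
 have d: "(LINT x|LD. 0 * \<psi> x) = - (LINT x|LD. comp_rho u x * (\<psi>' x \<bullet> e_rho x) + comp_phi u x * (\<psi>' x \<bullet> e_phi x))"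
 if t: "test_function D \<psi>" "C1 \<psi> \<psi>'" for \<psi> \<psi>'
 proof -
 note c = C1_continuous[OF t(2)] C1D(2)[OF t(2)]
 have fr: "frechet_derivative \<psi> (at x) b = \<psi>' x \<bullet> b" if "x \<in> D" for x b using C1_frechet[OF t(2) D_off[OF that]] .
 have 1: "(LINT x|LD. (\<psi>' x \<bullet> b) * (u x \<bullet> b)) = - (LINT x|LD. \<psi> x * (wd b x \<bullet> b))" if "b \<in> Basis" for b
 using weak_deriv_inner(1)[OF open_D derivs(1)[OF that] t(1) that, of b] LD_cong[of "%x. (\<psi>' x \<bullet> b) * (u x \<bullet> b)"
 "%x. frechet_derivative \<psi> (at x) b * (u x \<bullet> b)"] fr by simp
 have i1: "integrable LD (%x. (\<psi>' x \<bullet> b) * (u x \<bullet> b))" for b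
 by (intro integrable_mult_continuous l2_inner_continuous u_l2 continuous_intros c)
 have i2: "integrable LD (%x. \<psi> x * (wd b x \<bullet> b))" if "b \<in> Basis" for b
 by (intro integrable_mult_continuous l2_inner_continuous derivs(2)[OF that] continuous_on_const c)
 have iw: "integrable LD (%x. \<psi> x * wdiv D u x)"
 unfolding wdiv_def sum_distrib_left by (intro Bochner_Integration.integrable_sum i2)
 have "(LINT x|LD. \<psi>' x \<bullet> u x) = (LINT x|LD. (\<Sum>b\<in>Basis. (\<psi>' x \<bullet> b) * (u x \<bullet> b)))"
 by (rule LD_cong) (simp add: euclidean_inner[symmetric])
 also have "... = (\<Sum>b\<in>Basis. - (LINT x|LD. \<psi> x * (wd b x \<bullet> b)))"
 by (subst Bochner_Integration.integral_sum) (auto intro!: i1 sum.cong simp: 1)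
 also have "... = - (LINT x|LD. \<psi> x * wdiv D u x)"
 unfolding wdiv_def sum_distrib_left by (subst Bochner_Integration.integral_sum) (auto intro!: i2 simp: sum_negf)
 also have "(LINT x|LD. \<psi> x * wdiv D u x) = 0"
 by (rule integral_eq_zero_AE) (use dv in \<open>auto elim: eventually_mono\<close>)
 finally have A: "(LINT x|LD. \<psi>' x \<bullet> u x) = 0" by simp
 have il: "l2 LD (%x. ang x / (cyl x)^2)"
 using l2_mult_continuous[OF ang_l2 continuous_cyl_sq] by simp
 have B: "(LINT x|LD. ang x / (cyl x)^2 * (\<psi>' x \<bullet> rot_field x)) = 0"
 by (rule axisymmetric_ibp[OF axisymmetric_ang(2) l2_integrable[OF finite_measure_D il] t(2)])
 have iB: "integrable LD (%x. ang x / (cyl x)^2 * (\<psi>' x \<bullet> rot_field x))"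
 unfolding mult.commute[of "_ / _"] by (intro integrable_mult_continuous il continuous_intros c continuous_rot_field)
 have iu: "integrable LD (%x. \<psi>' x \<bullet> u x)"
 using l2_integrable[OF finite_measure_D l2_inner_continuous[OF u_l2 c(2)]] by (simp add: inner_commute)
 have "(LINT x|LD. comp_rho u x * (\<psi>' x \<bullet> e_rho x) + comp_phi u x * (\<psi>' x \<bullet> e_phi x))
 = (LINT x|LD. \<psi>' x \<bullet> u x - ang x / (cyl x)^2 * (\<psi>' x \<bullet> rot_field x))"
 proof (rule LD_cong)
 fix x assume x: "x \<in> D"
 have "(\<psi>' x \<bullet> e_theta x) * (u x \<bullet> e_theta x) = ang x / (cyl x)^2 * (\<psi>' x \<bullet> rot_field x)"
 by (simp add: e_theta_eq[OF D_off[OF x]] ang_def power2_eq_square divide_inverse)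
 then show "comp_rho u x * (\<psi>' x \<bullet> e_rho x) + comp_phi u x * (\<psi>' x \<bullet> e_phi x) = \<psi>' x \<bullet> u x - ang x / (cyl x)^2 * (\<psi>' x \<bullet> rot_field x)"
 using frame_expansion[OF D_off[OF x], of "\<psi>' x" "u x"] by (simp add: comp_rho_def comp_phi_def mult.commute)
 qed
 also have "... = 0" using A B iB iu by simp
 finally show ?thesis by simp
 qed
 have "(LINT x|LD. 0 * f x) = - (LINT x|LD. comp_rho u x * (h x \<bullet> e_rho x) + comp_phi u x * (h x \<bullet> e_phi x))"
 by (rule flux_H1lim[OF z comp_l2 divergence_ibp[OF comp_l2(1) qr comp_l2(2) qp z d] f])
 then show ?thesis by simp
qed

lemma angular_force:
 assumes F: "H1lim F F' ang g"
 shows "AE x in LD. w x \<bullet> rot_field x = wlaplacian D u x \<bullet> rot_field x - (comp_rho u x * (g x \<bullet> e_rho x) + comp_phi u x * (g x \<bullet> e_phi x))"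
 using eq pressure_rot angular_gradient_rot[OF F] angular_gradient[OF F axis_Basis[of 1]] angular_gradient[OF F axis_Basis[of 2]]
 angular_gradient[OF F axis_Basis[of 3]] AE_in_D
proof eventually_elim
 case (elim x)
 note o = D_off[OF elim(7)]
 have "convection D u u x \<bullet> rot_field x = u x $ 1 * (wd (axis 1 1) x \<bullet> rot_field x) + u x $ 2 * (wd (axis 2 1) x \<bullet> rot_field x)
 + u x $ 3 * (wd (axis 3 1) x \<bullet> rot_field x)"
 unfolding convection_def sum_Basis_3 inner_axis_1 by (simp add: inner_add_left)
 also have "... = u x $ 1 * (g x $ 1 - u x \<bullet> rot_field (axis 1 1)) + u x $ 2 * (g x $ 2 - u x \<bullet> rot_field (axis 2 1))
 + u x $ 3 * (g x $ 3 - u x \<bullet> rot_field (axis 3 1))"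
 using elim(4,5,6) by (simp add: inner_axis_1)
 \<comment> \<open>The correction terms add up to \<open>u x \<bullet> rot_field (u x)\<close>,
   which is 0 by antisymmetry.\<close>
 also have "... = u x \<bullet> g x" unfolding inner_rot_field by (simp add: axis_3_nth inner_3 algebra_simps)
 also have "... = comp_rho u x * (g x \<bullet> e_rho x) + comp_phi u x * (g x \<bullet> e_phi x)"
 using frame_expansion[OF o, of "u x" "g x"] elim(3) by (simp add: comp_rho_def comp_phi_def e_theta_eq[OF o])
 moreover have "w x = wlaplacian D u x - convection D u u x - wgrad D P x" using elim(1) by simp
 ultimately show ?case using elim(2) by (simp add: inner_diff_left)
qed

lemma ang_bounded: "AE x in LD. \<bar>ang x\<bar> <= M"
 using bd AE_in_D
proof eventually_elim
 case (elim x)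
 have "(norm (rot_field x))^2 = (cyl x)^2" unfolding norm_sq_3 by (simp add: rot_field_def cyl_sq)
 then have "(norm (rot_field x))^2 <= (norm x)^2" using norm_sq_cyl[of x] by simp
 then have "norm (rot_field x) <= norm x" by (rule power2_le_imp_le) simp
 also have "norm x <= 1" using elim(2) by (simp add: D_eq)
 finally have "norm (u x) * norm (rot_field x) <= norm (u x) * 1" by (intro mult_left_mono) auto
 then show ?case using Cauchy_Schwarz_ineq2[of "u x" "rot_field x"] elim(1) by (simp add: ang_def)
qed

text \<open>Transport contributes nothing: \<open>ang^k\<close> times the derivative of
  \<open>ang\<close> along the velocity is, up to the factor 1/(k+1), the derivative of
  \<open>ang^(k+1)\<close>, and \<open>divergence_balance\<close> applies to the latter. Only the
  diffusive flux of \<open>angular_balance\<close> is left.\<close>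

lemma power_identity:
 assumes F: "H1lim F F' ang g"
 shows "(LINT x|LD. ang x ^ k * (w x \<bullet> rot_field x))
 = - (LINT x|LD. real k * ang x ^ (k - 1) * ((g x \<bullet> e_rho x)^2 + (g x \<bullet> e_phi x)^2 - 2 * ang x * (g x \<bullet> swirl_field x)))"
proof -
 obtain A A' where A: "H1lim A A' (%x. ang x ^ k) (%x. (real k * ang x ^ (k - 1)) *\<^sub>R g x)"
 using H1lim_power[OF F ang_bounded] by blast
 obtain B B' where B: "H1lim B B' (%x. ang x ^ Suc k) (%x. (real (Suc k) * ang x ^ (Suc k - 1)) *\<^sub>R g x)"
 using H1lim_power[OF F ang_bounded] by blast
 let ?h = "%x. comp_rho u x * (((real (Suc k) * ang x ^ (Suc k - 1)) *\<^sub>R g x) \<bullet> e_rho x) + comp_phi u x * (((real (Suc k) * ang x ^ (Suc k - 1)) *\<^sub>R g x) \<bullet> e_phi x)"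
 have ih: "integrable LD ?h"
 by (intro Bochner_Integration.integrable_add l2_mult_integrable comp_l2 l2_inner_continuous H1lim_l2(2)[OF B] continuous_frame)
 have il: "integrable LD (%x. (wlaplacian D u x \<bullet> rot_field x) * ang x ^ k)"
 by (rule l2_mult_integrable[OF lap_l2 H1lim_l2(1)[OF A]])
 have iw: "integrable LD (%x. ang x ^ k * (w x \<bullet> rot_field x))"
 by (rule l2_mult_integrable[OF H1lim_l2(1)[OF A] l2_inner_continuous[OF w_l2 continuous_rot_field]])
 have "(LINT x|LD. ang x ^ k * (w x \<bullet> rot_field x)) = (LINT x|LD. (wlaplacian D u x \<bullet> rot_field x) * ang x ^ k - (1 / real (Suc k)) * ?h x)"
 proof (rule integral_cong_AE)
 show "AE x in LD. ang x ^ k * (w x \<bullet> rot_field x) = (wlaplacian D u x \<bullet> rot_field x) * ang x ^ k - (1 / real (Suc k)) * ?h x"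
 using angular_force[OF F]
 proof eventually_elim
 case (elim x)
 have "(1 / real (Suc k)) * ?h x = ang x ^ k * (comp_rho u x * (g x \<bullet> e_rho x) + comp_phi u x * (g x \<bullet> e_phi x))"
 by (simp add: field_simps del: of_nat_Suc)
 then show ?case unfolding elim by (simp add: algebra_simps)
 qed
 qed (use ih il iw in auto)
 also have "... = (LINT x|LD. (wlaplacian D u x \<bullet> rot_field x) * ang x ^ k) - (1 / real (Suc k)) * (LINT x|LD. ?h x)"
 by (subst BI_diff[OF il integrable_mult_right[OF ih]]) (simp only: integral_mult_right_zero)
 also have "(LINT x|LD. ?h x) = 0" by (rule divergence_balance[OF B])
 finally have 1: "(LINT x|LD. ang x ^ k * (w x \<bullet> rot_field x)) = (LINT x|LD. (wlaplacian D u x \<bullet> rot_field x) * ang x ^ k)" by simp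
 show ?thesis
 unfolding 1 angular_balance[OF F A]
 proof (intro arg_cong[where f=uminus] LD_cong)
 fix x assume x: "x \<in> D"
 have s: "g x \<bullet> swirl_field x = (g x \<bullet> e_rho x) * (swirl_field x \<bullet> e_rho x) + (g x \<bullet> e_phi x) * (swirl_field x \<bullet> e_phi x)"
 using frame_expansion[OF D_off[OF x], of "g x" "swirl_field x"] swirl_frame(3)[OF D_off[OF x]] by simp
 show "((g x - (2 * ang x) *\<^sub>R swirl_field x) \<bullet> e_rho x) * (((real k * ang x ^ (k - 1)) *\<^sub>R g x) \<bullet> e_rho x)
 + ((g x - (2 * ang x) *\<^sub>R swirl_field x) \<bullet> e_phi x) * (((real k * ang x ^ (k - 1)) *\<^sub>R g x) \<bullet> e_phi x)
 = real k * ang x ^ (k - 1) * ((g x \<bullet> e_rho x)^2 + (g x \<bullet> e_phi x)^2 - 2 * ang x * (g x \<bullet> swirl_field x))"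
 unfolding s inner_diff_left inner_scaleR_left by (simp add: power2_eq_square algebra_simps)
 qed
qed

lemma integrable_square: "l2 LD h ==> integrable LD (%x. (h x)^2)" for h :: "real^3 => real"
 by (simp add: l2_def)

text \<open>For \<open>w\<close> the time derivative these are, up to positive factors, the
  derivatives of the moments of \<open>ang\<close>. The first is 0 because a constant has no
  gradient, the second has a sign because 0.95 < 1, and the third has one whenever the moment of
  order 2p already exceeds the squared L1 term of \<open>H1lim_inequalities\<close>.\<close>

theorem slice_estimates:
 shows "(LINT x|LD. w x \<bullet> rot_field x) = 0"
 and "(LINT x|LD. ang x) = 0 ==> (LINT x|LD. ang x * (w x \<bullet> rot_field x)) <= 0"
 and "1 <= p ==> 10^7 * real p^5 / \<alpha> * ((LINT x|LD. \<bar>ang x\<bar> ^ p) / (2 * pi))^2 <= (LINT x|LD. ang x ^ (2 * p))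
 ==> (LINT x|LD. ang x ^ (2 * p - 1) * (w x \<bullet> rot_field x)) <= 0"
proof -
 obtain F F' g where F: "H1lim F F' ang g" using angular_H1lim by blast
 note rot = angular_gradient_rot[OF F]
 show "(LINT x|LD. w x \<bullet> rot_field x) = 0" using power_identity[OF F, of 0] by simp
 show "(LINT x|LD. ang x * (w x \<bullet> rot_field x)) <= 0" if "(LINT x|LD. ang x) = 0"
 proof -
 let ?E = "%x. (g x \<bullet> e_rho x)^2 + (g x \<bullet> e_phi x)^2" and ?J = "%x. 2 * ang x * (g x \<bullet> swirl_field x)"
 have iE: "integrable LD ?E"
 by (intro Bochner_Integration.integrable_add integrable_square l2_inner_continuous H1lim_l2(2)[OF F] continuous_frame)
 have iJ: "integrable LD ?J"
 by (intro l2_mult_integrable l2_mult_continuous ang_l2 continuous_on_const l2_inner_continuous H1lim_l2(2)[OF F] continuous_swirl_field)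
 have "0 <= (LINT x|LD. ?E x)" by (rule Bochner_Integration.integral_nonneg) simp
 moreover have "20 * (LINT x|LD. ?J x) <= 19 * (LINT x|LD. ?E x)" using H1lim_inequalities(2)[OF F rot] that by simp
 moreover have "(LINT x|LD. ang x * (w x \<bullet> rot_field x)) = - ((LINT x|LD. ?E x) - (LINT x|LD. ?J x))"
 unfolding BI_diff[OF iE iJ, symmetric] using power_identity[OF F, of 1] by simp
 ultimately show ?thesis by linarith
 qed
 show "(LINT x|LD. ang x ^ (2 * p - 1) * (w x \<bullet> rot_field x)) <= 0"
 if p: "1 <= p" and le: "10^7 * real p^5 / \<alpha> * ((LINT x|LD. \<bar>ang x\<bar> ^ p) / (2 * pi))^2 <= (LINT x|LD. ang x ^ (2 * p))"
 proof -
 obtain j where j: "p = Suc j" using p by (cases p) auto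
 define h where "h x = (real p * ang x ^ (p - 1)) *\<^sub>R g x" for x
 obtain A A' where A: "H1lim A A' (%x. ang x ^ p) h"
 using H1lim_power[OF F ang_bounded] unfolding h_def[abs_def] by blast
 have rh: "AE x in LD. h x \<bullet> rot_field x = 0" using rot by eventually_elim (simp add: h_def)
 let ?E = "%x. (h x \<bullet> e_rho x)^2 + (h x \<bullet> e_phi x)^2" and ?J = "%x. 2 * ang x ^ p * (h x \<bullet> swirl_field x)"
 have iE: "integrable LD ?E"
 by (intro Bochner_Integration.integrable_add integrable_square l2_inner_continuous H1lim_l2(2)[OF A] continuous_frame)
 have iJ: "integrable LD ?J"
 by (intro l2_mult_integrable l2_mult_continuous H1lim_l2[OF A] continuous_on_const l2_inner_continuous continuous_swirl_field)
 have "real p * (LINT x|LD. ?J x) - (LINT x|LD. ?E x) <= 0"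
 using H1lim_inequalities(1)[OF A rh p] le by (simp add: power_abs power_mult[symmetric] mult.commute)
 \<comment> \<open>Testing with the power 2p-1 produces the factor 2p-1, while the energy of
   \<open>ang^p\<close> carries p^2; the quotient converts one into the other.\<close>
 then have n: "0 <= (real (2 * p - 1) / (real p)^2) * ((LINT x|LD. ?E x) - real p * (LINT x|LD. ?J x))"
 by (intro mult_nonneg_nonneg) auto
 have "(LINT x|LD. ang x ^ (2 * p - 1) * (w x \<bullet> rot_field x))
 = - (LINT x|LD. (real (2 * p - 1) / (real p)^2) * (?E x - real p * ?J x))"
 unfolding power_identity[OF F]
 proof (intro arg_cong[where f=uminus] LD_cong)
 fix x
 \<comment> \<open>Writing p as \<open>Suc j\<close> avoids truncated subtraction in the
   exponents.\<close>
 have e: "2 * p - 1 - 1 = j + j" "p - 1 = j" using j by auto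
 have "?E x - real p * ?J x = (real p)^2 * (ang x ^ (j + j) * ((g x \<bullet> e_rho x)^2 + (g x \<bullet> e_phi x)^2 - 2 * ang x * (g x \<bullet> swirl_field x)))"
 unfolding h_def e inner_scaleR_left unfolding j power_add power_Suc by (simp add: power2_eq_square algebra_simps)
 then show "real (2 * p - 1) * ang x ^ (2 * p - 1 - 1) * ((g x \<bullet> e_rho x)^2 + (g x \<bullet> e_phi x)^2 - 2 * ang x * (g x \<bullet> swirl_field x))
 = (real (2 * p - 1) / (real p)^2) * (?E x - real p * ?J x)"
 using p unfolding e(1) by simp
 qed
 also have "... = - ((real (2 * p - 1) / (real p)^2) * ((LINT x|LD. ?E x) - real p * (LINT x|LD. ?J x)))"
 unfolding integral_mult_right_zero BI_diff[OF iE integrable_mult_right[OF iJ]] ..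
 finally show ?thesis using n by simp
 qed
qed

end

section \<open>Weak time derivatives\<close>

lemma lborel_pair: "(lborel :: ('a::euclidean_space \<times> 'b::euclidean_space) measure) = lborel \<Otimes>\<^sub>M lborel"
 by (simp add: lborel_prod)

text \<open>The product rule for absolutely continuous functions by Fubini: the product of the two
  integrals is an integral over a square, cut along the diagonal.\<close>

lemma indefinite_integral_mult:
 fixes a b :: "real => real" and u0 w0 :: real
 assumes a: "integrable lborel a" and b: "integrable lborel b" and t: "0 <= t"
 defines "u \<equiv> %t. u0 + (LINT s|lborel. indicator {0..t} s * a s)" and "w \<equiv> %t. w0 + (LINT s|lborel. indicator {0..t} s * b s)"
 shows "u t * w t = u0 * w0 + (LINT s|lborel. indicator {0..t} s * (a s * w s + u s * b s))"
 and "integrable lborel (%s. indicator {0..t} s * (a s * w s + u s * b s))"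
proof -
 have [measurable]: "a \<in> borel_measurable borel" "b \<in> borel_measurable borel"
 using a b by (auto dest: borel_measurable_integrable)
 have ia: "integrable lborel (%s. indicator S s * a s)" "integrable lborel (%s. indicator S s * b s)"
 if "S \<in> sets borel" for S :: "real set"
 using integrable_mult_indicator[of S lborel a] integrable_mult_indicator[of S lborel b] a b that by auto
 let ?A = "%t. LINT s|lborel. indicator {0..t} s * a s" and ?B = "%t. LINT s|lborel. indicator {0..t} s * b s"
 let ?f = "%(s, r). (indicator {0..t} s * a s) * (indicator {0..t} r * b r)"
 let ?f1 = "%(s, r). (indicator {0..t} s * a s) * (indicator {0..s} r * b r)"
 \<comment> \<open>The half-open interval makes this triangle exclude the diagonal, which
   \<open>?f1\<close> already contains.\<close>
 let ?f2 = "%(s, r). (indicator {0..<r} s * a s) * (indicator {0..t} r * b r)"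
 have i: "integrable (lborel \<Otimes>\<^sub>M lborel) ?f"
 proof (rule lborel_pair.Fubini_integrable)
 show "integrable lborel (%s. LINT r|lborel. norm (?f (s, r)))"
 using integrable_norm[OF ia(1)[of "{0..t}"]] by (simp add: abs_mult)
 show "AE s in lborel. integrable lborel (%r. ?f (s, r))"
 using ia(2)[of "{0..t}"] by simp
 qed simp
 have i1: "integrable (lborel \<Otimes>\<^sub>M lborel) ?f1"
 by (rule Bochner_Integration.integrable_bound[OF i]) (auto simp: indicator_def split_beta' intro!: AE_I2)
 have i2: "integrable (lborel \<Otimes>\<^sub>M lborel) ?f2"
 by (rule Bochner_Integration.integrable_bound[OF i]) (auto simp: indicator_def split_beta' intro!: AE_I2)
 have eq: "?f z = ?f1 z + ?f2 z" for z by (auto simp: indicator_def split: prod.splits)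
 have 1: "(LINT z|(lborel \<Otimes>\<^sub>M lborel). ?f1 z) = (LINT s|lborel. indicator {0..t} s * (a s * ?B s))"
 "integrable lborel (%s. indicator {0..t} s * (a s * ?B s))"
 using lborel_pair.integral_fst'[OF i1] lborel_pair.integrable_fst'[OF i1] by (simp_all add: mult.assoc)
 have e2: "(LINT s|lborel. indicator {0..<r} s * a s) = ?A r" for r
 by (rule integral_cong_AE) (use AE_lborel_singleton[of r] in \<open>auto simp: indicator_def elim!: eventually_mono\<close>)
 have inner: "(LINT s|lborel. ?f2 (s, r)) = indicator {0..t} r * (?A r * b r)" for r
 proof -
 have "(LINT s|lborel. ?f2 (s, r)) = (LINT s|lborel. indicator {0..<r} s * a s) * (indicator {0..t} r * b r)"
 unfolding prod.case by (rule integral_mult_left_zero)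
 then show ?thesis unfolding e2 by (simp add: mult_ac)
 qed
 have i2': "integrable (lborel \<Otimes>\<^sub>M lborel) (case_prod (%s r. ?f2 (s, r)))" using i2 by (simp add: split_beta')
 have 2: "(LINT z|(lborel \<Otimes>\<^sub>M lborel). ?f2 z) = (LINT r|lborel. indicator {0..t} r * (?A r * b r))"
 "integrable lborel (%r. indicator {0..t} r * (?A r * b r))"
 using lborel_pair.integral_snd[OF i2'] lborel_pair.integrable_snd[OF i2'] unfolding inner by (simp_all add: split_beta')
 have "?A t * ?B t = (LINT z|(lborel \<Otimes>\<^sub>M lborel). ?f z)"
 using lborel_pair.integral_fst'[OF i] by (simp add: mult.commute)
 also have "... = (LINT z|(lborel \<Otimes>\<^sub>M lborel). ?f1 z) + (LINT z|(lborel \<Otimes>\<^sub>M lborel). ?f2 z)"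
 unfolding eq by (rule BI_add[OF i1 i2])
 finally have P: "?A t * ?B t = (LINT s|lborel. indicator {0..t} s * (a s * ?B s)) + (LINT r|lborel. indicator {0..t} r * (?A r * b r))"
 unfolding 1 2 .
 have split: "indicator {0..t} s * (a s * w s + u s * b s) = w0 * (indicator {0..t} s * a s) + u0 * (indicator {0..t} s * b s)
 + (indicator {0..t} s * (a s * ?B s) + indicator {0..t} s * (?A s * b s))" for s
 by (simp add: u_def w_def algebra_simps)
 show "integrable lborel (%s. indicator {0..t} s * (a s * w s + u s * b s))"
 unfolding split using 1(2) 2(2) ia[of "{0..t}"] by auto
 have "(LINT s|lborel. indicator {0..t} s * (a s * w s + u s * b s)) = w0 * ?A t + u0 * ?B t + ?A t * ?B t"
 unfolding split P using 1(2) 2(2) ia[of "{0..t}"] by simp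
 then show "u t * w t = u0 * w0 + (LINT s|lborel. indicator {0..t} s * (a s * w s + u s * b s))"
 by (simp add: u_def w_def algebra_simps)
qed

text \<open>Induction with the product rule for u times u^k. Integrability of the new density is
  part of the claim because the next step takes it as input.\<close>

lemma indefinite_integral_power:
 fixes a :: "real => real" and u0 :: real
 assumes a: "integrable lborel a" "!!s. s \<notin> {0..T} ==> a s = 0"
 defines "u \<equiv> %t. u0 + (LINT s|lborel. indicator {0..t} s * a s)"
 shows "integrable lborel (%s. real k * u s ^ (k - 1) * a s)
 \<and> (\<forall>t\<ge>0. u t ^ k = u0 ^ k + (LINT s|lborel. indicator {0..t} s * (real k * u s ^ (k - 1) * a s)))"
proof (induction k)
 case 0
 show ?case by simp
next
 case (Suc k)
 let ?b = "%s. real k * u s ^ (k - 1) * a s"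
 from Suc have b: "integrable lborel ?b" and w: "!!t. t >= 0 ==> u t ^ k = u0 ^ k + (LINT s|lborel. indicator {0..t} s * ?b s)" by auto
 have PR: "u t * (u0 ^ k + (LINT s|lborel. indicator {0..t} s * ?b s)) = u0 * u0 ^ k + (LINT s|lborel. indicator {0..t} s * (a s * (u0 ^ k + (LINT r|lborel. indicator {0..s} r * ?b r)) + u s * ?b s))"
 "integrable lborel (%s. indicator {0..t} s * (a s * (u0 ^ k + (LINT r|lborel. indicator {0..s} r * ?b r)) + u s * ?b s))" if "0 <= t" for t
 using indefinite_integral_mult[OF a(1) b that, where ?u0.0=u0 and ?w0.0="u0 ^ k"] unfolding u_def by blast+
 have eq: "indicator {0..t} s * (a s * (u0 ^ k + (LINT r|lborel. indicator {0..s} r * ?b r)) + u s * ?b s)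
 = indicator {0..t} s * (real (Suc k) * u s ^ (Suc k - 1) * a s)" for s t
 using w[of s] by (cases k) (auto simp: indicator_def algebra_simps)
 have i: "integrable lborel (%s. indicator {0..t} s * (real (Suc k) * u s ^ (Suc k - 1) * a s))" if "t >= 0" for t
 using PR(2)[OF that] by (simp only: eq)
 \<comment> \<open>As \<open>a\<close> vanishes outside \<open>{0..T}\<close>, integrability up to
   \<open>max 0 T\<close> is integrability on the line; the maximum covers negative
   \<open>T\<close>.\<close>
 have "(%s. real (Suc k) * u s ^ (Suc k - 1) * a s) = (%s. indicator {0..max 0 T} s * (real (Suc k) * u s ^ (Suc k - 1) * a s))"
 using a(2) by (force simp: indicator_def fun_eq_iff max_def)
 then have "integrable lborel (%s. real (Suc k) * u s ^ (Suc k - 1) * a s)" using i[of "max 0 T"] by simp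
 moreover have "u t ^ Suc k = u0 ^ Suc k + (LINT s|lborel. indicator {0..t} s * (real (Suc k) * u s ^ (Suc k - 1) * a s))" if "t >= 0" for t
 using PR(1)[OF that] unfolding eq[abs_def] w[OF that, symmetric] by (simp only: power_Suc)
 ultimately show ?case by blast
qed

lemma indefinite_integral_continuous:
 fixes a :: "real => real"
 assumes a: "integrable lborel a"
 shows "continuous_on UNIV (%t. LINT s|lborel. indicator {0..t} s * a s)"
proof (rule continuous_on_sequentiallyI)
 fix X :: "nat => real" and t assume X: "X \<longlonglongrightarrow> t"
 have [measurable]: "a \<in> borel_measurable borel" using a by (auto dest: borel_measurable_integrable)
 show "(%n. LINT s|lborel. indicator {0..X n} s * a s) \<longlonglongrightarrow> (LINT s|lborel. indicator {0..t} s * a s)"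
 proof (rule integral_dominated_convergence[where w="%s. \<bar>a s\<bar>"])
 show "AE s in lborel. (%n. indicat_real {0..X n} s * a s) \<longlonglongrightarrow> indicat_real {0..t} s * a s"
 using AE_lborel_singleton[of t]
 proof eventually_elim
 case (elim s)
 have "\<forall>\<^sub>F n in sequentially. indicat_real {0..t} s * a s = indicat_real {0..X n} s * a s"
 proof (cases "s < t")
 case True
 with X have "\<forall>\<^sub>F n in sequentially. s < X n" by (simp add: order_tendsto_iff)
 then show ?thesis by (rule eventually_mono) (use True in \<open>auto simp: indicator_def\<close>)
 next
 case False
 with elim have "t < s" by simp
 with X have "\<forall>\<^sub>F n in sequentially. X n < s" by (simp add: order_tendsto_iff)
 then show ?thesis by (rule eventually_mono) (use \<open>t < s\<close> in \<open>auto simp: indicator_def\<close>)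
 qed
 then show ?case by (rule Lim_transform_eventually[OF tendsto_const])
 qed
 show "AE s in lborel. norm (indicat_real {0..X n} s * a s) <= \<bar>a s\<bar>" for n
 by (auto simp: indicator_def)
 qed (use a in auto)
qed

text \<open>On space-time, box bumps factor into a time and a space bump. This is why the
  fundamental lemma has a version for box bumps alone: test functions of product form then
  suffice.\<close>

lemma box_bump_Pair:
 "box_bump n (a, c) (b, d) (t, x :: 'a::euclidean_space) = box_bump n a b (t :: real) * box_bump n c d x"
 unfolding box_bump_def
 by (subst Basis_prod_def, subst prod.union_disjoint)
 (auto simp: prod.reindex inj_on_def)

lemma Ck_Pair:
 fixes f :: "real => real" and g :: "'a::euclidean_space => real"
 shows "Ck k f ==> Ck k (%z :: real \<times> 'a. f (fst z))" "Ck k g ==> Ck k (%z :: real \<times> 'a. g (snd z))"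
proof -
 show "Ck k f ==> Ck k (%z :: real \<times> 'a. f (fst z))"
 using Ck_affine_compose[of k f "(1, 0) :: real \<times> 'a" 0] by (simp add: inner_prod_def)
 show "Ck k g ==> Ck k (%z :: real \<times> 'a. g (snd z))"
 proof (induction k arbitrary: g)
 case 0
 then show ?case by (auto intro!: continuous_on_compose2[of UNIV g] continuous_intros)
 next
 case (Suc k)
 show ?case
 proof (rule Ck_SucI)
 fix z :: "real \<times> 'a"
 have "((snd :: real \<times> 'a => 'a) has_derivative snd) (at z)" by (auto intro!: derivative_eq_intros)
 from has_derivative_compose[OF this Ck_SucD(1)[OF Suc.prems]]
 show "((%z. g (snd z)) has_derivative (%h. frechet_derivative g (at (snd z)) (snd h))) (at z)" .
 next
 fix b :: "real \<times> 'a" assume "b \<in> Basis"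
 then consider "snd b = 0" | "snd b \<in> Basis" by (auto simp: Basis_prod_def)
 then show "Ck k (%z :: real \<times> 'a. frechet_derivative g (at (snd z)) (snd b))"
 proof cases
 case 1
 have "frechet_derivative g (at y) 0 = 0" for y
 using linear_0[OF has_derivative_linear[OF Ck_SucD(1)[OF Suc.prems]]] .
 then show ?thesis using 1 Ck_const[of k 0] by simp
 next
 case 2
 then show ?thesis using Suc.IH[OF Ck_SucD(2)[OF Suc.prems 2]] by simp
 qed
 qed
 qed
qed

lemma smooth_antiderivative:
 fixes f :: "real => real"
 assumes "smooth f" obtains F where "smooth F" "!!t. (F has_real_derivative f t) (at t)"
proof -
 obtain F where F: "!!t. (F has_vector_derivative f t) (at t)"
 using einterval_antiderivative[of "-\<infinity>" "\<infinity>" f] smooth_continuous[OF assms, of UNIV]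
 by (auto simp: continuous_on_eq_continuous_at)
 then have d: "(F has_real_derivative f t) (at t)" for t
 by (simp add: has_real_derivative_iff_has_vector_derivative)
 have "Ck k F" for k
 proof (cases k)
 case 0
 then show ?thesis using DERIV_isCont[OF d] by (auto intro: continuous_at_imp_continuous_on)
 next
 case (Suc n)
 have "Ck n f" using assms by (simp add: smooth_def)
 show ?thesis unfolding Suc
 proof (rule Ck_SucI)
 show "(F has_derivative (%h. f t * h)) (at t)" for t using d[of t] by (simp add: has_field_derivative_def)
 show "Ck n (%x. f x * b)" if "b \<in> Basis" for b using \<open>Ck n f\<close> that by simp
 qed
 qed
 then show ?thesis by (intro that[of F] d) (simp add: smooth_def)
qed

text \<open>Mean zero is what makes an antiderivative vanish on both sides of the support; it
  supplies time factors for test functions whose derivative is prescribed.\<close>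

lemma compact_bump_antiderivative:
 fixes f :: "real => real"
 assumes f: "smooth f" and ab: "a <= b" "!!t. t \<notin> {a..b} ==> f t = 0" and z: "integral {a..b} f = 0"
 obtains F where "smooth F" "!!t. (F has_real_derivative f t) (at t)" "!!t. t \<notin> {a..b} ==> F t = 0"
 "!!s t. [|s <= t; b <= t|] ==> integral {s..t} f = - F s"
proof -
 obtain F0 where F0: "smooth F0" "!!t. (F0 has_real_derivative f t) (at t)" using smooth_antiderivative[OF f] by blast
 define F where "F t = F0 t - F0 a" for t
 have F: "smooth F" "!!t. (F has_real_derivative f t) (at t)"
 unfolding F_def[abs_def] using smooth_diff[OF F0(1) smooth_const] F0(2) by (auto intro!: derivative_eq_intros)
 have ftc: "(f has_integral F t - F s) {s..t}" if "s <= t" for s t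
 by (rule fundamental_theorem_of_calculus[OF that])
 (auto simp flip: has_real_derivative_iff_has_vector_derivative intro: DERIV_subset[OF F(2)])
 have Fa: "F a = 0" by (simp add: F_def)
 have Fb: "F b = 0" using integral_unique[OF ftc[OF ab(1)]] z Fa by simp
 have z0: "integral {s..t} f = 0" if "{s..t} \<inter> {a<..<b} = {}" for s t
 proof -
 have "integral {s..t} f = integral {s..t} (%x. 0)"
 proof (rule integral_spike[of "{a, b}"])
 show "(0::real) = f x" if x: "x \<in> {s..t} - {a, b}" for x
 using that \<open>{s..t} \<inter> {a<..<b} = {}\<close> ab(2)[of x] by (cases "x \<in> {a..b}") (auto simp: less_le)
 qed simp
 then show ?thesis by simp
 qed
 have out: "F t = 0" if "t \<notin> {a..b}" for t
 proof (cases "t < a")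
 case True
 then have "F a - F t = 0" using integral_unique[OF ftc[of t a]] z0[of t a] by force
 then show ?thesis using Fa by simp
 next
 case False
 with that have t: "b <= t" by auto
 then have "F t - F b = 0" using integral_unique[OF ftc[of b t]] z0[of b t] by force
 then show ?thesis using Fb by simp
 qed
 have "integral {s..t} f = - F s" if "s <= t" "b <= t" for s t
 proof -
 have "F t = 0" using out[of t] Fb that by (cases "t = b") auto
 then show ?thesis using integral_unique[OF ftc[OF that(1)]] by simp
 qed
 then show ?thesis using that F out by blast
qed

text \<open>Fubini is applied to Borel functions on a product, whereas weak derivatives are
  measurable for the Lebesgue completion only; a Borel version vanishing outside \<open>U\<close>
  mediates.\<close>

lemma borel_representative:
 fixes f :: "'a::euclidean_space => real"
 assumes f: "f \<in> borel_measurable (lebesgue_on U)" and U: "open U"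
 obtains f' where "f' \<in> borel_measurable borel" "!!x. x \<notin> U ==> f' x = 0" "AE x in lebesgue_on U. f x = f' x"
proof -
 have U': "U \<in> sets lebesgue" by (rule open_in_sets_lebesgue[OF U])
 have "(%x. indicator U x *\<^sub>R f x) \<in> borel_measurable lebesgue" using f U' by (simp add: borel_measurable_restrict_space_iff)
 from completion_ex_borel_measurable_real[OF this]
 obtain h where h: "h \<in> borel_measurable lborel" "AE x in lborel. indicator U x *\<^sub>R f x = h x" by blast
 have ae: "AE x in lebesgue. indicator U x *\<^sub>R f x = h x" by (rule AE_completion[OF h(2)])
 show ?thesis
 proof (rule that[of "%x. if x \<in> U then h x else 0"])
 have [measurable]: "h \<in> borel_measurable borel" "U \<in> sets borel" using h(1) U by auto
 show "(%x. if x \<in> U then h x else 0) \<in> borel_measurable borel" by measurable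
 show "AE x in lebesgue_on U. f x = (if x \<in> U then h x else 0)"
 unfolding AE_lebesgue_on_iff[OF U'] using ae by eventually_elim auto
 qed simp
qed

lemma integral_representative:
 fixes f f' q :: "'a::euclidean_space => real"
 assumes U: "open U" and f: "f \<in> borel_measurable (lebesgue_on U)"
 and f': "f' \<in> borel_measurable borel" "!!x. x \<notin> U ==> f' x = 0" "AE x in lebesgue_on U. f x = f' x"
 and q: "q \<in> borel_measurable borel"
 shows "(LINT x|lebesgue_on U. q x * f x) = (LINT x|lborel. q x * f' x)"
 and "integrable (lebesgue_on U) f \<longleftrightarrow> integrable lborel f'"
proof -
 have U': "U \<in> sets lebesgue" by (rule open_in_sets_lebesgue[OF U])
 have m: "q \<in> borel_measurable (lebesgue_on U)" "f' \<in> borel_measurable (lebesgue_on U)"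
 using q f'(1) by (auto intro!: measurable_restrict_space1 measurable_completion)
 have i: "indicator U x *\<^sub>R f' x = f' x" "indicator U x *\<^sub>R (q x * f' x) = q x * f' x" for x using f'(2)[of x] by (auto simp: indicator_def)
 have "(LINT x|lebesgue_on U. q x * f x) = (LINT x|lebesgue_on U. q x * f' x)"
 using f'(3) by (intro integral_cong_AE borel_measurable_times m f) (auto elim: eventually_mono)
 also have "... = (LINT x|lebesgue. q x * f' x)" unfolding integral_lebesgue_on_indicator(1)[OF U'] i ..
 also have "... = (LINT x|lborel. q x * f' x)" using q f'(1) by (intro integral_completion) simp
 finally show "(LINT x|lebesgue_on U. q x * f x) = (LINT x|lborel. q x * f' x)" .
 have "integrable (lebesgue_on U) f \<longleftrightarrow> integrable (lebesgue_on U) f'"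
 using f'(3) by (intro integrable_cong_AE m f)
 also have "... \<longleftrightarrow> integrable lebesgue f'" unfolding integral_lebesgue_on_indicator(2)[OF U'] i ..
 also have "... \<longleftrightarrow> integrable lborel f'" using f'(1) by (intro integrable_completion) simp
 finally show "integrable (lebesgue_on U) f \<longleftrightarrow> integrable lborel f'" .
qed

lemma integrable_product:
 fixes a :: "real => real" and b :: "'a::euclidean_space => real"
 assumes a: "integrable lborel a" and b: "integrable lborel b"
 shows "integrable lborel (%z. a (fst z) * b (snd z))"
proof -
 have [measurable]: "a \<in> borel_measurable borel" "b \<in> borel_measurable borel"
 using a b by (auto dest: borel_measurable_integrable)
 have "integrable (lborel \<Otimes>\<^sub>M lborel) (%z. a (fst z) * b (snd z))"
 proof (rule lborel_pair.Fubini_integrable)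
 show "integrable lborel (%x. LINT y|lborel. norm (a (fst (x, y)) * b (snd (x, y))))"
 using integrable_norm[OF a] by (simp add: abs_mult)
 show "AE x in lborel. integrable lborel (%y. a (fst (x, y)) * b (snd (x, y)))" using b by simp
 qed measurable
 then show ?thesis by (simp add: lborel_pair)
qed

lemma interval_point:
 assumes "AE t in lborel. t \<in> {0<..<T} --> P t" "(a::real) < b" "0 <= a" "b <= T"
 obtains t where "t \<in> {a<..<b}" "P t"
proof (rule ccontr)
 assume "\<not> thesis"
 then have no: "\<not> P t" if "t \<in> {a<..<b}" for t using that \<open>!!t. t \<in> {a<..<b} ==> P t ==> thesis\<close> by blast
 have "AE t in lborel. t \<notin> {a<..<b}"
 using assms(1) by eventually_elim (use no assms(2-) in force)
 then have "{a<..<b} \<in> null_sets lborel" by (subst AE_iff_null_sets) auto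
 then show False using assms(2) by (simp add: null_sets_def)
qed

lemma AE_bound_continuous:
 fixes y :: "real => real"
 assumes c: "continuous_on {0..T} y" and ae: "AE t in lborel. t \<in> {0<..<T} --> \<bar>y t\<bar> <= M" and t: "t \<in> {0..T}" and T: "0 < T"
 shows "\<bar>y t\<bar> <= M"
proof (rule ccontr)
 assume n: "\<not> \<bar>y t\<bar> <= M"
 then obtain d where d: "d > 0" "!!s. s \<in> {0..T} ==> dist s t < d ==> dist (y s) (y t) < \<bar>y t\<bar> - M"
 using c t unfolding continuous_on_iff by (metis diff_gt_0_iff_gt linorder_not_le)
 obtain s where s: "s \<in> {max 0 (t - d)<..<min T (t + d)}" "\<bar>y s\<bar> <= M"
 by (rule interval_point[OF ae, of "max 0 (t - d)" "min T (t + d)"]) (use t T d(1) in auto)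
 then have "s \<in> {0..T}" "dist s t < d" by (auto simp: dist_real_def)
 from d(2)[OF this] have "\<bar>y s - y t\<bar> < \<bar>y t\<bar> - M" by (simp add: dist_real_def)
 then show False using s(2) by linarith
qed

lemma bump_integral:
 fixes f :: "real => real"
 assumes "continuous_on UNIV f" "!!t. t \<notin> {a..b} ==> f t = 0"
 shows "integrable lborel f" "(LINT t|lborel. f t) = integral {a..b} f"
proof -
 have i: "set_integrable lborel {a..b} f"
 by (rule borel_integrable_atLeastAtMost') (rule continuous_on_subset[OF assms(1)], simp)
 have e: "indicator {a..b} t *\<^sub>R f t = f t" for t using assms(2)[of t] by (auto simp: indicator_def)
 show "integrable lborel f" using i unfolding set_integrable_def e .
 show "(LINT t|lborel. f t) = integral {a..b} f"
 using set_borel_integral_eq_integral(2)[OF i] unfolding set_lebesgue_integral_def e .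
qed

lemma test_function_Pair:
 fixes Tht f :: "real => real" and \<kappa> :: "'a::euclidean_space => real"
 assumes Tht: "smooth Tht" "!!t. t \<notin> {a0..b0} ==> Tht t = 0" "!!t. (Tht has_real_derivative f t) (at t)"
 and \<kappa>: "smooth \<kappa>" "!!x. x \<notin> cbox a b ==> \<kappa> x = 0" and sub: "{a0..b0} \<times> cbox a b \<subseteq> U"
 shows "test_function U (%z. Tht (fst z) * \<kappa> (snd z))"
 and "frechet_derivative (%z. Tht (fst z) * \<kappa> (snd z)) (at z) (1, 0) = f (fst z) * \<kappa> (snd z)"
proof -
 have s: "smooth (%z. Tht (fst z) * \<kappa> (snd z))"
 proof (rule smooth_mult)
 show "smooth (%z :: real \<times> 'a. Tht (fst z))" unfolding smooth_def by (intro allI Ck_Pair(1)) (use Tht(1) in \<open>simp add: smooth_def\<close>)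
 show "smooth (%z :: real \<times> 'a. \<kappa> (snd z))" unfolding smooth_def by (intro allI Ck_Pair(2)) (use \<kappa>(1) in \<open>simp add: smooth_def\<close>)
 qed
 have "closure {z. Tht (fst z) * \<kappa> (snd z) ~= 0} \<subseteq> {a0..b0} \<times> cbox a b"
 proof (rule closure_minimal)
 show "{z. Tht (fst z) * \<kappa> (snd z) ~= 0} \<subseteq> {a0..b0} \<times> cbox a b" using Tht(2) \<kappa>(2) by force
 show "closed ({a0..b0} \<times> cbox a b)" by (intro closed_Times closed_cbox) auto
 qed
 moreover have "compact (closure {z. Tht (fst z) * \<kappa> (snd z) ~= 0})"
 unfolding compact_closure
 by (rule bounded_subset[OF compact_imp_bounded[OF compact_Times[OF compact_Icc[of a0 b0] compact_cbox[of a b]]]]) (use Tht(2) \<kappa>(2) in force)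
 ultimately show "test_function U (%z. Tht (fst z) * \<kappa> (snd z))"
 using s sub unfolding test_function_def by blast
 have d: "((%z. Tht (fst z)) has_derivative (%h. f (fst z) * fst h)) (at z)"
 by (rule has_derivative_compose[OF _ Tht(3)[unfolded has_field_derivative_def], of fst fst z UNIV]) (auto intro!: derivative_eq_intros)
 have e: "((%z. \<kappa> (snd z)) has_derivative (%h. frechet_derivative \<kappa> (at (snd z)) (snd h))) (at z)"
 by (rule has_derivative_compose[OF _ smooth_has_derivative[OF \<kappa>(1)], of snd snd z UNIV]) (auto intro!: derivative_eq_intros)
 have "frechet_derivative \<kappa> (at (snd z)) 0 = 0"
 by (rule linear_0[OF has_derivative_linear[OF smooth_has_derivative[OF \<kappa>(1)]]])
 then show "frechet_derivative (%z. Tht (fst z) * \<kappa> (snd z)) (at z) (1, 0) = f (fst z) * \<kappa> (snd z)"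
 unfolding frechet_derivative_at[OF has_derivative_mult[OF d e], symmetric] by simp
qed

locale weak_time =
 fixes T :: real and U :: "'a::euclidean_space set" and G g :: "real \<times> 'a => real" and M :: real
 assumes T: "0 < T" and openU: "open U" and finU: "emeasure lborel U < \<infinity>"
 and wd: "has_weak_deriv ({0<..<T} \<times> U) (1, 0) G g" and gi: "integrable (lebesgue_on ({0<..<T} \<times> U)) g"
 and Gm: "G \<in> borel_measurable (lebesgue_on ({0<..<T} \<times> U))"
 and bd: "AE z in lebesgue_on ({0<..<T} \<times> U). \<bar>G z\<bar> <= M" and M: "0 <= M"
begin

abbreviation "Q \<equiv> {0<..<T} \<times> U"

lemma open_Q: "open Q" by (intro open_Times openU) auto

lemma Q_sets: "Q \<in> sets lebesgue" by (rule open_in_sets_lebesgue[OF open_Q])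

text \<open>A du Bois-Reymond argument with a parameter: subtracting from \<open>G\<close> the time
  integral of its weak derivative leaves a function whose weak time derivative is 0, hence one that
  depends on \<open>x\<close> only. The formula for \<open>Y\<close> is arranged to hold for every
  \<open>t\<close> and \<open>x\<close>, not merely almost all.\<close>

lemma representative:
 obtains Y :: "real => 'a => real" and h :: "real \<times> 'a => real" where
 "(%z. Y (fst z) (snd z)) \<in> borel_measurable borel" "h \<in> borel_measurable borel" "integrable lborel h"
 "!!z. z \<notin> Q ==> h z = 0" "AE z in lebesgue_on Q. g z = h z" "AE z in lebesgue_on Q. G z = Y (fst z) (snd z)"
 "!!x. integrable lborel (%s. h (s, x))" "!!t x. Y t x = Y 0 x + (LINT s|lborel. indicator {0..t} s * h (s, x))"
proof -
 obtain h0 where h0: "h0 \<in> borel_measurable borel" "!!z. z \<notin> Q ==> h0 z = 0" "AE z in lebesgue_on Q. g z = h0 z"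
 using borel_representative[OF borel_measurable_integrable[OF gi] open_Q] by blast
 have h0i: "integrable lborel h0"
 using integral_representative(2)[OF open_Q borel_measurable_integrable[OF gi] h0 borel_measurable_const[of 0]] gi by blast
 have [measurable]: "h0 \<in> borel_measurable (borel \<Otimes>\<^sub>M borel)" using h0(1) by (simp add: borel_prod)
 \<comment> \<open>The points whose time line carries an integrable density. Redefining the density
   as 0 on all other lines makes the time integral meaningful for every \<open>x\<close>, at the
   cost of a null set.\<close>
 define N where "N = {x :: 'a. (\<integral>\<^sup>+s. ennreal (norm (h0 (s, x))) \<partial>lborel) < \<infinity>}"
 have [measurable]: "N \<in> sets borel" unfolding N_def by measurable
 define h where "h z = (if snd z \<in> N then h0 z else 0)" for z
 have hm [measurable]: "h \<in> borel_measurable (borel \<Otimes>\<^sub>M borel)" unfolding h_def[abs_def] by measurable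
 have hb: "h \<in> borel_measurable borel" using hm by (simp add: borel_prod)
 have hQ: "h z = 0" if "z \<notin> Q" for z using h0(2)[OF that] by (simp add: h_def)
 have hx: "integrable lborel (%s. h (s, x))" for x
 proof (cases "x \<in> N")
 case True
 then have "(\<integral>\<^sup>+s. ennreal (norm (h0 (s, x))) \<partial>lborel) < \<infinity>" by (simp add: N_def)
 moreover have "(%s. h0 (s, x)) \<in> borel_measurable lborel"
 using measurable_compose[OF _ \<open>h0 \<in> borel_measurable (borel \<Otimes>\<^sub>M borel)\<close>, of "%s. (s, x)" borel] by simp
 ultimately have "integrable lborel (%s. h0 (s, x))" by (intro integrableI_bounded)
 then show ?thesis using True by (simp add: h_def)
 qed (simp add: h_def)
 have NN: "AE x in lborel. x \<in> N"
 proof -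
 have "integrable (lborel \<Otimes>\<^sub>M lborel) (case_prod (%s x. h0 (s, x)))" using h0i by (simp add: lborel_pair)
 from lborel_pair.AE_integrable_snd[OF this]
 show ?thesis by eventually_elim (simp add: N_def integrable_iff_bounded)
 qed
 have hh0: "AE z in lborel. h z = h0 z"
 proof -
 have "AE z in (lborel :: real measure) \<Otimes>\<^sub>M (lborel :: 'a measure). snd z \<in> N"
 proof (rule lborel_pair.AE_pair_measure)
 have "{z \<in> space ((lborel :: real measure) \<Otimes>\<^sub>M (lborel :: 'a measure)). snd z \<in> N} = (UNIV :: real set) \<times> N" by (auto simp: space_pair_measure)
 moreover have "(UNIV :: real set) \<times> N \<in> sets (lborel \<Otimes>\<^sub>M lborel)" by (intro pair_measureI) auto
 ultimately show "{z \<in> space (lborel \<Otimes>\<^sub>M lborel). snd z \<in> N} \<in> sets (lborel \<Otimes>\<^sub>M lborel :: (real \<times> 'a) measure)" by simp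
 qed (use NN in auto)
 then show ?thesis unfolding lborel_pair[symmetric] by eventually_elim (simp add: h_def)
 qed
 have hi: "integrable lborel h"
 using h0i hh0 hb h0(1) by (subst integrable_cong_AE[of h _ h0]) auto
 have gh: "AE z in lebesgue_on Q. g z = h z"
 proof -
 have "AE z in lebesgue. z \<in> Q --> h z = h0 z" using AE_completion[OF hh0] by eventually_elim simp
 then show ?thesis using h0(3) unfolding AE_lebesgue_on_iff[OF Q_sets] by eventually_elim simp
 qed
 obtain G' where G': "G' \<in> borel_measurable borel" "!!z. z \<notin> Q ==> G' z = 0" "AE z in lebesgue_on Q. G z = G' z"
 using borel_representative[OF Gm open_Q] by blast
 have [measurable]: "G' \<in> borel_measurable (borel \<Otimes>\<^sub>M borel)" using G'(1) by (simp add: borel_prod)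
 have QB: "Q \<in> sets borel" using open_Q by simp
 have G'b: "AE z in lborel. \<bar>G' z\<bar> <= M"
 proof -
 have "AE z in lebesgue. \<bar>G' z\<bar> <= M"
 using bd G'(3) unfolding AE_lebesgue_on_iff[OF Q_sets] by eventually_elim (metis G'(2) M abs_zero)
 then show ?thesis by (simp add: AE_completion_iff)
 qed
 have G'i: "integrable lborel G'"
 proof (rule Bochner_Integration.integrable_bound[where f="%z. M * indicator Q z"])
 have e: "emeasure lborel Q < \<infinity>"
 using lborel.emeasure_pair_measure_Times[of "{0<..<T}" lborel U] finU openU T by (simp add: lborel_pair ennreal_mult_less_top)
 show "integrable lborel (%z. M * indicator Q z)" using e QB by auto
 show "AE z in lborel. norm (G' z) <= norm (M * indicator Q z)"
 using G'b by eventually_elim (use G'(2) M in \<open>auto simp: indicator_def\<close>)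
 qed (use G'(1) in simp)
 define A where "A t x = (LINT s|lborel. indicator {0..t} s * h (s, x))" for t x
 have Am: "(%z. A (fst z) (snd z)) \<in> borel_measurable (borel \<Otimes>\<^sub>M borel)"
 proof -
 have 1: "(%p. h (snd p, snd (fst p))) \<in> borel_measurable (((borel :: real measure) \<Otimes>\<^sub>M (borel :: 'a measure)) \<Otimes>\<^sub>M (lborel :: real measure))"
 by (rule measurable_compose[OF measurable_Pair hm]; measurable)
 have 2: "(%p. if 0 <= snd p \<and> snd p <= fst (fst p) then 1 else 0 :: real)
 \<in> borel_measurable (((borel :: real measure) \<Otimes>\<^sub>M (borel :: 'a measure)) \<Otimes>\<^sub>M (lborel :: real measure))"
 proof -
 have a: "(%p. snd p) \<in> borel_measurable (((borel :: real measure) \<Otimes>\<^sub>M (borel :: 'a measure)) \<Otimes>\<^sub>M (lborel :: real measure))"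
 "(%p. fst (fst p) - snd p) \<in> borel_measurable (((borel :: real measure) \<Otimes>\<^sub>M (borel :: 'a measure)) \<Otimes>\<^sub>M (lborel :: real measure))"
 by measurable
 have "(%p. indicat_real {0..} (snd p) * indicat_real {0..} (fst (fst p) - snd p))
 \<in> borel_measurable (((borel :: real measure) \<Otimes>\<^sub>M (borel :: 'a measure)) \<Otimes>\<^sub>M (lborel :: real measure))"
 by (rule borel_measurable_times[OF measurable_compose[OF a(1) borel_measurable_indicator] measurable_compose[OF a(2) borel_measurable_indicator]]) auto
 moreover have "(%p :: (real \<times> 'a) \<times> real. indicat_real {0..} (snd p) * indicat_real {0..} (fst (fst p) - snd p))
 = (%p. if 0 <= snd p \<and> snd p <= fst (fst p) then 1 else 0)"
 by (auto simp: fun_eq_iff indicator_def)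
 ultimately show ?thesis by simp
 qed
 have "(%z. LINT s|lborel. (if 0 <= s \<and> s <= fst z then 1 else 0) * h (s, snd z)) \<in> borel_measurable (borel \<Otimes>\<^sub>M borel)"
 proof (rule lborel.borel_measurable_lebesgue_integral)
 show "(%(z, s). (if 0 <= s \<and> s <= fst z then 1 else 0) * h (s, snd z))
 \<in> borel_measurable (((borel :: real measure) \<Otimes>\<^sub>M (borel :: 'a measure)) \<Otimes>\<^sub>M (lborel :: real measure))"
 unfolding case_prod_beta by (rule borel_measurable_times[OF 2 1])
 qed
 then show ?thesis by (simp add: A_def indicator_def)
 qed
 note [measurable] = Am
 define B where "B x = (LINT s|lborel. \<bar>h (s, x)\<bar>)" for x
 have AB: "\<bar>A t x\<bar> <= B x" for t x
 proof -
 have "\<bar>A t x\<bar> <= (LINT s|lborel. \<bar>indicator {0..t} s * h (s, x)\<bar>)" unfolding A_def by (rule integral_abs_bound)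
 also have "... <= B x" unfolding B_def
 using hx[of x] integrable_mult_indicator[of "{0..t}" lborel "%s. h (s, x)"]
 by (intro Bochner_Integration.integral_mono integrable_abs) (auto simp: indicator_def)
 finally show ?thesis .
 qed
 have Bi: "integrable lborel B"
 using lborel_pair.integrable_snd[of "%s x. \<bar>h (s, x)\<bar>"] integrable_abs[OF hi] by (simp add: lborel_pair split_beta' B_def[abs_def])
 have indT: "integrable lborel (indicat_real {0<..<T})" by (rule integrable_real_indicator) (use T in auto)
 have UB: "U \<in> sets borel" using openU by simp
 have Ai: "integrable lborel (%z. indicator {0<..<T} (fst z) * A (fst z) (snd z))"
 proof (rule Bochner_Integration.integrable_bound[OF integrable_product[OF indT Bi]])
 show "(%z. indicator {0<..<T} (fst z) * A (fst z) (snd z)) \<in> borel_measurable lborel"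
 using Am by (simp add: borel_prod[symmetric])
 show "AE z in lborel. norm (indicat_real {0<..<T} (fst z) * A (fst z) (snd z)) <= norm (indicat_real {0<..<T} (fst z) * B (snd z))"
 using AB order_trans[OF AB abs_ge_self] by (auto simp: indicator_def)
 qed
 \<comment> \<open>The candidate for a function constant in time; \<open>c\<close> below is its
   average against a fixed bump.\<close>
 define K where "K z = G' z - indicator {0<..<T} (fst z) * A (fst z) (snd z)" for z
 have Ki: "integrable lborel K" unfolding K_def[abs_def] by (rule Bochner_Integration.integrable_diff[OF G'i Ai])
 have Km [measurable]: "K \<in> borel_measurable (borel \<Otimes>\<^sub>M borel)" using borel_measurable_integrable[OF Ki] by (simp add: borel_prod)
 have "(%n. box_bump n (T/4) (3*T/4) (T/2)) \<longlonglongrightarrow> indicator (box (T/4) (3*T/4)) (T/2)" by (rule box_bump_tendsto)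
 then have "(%n. box_bump n (T/4) (3*T/4) (T/2)) \<longlonglongrightarrow> 1" using T by (simp add: box_real)
 then have "\<forall>\<^sub>F n in sequentially. box_bump n (T/4) (3*T/4) (T/2) > 0" by (rule order_tendstoD) simp
 then obtain n0 where n0: "box_bump n0 (T/4) (3*T/4) (T/2) > 0" using eventually_sequentially by auto
 \<comment> \<open>A fixed reference bump in the middle of the time interval; \<open>n0\<close> only
   ensures that its integral \<open>I\<close> is positive.\<close>
 define e where "e = box_bump n0 (T/4) (3*T/4)"
 have es: "smooth e" and eb: "!!t. 0 <= e t" "!!t. e t <= 1"
 unfolding e_def by (rule smooth_box_bump box_bump_bounds)+
 have e0: "e t = 0" if "t \<notin> {T/4..3*T/4}" for t
 unfolding e_def by (rule box_bump_eq_0) (use that in \<open>auto simp: box_real\<close>)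
 note ec = smooth_continuous[OF es, of UNIV]
 have [measurable]: "e \<in> borel_measurable borel" by (rule borel_measurable_continuous_onI[OF ec])
 define I where "I = (LINT t|lborel. e t)"
 have ei: "integrable lborel e" and I_eq: "I = integral {T/4..3*T/4} e"
 unfolding I_def by (rule bump_integral[OF ec], erule e0)+
 have I: "I > 0"
 proof -
 have "integral (cbox (T/4) (3*T/4)) e ~= 0"
 by (subst integral_cbox_eq_0_iff) (use T n0 eb continuous_on_subset[OF ec] in \<open>auto simp: e_def box_real intro!: bexI[of _ "T/2"]\<close>)
 moreover have "0 <= I" unfolding I_def by (rule Bochner_Integration.integral_nonneg) (rule eb)
 ultimately show ?thesis using I_eq by simp
 qed
 define c where "c x = (1 / I) * (LINT t|lborel. e t * K (t, x))" for x
 have bK: "integrable lborel (%z. p z * K z)" if "p \<in> borel_measurable borel" "!!z. \<bar>p z\<bar> <= C" for p :: "real \<times> 'a => real" and C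
 proof (rule Bochner_Integration.integrable_bound[OF integrable_mult_right[OF Ki, of C]])
 show "(%z. p z * K z) \<in> borel_measurable lborel" using that(1) borel_measurable_integrable[OF Ki] by simp
 show "AE z in lborel. norm (p z * K z) <= norm (C * K z)"
 using that(2) by (auto simp: abs_mult intro!: mult_right_mono order_trans[OF that(2) abs_ge_self])
 qed
 have fstm: "(%z. q (fst z)) \<in> borel_measurable (borel :: (real \<times> 'a) measure)" if "q \<in> borel_measurable borel" for q :: "real => real"
 using that by (simp add: borel_prod[symmetric])
 have sndm: "(%z. q (snd z)) \<in> borel_measurable (borel :: (real \<times> 'a) measure)" if "q \<in> borel_measurable borel" for q :: "'a => real"
 using that by (simp add: borel_prod[symmetric])
 have eK: "integrable lborel (%z. e (fst z) * K z)" by (rule bK[OF fstm, where C=1]) (simp_all add: eb abs_of_nonneg)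
 have ci: "integrable lborel c"
 unfolding c_def[abs_def] using lborel_pair.integrable_snd[of "%t x. e t * K (t, x)"] eK
 by (intro integrable_mult_right) (simp add: lborel_pair split_beta')
 have cTi: "integrable lborel (%z. indicator {0<..<T} (fst z) * c (snd z))" by (rule integrable_product[OF indT ci])
 have cU: "c x = 0" if "x \<notin> U" for x
 proof -
 have "K (t, x) = 0" for t
 using G'(2)[of "(t, x)"] hQ[of "(_, x)"] that by (simp add: K_def A_def)
 then show ?thesis by (simp add: c_def)
 qed
 have test: "(LINT z|lborel. box_bump n a b z * (K z - indicator {0<..<T} (fst z) * c (snd z))) = 0" if ab: "cbox a b \<subseteq> Q" for n a b
 proof (cases "cbox a b = {}")
 case True
 then have "box_bump n a b z = 0" for z using box_subset_cbox[of a b] box_bump_eq_0[of z a b n] by auto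
 then show ?thesis by simp
 next
 case False
 obtain a1 a2 b1 b2 where p: "a = (a1, a2)" "b = (b1, b2)" by (cases a, cases b) auto
 have sub: "{a1..b1} \<times> cbox a2 b2 \<subseteq> Q" and ne: "{a1..b1} ~= {}" "cbox a2 b2 ~= {}" using ab False by (auto simp: p cbox_Pair_eq)
 define \<tau> where "\<tau> = box_bump n a1 b1"
 define \<kappa> where "\<kappa> = box_bump n a2 b2"
 have bb: "\<bar>\<tau> t\<bar> <= 1" "\<bar>\<kappa> x\<bar> <= 1" for t x
 unfolding \<tau>_def \<kappa>_def by (simp_all add: box_bump_bounds abs_of_nonneg)
 have \<tau>0: "\<tau> t = 0" if "t \<notin> {a1..b1}" for t
 unfolding \<tau>_def by (rule box_bump_eq_0) (use that in \<open>auto simp: box_real\<close>)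
 have \<kappa>0: "\<kappa> x = 0" if "x \<notin> cbox a2 b2" for x
 unfolding \<kappa>_def by (rule box_bump_eq_0) (use that box_subset_cbox[of a2 b2] in auto)
 have "smooth \<tau>" "smooth \<kappa>" unfolding \<tau>_def \<kappa>_def by (rule smooth_box_bump)+
 note \<tau> = \<open>smooth \<tau>\<close> \<tau>0 bb(1) and \<kappa> = \<open>smooth \<kappa>\<close> \<kappa>0 bb(2)
 have [measurable]: "\<tau> \<in> borel_measurable borel" "\<kappa> \<in> borel_measurable borel"
 by (rule borel_measurable_continuous_onI[OF smooth_continuous], rule \<tau>(1) \<kappa>(1))+
 define a0 b0 where "a0 = min a1 (T/4)" and "b0 = max b1 (3*T/4)"
 obtain x0 where x0: "x0 \<in> cbox a2 b2" using ne by blast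
 have le1: "a1 <= b1" using ne by simp
 have "(a1, x0) \<in> Q" "(b1, x0) \<in> Q" by (rule subsetD[OF sub], simp add: x0 le1)+
 then have a1b1: "0 < a1" "b1 < T" "a1 <= b1" using le1 by auto
 have ab0: "0 < a0" "b0 < T" "a0 <= b0" using a1b1 T by (auto simp: a0_def b0_def)
 have \<kappa>U: "cbox a2 b2 \<subseteq> U"
 proof
 fix x assume "x \<in> cbox a2 b2"
 then have "(a1, x) \<in> Q" by (intro subsetD[OF sub]) (simp add: le1)
 then show "x \<in> U" by simp
 qed
 define I1 where "I1 = (LINT t|lborel. \<tau> t)"
 have \<tau>i: "integrable lborel \<tau>" by (rule bump_integral(1)[OF smooth_continuous[OF \<tau>(1)]], erule \<tau>(2))
 \<comment> \<open>Subtracting a multiple of the reference bump makes the time factor mean zero, so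
   it is the derivative of a compactly supported \<open>Tht\<close> and the weak derivative can be
   tested with it.\<close>
 define f where "f t = \<tau> t - (I1 / I) * e t" for t
 have fs: "smooth f" unfolding f_def[abs_def] by (intro smooth_diff smooth_mult smooth_const \<tau>(1) es)
 have f0: "f t = 0" if "t \<notin> {a0..b0}" for t
 proof -
 have n: "t \<notin> {a1..b1}" "t \<notin> {T/4..3*T/4}" using that by (auto simp: a0_def b0_def)
 show ?thesis unfolding f_def \<tau>(2)[OF n(1)] e0[OF n(2)] by simp
 qed
 have fint: "integrable lborel f" "(LINT t|lborel. f t) = integral {a0..b0} f"
 by (rule bump_integral[OF smooth_continuous[OF fs]], erule f0)+
 have "(LINT t|lborel. f t) = 0" unfolding f_def using \<tau>i ei I by (simp add: I1_def I_def)
 then have "integral {a0..b0} f = 0" using fint(2) by simp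
 from compact_bump_antiderivative[OF fs ab0(3) _ this] f0
 obtain Tht where Tht: "smooth Tht" "!!t. (Tht has_real_derivative f t) (at t)" "!!t. t \<notin> {a0..b0} ==> Tht t = 0" by metis
 have [measurable]: "Tht \<in> borel_measurable borel" "f \<in> borel_measurable borel"
 by (rule borel_measurable_continuous_onI[OF smooth_continuous], rule Tht(1) fs)+
 obtain C where C: "!!t. \<bar>Tht t\<bar> <= C"
 using continuous_compact_support_bounded[OF smooth_continuous[OF Tht(1)] compact_Icc[of a0 b0]] Tht(3) by metis
 obtain C' where C': "!!t. \<bar>f t\<bar> <= C'"
 using continuous_compact_support_bounded[OF smooth_continuous[OF fs] compact_Icc[of a0 b0]] f0 by metis
 have sub0: "{a0..b0} \<times> cbox a2 b2 \<subseteq> Q" using ab0 \<kappa>U by auto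
 have tf: "test_function Q (%z. Tht (fst z) * \<kappa> (snd z))"
 "!!z. frechet_derivative (%z. Tht (fst z) * \<kappa> (snd z)) (at z) (1, 0) = f (fst z) * \<kappa> (snd z)"
 by (rule test_function_Pair[OF Tht(1) _ Tht(2) \<kappa>(1) _ sub0]; erule Tht(3) \<kappa>(2))+
 have one: "(1, 0) \<in> (Basis :: (real \<times> 'a) set)" by (simp add: Basis_prod_def)
 have wd': "(LINT z|lebesgue_on Q. frechet_derivative \<psi> (at z) (1, 0) *\<^sub>R G z) = - (LINT z|lebesgue_on Q. \<psi> z *\<^sub>R g z)"
 if "test_function Q \<psi>" for \<psi> using wd that unfolding has_weak_deriv_def by blast
 have "(LINT z|lebesgue_on Q. (f (fst z) * \<kappa> (snd z)) * G z) = - (LINT z|lebesgue_on Q. (Tht (fst z) * \<kappa> (snd z)) * g z)"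
 using wd'[OF tf(1)] unfolding tf(2) real_scaleR_def .
 moreover have fm: "(%z. f (fst z) * \<kappa> (snd z)) \<in> borel_measurable borel" "(%z. Tht (fst z) * \<kappa> (snd z)) \<in> borel_measurable borel"
 by (intro borel_measurable_times fstm sndm; measurable)+
 ultimately have E1: "(LINT z|lborel. (f (fst z) * \<kappa> (snd z)) * G' z) = - (LINT z|lborel. (Tht (fst z) * \<kappa> (snd z)) * h z)"
 using integral_representative(1)[OF open_Q Gm G' fm(1)] integral_representative(1)[OF open_Q borel_measurable_integrable[OF gi] hb hQ gh fm(2)] by simp
 \<comment> \<open>Integration by parts in time for each fixed \<open>x\<close>; the boundary terms
   vanish because \<open>Tht\<close> is 0 at times 0 and \<open>T\<close>.\<close>
 have ptw: "(LINT s|lborel. Tht s * h (s, x)) = - (LINT s|lborel. f s * (indicator {0<..<T} s * A s x))" for x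
 proof -
 have W: "(LINT s|lborel. indicator {0..t} s * f s) = Tht t" if "t >= 0" for t
 proof -
 have i: "set_integrable lborel {0..t} f"
 by (rule borel_integrable_atLeastAtMost') (rule smooth_continuous[OF fs])
 have "(f has_integral Tht t - Tht 0) {0..t}"
 by (rule fundamental_theorem_of_calculus[OF that])
 (auto simp flip: has_real_derivative_iff_has_vector_derivative intro: DERIV_subset[OF Tht(2)])
 then have "integral {0..t} f = Tht t" using Tht(3)[of 0] ab0 by (simp add: integral_unique)
 then show ?thesis using set_borel_integral_eq_integral(2)[OF i] by (simp add: set_lebesgue_integral_def)
 qed
 have z: "0 = (LINT s|lborel. indicator {0..T} s * (h (s, x) * (LINT r|lborel. indicator {0..s} r * f r) + A s x * f s))"
 using indefinite_integral_mult(1)[OF hx[of x] fint(1), of T 0 0] T W[of T] Tht(3)[of T] ab0 by (simp add: A_def)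
 have Amx: "(%s. A s x) \<in> borel_measurable borel" using measurable_compose[OF _ Am, of "%s. (s, x)" borel] by simp
 note [measurable] = Amx
 have i1: "integrable lborel (%s. Tht s * h (s, x))"
 proof (rule Bochner_Integration.integrable_bound[OF integrable_mult_right[OF hx[of x], of C]])
 show "(%s. Tht s * h (s, x)) \<in> borel_measurable lborel" using borel_measurable_integrable[OF hx[of x]] by simp
 show "AE s in lborel. norm (Tht s * h (s, x)) <= norm (C * h (s, x))"
 by (auto simp: abs_mult intro!: mult_right_mono order_trans[OF C abs_ge_self])
 qed
 have i2: "integrable lborel (%s. f s * (indicator {0<..<T} s * A s x))"
 proof (rule Bochner_Integration.integrable_bound[OF integrable_mult_right[OF fint(1), of "B x"]])
 show "(%s. f s * (indicator {0<..<T} s * A s x)) \<in> borel_measurable lborel" by simp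
 show "AE s in lborel. norm (f s * (indicat_real {0<..<T} s * A s x)) <= norm (B x * f s)"
 using AB[of _ x] order_trans[OF AB[of _ x] abs_ge_self]
 by (auto simp: abs_mult indicator_def mult.commute[of "\<bar>f _\<bar>"] intro!: mult_right_mono)
 qed
 have "indicator {0..T} s * (h (s, x) * (LINT r|lborel. indicator {0..s} r * f r) + A s x * f s)
 = Tht s * h (s, x) + f s * (indicator {0<..<T} s * A s x)" for s
 using W[of s] Tht(3)[of s] f0[of s] ab0 by (cases "s \<in> {a0..b0}") (auto simp: indicator_def)
 then have "0 = (LINT s|lborel. Tht s * h (s, x)) + (LINT s|lborel. f s * (indicator {0<..<T} s * A s x))"
 using z i1 i2 by simp
 then show ?thesis by simp
 qed
 have fub: "(LINT z|lborel. (p (fst z) * \<kappa> (snd z)) * q z) = (LINT x|lborel. \<kappa> x * (LINT t|lborel. p t * q (t, x)))"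
 "integrable lborel (%z. (p (fst z) * \<kappa> (snd z)) * q z)"
 if "integrable lborel q" "p \<in> borel_measurable borel" "!!t. \<bar>p t\<bar> <= R" for p :: "real => real" and q :: "real \<times> 'a => real" and R
 proof -
 show i: "integrable lborel (%z. (p (fst z) * \<kappa> (snd z)) * q z)"
 proof (rule Bochner_Integration.integrable_bound[OF integrable_mult_right[OF that(1), of R]])
 show "(%z. (p (fst z) * \<kappa> (snd z)) * q z) \<in> borel_measurable lborel"
 proof -
 have "q \<in> borel_measurable borel" using borel_measurable_integrable[OF that(1)] by simp
 from borel_measurable_times[OF borel_measurable_times[OF fstm[OF that(2)] sndm[OF borel_measurable_continuous_onI[OF smooth_continuous[OF \<kappa>(1)]]]] this]
 show ?thesis by simp
 qed
 have "\<bar>p t * \<kappa> x\<bar> <= \<bar>R\<bar>" for t x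
 using mult_mono[OF order_trans[OF that(3)[of t] abs_ge_self] \<kappa>(3)[of x]] by (simp add: abs_mult)
 then show "AE z in lborel. norm ((p (fst z) * \<kappa> (snd z)) * q z) <= norm (R * q z)"
 by (auto simp: abs_mult[of _ "q _"] intro!: mult_right_mono)
 qed
 from i have "integrable (lborel \<Otimes>\<^sub>M lborel) (case_prod (%t x. (p t * \<kappa> x) * q (t, x)))" by (simp add: lborel_pair split_beta')
 from lborel_pair.integral_snd[OF this]
 show "(LINT z|lborel. (p (fst z) * \<kappa> (snd z)) * q z) = (LINT x|lborel. \<kappa> x * (LINT t|lborel. p t * q (t, x)))" by (simp add: lborel_pair[symmetric] split_beta' mult_ac)
 qed
 have mt: "Tht \<in> borel_measurable borel" "f \<in> borel_measurable borel" "e \<in> borel_measurable borel" "\<tau> \<in> borel_measurable borel" by simp_all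
 have eb': "\<bar>e t\<bar> <= 1" for t using eb[of t] by simp
 have "(LINT z|lborel. (Tht (fst z) * \<kappa> (snd z)) * h z)
 = - (LINT z|lborel. (f (fst z) * \<kappa> (snd z)) * (indicator {0<..<T} (fst z) * A (fst z) (snd z)))"
 unfolding fub(1)[OF hi mt(1) C] fub(1)[OF Ai mt(2) C'] by (simp add: ptw)
 with E1 have "(LINT z|lborel. (f (fst z) * \<kappa> (snd z)) * G' z)
 - (LINT z|lborel. (f (fst z) * \<kappa> (snd z)) * (indicator {0<..<T} (fst z) * A (fst z) (snd z))) = 0" by linarith
 then have fK: "(LINT z|lborel. (f (fst z) * \<kappa> (snd z)) * K z) = 0"
 unfolding BI_diff[OF fub(2)[OF G'i mt(2) C'] fub(2)[OF Ai mt(2) C'], symmetric]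
 by (simp only: K_def right_diff_distrib)
 note iK = fub(2)[OF Ki mt(4) \<tau>(3)] fub(2)[OF Ki mt(3) eb']
 have "(LINT z|lborel. (f (fst z) * \<kappa> (snd z)) * K z)
 = (LINT z|lborel. (\<tau> (fst z) * \<kappa> (snd z)) * K z - (I1 / I) * ((e (fst z) * \<kappa> (snd z)) * K z))"
 by (rule BI_cong) (simp_all add: f_def algebra_simps)
 also have "... = (LINT z|lborel. (\<tau> (fst z) * \<kappa> (snd z)) * K z) - (I1 / I) * (LINT z|lborel. (e (fst z) * \<kappa> (snd z)) * K z)"
 by (subst BI_diff[OF iK(1) integrable_mult_right[OF iK(2)]]) (simp only: integral_mult_right_zero)
 finally have s1: "(LINT z|lborel. (\<tau> (fst z) * \<kappa> (snd z)) * K z) = (I1 / I) * (LINT z|lborel. (e (fst z) * \<kappa> (snd z)) * K z)"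
 using fK by simp
 have "(LINT t|lborel. e t * K (t, x)) = I * c x" for x using I by (simp add: c_def)
 then have s2: "(LINT z|lborel. (e (fst z) * \<kappa> (snd z)) * K z) = (LINT x|lborel. I * (\<kappa> x * c x))"
 unfolding fub(1)[OF Ki mt(3) eb'] by (simp add: mult_ac)
 have "(LINT t|lborel. \<tau> t * (indicator {0<..<T} t * c x)) = I1 * c x" for x
 proof -
 have e: "\<tau> t * (indicator {0<..<T} t * c x) = \<tau> t * c x" for t
 proof (cases "t \<in> {0<..<T}")
 case False
 then have n: "t \<notin> {a1..b1}" using a1b1 by auto
 show ?thesis unfolding \<tau>(2)[OF n] by simp
 qed simp
 show ?thesis unfolding e I1_def by simp
 qed
 then have s3: "(LINT z|lborel. (\<tau> (fst z) * \<kappa> (snd z)) * (indicator {0<..<T} (fst z) * c (snd z))) = (LINT x|lborel. I1 * (\<kappa> x * c x))"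
 unfolding fub(1)[OF cTi mt(4) \<tau>(3)] by (simp add: mult_ac)
 have "(LINT z|lborel. box_bump n a b z * (K z - indicator {0<..<T} (fst z) * c (snd z)))
 = (LINT z|lborel. (\<tau> (fst z) * \<kappa> (snd z)) * K z - (\<tau> (fst z) * \<kappa> (snd z)) * (indicator {0<..<T} (fst z) * c (snd z)))"
 by (rule BI_cong) (simp_all add: p \<tau>_def \<kappa>_def box_bump_Pair[symmetric] right_diff_distrib)
 also have "... = 0"
 unfolding BI_diff[OF iK(1) fub(2)[OF cTi mt(4) \<tau>(3)]] s1 s2 s3 using I by simp
 finally show ?thesis .
 qed
 let ?H = "%z. K z - indicator {0<..<T} (fst z) * c (snd z)"
 have Hi: "integrable lborel ?H" by (rule Bochner_Integration.integrable_diff[OF Ki cTi])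
 have H0: "?H z = 0" if "z \<notin> Q" for z
 proof (cases "snd z \<in> U")
 case True
 then have "fst z \<notin> {0<..<T}" using that by (cases z) auto
 then show ?thesis using G'(2)[OF that] by (simp add: K_def)
 next
 case False
 then have "A (fst z) (snd z) = 0" using hQ by (simp add: A_def)
 then show ?thesis using G'(2)[OF that] cU[OF False] by (simp add: K_def)
 qed
 have HL: "integrable (lebesgue_on Q) ?H"
 proof -
 have e: "indicator Q z *\<^sub>R ?H z = ?H z" for z using H0[of z] by (auto simp: indicator_def)
 show ?thesis unfolding integral_lebesgue_on_indicator(2)[OF Q_sets] e
 using Hi integrable_completion[OF borel_measurable_integrable[OF Hi]] by blast
 qed
 have "AE z in lebesgue_on Q. ?H z = 0"
 proof (rule fundamental_lemma_box[OF open_Q locally_integrable_if_integrable[OF HL open_Q]])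
 fix n :: nat and a b :: "real \<times> 'a" assume ab: "cbox a b \<subseteq> Q"
 have bm: "(%z. box_bump n a b z * ?H z) \<in> borel_measurable lborel"
 using borel_measurable_integrable[OF Hi] borel_measurable_continuous_onI[OF smooth_continuous[OF smooth_box_bump[of n a b]]]
 by (intro borel_measurable_times) auto
 have e: "indicator Q z *\<^sub>R (box_bump n a b z * ?H z) = box_bump n a b z * ?H z" for z using H0[of z] by (auto simp: indicator_def)
 have "(LINT z|lebesgue_on Q. box_bump n a b z * ?H z) = (LINT z|lebesgue. box_bump n a b z * ?H z)"
 unfolding integral_lebesgue_on_indicator(1)[OF Q_sets] e ..
 also have "... = 0" unfolding integral_completion[OF bm] by (rule test[OF ab])
 finally show "(LINT z|lebesgue_on Q. box_bump n a b z * ?H z) = 0" .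
 qed
 then have GY: "AE z in lebesgue_on Q. G z = c (snd z) + A (fst z) (snd z)"
 using G'(3) unfolding AE_lebesgue_on_iff[OF Q_sets] by eventually_elim (auto simp: K_def)
 have A0: "A 0 x = 0" for x
 unfolding A_def by (rule integral_eq_zero_AE, rule eventually_mono[OF AE_lborel_singleton[of 0]]) (auto simp: indicator_def)
 have cm: "c \<in> borel_measurable borel" using borel_measurable_integrable[OF ci] by simp
 show ?thesis
 proof (rule that[of "%t x. c x + A t x" h])
 show "(%z. c (snd z) + A (fst z) (snd z)) \<in> borel_measurable borel"
 using sndm[OF cm] Am by (intro borel_measurable_add) (simp_all add: borel_prod)
 qed (use hb hi hQ gh GY hx A0 in \<open>simp_all add: A_def\<close>)
qed

text \<open>The spatial integral of the pointwise formula for powers, with the order of integration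
  exchanged. Every moment becomes an absolutely continuous function of time whose density can be
  compared with slice identities at almost every time.\<close>

theorem evolution:
 obtains Y :: "real => 'a => real" and h :: "real \<times> 'a => real" where
 "(%z. Y (fst z) (snd z)) \<in> borel_measurable borel" "AE z in lebesgue_on Q. G z = Y (fst z) (snd z)"
 "AE s in lborel. s \<in> {0<..<T} --> (AE x in lebesgue_on U. G (s, x) = Y s x \<and> g (s, x) = h (s, x))"
 "AE x in lebesgue_on U. \<forall>t\<in>{0..T}. \<bar>Y t x\<bar> <= M" "!!x. continuous_on UNIV (%t. Y t x)"
 "!!k. \<exists>z. integrable lborel z \<and> (\<forall>s\<in>{0<..<T}. z s = real k * (LINT x|lebesgue_on U. Y s x ^ (k - 1) * h (s, x))) \<and>
 (\<forall>t\<in>{0..T}. (LINT x|lebesgue_on U. Y t x ^ k) = (LINT x|lebesgue_on U. Y 0 x ^ k) + (LINT s|lborel. indicator {0..t} s * z s))"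
 "!!s. h \<in> borel_measurable borel"
proof -
 obtain Y h where Ym: "(%z. Y (fst z) (snd z)) \<in> borel_measurable borel" and hm: "h \<in> borel_measurable borel" and hi: "integrable lborel h"
 and hQ: "!!z. z \<notin> Q ==> h z = 0" and gh: "AE z in lebesgue_on Q. g z = h z" and GY: "AE z in lebesgue_on Q. G z = Y (fst z) (snd z)"
 and hx: "!!x. integrable lborel (%s. h (s, x))" and Y: "!!t x. Y t x = Y 0 x + (LINT s|lborel. indicator {0..t} s * h (s, x))"
 by (rule representative) (rule that; assumption)
 have [measurable]: "(%z. Y (fst z) (snd z)) \<in> borel_measurable (borel \<Otimes>\<^sub>M borel)" "h \<in> borel_measurable (borel \<Otimes>\<^sub>M borel)"
 using Ym hm by (simp_all add: borel_prod)
 have U': "U \<in> sets lebesgue" by (rule open_in_sets_lebesgue[OF openU])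
 have UB [measurable]: "U \<in> sets borel" using openU by simp
 have QB: "Q \<in> sets (borel \<Otimes>\<^sub>M borel)" using open_Q by (simp add: borel_prod)
 have Yt [measurable]: "Y t \<in> borel_measurable borel" for t
 using measurable_compose[of "%x. (t, x)" borel "borel \<Otimes>\<^sub>M borel" "%z. Y (fst z) (snd z)" borel] by simp
 have ht [measurable]: "(%x. h (t, x)) \<in> borel_measurable borel" for t
 using measurable_compose[of "%x. (t, x)" borel "borel \<Otimes>\<^sub>M borel" h borel] by simp
 have LU: "(LINT x|lebesgue_on U. q x) = (LINT x|lborel. indicator U x * q x)" if "q \<in> borel_measurable borel" for q :: "'a => real"
 unfolding integral_lebesgue_on_indicator(1)[OF U'] real_scaleR_def by (rule integral_completion) (use that in simp)
 have YM: "AE z in lborel. z \<in> Q --> \<bar>Y (fst z) (snd z)\<bar> <= M"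
 proof -
 have "AE z in lebesgue. z \<in> Q --> \<bar>Y (fst z) (snd z)\<bar> <= M"
 using GY bd unfolding AE_lebesgue_on_iff[OF Q_sets] by eventually_elim auto
 then show ?thesis by (simp only: AE_completion_iff)
 qed
 have cont: "continuous_on UNIV (%t. Y t x)" for x
 proof -
 have A: "continuous_on UNIV (%t. Y t x) \<longleftrightarrow> continuous_on UNIV (%t. Y 0 x + (LINT s|lborel. indicator {0..t} s * h (s, x)))"
 by (rule continuous_on_cong[OF refl Y])
 have B: "continuous_on UNIV (%t. Y 0 x + (LINT s|lborel. indicator {0..t} s * h (s, x)))"
 by (intro continuous_on_add continuous_on_const indefinite_integral_continuous hx)
 show ?thesis by (rule iffD2[OF A B])
 qed
 \<comment> \<open>The bound holds almost everywhere in space-time; exchanging the null sets gives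
   it for almost every \<open>x\<close> at almost all times, and continuity in time extends it to
   all times outside a single null set.\<close>
 have bound: "AE x in lborel. x \<in> U --> (\<forall>t\<in>{0..T}. \<bar>Y t x\<bar> <= M)"
 proof -
 have "AE t in lborel. AE x in lborel. (t, x) \<in> Q --> \<bar>Y t x\<bar> <= M"
 using lborel_pair.AE_pair[OF YM[unfolded lborel_pair]] by simp
 moreover have "{z \<in> space (lborel \<Otimes>\<^sub>M lborel). (fst z, snd z) \<in> Q --> \<bar>Y (fst z) (snd z)\<bar> <= M} \<in> sets (lborel \<Otimes>\<^sub>M lborel :: (real \<times> 'a) measure)"
 using QB by measurable
 ultimately have "AE x in lborel. AE t in lborel. (t, x) \<in> Q --> \<bar>Y t x\<bar> <= M"
 using lborel_pair.AE_commute[of "%t x. (t, x) \<in> Q --> \<bar>Y t x\<bar> <= M"] by blast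
 then show ?thesis
 proof eventually_elim
 case (elim x)
 show ?case
 proof (intro impI ballI)
 fix t assume x: "x \<in> U" and t: "t \<in> {0..T}"
 have "AE t in lborel. t \<in> {0<..<T} --> \<bar>Y t x\<bar> <= M" using elim by eventually_elim (use x in auto)
 then show "\<bar>Y t x\<bar> <= M" by (rule AE_bound_continuous[OF continuous_on_subset[OF cont subset_UNIV] _ t T])
 qed
 qed
 qed
 have ae: "AE s in lborel. s \<in> {0<..<T} --> (AE x in lebesgue_on U. G (s, x) = Y s x \<and> g (s, x) = h (s, x))"
 proof -
 have "AE z in lebesgue. z \<in> Q --> G z = Y (fst z) (snd z) \<and> g z = h z"
 using GY gh unfolding AE_lebesgue_on_iff[OF Q_sets] by eventually_elim auto
 then have "AE z in lborel. z \<in> Q --> G z = Y (fst z) (snd z) \<and> g z = h z" by (simp only: AE_completion_iff)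
 from lborel_pair.AE_pair[OF this[unfolded lborel_pair]]
 show ?thesis
 proof eventually_elim
 case (elim s)
 show ?case
 proof
 assume s: "s \<in> {0<..<T}"
 have "AE x in lebesgue. x \<in> U --> G (s, x) = Y s x \<and> g (s, x) = h (s, x)"
 unfolding AE_completion_iff using elim by eventually_elim (use s in auto)
 then show "AE x in lebesgue_on U. G (s, x) = Y s x \<and> g (s, x) = h (s, x)" unfolding AE_lebesgue_on_iff[OF U'] .
 qed
 qed
 qed
 have pow: "\<exists>z. integrable lborel z \<and> (\<forall>s\<in>{0<..<T}. z s = real k * (LINT x|lebesgue_on U. Y s x ^ (k - 1) * h (s, x))) \<and>
 (\<forall>t\<in>{0..T}. (LINT x|lebesgue_on U. Y t x ^ k) = (LINT x|lebesgue_on U. Y 0 x ^ k) + (LINT s|lborel. indicator {0..t} s * z s))" for k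
 proof -
 define H where "H s x = real k * Y s x ^ (k - 1) * h (s, x)" for s x
 have Hm [measurable]: "(%z. H (fst z) (snd z)) \<in> borel_measurable (borel \<Otimes>\<^sub>M borel)"
 unfolding H_def prod.collapse by measurable
 have HU: "H s x = 0" if "x \<notin> U" for s x using hQ[of "(s, x)"] that by (simp add: H_def)
 have Hi: "integrable lborel (%z. H (fst z) (snd z))"
 proof (rule Bochner_Integration.integrable_bound[OF integrable_mult_right[OF hi, of "real k * M ^ (k - 1)"]])
 show "(%z. H (fst z) (snd z)) \<in> borel_measurable lborel" using Hm by (simp add: borel_prod)
 show "AE z in lborel. norm (H (fst z) (snd z)) <= norm (real k * M ^ (k - 1) * h z)"
 using YM
 proof eventually_elim
 case (elim z)
 show ?case
 proof (cases "z \<in> Q")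
 case True
 then have "\<bar>Y (fst z) (snd z)\<bar> ^ (k - 1) <= M ^ (k - 1)" using elim by (intro power_mono) auto
 then show ?thesis using M by (auto simp: H_def abs_mult power_abs intro!: mult_right_mono mult_left_mono)
 qed (simp add: H_def hQ)
 qed
 qed
 have HiT: "integrable lborel (%z. indicator {0..t} (fst z) * H (fst z) (snd z))" for t
 proof (rule Bochner_Integration.integrable_bound[OF Hi])
 have "(%z. indicator {0..t} (fst z) * H (fst z) (snd z)) \<in> borel_measurable (borel \<Otimes>\<^sub>M borel)" by measurable
 then show "(%z. indicator {0..t} (fst z) * H (fst z) (snd z)) \<in> borel_measurable lborel" by (simp add: borel_prod)
 qed (auto simp: indicator_def)
 have HiT': "integrable (lborel \<Otimes>\<^sub>M lborel) (case_prod (%s x. indicator {0..t} s * H s x))" for t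
 using HiT[of t] by (simp add: lborel_pair split_beta')
 define z where "z s = (LINT x|lborel. H s x)" for s
 have zi: "integrable lborel z"
 using lborel_pair.integrable_fst[of H] Hi by (simp add: lborel_pair split_beta' z_def[abs_def])
 have zs: "z s = real k * (LINT x|lebesgue_on U. Y s x ^ (k - 1) * h (s, x))" for s
 proof -
 have e: "indicator U x * (Y s x ^ (k - 1) * h (s, x)) = Y s x ^ (k - 1) * h (s, x)" for x
 using hQ[of "(s, x)"] by (auto simp: indicator_def)
 have "(%x. Y s x ^ (k - 1) * h (s, x)) \<in> borel_measurable borel" by measurable
 from LU[OF this] have "(LINT x|lebesgue_on U. Y s x ^ (k - 1) * h (s, x)) = (LINT x|lborel. Y s x ^ (k - 1) * h (s, x))"
 unfolding e .
 then show ?thesis unfolding z_def H_def mult.assoc by simp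
 qed
 have e: "(LINT x|lebesgue_on U. Y t x ^ k) = (LINT x|lebesgue_on U. Y 0 x ^ k) + (LINT s|lborel. indicator {0..t} s * z s)"
 if t: "t \<in> {0..T}" for t
 proof -
 have P: "Y t x ^ k = Y 0 x ^ k + (LINT s|lborel. indicator {0..t} s * H s x)" for x
 proof -
 have z0: "h (s, x) = 0" if "s \<notin> {0..T}" for s using hQ[of "(s, x)"] that by auto
 have "\<forall>t\<ge>0. (Y 0 x + (LINT s|lborel. indicator {0..t} s * h (s, x))) ^ k = Y 0 x ^ k
 + (LINT s|lborel. indicator {0..t} s * (real k * (Y 0 x + (LINT r|lborel. indicator {0..s} r * h (r, x))) ^ (k - 1) * h (s, x)))"
 by (rule conjunct2[OF indefinite_integral_power[where a="%s. h (s, x)" and T=T, OF hx[of x]]], erule z0)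
 then have "(Y 0 x + (LINT s|lborel. indicator {0..t} s * h (s, x))) ^ k = Y 0 x ^ k
 + (LINT s|lborel. indicator {0..t} s * (real k * (Y 0 x + (LINT r|lborel. indicator {0..s} r * h (r, x))) ^ (k - 1) * h (s, x)))"
 using t by simp
 then show ?thesis unfolding Y[of _ x, symmetric] H_def .
 qed
 have split: "indicator U x * Y t x ^ k = indicator U x * Y 0 x ^ k + (LINT s|lborel. indicator {0..t} s * H s x)" for x
 unfolding P using HU[of x] by (cases "x \<in> U") auto
 have i0: "integrable lborel (%x. indicator U x * Y 0 x ^ k)"
 proof (rule Bochner_Integration.integrable_bound[where f="%x. M ^ k * indicator U x"])
 show "integrable lborel (%x. M ^ k * indicator U x)" using finU UB by auto
 show "AE x in lborel. norm (indicator U x * Y 0 x ^ k) <= norm (M ^ k * indicator U x)"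
 using bound
 proof eventually_elim
 case (elim x)
 show ?case
 proof (cases "x \<in> U")
 case True
 then have "\<bar>Y 0 x\<bar> ^ k <= M ^ k" using elim T by (intro power_mono) auto
 then show ?thesis using True M by (simp add: power_abs)
 qed simp
 qed
 qed measurable
 have i1: "integrable lborel (%x. LINT s|lborel. indicator {0..t} s * H s x)" by (rule lborel_pair.integrable_snd[OF HiT'])
 have "(LINT x|lebesgue_on U. Y t x ^ k) = (LINT x|lborel. indicator U x * Y 0 x ^ k) + (LINT x|lborel. LINT s|lborel. indicator {0..t} s * H s x)"
 unfolding BI_add[OF i0 i1, symmetric] split[symmetric] by (rule LU[OF borel_measurable_power[OF Yt]])
 also have "(LINT x|lborel. LINT s|lborel. indicator {0..t} s * H s x) = (LINT s|lborel. indicator {0..t} s * z s)"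
 unfolding lborel_pair.Fubini_integral[OF HiT'] z_def by simp
 also have "(LINT x|lborel. indicator U x * Y 0 x ^ k) = (LINT x|lebesgue_on U. Y 0 x ^ k)" by (rule LU[OF borel_measurable_power[OF Yt], symmetric])
 finally show ?thesis .
 qed
 show ?thesis using zi zs e by blast
 qed
 have "AE x in lebesgue_on U. \<forall>t\<in>{0..T}. \<bar>Y t x\<bar> <= M"
 unfolding AE_lebesgue_on_iff[OF U'] by (rule AE_completion[OF bound])
 then show ?thesis using that[OF Ym GY ae _ cont pow hm] by blast
qed

end

section \<open>Threshold argument and passage between slices and space-time\<close>

lemma integral_threshold:
 fixes y z :: "real => real"
 assumes z: "integrable lborel z" and y: "!!t. t \<in> {0..T} ==> y t = y 0 + (LINT s|lborel. indicator {0..t} s * z s)"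
 and neg: "AE s in lborel. s \<in> {0<..<T} --> y s > B --> z s <= 0" and y0: "y 0 <= B" and t: "t \<in> {0..T}"
 shows "y t <= B"
proof (rule ccontr)
 assume n: "\<not> y t <= B"
 have "continuous_on {0..T} (%t. y 0 + (LINT s|lborel. indicator {0..t} s * z s))"
 by (intro continuous_intros continuous_on_subset[OF indefinite_integral_continuous[OF z]]) simp
 then have "continuous_on {0..T} y" by (rule continuous_on_eq) (simp add: y[symmetric])
 then have cy: "continuous_on {0..t} y" by (rule continuous_on_subset) (use t in auto)
 \<comment> \<open>After the last time at which \<open>y\<close> is at most \<open>B\<close> the
   density is nonpositive almost everywhere, so \<open>y\<close> cannot have risen by time
   \<open>t\<close>.\<close>
 define S where "S = {0..t} \<inter> y -` {..B}"
 have "closed S" unfolding S_def by (rule continuous_closed_preimage[OF cy]) auto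
 then have "compact S" using bounded_subset[of "{0..t}" S] by (auto simp: compact_eq_bounded_closed S_def) 
 moreover have "S ~= {}" using y0 t by (auto simp: S_def)
 ultimately obtain s0 where s0: "s0 \<in> S" "!!s. s \<in> S ==> s <= s0" using compact_attains_sup by metis
 have s0t: "0 <= s0" "s0 <= t" "y s0 <= B" using s0(1) by (auto simp: S_def)
 have i: "integrable lborel (%s. indicator {0..r} s * z s)" for r
 using integrable_mult_indicator[OF _ z, of "{0..r}"] by simp
 have "0 <= (LINT s|lborel. indicator {0..s0} s * z s - indicator {0..t} s * z s)"
 proof (rule integral_nonneg_AE)
 show "AE s in lborel. 0 <= indicat_real {0..s0} s * z s - indicat_real {0..t} s * z s"
 using neg AE_lborel_singleton[of T]
 proof eventually_elim
 case (elim s)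
 show ?case
 proof (cases "s0 < s \<and> s <= t")
 case True
 then have "s \<notin> S" using s0(2)[of s] by auto
 then have "y s > B" using True s0t by (auto simp: S_def not_le)
 moreover have "s \<in> {0<..<T}" using True s0t t elim(2) by auto
 ultimately show ?thesis using elim(1) True s0t by (auto simp: indicator_def)
 qed (use s0t in \<open>auto simp: indicator_def\<close>)
 qed
 qed
 then have "y t <= y s0" using y[OF t] y[of s0] i s0t t by simp
 then show False using n s0t by simp
qed

text \<open>Chebyshev's inequality: the set where the absolute value of \<open>f\<close> is at least
  R has measure at most a (q/R)^(2^k), which tends to 0 for every R > q. The factor \<open>a\<close>
  may be anything independent of \<open>k\<close>.\<close>

lemma AE_bound_from_powers:
 fixes f :: "'a => real"
 assumes M: "finite_measure M" and f [measurable]: "f \<in> borel_measurable M"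
 and i: "!!k. integrable M (%x. f x ^ (2 ^ k))" and q: "0 <= q"
 and le: "!!k. k >= 1 ==> (LINT x|M. f x ^ (2 ^ k)) <= a * q ^ (2 ^ k)"
 shows "AE x in M. \<bar>f x\<bar> <= q"
proof -
 interpret finite_measure M by (rule M)
 have 1: "AE x in M. \<bar>f x\<bar> < q + inverse (real (Suc n))" for n
 proof -
 define R where "R = q + inverse (real (Suc n))"
 have R: "R > 0" "q < R" using q by (auto simp: R_def add_nonneg_pos)
 define S where "S = {x \<in> space M. R <= \<bar>f x\<bar>}"
 have Sm [measurable]: "S \<in> sets M" unfolding S_def by measurable
 have b: "measure M S <= a * (q / R) ^ (2 ^ k)" if k: "k >= 1" for k
 proof -
 have "measure M S * R ^ (2 ^ k) = (LINT x|M. R ^ (2 ^ k) * indicator S x)" by simp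
 also have "... <= (LINT x|M. f x ^ (2 ^ k))"
 proof (rule Bochner_Integration.integral_mono)
 show "integrable M (%x. R ^ (2 ^ k) * indicator S x)"
 by (intro integrable_mult_right integrable_real_indicator) (use Sm in \<open>auto simp: emeasure_eq_measure\<close>)
 fix x
 have ev: "even ((2::nat) ^ k)" using k by simp
 show "R ^ (2 ^ k) * indicator S x <= f x ^ (2 ^ k)"
 proof (cases "x \<in> S")
 case True
 then have "R ^ (2 ^ k) <= \<bar>f x\<bar> ^ (2 ^ k)" using R by (intro power_mono) (auto simp: S_def)
 then show ?thesis using True ev by (simp add: power_even_abs)
 next
 case False
 then show ?thesis using zero_le_even_power[OF ev, of "f x"] by simp
 qed
 qed (rule i)
 also have "... <= a * q ^ (2 ^ k)" by (rule le[OF k])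
 finally show ?thesis using R by (simp add: power_divide field_simps)
 qed
 have "(%k. (q / R) ^ (2 ^ k)) \<longlonglongrightarrow> 0"
 proof -
 have "(%j. (q / R) ^ j) \<longlonglongrightarrow> 0" using q R by (intro LIMSEQ_realpow_zero) auto
 moreover have "strict_mono (%k. (2::nat) ^ k)" by (rule strict_monoI) simp
 ultimately show ?thesis using LIMSEQ_subseq_LIMSEQ[of "%j. (q / R) ^ j" 0 "%k. 2 ^ k"] by (simp add: o_def)
 qed
 then have "(%k. a * (q / R) ^ (2 ^ k)) \<longlonglongrightarrow> a * 0" by (intro tendsto_intros)
 then have "measure M S <= a * 0"
 by (rule LIMSEQ_le_const) (use b in \<open>auto intro!: exI[of _ 1]\<close>)
 then have "measure M S = 0" using measure_nonneg[of M S] by simp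
 then have "S \<in> null_sets M" using Sm by (simp add: null_sets_def emeasure_eq_measure)
 then have "AE x in M. x \<notin> S" by (rule AE_not_in)
 then show ?thesis using AE_space by eventually_elim (auto simp: S_def R_def)
 qed
 have "AE x in M. \<forall>n. \<bar>f x\<bar> < q + inverse (real (Suc n))" using 1 by (simp add: AE_all_countable)
 then show ?thesis
 proof eventually_elim
 case (elim x)
 have "(%n. q + inverse (real (Suc n))) \<longlonglongrightarrow> q + 0" by (intro tendsto_intros LIMSEQ_inverse_real_of_nat)
 then have "\<bar>f x\<bar> <= q + 0" by (rule LIMSEQ_le_const) (use elim in \<open>auto intro!: exI[of _ 0] less_imp_le\<close>)
 then show ?case by simp
 qed
qed

lemma AE_slices:
 fixes V :: "'a::euclidean_space set"
 assumes V: "open V" and ae: "AE z in lebesgue_on ({0<..<T::real} \<times> V). R z"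
 shows "AE s in lborel. s \<in> {0<..<T} --> (AE x in lebesgue_on V. R (s, x))"
proof -
 have Q: "{0<..<T} \<times> V \<in> sets lebesgue" by (intro open_in_sets_lebesgue open_Times V) auto
 have "AE z in lborel. z \<in> {0<..<T} \<times> V --> R z"
 using ae unfolding AE_lebesgue_on_iff[OF Q] AE_completion_iff .
 from lborel_pair.AE_pair[OF this[unfolded lborel_pair]]
 show ?thesis
 proof eventually_elim
 case (elim s)
 show ?case
 proof
 assume s: "s \<in> {0<..<T}"
 have "AE x in lebesgue. x \<in> V --> R (s, x)"
 unfolding AE_completion_iff using elim by eventually_elim (use s in auto)
 then show "AE x in lebesgue_on V. R (s, x)" unfolding AE_lebesgue_on_iff[OF open_in_sets_lebesgue[OF V]] .
 qed
 qed
qed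

lemma AE_from_slices:
 fixes V :: "'a::euclidean_space set" and Y :: "real => 'a => real"
 assumes V: "open V" and Y: "(%z. Y (fst z) (snd z)) \<in> borel_measurable borel"
 and ae: "!!t. t \<in> {0..T} ==> AE x in lebesgue_on V. \<bar>Y t x\<bar> <= q"
 shows "AE z in lebesgue_on ({0<..<T} \<times> V). \<bar>Y (fst z) (snd z)\<bar> <= q"
proof -
 have Q: "open ({0<..<T} \<times> V)" by (intro open_Times V) auto
 have QB: "{0<..<T} \<times> V \<in> sets (borel \<Otimes>\<^sub>M borel)" unfolding borel_prod by (rule borel_open[OF Q])
 have [measurable]: "(%z. Y (fst z) (snd z)) \<in> borel_measurable (borel \<Otimes>\<^sub>M borel)" using Y by (simp add: borel_prod)
 have "AE z in lborel \<Otimes>\<^sub>M lborel. z \<in> {0<..<T} \<times> V --> \<bar>Y (fst z) (snd z)\<bar> <= q"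
 proof (rule lborel_pair.AE_pair_measure)
 show "{z \<in> space (lborel \<Otimes>\<^sub>M lborel). z \<in> {0<..<T} \<times> V --> \<bar>Y (fst z) (snd z)\<bar> <= q} \<in> sets (lborel \<Otimes>\<^sub>M lborel :: (real \<times> 'a) measure)"
 using QB by measurable
 show "AE t in lborel. AE x in lborel. (t, x) \<in> {0<..<T} \<times> V --> \<bar>Y (fst (t, x)) (snd (t, x))\<bar> <= q"
 proof (rule AE_I2)
 fix t :: real
 show "AE x in lborel. (t, x) \<in> {0<..<T} \<times> V --> \<bar>Y (fst (t, x)) (snd (t, x))\<bar> <= q"
 proof (cases "t \<in> {0..T}")
 case True
 from ae[OF True] show ?thesis unfolding AE_lebesgue_on_iff[OF open_in_sets_lebesgue[OF V]] AE_completion_iff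
 by eventually_elim auto
 qed (auto simp: greaterThanLessThan_iff)
 qed
 qed
 then show ?thesis unfolding AE_lebesgue_on_iff[OF open_in_sets_lebesgue[OF Q]] unfolding AE_completion_iff lborel_pair .
qed

text \<open>\<open>rot_field\<close> does not depend on time, so in contrast to the spatial product
  rule no extra term appears.\<close>

lemma weak_time_deriv_rot:
 fixes f f' :: "real \<times> (real^3) => real^3"
 assumes U: "open U" and f: "has_weak_deriv U (1, 0) f f'" and t: "test_function U \<psi>"
 shows "(LINT z|lebesgue_on U. frechet_derivative \<psi> (at z) (1, 0) * (f z \<bullet> rot_field (snd z)))
 = - (LINT z|lebesgue_on U. \<psi> z * (f' z \<bullet> rot_field (snd z)))"
proof -
 have sm: "smooth \<psi>" using t by (simp add: test_function_def)
 have b: "(1, 0) \<in> (Basis :: (real \<times> (real^3)) set)" by (simp add: Basis_prod_def)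
 have e: "(1, 0) \<bullet> (0, c) = (0::real)" "z \<bullet> (0, axis i 1) = snd z $ i" for c :: "real^3" and z :: "real \<times> (real^3)" and i
 by (simp_all add: inner_prod_def inner_axis_1)
 note A = weak_deriv_inner[OF U f test_function_mult[OF t smooth_inner[of "(0, axis 1 1) :: real \<times> (real^3)"]] b, of "axis 2 1 :: real^3",
 unfolded frechet_mult_inner[OF sm], unfolded e(1), unfolded e(2) inner_axis_1]
 note B = weak_deriv_inner[OF U f test_function_mult[OF t smooth_inner[of "(0, axis 2 1) :: real \<times> (real^3)"]] b, of "axis 1 1 :: real^3",
 unfolded frechet_mult_inner[OF sm], unfolded e(1), unfolded e(2) inner_axis_1]
 let ?I = "integral\<^sup>L (lebesgue_on U)"
 have 1: "?I (%z. frechet_derivative \<psi> (at z) (1, 0) * (f z \<bullet> rot_field (snd z)))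
 = ?I (%x. (\<psi> x * 0 + frechet_derivative \<psi> (at x) (1, 0) * snd x $ 1) * f x $ 2
 - (\<psi> x * 0 + frechet_derivative \<psi> (at x) (1, 0) * snd x $ 2) * f x $ 1)"
 by (rule BI_cong) (auto simp: inner_rot_field algebra_simps)
 have 2: "?I (%z. \<psi> z * (f' z \<bullet> rot_field (snd z)))
 = ?I (%x. \<psi> x * snd x $ 1 * f' x $ 2 - \<psi> x * snd x $ 2 * f' x $ 1)"
 by (rule BI_cong) (auto simp: inner_rot_field algebra_simps)
 show ?thesis
 unfolding 1 2 BI_diff[OF A(2) B(2)] A(1) B(1) BI_diff[OF A(3) B(3)] by simp
qed

text \<open>Explains the constant 10^6: it lets the moments of the initial data lie below every
  threshold of the iteration. At k = 1 the comparison is about 1.3 * 10^10 against 10^12; squaring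
  at each step then outruns the factor 32.\<close>

lemma growth_bound: "1 <= k ==> 13 * 10^6 * 32 ^ (k + 1) <= (10^6 :: real) ^ (2 ^ k)"
proof (induction k rule: dec_induct)
 case (step k)
 let ?X = "(10^6 :: real) ^ (2 ^ k)"
 have "(32::real) <= 13 * 10^6 * 32 ^ (k + 1)" 
 proof -
 have "(1::real) <= 32 ^ k" by simp
 moreover have "13 * 10^6 * 32 ^ (k + 1) = 416000000 * (32::real) ^ k" by simp
 ultimately show ?thesis by linarith
 qed
 then have "32 <= ?X" using step by linarith
 then have "(13 * 10^6 * 32 ^ (k + 1)) * 32 <= ?X * ?X" using step by (intro mult_mono) auto
 also have "?X * ?X = (10^6) ^ (2 ^ Suc k)" by (simp only: power_add[symmetric] power_Suc mult_2)
 finally show ?case by (simp only: power_Suc add_Suc mult_ac)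
qed simp

section \<open>Iteration over powers of two and the final bound\<close>

context cone begin

text \<open>Linear in \<alpha>, matching the factor 1/\<alpha> in front of the squared L1 norms; 13
  exceeds 2 * 3.2 * 2, with 3.2 an upper bound of pi.\<close>

lemma volume_D: "(LINT x|LD. 1) <= 13 * \<alpha>"
proof -
 let ?f = "%(q :: real, p, r). 1 * (r^2 * sin p)"
 have "(LINT x|LD. 1) = integral coord_box ?f" by (rule integral_D_spherical) (rule continuous_on_const)
 also have "... <= integral coord_box (%x. 1)"
 proof (rule integral_le)
 show "?f integrable_on coord_box" unfolding coord_box_def split_beta' by (intro integrable_continuous continuous_intros)
 show "(%x. 1 :: real) integrable_on coord_box" unfolding coord_box_def by (rule integrable_const)
 fix x assume "x \<in> coord_box"
 then obtain q p r where x: "x = (q, p, r)" "r \<in> {r0..1}" by (cases x) (auto simp: mem_coord_box)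
 have "r^2 * sin p <= r^2 * 1" by (intro mult_left_mono) auto
 moreover have "r^2 <= 1" using x(2) r0_bounds by (intro power_le_one) auto
 ultimately have "r^2 * sin p <= 1" by simp
 then show "?f x <= 1" by (simp add: x(1))
 qed
 also have "... = (2 * pi) * ((p1 - p0) * (1 - r0))"
 using p_bounds r0_bounds by (simp add: coord_box_def content_Pair)
 also have "... <= (2 * 3.2) * ((2 * \<alpha>) * 1)"
 using pi_approx(2) p_bounds r0_bounds \<alpha>_pos by (intro mult_mono) auto
 also have "... <= 13 * \<alpha>" using \<alpha>_pos by simp
 finally show ?thesis .
qed

lemma norm_rot_field_le: "x \<in> D ==> norm (rot_field x) <= 1"
proof -
 assume x: "x \<in> D"
 have "(norm (rot_field x))^2 = (cyl x)^2" unfolding norm_sq_3 by (simp add: rot_field_def cyl_sq)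
 then have "(norm (rot_field x))^2 <= (norm x)^2" using norm_sq_cyl[of x] by simp
 then have "norm (rot_field x) <= norm x" by (rule power2_le_imp_le) simp
 also have "norm x <= 1" using x by (simp add: D_eq)
 finally show ?thesis .
qed

lemma integral_power_le:
 assumes f: "f \<in> borel_measurable LD" and b: "AE x in LD. \<bar>f x\<bar> <= B" and B: "0 <= B"
 shows "integrable LD (%x. f x ^ k)" "(LINT x|LD. f x ^ k) <= 13 * \<alpha> * B ^ k"
proof -
 interpret finite_measure LD by (rule finite_measure_D)
 have p: "AE x in LD. \<bar>f x ^ k\<bar> <= B ^ k" using b by eventually_elim (auto simp: power_abs intro!: power_mono)
 show i: "integrable LD (%x. f x ^ k)"
 by (rule integrable_const_bound[where B="B ^ k"]) (use p f in auto)
 have "(LINT x|LD. f x ^ k) <= (LINT x|LD. B ^ k * 1)"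
 by (rule integral_mono_AE[OF i]) (use p in \<open>auto elim: eventually_mono\<close>)
 also have "... = B ^ k * (LINT x|LD. 1)" by (rule integral_mult_right_zero)
 also have "... <= B ^ k * (13 * \<alpha>)" by (rule mult_left_mono[OF volume_D]) (use B in simp)
 finally show "(LINT x|LD. f x ^ k) <= 13 * \<alpha> * B ^ k" by (simp add: mult_ac)
qed

end

context cone begin

lemma borel_measurable_LD: "f \<in> borel_measurable borel ==> f \<in> borel_measurable LD" for f :: "real^3 => real"
 by (auto intro!: measurable_restrict_space1 measurable_completion)

text \<open>The slice estimates hold at almost every time, and \<open>evolution\<close> turns them
  into statements about moments at all times. The moments of order 2^k are then bounded one after
  the other, and their growth rate bounds the supremum.\<close>

lemma angular_bound:
 assumes T: "0 < T" and sol: "strong_solution m \<alpha> T v0 v P"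
 and B0: "0 <= B0" "AE x in LD. \<bar>v0 x \<bullet> rot_field x\<bar> <= B0"
 shows "AE z in lebesgue_on ({0<..<T} \<times> D). \<bar>v (fst z) (snd z) \<bullet> rot_field (snd z)\<bar> <= 10^6 * B0"
proof -
 let ?Q = "{0<..<T} \<times> D"
 let ?V = "%z. v (fst z) (snd z)"
 have oQ: "open ?Q" by (intro open_Times open_D) auto
 have Qs: "?Q \<in> sets lebesgue" by (rule open_in_sets_lebesgue[OF oQ])
 have bD: "bounded D" using bounded_subset[OF compact_imp_bounded[OF compact_D_closed] D_subset] .
 have bT: "bounded {0<..<T}" by (rule bounded_subset[OF compact_imp_bounded[OF compact_Icc[of 0 T]]]) auto
 have Qf: "finite_measure (lebesgue_on ?Q)"
 by (intro finite_measure_lebesgue_on lmeasurable_open oQ bounded_Times bD bT)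
 note sol' = sol[unfolded strong_solution_def Let_def]
 have adm: "admissible_data m \<alpha> v0" and H1: "H1_time_L2 T D v" and L2v: "L2_time_sobolev 2 T D v"
 and Linf: "Linfty_on ({0..T} \<times> D) (%(t, x). v t x)" and L2P: "L2_time_sobolev 1 T D P"
 and axs: "AE t in lebesgue_on {0<..<T}. axisymmetric_field D (v t) \<and> axisymmetric D (P t)"
 and eqs: "AE t in lebesgue_on {0<..<T}. AE x in LD. wlaplacian D (v t) x - convection D (v t) (v t) x - wgrad D (P t) x - time_deriv T D v t x = 0"
 and dvs: "AE t in lebesgue_on {0<..<T}. AE x in LD. wdiv D (v t) x = 0"
 and bcs: "AE t in lebesgue_on {0<..<T}. BC m \<alpha> (v t)" and init: "has_initial_value D v v0"
 using sol' by auto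
 define vt where "vt = wderiv ?Q (1, 0) (%(s, y). v s y)"
 from H1 obtain g0 where g0: "has_weak_deriv ?Q (1, 0) (%(s, y). v s y) g0" "l2 (lebesgue_on ?Q) g0" and vl2: "l2 (lebesgue_on ?Q) (%(s, y). v s y)"
 by (auto simp: H1_time_L2_def L2_on_iff_l2)
 have wvt: "has_weak_deriv ?Q (1, 0) (%(s, y). v s y) vt" unfolding vt_def by (rule has_weak_deriv_wderiv[OF g0(1)])
 have "AE z in lebesgue_on ?Q. g0 z = vt z"
 using wderiv_AE[OF oQ g0(1)] unfolding vt_def by eventually_elim simp
 then have vtl2: "l2 (lebesgue_on ?Q) vt" by (rule l2_cong_AE[OF Qs g0(2)])
 have rm: "(%z :: real \<times> (real^3). rot_field (snd z)) \<in> borel_measurable (lebesgue_on A)" for A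
 by (rule lebesgue_on_measurable_continuous) (intro continuous_on_compose2[OF continuous_rot_field[of UNIV]] continuous_intros, auto)
 have rb: "AE z in lebesgue_on ?Q. norm (rot_field (snd z)) <= 1"
 by (rule AE_I2) (auto intro: norm_rot_field_le)
 define G where "G z = ?V z \<bullet> rot_field (snd z)" for z
 define g where "g z = vt z \<bullet> rot_field (snd z)" for z
 have Gl: "l2 (lebesgue_on ?Q) G" and gl: "l2 (lebesgue_on ?Q) g"
 unfolding G_def[abs_def] g_def[abs_def] using l2_inner_bounded[OF vl2 rm rb] l2_inner_bounded[OF vtl2 rm rb]
 by (simp_all add: split_beta')
 have gi: "integrable (lebesgue_on ?Q) g" by (rule l2_integrable[OF Qf gl])
 have wd: "has_weak_deriv ?Q (1, 0) G g"
 unfolding has_weak_deriv_def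
 proof (intro conjI allI impI)
 show "locally_integrable ?Q G" "locally_integrable ?Q g"
 by (intro locally_integrable_if_integrable[OF _ oQ] l2_integrable[OF Qf] Gl gl)+
 fix \<psi> assume t: "test_function ?Q \<psi>"
 show "(\<integral>x. frechet_derivative \<psi> (at x) (1, 0) *\<^sub>R G x \<partial>lebesgue_on ?Q) = - (\<integral>x. \<psi> x *\<^sub>R g x \<partial>lebesgue_on ?Q)"
 using weak_time_deriv_rot[OF oQ wvt t] by (simp add: G_def g_def split_beta')
 qed
 define M where "M = enn2real (Linfty_norm ({0..T} \<times> D) (%(t, x). v t x))"
 have RD: "{0..T} \<times> D \<in> sets lebesgue"
 using open_D by (intro sets_completionI_sets) (simp add: borel_Times)
 have vM: "AE z in lebesgue_on ?Q. norm (?V z) <= M"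
 proof -
 have "AE z in lebesgue_on ({0..T} \<times> D). ennreal (norm (case z of (t, x) => v t x)) <= Linfty_norm ({0..T} \<times> D) (%(t, x). v t x)"
 unfolding Linfty_norm_def by (rule esssup_AE)
 moreover have "Linfty_norm ({0..T} \<times> D) (%(t, x). v t x) = ennreal M"
 using Linf by (simp add: M_def Linfty_on_def)
 ultimately have le: "AE z in lebesgue_on ({0..T} \<times> D). ennreal (norm (case z of (t, x) => v t x)) <= ennreal M" by (simp only:)
 have M0: "0 <= M" by (simp add: M_def)
 from le have "AE z in lebesgue_on ({0..T} \<times> D). norm (?V z) <= M"
 proof eventually_elim
 case (elim z)
 then show ?case unfolding ennreal_le_iff[OF M0] by (cases z) simp
 qed
 then show ?thesis unfolding AE_lebesgue_on_iff[OF RD] AE_lebesgue_on_iff[OF Qs] by eventually_elim auto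
 qed
 have M0: "0 <= M" by (simp add: M_def)
 have GM: "AE z in lebesgue_on ?Q. \<bar>G z\<bar> <= M"
 using vM rb
 proof eventually_elim
 case (elim z)
 have "\<bar>G z\<bar> <= norm (?V z) * norm (rot_field (snd z))" unfolding G_def by (rule Cauchy_Schwarz_ineq2)
 also have "... <= M * 1" using elim M0 by (intro mult_mono) auto
 finally show ?case by simp
 qed
 have finU: "emeasure lborel D < \<infinity>" using emeasure_bounded_finite[OF bD] .
 interpret W: weak_time T D G g M
 by (unfold_locales; fact T open_D finU wd gi l2_measurable[OF Gl] GM M0)
 obtain Y h where Y: "(%z. Y (fst z) (snd z)) \<in> borel_measurable borel" "AE z in lebesgue_on ?Q. G z = Y (fst z) (snd z)"
 "AE s in lborel. s \<in> {0<..<T} --> (AE x in LD. G (s, x) = Y s x \<and> g (s, x) = h (s, x))"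
 "AE x in LD. \<forall>t\<in>{0..T}. \<bar>Y t x\<bar> <= M" "!!x. continuous_on UNIV (%t. Y t x)"
 and pw: "!!k. \<exists>z. integrable lborel z \<and> (\<forall>s\<in>{0<..<T}. z s = real k * (LINT x|LD. Y s x ^ (k - 1) * h (s, x))) \<and>
 (\<forall>t\<in>{0..T}. (LINT x|LD. Y t x ^ k) = (LINT x|LD. Y 0 x ^ k) + (LINT s|lborel. indicator {0..t} s * z s))"
 and hm: "h \<in> borel_measurable borel"
 by (rule W.evolution) (rule that; assumption)
 have Ym: "Y t \<in> borel_measurable LD" for t
 proof (rule borel_measurable_LD)
 show "Y t \<in> borel_measurable borel"
 using measurable_compose[of "%x. (t, x)" borel "borel \<Otimes>\<^sub>M borel" "%z. Y (fst z) (snd z)" borel] Y(1) by (simp add: borel_prod)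
 qed
 have hm': "(%x. h (t, x)) \<in> borel_measurable LD" for t
 proof (rule borel_measurable_LD)
 show "(%x. h (t, x)) \<in> borel_measurable borel"
 using measurable_compose[of "%x. (t, x)" borel "borel \<Otimes>\<^sub>M borel" h borel] hm by (simp add: borel_prod)
 qed
 have YM: "AE x in LD. \<bar>Y t x\<bar> <= M" if "t \<in> {0..T}" for t
 using Y(4) by eventually_elim (use that in auto)
 note Yi = integral_power_le(1)[OF Ym YM M0]
 have Ts: "{0<..<T} \<in> sets lebesgue" by (rule open_in_sets_lebesgue) auto
 note lift = AE_lebesgue_on_iff[OF Ts] AE_completion_iff
 \<comment> \<open>The times at which all slice hypotheses hold and at which the continuous
   representative agrees with the solution; almost every time in the interval is of this
   kind.\<close>
 define good where "good s \<longleftrightarrow> slice m \<alpha> (v s) (P s) (%x. time_deriv T D v s x) M \<and>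
 (AE x in LD. v s x \<bullet> rot_field x = Y s x) \<and> (AE x in LD. time_deriv T D v s x \<bullet> rot_field x = h (s, x))" for s
 have good: "AE s in lborel. s \<in> {0<..<T} --> good s"
 proof -
 have s2: "AE s in lborel. s \<in> {0<..<T} --> sobolev 2 D (v s)" "AE s in lborel. s \<in> {0<..<T} --> sobolev 1 D (P s)"
 using L2v L2P unfolding L2_time_sobolev_def lift by auto
 have vs: "AE s in lborel. s \<in> {0<..<T} --> (AE x in LD. norm (v s x) <= M)"
 using AE_slices[OF open_D vM] by simp
 show ?thesis
 using s2 vs Y(3) axs[unfolded lift] eqs[unfolded lift] dvs[unfolded lift] bcs[unfolded lift]
 proof eventually_elim
 case (elim s)
 show ?case
 proof
 assume s: "s \<in> {0<..<T}"
 note e = elim[THEN mp, OF s]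
 have "slice m \<alpha> (v s) (P s) (%x. time_deriv T D v s x) M"
 by (intro slice.intro slice_axioms.intro cone_axioms) (use e in auto)
 moreover have "AE x in LD. v s x \<bullet> rot_field x = Y s x" using e(4) by eventually_elim (simp add: G_def)
 moreover have "AE x in LD. time_deriv T D v s x \<bullet> rot_field x = h (s, x)"
 using e(4) by eventually_elim (simp add: g_def vt_def time_deriv_def)
 ultimately show "good s" by (simp add: good_def)
 qed
 qed
 qed
 have conv: "(LINT x|LD. Y s x ^ k * h (s, x)) = (LINT x|LD. (v s x \<bullet> rot_field x) ^ k * (time_deriv T D v s x \<bullet> rot_field x))"
 "(LINT x|LD. Y s x ^ k) = (LINT x|LD. (v s x \<bullet> rot_field x) ^ k)" if "good s" for s k
 proof -
 interpret slice m \<alpha> "v s" "P s" "%x. time_deriv T D v s x" M using that by (simp add: good_def)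
 have a: "AE x in LD. v s x \<bullet> rot_field x = Y s x" "AE x in LD. time_deriv T D v s x \<bullet> rot_field x = h (s, x)"
 using that by (simp_all add: good_def)
 have m: "(%x. v s x \<bullet> rot_field x) \<in> borel_measurable LD" "(%x. time_deriv T D v s x \<bullet> rot_field x) \<in> borel_measurable LD"
 using l2_measurable[OF ang_l2] l2_measurable[OF l2_inner_continuous[OF w_l2 continuous_rot_field]] by (simp_all add: ang_def[abs_def])
 show "(LINT x|LD. Y s x ^ k * h (s, x)) = (LINT x|LD. (v s x \<bullet> rot_field x) ^ k * (time_deriv T D v s x \<bullet> rot_field x))"
 proof (rule integral_cong_AE)
 show "AE x in LD. Y s x ^ k * h (s, x) = (v s x \<bullet> rot_field x) ^ k * (time_deriv T D v s x \<bullet> rot_field x)"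
 using a by eventually_elim simp
 qed (intro borel_measurable_times borel_measurable_power Ym hm' m)+
 show "(LINT x|LD. Y s x ^ k) = (LINT x|LD. (v s x \<bullet> rot_field x) ^ k)"
 proof (rule integral_cong_AE)
 show "AE x in LD. Y s x ^ k = (v s x \<bullet> rot_field x) ^ k" using a(1) by eventually_elim simp
 qed (intro borel_measurable_power Ym m)+
 qed
 have v0l2: "l2 LD v0" using adm by (simp add: admissible_data_def numeral_2_eq_2 L2_on_iff_l2)
 \<comment> \<open>The initial value is attained only as an essential limit in L2. Good times
   tending to 0 are selected, a subsequence converges almost everywhere to the data, and continuity
   of \<open>Y\<close> in time identifies the limit with \<open>Y 0\<close>.\<close>
 have Y0: "AE x in LD. Y 0 x = v0 x \<bullet> rot_field x"
 proof -
 have ex: "\<exists>t. 0 < t \<and> t < inverse (real (Suc n)) \<and> good t \<and> L2_norm_sq D (%x. v t x - v0 x) < ennreal (inverse (real (Suc n)))" for n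
 proof -
 have "inverse (real (Suc n)) > 0" by simp
 with init obtain \<delta> where \<delta>: "\<delta> > 0" "AE t in lebesgue_on {0<..<\<delta>}. L2_norm_sq D (%x. v t x - v0 x) < ennreal (inverse (real (Suc n)))"
 unfolding has_initial_value_def by blast
 have ds: "{0<..<\<delta>} \<in> sets lebesgue" by (rule open_in_sets_lebesgue) auto
 have ae: "AE t in lborel. t \<in> {0<..<T} --> (t < \<delta> --> good t \<and> L2_norm_sq D (%x. v t x - v0 x) < ennreal (inverse (real (Suc n))))"
 using good \<delta>(2)[unfolded AE_lebesgue_on_iff[OF ds] AE_completion_iff] by eventually_elim auto
 define b where "b = min (min \<delta> T) (inverse (real (Suc n)))"
 have b: "0 < b" "b <= T" using \<delta>(1) T by (auto simp: b_def)
 obtain t where t: "t \<in> {0<..<b}"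
 "t < \<delta> --> good t \<and> L2_norm_sq D (%x. v t x - v0 x) < ennreal (inverse (real (Suc n)))"
 by (rule interval_point[OF ae b(1) order_refl b(2)], rule that)
 have "0 < t" "t < \<delta>" "t < inverse (real (Suc n))" using t(1) unfolding b_def by simp_all
 then show ?thesis using t(2) by blast
 qed
 define \<tau> where "\<tau> n = (SOME t. 0 < t \<and> t < inverse (real (Suc n)) \<and> good t \<and> L2_norm_sq D (%x. v t x - v0 x) < ennreal (inverse (real (Suc n))))" for n
 have \<tau>: "0 < \<tau> n" "\<tau> n < inverse (real (Suc n))" "good (\<tau> n)" "L2_norm_sq D (%x. v (\<tau> n) x - v0 x) < ennreal (inverse (real (Suc n)))" for n
 using someI_ex[OF ex[of n]] unfolding \<tau>_def by auto
 have \<tau>0: "\<tau> \<longlonglongrightarrow> 0"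
 by (rule tendsto_sandwich[OF _ _ tendsto_const LIMSEQ_inverse_real_of_nat]) (use \<tau>(1,2) less_imp_le in \<open>auto intro!: always_eventually\<close>)
 have vl: "l2 LD (v (\<tau> n))" for n
 proof -
 interpret slice m \<alpha> "v (\<tau> n)" "P (\<tau> n)" "%x. time_deriv T D v (\<tau> n) x" M using \<tau>(3)[of n] by (simp add: good_def)
 show ?thesis by (rule u_l2)
 qed
 have "l2lim LD (%n. v (\<tau> n)) v0"
 proof (rule l2lim_if_L2_norm_sq[OF vl v0l2])
 have "(%n. ennreal (inverse (real (Suc n)))) \<longlonglongrightarrow> ennreal 0" by (intro tendsto_ennrealI LIMSEQ_inverse_real_of_nat)
 then have l: "(%n. ennreal (inverse (real (Suc n)))) \<longlonglongrightarrow> 0" by simp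
 show "(%n. L2_norm_sq D (%x. v (\<tau> n) x - v0 x)) \<longlonglongrightarrow> 0"
 by (rule tendsto_sandwich[OF _ _ tendsto_const l]) (use \<tau>(4) less_imp_le in \<open>auto intro!: always_eventually\<close>)
 qed
 then have lc: "l2lim LD (%n x. v (\<tau> n) x \<bullet> rot_field x) (%x. v0 x \<bullet> rot_field x)"
 by (rule l2lim_inner_continuous[OF _ continuous_rot_field])
 obtain r where r: "strict_mono r" "AE x in LD. (%n. v (\<tau> (r n)) x \<bullet> rot_field x) \<longlonglongrightarrow> v0 x \<bullet> rot_field x"
 using l2lim_AE_subseq[OF lc] by blast
 have "AE x in LD. \<forall>n. v (\<tau> n) x \<bullet> rot_field x = Y (\<tau> n) x"
 using \<tau>(3) by (simp add: AE_all_countable good_def)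
 with r(2) show ?thesis
 proof eventually_elim
 case (elim x)
 have "isCont (%t. Y t x) 0" using Y(5)[of x] by (simp add: continuous_on_eq_continuous_at)
 from isCont_tendsto_compose[OF this LIMSEQ_subseq_LIMSEQ[OF \<tau>0 r(1)]]
 have "(%n. Y (\<tau> (r n)) x) \<longlonglongrightarrow> Y 0 x" by (simp add: o_def)
 with elim show ?case using LIMSEQ_unique by auto
 qed
 qed
 have T0: "0 \<in> {0..T}" using T by simp
 have Y0B: "AE x in LD. \<bar>Y 0 x\<bar> <= B0" using Y0 B0(2) by eventually_elim simp
 define E where "E k t = (LINT x|LD. Y t x ^ k)" for k t
 have E0: "E k 0 <= 13 * \<alpha> * B0 ^ k" for k unfolding E_def by (rule integral_power_le(2)[OF Ym Y0B B0(1)])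
 have mean0: "E 1 t = 0" if t: "t \<in> {0..T}" for t
 proof -
 obtain z where z: "integrable lborel z" "!!s. s \<in> {0<..<T} ==> z s = real 1 * (LINT x|LD. Y s x ^ (1 - 1) * h (s, x))"
 "!!t. t \<in> {0..T} ==> (LINT x|LD. Y t x ^ 1) = (LINT x|LD. Y 0 x ^ 1) + (LINT s|lborel. indicator {0..t} s * z s)"
 using pw[of 1] by blast
 have zg: "z s = 0" if "good s" "s \<in> {0<..<T}" for s
 proof -
 interpret slice m \<alpha> "v s" "P s" "%x. time_deriv T D v s x" M using that by (simp add: good_def)
 show ?thesis using z(2)[OF that(2)] conv(1)[OF that(1), of 0] slice_estimates(1) by simp
 qed
 have "(LINT s|lborel. indicator {0..t} s * z s) = 0"
 proof (rule integral_eq_zero_AE)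
 show "AE s in lborel. indicat_real {0..t} s * z s = 0"
 using good AE_lborel_singleton[of 0] AE_lborel_singleton[of T]
 by eventually_elim (use zg t in \<open>auto simp: indicator_def\<close>)
 qed
 moreover have "(LINT x|LD. Y 0 x ^ 1) = 0"
 proof -
 have "(LINT x|LD. Y 0 x ^ 1) = (LINT x|LD. v0 x \<bullet> rot_field x)"
 by (rule integral_cong_AE) (use Y0 Ym l2_measurable[OF l2_inner_continuous[OF v0l2 continuous_rot_field]] in auto)
 also have "... = (LINT x|LD. rho x * sin (phi x) * comp_theta v0 x)"
 by (rule LD_cong) (use Gamma_of_eq D_off_axis in \<open>force simp: Gamma_of_def\<close>)
 finally show ?thesis using adm by (simp add: admissible_data_def)
 qed
 ultimately show ?thesis unfolding E_def z(3)[OF t] by simp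
 qed
 \<comment> \<open>Only times at which the moment exceeds \<open>B\<close> need a sign of the
   derivative, which is exactly the form in which the slice estimate for powers is
   available.\<close>
 have threshold: "E k t <= B" if neg: "!!s. good s ==> s \<in> {0<..<T} ==> E k s > B ==> (LINT x|LD. Y s x ^ (k - 1) * h (s, x)) <= 0"
 and b0: "E k 0 <= B" and t: "t \<in> {0..T}" for k B t
 proof -
 obtain z where z: "integrable lborel z" "!!s. s \<in> {0<..<T} ==> z s = real k * (LINT x|LD. Y s x ^ (k - 1) * h (s, x))"
 "!!t. t \<in> {0..T} ==> E k t = E k 0 + (LINT s|lborel. indicator {0..t} s * z s)"
 using pw[of k] unfolding E_def by blast
 show ?thesis
 proof (rule integral_threshold[OF z(1) z(3) _ b0 t])
 show "AE s in lborel. s \<in> {0<..<T} --> B < E k s --> z s <= 0"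
 using good
 proof eventually_elim
 case (elim s)
 show ?case
 proof (intro impI)
 assume s: "s \<in> {0<..<T}" "B < E k s"
 then show "z s <= 0" unfolding z(2)[OF s(1)] using neg[of s] elim by (intro mult_nonneg_nonpos) auto
 qed
 qed
 qed
 qed
 \<comment> \<open>The start of the iteration, and the only place where zero angular momentum
   enters: the mean stays 0, hence the second moment does not exceed its initial bound.\<close>
 have E2: "E 2 t <= 13 * \<alpha> * B0^2" if t: "t \<in> {0..T}" for t
 proof (rule threshold[OF _ E0 t])
 fix s assume s: "good s" "s \<in> {0<..<T}"
 interpret slice m \<alpha> "v s" "P s" "%x. time_deriv T D v s x" M using s by (simp add: good_def)
 have "(LINT x|LD. ang x) = 0" using conv(2)[OF s(1), of 1] mean0[of s] s(2) by (simp add: E_def ang_def)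
 from slice_estimates(2)[OF this] show "(LINT x|LD. Y s x ^ (2 - 1) * h (s, x)) <= 0"
 using conv(1)[OF s(1), of 1] by (simp add: ang_def)
 qed
 define q where "q = 10^6 * B0"
 have q: "0 <= q" using B0(1) by (simp add: q_def)
 have small: "13 * B0 ^ (2 ^ k) <= q ^ (2 ^ k) / (10^6 * 32 ^ (k + 1))" if "1 <= k" for k
 proof -
 have "13 * B0 ^ (2 ^ k) * (10^6 * 32 ^ (k + 1)) = (13 * 10^6 * 32 ^ (k + 1)) * B0 ^ (2 ^ k)" by simp
 also have "... <= (10^6) ^ (2 ^ k) * B0 ^ (2 ^ k)"
 by (rule mult_right_mono[OF growth_bound[OF that]]) (use B0(1) in simp)
 also have "... = q ^ (2 ^ k)" unfolding q_def by (rule power_mult_distrib[symmetric])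
 finally show ?thesis by (simp add: pos_le_divide_eq)
 qed
 \<comment> \<open>The bounds b_k = 1/(10^6 * 32^(k+1)) solve the recursion 10^6 * 32^k * b_k^2 =
   b_(k+1), where 32^k is p^5 for p = 2^k. They thus absorb both the constant and the polynomial
   growth at every step, with nothing left to accumulate.\<close>
 have main: "\<forall>t\<in>{0..T}. E (2 ^ k) t <= \<alpha> * (q ^ (2 ^ k) / (10^6 * 32 ^ (k + 1)))" if "1 <= k" for k
 using that
 proof (induction k rule: dec_induct)
 case base
 show ?case
 proof
 fix t assume "t \<in> {0..T}"
 from E2[OF this] have "E (2 ^ 1) t <= \<alpha> * (13 * B0 ^ (2 ^ 1))" by (simp add: mult_ac)
 also have "... <= \<alpha> * (q ^ (2 ^ 1) / (10^6 * 32 ^ (1 + 1)))" using small[of 1] \<alpha>_pos by (intro mult_left_mono) auto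
 finally show "E (2 ^ 1) t <= \<alpha> * (q ^ (2 ^ 1) / (10^6 * 32 ^ (1 + 1)))" .
 qed
 next
 case (step k)
 define p :: nat where "p = 2 ^ k"
 define a where "a = q ^ p / (10^6 * 32 ^ (k + 1))"
 define B where "B = \<alpha> * (q ^ (2 * p) / (10^6 * 32 ^ (k + 2)))"
 have p1: "1 <= p" and ep: "even p" and pp: "2 ^ Suc k = 2 * p" using step(1) by (auto simp: p_def)
 have a: "0 <= a" using q by (simp add: a_def)
 have IH: "E p t <= \<alpha> * a" if "t \<in> {0..T}" for t using step that by (simp add: p_def a_def)
 have E0': "E (2 * p) 0 <= B"
 proof -
 have "E (2 * p) 0 <= \<alpha> * (13 * B0 ^ (2 ^ Suc k))" using E0[of "2 * p"] unfolding pp by (simp add: mult_ac)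
 also have "... <= B" unfolding B_def using small[of "Suc k"] \<alpha>_pos unfolding pp by (intro mult_left_mono) auto
 finally show ?thesis .
 qed
 \<comment> \<open>The factor (2 pi)^2 is at least 36 and may be replaced by 10, which turns 10^7
   into the 10^6 of the recursion; one power of \<alpha> cancels and one survives, as in
   \<open>B\<close>.\<close>
 have key: "10^7 * real p^5 / \<alpha> * (\<alpha> * a / (2 * pi))^2 <= B"
 proof -
 have p5: "real p ^ 5 = 32 ^ k" unfolding p_def by (simp add: power_mult[symmetric] mult.commute[of k 5]) (simp add: power_mult)
 have "36 <= (2 * pi)^2" using power_mono[of 6 "2 * pi" 2] pi_gt3 by simp
 then have "10^7 * 32 ^ k * \<alpha> * a^2 / (2 * pi)^2 <= 10^7 * 32 ^ k * \<alpha> * a^2 / 10"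
 using \<alpha>_pos a by (intro divide_left_mono mult_pos_pos mult_nonneg_nonneg) auto
 also have "... = B"
 proof -
 have "a^2 = q ^ (2 * p) / (10^12 * 32 ^ (k + 1) * 32 ^ (k + 1))"
 proof -
 have "q ^ p * q ^ p = q ^ (p * 2)" by (simp add: mult_2_right power_add)
 then show ?thesis by (simp add: a_def power_divide power_mult[symmetric] mult.commute power2_eq_square)
 qed
 then show ?thesis by (simp add: B_def)
 qed
 finally show ?thesis using \<alpha>_pos by (simp add: p5 power_divide power_mult_distrib power2_eq_square)
 qed
 have "E (2 * p) t <= B" if t: "t \<in> {0..T}" for t
 proof (rule threshold[OF _ E0' t])
 fix s assume s: "good s" "s \<in> {0<..<T}" "B < E (2 * p) s"
 interpret slice m \<alpha> "v s" "P s" "%x. time_deriv T D v s x" M using s by (simp add: good_def)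
 have abs: "\<bar>ang x\<bar> ^ p = ang x ^ p" for x using ep by (simp add: power_even_abs)
 have i: "(LINT x|LD. ang x ^ p) = E p s" "(LINT x|LD. ang x ^ (2 * p)) = E (2 * p) s"
 using conv(2)[OF s(1)] by (simp_all add: E_def ang_def)
 have "0 <= E p s" unfolding E_def by (rule Bochner_Integration.integral_nonneg) (use ep in \<open>simp add: zero_le_even_power\<close>)
 moreover have "E p s <= \<alpha> * a" using IH[of s] s(2) by simp
 ultimately have "(E p s / (2 * pi))^2 <= (\<alpha> * a / (2 * pi))^2" by (intro power_mono divide_right_mono) auto
 then have "10^7 * real p^5 / \<alpha> * (E p s / (2 * pi))^2 <= 10^7 * real p^5 / \<alpha> * (\<alpha> * a / (2 * pi))^2"
 using \<alpha>_pos by (intro mult_left_mono) auto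
 then have "10^7 * real p^5 / \<alpha> * ((LINT x|LD. \<bar>ang x\<bar> ^ p) / (2 * pi))^2 <= (LINT x|LD. ang x ^ (2 * p))"
 unfolding abs i using key s(3) by linarith
 from slice_estimates(3)[OF p1 this]
 show "(LINT x|LD. Y s x ^ (2 * p - 1) * h (s, x)) <= 0" using conv(1)[OF s(1), of "2 * p - 1"] by (simp add: ang_def)
 qed
 then show ?case unfolding pp B_def by simp
 qed
 \<comment> \<open>The small factors in the moment bounds have served the induction and are dropped:
   the measure-like factor \<alpha> is all that \<open>AE_bound_from_powers\<close> needs.\<close>
 have Yq: "AE x in LD. \<bar>Y t x\<bar> <= q" if t: "t \<in> {0..T}" for t
 proof (rule AE_bound_from_powers[OF finite_measure_D Ym Yi[OF t] q])
 fix k :: nat assume k: "1 <= k"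
 have "q ^ (2 ^ k) / (10^6 * 32 ^ (k + 1)) <= q ^ (2 ^ k) / 1"
 proof (rule divide_left_mono)
 have "(1::real) * 1 <= 10^6 * 32 ^ (k + 1)" by (intro mult_mono one_le_power) auto
 then show "(1::real) <= 10^6 * 32 ^ (k + 1)" by simp
 qed (use q in auto)
 then have "\<alpha> * (q ^ (2 ^ k) / (10^6 * 32 ^ (k + 1))) <= \<alpha> * q ^ (2 ^ k)" using \<alpha>_pos by (intro mult_left_mono) auto
 then show "(LINT x|LD. Y t x ^ (2 ^ k)) <= \<alpha> * q ^ (2 ^ k)" using main[OF k] t unfolding E_def by force
 qed
 have "AE z in lebesgue_on ?Q. \<bar>Y (fst z) (snd z)\<bar> <= q" by (rule AE_from_slices[OF open_D Y(1)], erule Yq)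
 then show ?thesis using Y(2) by eventually_elim (simp add: G_def q_def)
qed

end

theorem lemma7p2:
  shows "\<exists>C\<^sub>\<Gamma>::real. C\<^sub>\<Gamma> > 0 \<and>
  (\<forall>(m::nat) (\<alpha>::real) (T::real) (v0 :: real^3 \<Rightarrow> real^3) (v :: real \<Rightarrow> real^3 \<Rightarrow> real^3)
    (P :: real \<Rightarrow> real^3 \<Rightarrow> real).
   m \<ge> 10^3 \<longrightarrow> 0 < \<alpha> \<longrightarrow> \<alpha> \<le> pi/6 \<longrightarrow> 0 < T \<longrightarrow>
   strong_solution m \<alpha> T v0 v P \<longrightarrow>
   Linfty_norm ({0..T} \<times> Dm m \<alpha>) (\<lambda>(t, x). Gamma_of (v t) x)
    \<le> ennreal C\<^sub>\<Gamma> * Linfty_norm (Dm m \<alpha>) (Gamma_of v0))"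
proof (intro exI[of _ "10^6"] conjI allI impI)
 fix m :: nat and \<alpha> T :: real and v0 :: "real^3 => real^3" and v :: "real => real^3 => real^3" and P :: "real => real^3 => real"
 assume as: "m >= 10^3" "0 < \<alpha>" "\<alpha> <= pi/6" and T: "0 < T" and sol: "strong_solution m \<alpha> T v0 v P"
 interpret cone m \<alpha> by unfold_locales (use as in auto)
 let ?X = "Linfty_norm D (Gamma_of v0)"
 show "Linfty_norm ({0..T} \<times> D) (%(t, x). Gamma_of (v t) x) <= ennreal (10^6) * ?X"
 proof (cases "?X = \<infinity>")
 case True
 have "ennreal (10^6) * ?X = \<infinity>" unfolding True by (subst ennreal_mult_eq_top_iff[unfolded infinity_ennreal_def[symmetric]]) auto
 then show ?thesis by simp
 next
 case False
 define B0 where "B0 = enn2real ?X"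
 have X: "?X = ennreal B0" and B0: "0 <= B0" using False by (simp_all add: B0_def less_top)
 have "AE x in LD. ennreal (norm (Gamma_of v0 x)) <= ?X" unfolding Linfty_norm_def by (rule esssup_AE)
 moreover have "AE x in LD. x \<in> D" by (rule AE_LD)
 ultimately have "AE x in LD. \<bar>v0 x \<bullet> rot_field x\<bar> <= B0"
 proof eventually_elim
 case (elim x)
 then have "x \<in> off_axis" using D_off_axis by auto
 then show ?case using elim(1) B0 unfolding X by (simp add: Gamma_of_eq)
 qed
 note bound = angular_bound[OF T sol B0 this]
 have RD: "{0..T} \<times> D \<in> sets lebesgue"
 using open_D by (intro sets_completionI_sets) (simp add: borel_Times)
 have Qs: "{0<..<T} \<times> D \<in> sets lebesgue" by (intro open_in_sets_lebesgue open_Times open_D) auto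
 have Linf: "(%(t, x). v t x) \<in> borel_measurable (lebesgue_on ({0..T} \<times> D))"
 using sol by (simp add: strong_solution_def Let_def Linfty_on_def)
 have rm: "(%z :: real \<times> (real^3). rot_field (snd z)) \<in> borel_measurable (lebesgue_on ({0..T} \<times> D))"
 by (rule lebesgue_on_measurable_continuous) (intro continuous_on_compose2[OF continuous_rot_field[of UNIV]] continuous_intros, auto)
 have meas: "(%z. ennreal (norm (case z of (t, x) => Gamma_of (v t) x))) \<in> borel_measurable (lebesgue_on ({0..T} \<times> D))"
 proof -
 have "(%z. ennreal (norm ((case z of (t, x) => v t x) \<bullet> rot_field (snd z)))) \<in> borel_measurable (lebesgue_on ({0..T} \<times> D))"
 using Linf rm by measurable
 moreover have "ennreal (norm ((case z of (t, x) => v t x) \<bullet> rot_field (snd z))) = ennreal (norm (case z of (t, x) => Gamma_of (v t) x))"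
 if "z \<in> space (lebesgue_on ({0..T} \<times> D))" for z
 using that Gamma_of_eq D_off_axis by (force simp: split_beta')
 ultimately show ?thesis by (rule measurable_cong[THEN iffD1, rotated])
 qed
 \<comment> \<open>The norm in the statement is taken over the closed time interval, while
   \<open>angular_bound\<close> concerns the open one; the two end slices form a null set of
   space-time.\<close>
 have ends: "AE z in lebesgue. fst z ~= 0 \<and> fst (z :: real \<times> (real^3)) ~= T"
 proof -
 have "AE z in (lborel :: real measure) \<Otimes>\<^sub>M (lborel :: (real^3) measure). fst z ~= 0 \<and> fst z ~= T"
 proof (rule lborel_pair.AE_pair_measure)
 have "{z \<in> space ((lborel :: real measure) \<Otimes>\<^sub>M (lborel :: (real^3) measure)). fst z ~= 0 \<and> fst z ~= T} = (UNIV - {0, T}) \<times> UNIV"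
 by (auto simp: space_pair_measure)
 moreover have "(UNIV - {0, T}) \<times> UNIV \<in> sets ((lborel :: real measure) \<Otimes>\<^sub>M (lborel :: (real^3) measure))"
 by (intro pair_measureI) auto
 ultimately show "{z \<in> space (lborel \<Otimes>\<^sub>M lborel). fst z ~= 0 \<and> fst z ~= T} \<in> sets ((lborel :: real measure) \<Otimes>\<^sub>M (lborel :: (real^3) measure))"
 by (simp only:)
 show "AE t in lborel. AE x in (lborel :: (real^3) measure). fst (t, x) ~= 0 \<and> fst (t, x) ~= T"
 using AE_lborel_singleton[of "0 :: real"] AE_lborel_singleton[of T] by eventually_elim simp
 qed
 then show ?thesis unfolding AE_completion_iff lborel_pair .
 qed
 show ?thesis
 unfolding Linfty_norm_def[of "{0..T} \<times> D"]
 proof (rule esssup_I[OF meas])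
 have r: "ennreal (10^6) * ?X = ennreal (10^6 * B0)" unfolding X by (rule ennreal_mult'[symmetric]) simp
 show "AE z in lebesgue_on ({0..T} \<times> D). ennreal (norm (case z of (t, x) => Gamma_of (v t) x)) <= ennreal (10^6) * ?X"
 unfolding r AE_lebesgue_on_iff[OF RD]
 using bound[unfolded AE_lebesgue_on_iff[OF Qs]] ends
 proof eventually_elim
 case (elim z)
 show ?case
 proof
 assume z: "z \<in> {0..T} \<times> D"
 then have "z \<in> {0<..<T} \<times> D" using elim(2) by (cases z) auto
 moreover have "snd z \<in> off_axis" using z D_off_axis by auto
 ultimately show "ennreal (norm (case z of (t, x) => Gamma_of (v t) x)) <= ennreal (10^6 * B0)"
 using elim(1) by (intro ennreal_leI) (simp add: split_beta' Gamma_of_eq)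
 qed
 qed
 qed
 qed
qed simp

end
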